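(* Let $\mathbf{K}=\mathbf{D}/\Gamma$ be the hyperbolic double doughnut, with fundamental polygon $\mathcal{F}\subset\mathbf{D}$, and let $a\in L^{\infty}(\mathbf{K})$ with $a\geq 0$. Let $\psi_0\in W^2(\mathcal{F})$ and $\psi_1\in W^1(\mathcal{F})$. Let $\psi\in C^0(\mathbb{R}^+_t;W^1(\mathcal{F}))\cap C^1(\mathbb{R}^+_t;L^2(\mathcal{F}))$ be the (unique) finite energy solution of the Cauchy problem $$\partial_t^2\psi-\Delta_{\mathbf{K}}\psi+a\,\partial_t\psi=0,\qquad \psi(t=0)=\psi_0,\quad \partial_t\psi(t=0)=\psi_1,$$ where functions on $\mathbf{K}$ are identified with functions on $\mathcal{F}$. Then $\psi$ is the unique element of $C^0(\mathbb{R}^+_t;W^1(\mathcal{F}))\cap C^1(\mathbb{R}^+_t;L^2(\mathcal{F}))$ satisfying $\psi(0)=\psi_0$, $\partial_t\psi(0)=\psi_1$ and solving the variational problem: for all $\phi\in W^1(\mathcal{F})$, $$\frac{d^2}{dt^2}\int_{\mathcal{F}}\frac{4}{(1-|z|^2)^2}\psi(t,z)\phi(z)\,dx\,dy+\frac{d}{dt}\int_{\mathcal{F}}\frac{4a(z)}{(1-|z|^2)^2}\psi(t,z)\phi(z)\,dx\,dy+\int_{\mathcal{F}}\partial_x\psi(t,z)\,\partial_x\phi(z)+\partial_y\psi(t,z)\,\partial_y\phi(z)\,dx\,dy=0.$$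
   Context: Points are written $z=x+iy$. $\mathbf{D}=\{(x,y)\in\mathbb{R}^2: x^2+y^2<1\}$ is the Poincaré disc with the metric $ds_{\mathbf{D}}^2=\frac{4}{(1-x^2-y^2)^2}(dx^2+dy^2)$. A matrix $\begin{pmatrix}\alpha&\beta\\ \gamma&\delta\end{pmatrix}$ acts on $\mathbf{D}$ by $z\mapsto\frac{\alpha z+\beta}{\gamma z+\delta}$. $\Gamma$ is the Fuchsian group of isometries of $\mathbf{D}$ generated by $g_0,g_1,g_2,g_3$, where $$g_k=\begin{pmatrix}1+\sqrt2&\sqrt{2+2\sqrt2}\,e^{ik\pi/4}\\ \sqrt{2+2\sqrt2}\,e^{-ik\pi/4}&1+\sqrt2\end{pmatrix}.$$ The hyperbolic double doughnut is $\mathbf{K}=\mathbf{D}/\Gamma$ with the metric $ds_{\mathbf{K}}^2$ induced by $ds_{\mathbf{D}}^2$; it is a smooth compact surface without boundary, of genus 2 and constant curvature $-1$. $\Delta_{\mathbf{K}}$ is its Laplace–Beltrami operator, given in the coordinates $(x,y)$ by $\frac{(1-x^2-y^2)^2}{4}(\partial_{xx}+\partial_{yy})$. The fundamental polygon is $$\mathcal{F}=\{z\in\mathbf{D}:\ |g_i(z)|\geq|z|\ \text{and}\ |g_i^{-1}(z)|\geq|z|\ \text{for } i=0,1,2,3\},$$ a closed regular hyperbolic octagon, compact in $\mathbf{D}$. On $\mathcal{F}$, $z\sim z'$ means $z'=g(z)$ for some $g\in\Gamma$; then $\mathbf{K}=\mathcal{F}/\sim$, and functions on $\mathbf{K}$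 (such as $a$) are identified with functions on $\mathcal{F}$ (and with $\Gamma$-invariant functions on $\mathbf{D}$). For $m\in\mathbb{N}$, $H^m(\mathcal{F})$ is the usual Sobolev space for the Euclidean metric, $L^2(\mathcal{F})$ is the corresponding $L^2$ space, and $$W^m(\mathcal{F})=\{u|_{\mathcal{F}}:\ u\in H^m_{loc}(\mathbf{D}),\ u\circ g=u\ \text{for all } g\in\Gamma\},\qquad \|u\|_{W^m}=\|u|_{\mathcal{F}}\|_{H^m(\mathcal{F})}.$$ $W^m(\mathcal{F})$ corresponds to the Sobolev space $H^m(\mathbf{K})$. In particular $W^1(\mathcal{F})=\{u\in H^1(\mathcal{F}): z\sim z'\Rightarrow u(z)=u(z')\}$ (equality on $\partial\mathcal{F}$ in the sense of traces). For $\psi_0\in W^1(\mathcal{F})$ and $\psi_1\in L^2(\mathcal{F})$, the Cauchy problem is known to have a unique solution in $C^0(\mathbb{R}^+_t;W^1(\mathcal{F}))\cap C^1(\mathbb{R}^+_t;L^2(\mathcal{F}))$, where the equation on $\mathbb{R}_t\times\mathbf{K}$ is understood in the sense of distributions. In the variational problem, the $t$-derivatives are taken in the sense of distributions in $t>0$. *)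

theory Defs
  imports "HOL-Analysis.Analysis" "HOL-Algebra.Bij" "HOL-Algebra.Generated_Groups"
begin

section \<open>The Fuchsian group and its fundamental polygon\<close>

text \<open>The plane is the type complex, z = x + iy; its Lebesgue measure is dx dy.\<close>

definition disc :: "complex set" where
  "disc = ball 0 1"

definition gmat :: "nat \<Rightarrow> complex^2^2" where
  "gmat k = vector
     [vector [of_real (1 + sqrt 2), of_real (sqrt (2 + 2 * sqrt 2)) * cis (real k * pi / 4)],
      vector [of_real (sqrt (2 + 2 * sqrt 2)) * cis (- (real k * pi / 4)), of_real (1 + sqrt 2)]]"

definition act :: "complex^2^2 \<Rightarrow> complex \<Rightarrow> complex" where
  "act M = moebius (M $ 1 $ 1) (M $ 1 $ 2) (M $ 2 $ 1) (M $ 2 $ 2)"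

text \<open>The Fuchsian group, as a group of transformations of the disc: its elements are extensional functions on the
  disc, to be evaluated only there.\<close>

definition DDGroup :: "(complex \<Rightarrow> complex) set" where
  "DDGroup = generate (BijGroup disc) ((\<lambda>k. restrict (act (gmat k)) disc) ` {0..3})"

definition Fund :: "complex set" where
  "Fund = {z \<in> disc. \<forall>i\<in>{0..3}. cmod (act (gmat i) z) \<ge> cmod z \<and>
                                 cmod (act (matrix_inv (gmat i)) z) \<ge> cmod z}"

section \<open>Smooth functions and test functions\<close>

definition partial :: "'a::real_normed_vector \<Rightarrow> ('a \<Rightarrow> real) \<Rightarrow> 'a \<Rightarrow> real" where
  "partial b f = (\<lambda>x. frechet_derivative f (at x) b)"

text \<open>The class of k times continuously differentiable functions on an open set.\<close>

fun Ck_on :: "nat \<Rightarrow> 'a::euclidean_space set \<Rightarrow> ('a \<Rightarrow> real) \<Rightarrow> bool" where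
  "Ck_on 0 S f \<longleftrightarrow> continuous_on S f"
| "Ck_on (Suc k) S f \<longleftrightarrow>
     (\<forall>x\<in>S. f differentiable (at x)) \<and> (\<forall>b\<in>Basis. Ck_on k S (partial b f))"

definition smooth_on :: "'a::euclidean_space set \<Rightarrow> ('a \<Rightarrow> real) \<Rightarrow> bool" where
  "smooth_on S f \<longleftrightarrow> (\<forall>k. Ck_on k S f)"

text \<open>Real-valued test functions suffice throughout, also for complex-valued distributions,
  by linearity.\<close>

definition test_fun :: "'a::euclidean_space set \<Rightarrow> ('a \<Rightarrow> real) \<Rightarrow> bool" where
  "test_fun U f \<longleftrightarrow> smooth_on UNIV f \<and> compact (closure {x. f x \<noteq> 0}) \<and>
     closure {x. f x \<noteq> 0} \<subseteq> U"

section \<open>Sobolev spaces\<close>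

text \<open>Functions are representatives of classes modulo equality almost everywhere; all the
  spaces below are closed under change of representative.\<close>

definition L2 :: "complex set \<Rightarrow> (complex \<Rightarrow> complex) set" where
  "L2 S = {u \<in> borel_measurable (lebesgue_on S). integrable (lebesgue_on S) (\<lambda>z. (cmod (u z))\<^sup>2)}"

definition L2norm :: "complex set \<Rightarrow> (complex \<Rightarrow> complex) \<Rightarrow> real" where
  "L2norm S u = sqrt (LINT z|lebesgue_on S. (cmod (u z))\<^sup>2)"

definition L2_loc :: "complex set \<Rightarrow> (complex \<Rightarrow> complex) set" where
  "L2_loc U = {u. \<forall>C. compact C \<and> C \<subseteq> U \<longrightarrow> u \<in> L2 C}"

definition L1_loc :: "complex set \<Rightarrow> (complex \<Rightarrow> complex) set" where
  "L1_loc U = {u. \<forall>C. compact C \<and> C \<subseteq> U \<longrightarrow> integrable (lebesgue_on C) u}"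

text \<open>v is the weak derivative of u on the open set U, of order i in x and j in y.\<close>

definition has_weak_partial ::
    "complex set \<Rightarrow> nat \<Rightarrow> nat \<Rightarrow> (complex \<Rightarrow> complex) \<Rightarrow> (complex \<Rightarrow> complex) \<Rightarrow> bool" where
  "has_weak_partial U i j u v \<longleftrightarrow> u \<in> L1_loc U \<and> v \<in> L1_loc U \<and>
     (\<forall>\<phi>. test_fun U \<phi> \<longrightarrow>
        (LINT z|lebesgue_on U. (partial 1 ^^ i) ((partial \<i> ^^ j) \<phi>) z *\<^sub>R u z) =
        (- 1) ^ (i + j) * (LINT z|lebesgue_on U. \<phi> z *\<^sub>R v z))"

text \<open>A chosen representative; weak derivatives are unique almost everywhere.\<close>

definition weak_partial ::
    "complex set \<Rightarrow> nat \<Rightarrow> nat \<Rightarrow> (complex \<Rightarrow> complex) \<Rightarrow> complex \<Rightarrow> complex" where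
  "weak_partial U i j u = (SOME v. has_weak_partial U i j u v)"

definition H_loc :: "nat \<Rightarrow> complex set \<Rightarrow> (complex \<Rightarrow> complex) set" where
  "H_loc m U = {u. \<forall>i j. i + j \<le> m \<longrightarrow> (\<exists>v\<in>L2_loc U. has_weak_partial U i j u v)}"

definition W :: "nat \<Rightarrow> (complex \<Rightarrow> complex) set" where
  "W m = {u. \<exists>v\<in>H_loc m disc.
            (\<forall>g\<in>DDGroup. AE z in lebesgue_on disc. v (g z) = v z) \<and>
            (AE z in lebesgue_on Fund. u z = v z)}"

text \<open>Derivatives on the polygon, taken in its interior; its boundary is a null set.\<close>

definition dF :: "nat \<Rightarrow> nat \<Rightarrow> (complex \<Rightarrow> complex) \<Rightarrow> complex \<Rightarrow> complex" where
  "dF i j u = weak_partial (interior Fund) i j u"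

definition Wnorm :: "nat \<Rightarrow> (complex \<Rightarrow> complex) \<Rightarrow> real" where
  "Wnorm m u = sqrt (\<Sum>i\<le>m. \<Sum>j\<le>m - i. (L2norm Fund (dF i j u))\<^sup>2)"

definition Linf :: "(complex \<Rightarrow> real) set" where
  "Linf = {a \<in> borel_measurable (lebesgue_on Fund). \<exists>C. AE z in lebesgue_on Fund. \<bar>a z\<bar> \<le> C}"

section \<open>Functions of time\<close>

definition cont_W1 :: "(real \<Rightarrow> complex \<Rightarrow> complex) \<Rightarrow> bool" where
  "cont_W1 \<psi> \<longleftrightarrow> (\<forall>t\<ge>0. \<psi> t \<in> W 1 \<and>
     ((\<lambda>s. Wnorm 1 (\<lambda>z. \<psi> s z - \<psi> t z)) \<longlongrightarrow> 0) (at t within {0..}))"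

definition cont_L2 :: "(real \<Rightarrow> complex \<Rightarrow> complex) \<Rightarrow> bool" where
  "cont_L2 \<psi> \<longleftrightarrow> (\<forall>t\<ge>0. \<psi> t \<in> L2 Fund \<and>
     ((\<lambda>s. L2norm Fund (\<lambda>z. \<psi> s z - \<psi> t z)) \<longlongrightarrow> 0) (at t within {0..}))"

definition has_L2_time_derivative ::
    "(real \<Rightarrow> complex \<Rightarrow> complex) \<Rightarrow> (real \<Rightarrow> complex \<Rightarrow> complex) \<Rightarrow> bool" where
  "has_L2_time_derivative \<psi> \<psi>' \<longleftrightarrow> (\<forall>t\<ge>0.
     ((\<lambda>s. L2norm Fund (\<lambda>z. (\<psi> s z - \<psi> t z) /\<^sub>R (s - t) - \<psi>' t z)) \<longlongrightarrow> 0) (at t within {0..}))"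

text \<open>Elements of C0(W1) and C1(L2) on the closed half-line, with their time derivative; values
  at negative times are irrelevant.\<close>

definition energy_class ::
    "(real \<Rightarrow> complex \<Rightarrow> complex) \<Rightarrow> (real \<Rightarrow> complex \<Rightarrow> complex) \<Rightarrow> bool" where
  "energy_class \<psi> \<psi>' \<longleftrightarrow>
     cont_W1 \<psi> \<and> cont_L2 \<psi> \<and> cont_L2 \<psi>' \<and> has_L2_time_derivative \<psi> \<psi>'"

definition initial_data ::
    "(complex \<Rightarrow> complex) \<Rightarrow> (complex \<Rightarrow> complex) \<Rightarrow>
     (real \<Rightarrow> complex \<Rightarrow> complex) \<Rightarrow> (real \<Rightarrow> complex \<Rightarrow> complex) \<Rightarrow> bool" where
  "initial_data \<psi>0 \<psi>1 \<psi> \<psi>' \<longleftrightarrow>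
     (AE z in lebesgue_on Fund. \<psi> 0 z = \<psi>0 z) \<and> (AE z in lebesgue_on Fund. \<psi>' 0 z = \<psi>1 z)"

section \<open>The Cauchy problem\<close>

text \<open>The density of the hyperbolic area with respect to dx dy.\<close>

definition hyp_weight :: "complex \<Rightarrow> real" where
  "hyp_weight z = 4 / (1 - (cmod z)\<^sup>2)\<^sup>2"

definition Laplace_K :: "(complex \<Rightarrow> real) \<Rightarrow> complex \<Rightarrow> real" where
  "Laplace_K f z = (1 - (cmod z)\<^sup>2)\<^sup>2 / 4 *
     (partial 1 (partial 1 f) z + partial \<i> (partial \<i> f) z)"

text \<open>Smooth compactly supported functions on the product of the open half-line and the compact
  surface K, seen as functions on the product of the open half-line and the disc that are
  invariant under the group.\<close>

definition test_fun_K :: "(real \<times> complex \<Rightarrow> real) \<Rightarrow> bool" where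
  "test_fun_K \<theta> \<longleftrightarrow> smooth_on ({0<..} \<times> disc) \<theta> \<and>
     (\<forall>g\<in>DDGroup. \<forall>t>0. \<forall>z\<in>disc. \<theta> (t, g z) = \<theta> (t, z)) \<and>
     (\<exists>\<alpha>>0. \<exists>\<beta>. \<forall>t>0. \<forall>z\<in>disc. t \<notin> {\<alpha>..\<beta>} \<longrightarrow> \<theta> (t, z) = 0)"

text \<open>The damped wave equation in the sense of distributions on the product of the open half-line
  and K, with the Riemannian measure of K, for which the Laplacian is symmetric. As the
  representatives of the classes at different times are unrelated, they need not be jointly
  measurable: the pairing of a continuous L2-valued function with a test function is an iterated
  integral.\<close>

definition wave_equation_K ::
    "(complex \<Rightarrow> real) \<Rightarrow> (real \<Rightarrow> complex \<Rightarrow> complex) \<Rightarrow> (real \<Rightarrow> complex \<Rightarrow> complex) \<Rightarrow> bool" where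
  "wave_equation_K a \<psi> \<psi>' \<longleftrightarrow> (\<forall>\<theta>. test_fun_K \<theta> \<longrightarrow>
     (LINT t|lebesgue_on {0<..}. LINT z|lebesgue_on Fund. hyp_weight z *\<^sub>R
        (((deriv ^^ 2) (\<lambda>s. \<theta> (s, z)) t - Laplace_K (\<lambda>w. \<theta> (t, w)) z) *\<^sub>R \<psi> t z
         + (\<theta> (t, z) * a z) *\<^sub>R \<psi>' t z)) = 0)"

definition finite_energy_solution ::
    "(complex \<Rightarrow> real) \<Rightarrow> (complex \<Rightarrow> complex) \<Rightarrow> (complex \<Rightarrow> complex) \<Rightarrow>
     (real \<Rightarrow> complex \<Rightarrow> complex) \<Rightarrow> bool" where
  "finite_energy_solution a \<psi>0 \<psi>1 \<psi> \<longleftrightarrow>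
     (\<exists>\<psi>'. energy_class \<psi> \<psi>' \<and> initial_data \<psi>0 \<psi>1 \<psi> \<psi>' \<and> wave_equation_K a \<psi> \<psi>')"

section \<open>The variational problem\<close>

text \<open>The second derivative of A plus the first derivative of B plus C vanishes in the sense of
  distributions on the open half-line.\<close>

definition distr_ode :: "(real \<Rightarrow> complex) \<Rightarrow> (real \<Rightarrow> complex) \<Rightarrow> (real \<Rightarrow> complex) \<Rightarrow> bool" where
  "distr_ode A B C \<longleftrightarrow> (\<forall>\<eta>. test_fun {0<..} \<eta> \<longrightarrow>
     (LINT t|lebesgue_on {0<..}. (deriv ^^ 2) \<eta> t *\<^sub>R A t)
     - (LINT t|lebesgue_on {0<..}. deriv \<eta> t *\<^sub>R B t)
     + (LINT t|lebesgue_on {0<..}. \<eta> t *\<^sub>R C t) = 0)"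

definition variational_equation ::
    "(complex \<Rightarrow> real) \<Rightarrow> (real \<Rightarrow> complex \<Rightarrow> complex) \<Rightarrow> bool" where
  "variational_equation a \<psi> \<longleftrightarrow> (\<forall>\<phi>\<in>W 1. distr_ode
     (\<lambda>t. LINT z|lebesgue_on Fund. hyp_weight z *\<^sub>R (\<psi> t z * \<phi> z))
     (\<lambda>t. LINT z|lebesgue_on Fund. (hyp_weight z * a z) *\<^sub>R (\<psi> t z * \<phi> z))
     (\<lambda>t. LINT z|lebesgue_on Fund. dF 1 0 (\<psi> t) z * dF 1 0 \<phi> z + dF 0 1 (\<psi> t) z * dF 0 1 \<phi> z))"

definition variational_solution ::
    "(complex \<Rightarrow> real) \<Rightarrow> (complex \<Rightarrow> complex) \<Rightarrow> (complex \<Rightarrow> complex) \<Rightarrow>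
     (real \<Rightarrow> complex \<Rightarrow> complex) \<Rightarrow> bool" where
  "variational_solution a \<psi>0 \<psi>1 \<psi> \<longleftrightarrow>
     (\<exists>\<psi>'. energy_class \<psi> \<psi>' \<and> initial_data \<psi>0 \<psi>1 \<psi> \<psi>') \<and> variational_equation a \<psi>"

end

(* Write w for the hyperbolic density. The product of a time test function with a smooth invariant
 function p is a test function on K, and Green's formula on the octagon (side pairing cancels the
 boundary terms) turns the wave equation into the variational one for p. Smooth invariant functions
 are dense in the energy space, which gives all test functions.

 The density needs no discreteness of the group. One averages against a kernel J(s(z, z')), where
 s is a point-pair invariant of the disc: the result is smooth, it is invariant as soon as the
 function is, and averaging commutes with the Killing fields, so that gradients converge as well.

 Green's formula is proved with smooth cutoffs instead of boundary integrals. A cutoff of the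
 octagon is built from functions m_i that change sign on the i-th side and satisfy
 m_(i+4) o g_i = - m_i, so opposite sides cancel after a change of variables. A second cutoff,
 depending on the modulus only, removes neighbourhoods of the corners, of area O(delta^2).

 Uniqueness: integrate the equation for the difference u of two solutions once in time, and test it
 with the conjugate of u(t). The function e(t) = int w |u(t)|^2 satisfies
 e'(t) = - 2 int w a |u(t)|^2 - 2 Re int_0^t (grad u(s), grad u(t)) ds, and the time integral of the
 last term is nonnegative, because it is half of the integral of a positive kernel over a square. *)
theory Submission
 imports Defs
begin

text \<open>The lift of an element of \<open>W 1\<close> is only weakly differentiable and only
  almost everywhere invariant, whereas the boundary terms of the octagon cancel for functions that
  are invariant at every point. Euclidean mollification would destroy the invariance. The mass of a
  kernel that depends on hyperbolic distance is the same at all base points, so dividing by it gives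
  a genuine approximate identity; on non-smooth functions partial derivatives are replaced by the
  fields c - cnj(c) z^2, along which the kernel is constant. The number sqrt 2 / 2, which appears
  throughout, is the squared modulus of the vertices. Inside the circle through the vertices at most
  one side condition can fail, which makes a plain sum of eight step functions a cutoff of the
  octagon. The modulus cutoff has gradient of order 1/delta, which still loses against the area of
  the corners. In the uniqueness part, the time derivative of a finite energy solution is only in L2
  and cannot serve as a test function; the solution itself, frozen at the final time of the
  integrated equation, can. Only scalar pairings are ever integrated in time.\<close>

abbreviation (input) "lF \<equiv> lebesgue_on Fund"
abbreviation (input) "lD \<equiv> lebesgue_on disc"
abbreviation (input) "lT \<equiv> lebesgue_on {0::real<..}"

section \<open>Smooth functions\<close>

lemma partial_eqI: "(f has_derivative D) (at x) \<Longrightarrow> partial b f x = D b"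
 unfolding partial_def by (metis frechet_derivative_at)

text \<open>Both functions have the same derivatives at \<open>x\<close> in the sense of
  \<open>has_derivative\<close>, so the choice made by \<open>frechet_derivative\<close> is the
  same, whether or not they are differentiable there.\<close>

lemma partial_cong_open:
 assumes "open S" "x \<in> S" "\<And>y. y \<in> S \<Longrightarrow> f y = g y"
 shows "partial b f x = partial b g x"
proof -
 have "(f has_derivative D) (at x) \<longleftrightarrow> (g has_derivative D) (at x)" for D
  using assms has_derivative_transform_within_open[of f D x UNIV S g]
   has_derivative_transform_within_open[of g D x UNIV S f] by auto
 then show ?thesis unfolding partial_def frechet_derivative_def by simp
qed

lemma differentiable_cong_open:
 assumes "open S" "x \<in> S" "\<And>y. y \<in> S \<Longrightarrow> f y = g y" "f differentiable (at x)"
 shows "g differentiable (at x)"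
 using assms has_derivative_transform_within_open[of f _ x UNIV S g]
 unfolding differentiable_def by blast

lemma Ck_on_cong:
 assumes "open S" "\<And>y. y \<in> S \<Longrightarrow> f y = g y" "Ck_on k S f"
 shows "Ck_on k S g"
 using assms(2,3)
proof (induction k arbitrary: f g)
 case 0
 then show ?case using continuous_on_cong[of S S f g] by simp
next
 case (Suc k)
 have "Ck_on k S (partial b g)" if "b \<in> Basis" for b
  using Suc.IH[of "partial b f" "partial b g"] Suc.prems that partial_cong_open[OF assms(1)]
  by (metis Ck_on.simps(2))
 moreover have "g differentiable (at x)" if "x \<in> S" for x
  using differentiable_cong_open[OF assms(1) that] Suc.prems that by (metis Ck_on.simps(2))
 ultimately show ?case by simp
qed

lemma Ck_on_Suc_imp: "Ck_on (Suc k) S f \<Longrightarrow> Ck_on k S f"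
proof (induction k arbitrary: f)
 case 0
 then show ?case
  by (auto intro!: continuous_at_imp_continuous_on differentiable_imp_continuous_within)
next
 case (Suc k)
 then show ?case by (metis Ck_on.simps(2))
qed

lemma Ck_on_le: "Ck_on m S f \<Longrightarrow> k \<le> m \<Longrightarrow> Ck_on k S f"
 by (induction m) (auto simp: le_Suc_eq dest: Ck_on_Suc_imp simp del: Ck_on.simps(2))

lemma Ck_on_Un:
 assumes "open S" "open T" "Ck_on k S f" "Ck_on k T f"
 shows "Ck_on k (S \<union> T) f"
 using assms(3,4)
 by (induction k arbitrary: f) (auto intro: continuous_on_open_Un assms(1,2))

section \<open>Constants, linear maps, sums, products and compositions\<close>

lemma Ck_on_const: "Ck_on k S (\<lambda>x. c)"
proof (induction k arbitrary: c)
 case (Suc k)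
 have "partial b (\<lambda>x::'a. c) = (\<lambda>x. 0)" for b :: 'a
  by (rule ext, rule partial_eqI) (rule has_derivative_const)
 then show ?case using Suc by simp
qed simp

lemma Ck_on_linear:
 assumes "bounded_linear L"
 shows "Ck_on k S L"
proof (cases k)
 case 0
 then show ?thesis using assms by (simp add: linear_continuous_on)
next
 case (Suc m)
 have "partial b L = (\<lambda>x. L b)" for b
  by (rule ext, rule partial_eqI[OF bounded_linear_imp_has_derivative[OF assms]])
 then show ?thesis using Suc assms
  by (auto simp: Ck_on_const intro!: bounded_linear_imp_differentiable)
qed

lemma partial_add:
 assumes "f differentiable (at y)" "g differentiable (at y)"
 shows "partial b (\<lambda>x. f x + g x) y = partial b f y + partial b g y"
proof (rule trans[OF partial_eqI])
 show "((\<lambda>x. f x + g x) has_derivative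
   (\<lambda>h. frechet_derivative f (at y) h + frechet_derivative g (at y) h)) (at y)"
  using assms by (intro has_derivative_add) (auto simp: frechet_derivative_works)
qed (simp add: partial_def)

lemma Ck_on_add:
 assumes "open S" "Ck_on k S f" "Ck_on k S g"
 shows "Ck_on k S (\<lambda>x. f x + g x)"
 using assms(2,3)
proof (induction k arbitrary: f g)
 case 0
 then show ?case by (auto intro: continuous_intros)
next
 case (Suc k)
 have "Ck_on k S (partial b (\<lambda>x. f x + g x))" if b: "b \<in> Basis" for b
 proof (rule Ck_on_cong[OF assms(1)])
  show "Ck_on k S (\<lambda>x. partial b f x + partial b g x)"
   using Suc b by simp
  show "partial b f y + partial b g y = partial b (\<lambda>x. f x + g x) y" if y: "y \<in> S" for y
   using Suc.prems y by (intro partial_add[symmetric]) auto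
 qed
 then show ?case using Suc.prems by (auto intro: differentiable_add)
qed

lemma partial_mult:
 assumes "f differentiable (at y)" "g differentiable (at y)"
 shows "partial b (\<lambda>x. f x * g x) y = f y * partial b g y + partial b f y * g y"
proof (rule trans[OF partial_eqI])
 show "((\<lambda>x. f x * g x) has_derivative
   (\<lambda>h. f y * frechet_derivative g (at y) h + frechet_derivative f (at y) h * g y)) (at y)"
  using assms by (intro has_derivative_mult) (auto simp: frechet_derivative_works)
qed (simp add: partial_def)

lemma Ck_on_mult:
 assumes "open S" "Ck_on k S f" "Ck_on k S g"
 shows "Ck_on k S (\<lambda>x. f x * g x)"
 using assms(2,3)
proof (induction k arbitrary: f g)
 case 0
 then show ?case by (auto intro: continuous_intros)
next
 case (Suc k)
 have "Ck_on k S (partial b (\<lambda>x. f x * g x))" if b: "b \<in> Basis" for b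
 proof (rule Ck_on_cong[OF assms(1)])
  show "Ck_on k S (\<lambda>x. f x * partial b g x + partial b f x * g x)"
   using Suc.prems b Ck_on_Suc_imp[OF Suc.prems(1)] Ck_on_Suc_imp[OF Suc.prems(2)]
   by (intro Ck_on_add[OF assms(1)] Suc.IH) auto
  show "f y * partial b g y + partial b f y * g y = partial b (\<lambda>x. f x * g x) y" if y: "y \<in> S" for y
   using Suc.prems y by (intro partial_mult[symmetric]) auto
 qed
 then show ?case using Suc.prems by (auto intro: differentiable_mult)
qed

lemma partial_compose:
 fixes h :: "real \<Rightarrow> real"
 assumes "f differentiable (at y)" "h differentiable (at (f y))"
 shows "partial b (\<lambda>x. h (f x)) y = partial 1 h (f y) * partial b f y"
proof (rule trans[OF partial_eqI])
 show "((\<lambda>x. h (f x)) has_derivative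
   (\<lambda>v. frechet_derivative h (at (f y)) (frechet_derivative f (at y) v))) (at y)"
  using assms by (intro has_derivative_compose[of f _ _ _ h]) (auto simp: frechet_derivative_works)
 interpret bounded_linear "frechet_derivative h (at (f y))"
  using assms(2) by (rule linear_frechet_derivative[THEN linear_conv_bounded_linear[THEN iffD1]])
 show "frechet_derivative h (at (f y)) (frechet_derivative f (at y) b) = partial 1 h (f y) * partial b f y"
  using scaleR[of "frechet_derivative f (at y) b" 1] by (simp add: partial_def)
qed

text \<open>The outer function is one of a real variable, such as a bump, a step or the reciprocal.
  Combined with linear maps, sums and products this gives the explicit smooth functions used
  below.\<close>

lemma Ck_on_compose:
 fixes h :: "real \<Rightarrow> real"
 assumes "open S" "open T" "f ` S \<subseteq> T" "Ck_on k S f" "Ck_on k T h"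
 shows "Ck_on k S (\<lambda>x. h (f x))"
 using assms(4,5)
proof (induction k arbitrary: h)
 case 0
 then show ?case using assms(3) continuous_on_compose2[of T h S f] by auto
next
 case (Suc k)
 have "Ck_on k S (partial b (\<lambda>x. h (f x)))" if b: "b \<in> Basis" for b
 proof (rule Ck_on_cong[OF assms(1)])
  show "Ck_on k S (\<lambda>x. partial 1 h (f x) * partial b f x)"
  proof (rule Ck_on_mult[OF assms(1)])
   show "Ck_on k S (\<lambda>x. partial 1 h (f x))"
    by (rule Suc.IH[OF Ck_on_Suc_imp[OF Suc.prems(1)]]) (use Suc.prems in auto)
   show "Ck_on k S (partial b f)" using Suc.prems b by simp
  qed
  show "partial 1 h (f y) * partial b f y = partial b (\<lambda>x. h (f x)) y" if y: "y \<in> S" for y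
   using Suc.prems y assms(3) by (intro partial_compose[symmetric]) auto
 qed
 moreover have "(\<lambda>x. h (f x)) differentiable (at y)" if "y \<in> S" for y
  using Suc.prems that assms(3) differentiable_compose[of h f y UNIV] by auto
 ultimately show ?case by simp
qed

lemma smooth_on_const: "smooth_on S (\<lambda>x. c)"
 by (simp add: smooth_on_def Ck_on_const del: Ck_on.simps)

lemma smooth_on_linear: "bounded_linear L \<Longrightarrow> smooth_on S L"
 by (simp add: smooth_on_def Ck_on_linear del: Ck_on.simps)

lemma smooth_on_add: "open S \<Longrightarrow> smooth_on S f \<Longrightarrow> smooth_on S g \<Longrightarrow> smooth_on S (\<lambda>x. f x + g x)"
 by (simp add: smooth_on_def Ck_on_add del: Ck_on.simps)

lemma smooth_on_mult: "open S \<Longrightarrow> smooth_on S f \<Longrightarrow> smooth_on S g \<Longrightarrow> smooth_on S (\<lambda>x. f x * g x)"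
 by (simp add: smooth_on_def Ck_on_mult del: Ck_on.simps)

lemma smooth_on_cmult: "open S \<Longrightarrow> smooth_on S f \<Longrightarrow> smooth_on S (\<lambda>x. c * f x)"
 by (intro smooth_on_mult smooth_on_const)

lemma smooth_on_diff:
 assumes "open S" "smooth_on S f" "smooth_on S g" shows "smooth_on S (\<lambda>x. f x - g x)"
 using smooth_on_add[OF assms(1,2) smooth_on_cmult[OF assms(1,3), of "-1"]] by simp

lemma smooth_on_power: "open S \<Longrightarrow> smooth_on S f \<Longrightarrow> smooth_on S (\<lambda>x. f x ^ n)"
 by (induction n) (auto intro: smooth_on_const smooth_on_mult)

lemma smooth_on_sum:
 "open S \<Longrightarrow> (\<And>i. i \<in> I \<Longrightarrow> smooth_on S (f i)) \<Longrightarrow> smooth_on S (\<lambda>x. \<Sum>i\<in>I. f i x)"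
 by (induction I rule: infinite_finite_induct) (auto intro: smooth_on_const smooth_on_add)

lemma smooth_on_prod:
 "open S \<Longrightarrow> (\<And>i. i \<in> I \<Longrightarrow> smooth_on S (f i)) \<Longrightarrow> smooth_on S (\<lambda>x. \<Prod>i\<in>I. f i x)"
 by (induction I rule: infinite_finite_induct) (auto intro: smooth_on_const smooth_on_mult)

lemma smooth_on_compose:
 fixes h :: "real \<Rightarrow> real"
 shows "smooth_on T h \<Longrightarrow> open S \<Longrightarrow> open T \<Longrightarrow> f ` S \<subseteq> T \<Longrightarrow> smooth_on S f \<Longrightarrow> smooth_on S (\<lambda>x. h (f x))"
 by (simp add: smooth_on_def Ck_on_compose del: Ck_on.simps)

lemma smooth_on_cong: "open S \<Longrightarrow> (\<And>y. y \<in> S \<Longrightarrow> f y = g y) \<Longrightarrow> smooth_on S f \<Longrightarrow> smooth_on S g"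
 using Ck_on_cong[of S f g] by (auto simp add: smooth_on_def simp del: Ck_on.simps)

lemma smooth_on_Un:
 "open S \<Longrightarrow> open T \<Longrightarrow> smooth_on S f \<Longrightarrow> smooth_on T f \<Longrightarrow> smooth_on (S \<union> T) f"
 unfolding smooth_on_def using Ck_on_Un by blast

lemma smooth_on_partial: "smooth_on S f \<Longrightarrow> b \<in> Basis \<Longrightarrow> smooth_on S (partial b f)"
 by (metis Ck_on.simps(2) smooth_on_def)

lemma smooth_on_differentiable: "smooth_on S f \<Longrightarrow> x \<in> S \<Longrightarrow> f differentiable (at x)"
 by (metis Ck_on.simps(2) smooth_on_def)

lemma smooth_on_continuous: "smooth_on S f \<Longrightarrow> continuous_on S f"
 by (metis Ck_on.simps(1) smooth_on_def)

text \<open>A class of differentiable functions that is closed under partial derivatives, up to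
  values off \<open>S\<close>, consists of smooth functions. It is applied to the multiples of
  powers of 1/x, to integrals against admissible kernels and to functions of the second variable of
  a product.\<close>

lemma smooth_on_coinduct:
 assumes "P f"
  and "\<And>f x. P f \<Longrightarrow> x \<in> S \<Longrightarrow> f differentiable (at x)"
  and "\<And>f b. P f \<Longrightarrow> b \<in> Basis \<Longrightarrow> \<exists>g. P g \<and> (\<forall>x\<in>S. partial b f x = g x)"
  and "open S"
 shows "smooth_on S f"
proof -
 have "Ck_on k S f" if "P f" for k f
  using that
 proof (induction k arbitrary: f)
  case 0
  then show ?case
   using assms(2) by (auto intro!: continuous_at_imp_continuous_on differentiable_imp_continuous_within)
 next
  case (Suc k)
  have "Ck_on k S (partial b f)" if b: "b \<in> Basis" for b
  proof -
   obtain g where "P g" "\<forall>x\<in>S. partial b f x = g x" using assms(3)[OF Suc.prems b] by blast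
   then show ?thesis using Suc.IH Ck_on_cong[OF assms(4), of g "partial b f" k] by simp
  qed
  then show ?case using Suc.prems assms(2) by simp
 qed
 then show ?thesis using assms(1) by (simp add: smooth_on_def)
qed

lemma partial_real_deriv:
 assumes "(f has_real_derivative d) (at x)"
 shows "partial 1 f x = d"
 using partial_eqI[OF assms[unfolded has_field_derivative_def], of 1] by simp

lemma smooth_on_inverse: "smooth_on (-{0}) (inverse :: real \<Rightarrow> real)"
proof (rule smooth_on_coinduct[where P = "\<lambda>f. \<exists>c n. \<forall>x\<in>-{0}. f x = c * inverse x ^ n"])
 show "\<exists>c n. \<forall>x\<in>-{0}. inverse x = c * inverse (x::real) ^ n"
  by (rule exI[of _ 1], rule exI[of _ 1]) simp
next
 fix f :: "real \<Rightarrow> real" and x :: real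
 assume "\<exists>c n. \<forall>x\<in>-{0}. f x = c * inverse x ^ n" and x: "x \<in> -{0}"
 then obtain c n where f: "\<forall>x\<in>-{0}. f x = c * inverse x ^ n" by blast
 have "(\<lambda>x. c * inverse x ^ n) differentiable (at x)"
  using x by (auto intro!: derivative_intros)
 then show "f differentiable (at x)"
  using differentiable_cong_open[of "-{0}" x "\<lambda>x. c * inverse x ^ n" f] f x by auto
next
 fix f :: "real \<Rightarrow> real" and b :: real
 assume "\<exists>c n. \<forall>x\<in>-{0}. f x = c * inverse x ^ n" and b: "b \<in> Basis"
 then obtain c n where f: "\<forall>x\<in>-{0}. f x = c * inverse x ^ n" by blast
 have b1: "b = 1" using b by simp
 have "partial b f x = (- c * real n) * inverse x ^ (n+1)" if x: "x \<in> -{0}" for x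
 proof -
  have "partial b f x = partial 1 (\<lambda>x. c * inverse x ^ n) x"
   unfolding b1 using f x by (intro partial_cong_open[of "-{0}"]) auto
  also have "\<dots> = (- c * real n) * inverse x ^ (n+1)"
  proof (rule partial_real_deriv)
   show "((\<lambda>x. c * inverse x ^ n) has_real_derivative (- c * real n) * inverse x ^ (n+1)) (at x)"
   proof -
    have "((\<lambda>x. c * inverse x ^ n) has_real_derivative
      c * (real n * (- (inverse x * 1 * inverse x)) * inverse x ^ (n - Suc 0))) (at x)"
     using x by (auto intro!: derivative_eq_intros)
    then show ?thesis by (cases n) (simp_all add: algebra_simps)
   qed
  qed
  finally show ?thesis .
 qed
 then show "\<exists>g. (\<exists>c n. \<forall>x\<in>-{0}. g x = c * inverse x ^ n) \<and> (\<forall>x\<in>-{0}. partial b f x = g x)"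
  by (intro exI[of _ "\<lambda>x. (- c * real n) * inverse x ^ (n+1)"]) blast
qed auto

lemma smooth_on_divide:
 assumes "open S" "smooth_on S f" "smooth_on S g" "\<And>x. x \<in> S \<Longrightarrow> g x \<noteq> 0"
 shows "smooth_on S (\<lambda>x. f x / g x)"
proof -
 have "smooth_on S (\<lambda>x. inverse (g x))"
  by (rule smooth_on_compose[OF smooth_on_inverse assms(1) _ _ assms(3)]) (use assms(4) in auto)
 then show ?thesis using smooth_on_mult[OF assms(1,2)] by (simp add: divide_inverse)
qed

section \<open>The exponential bump and a symmetric smooth step\<close>

definition bumpE :: "nat \<Rightarrow> real \<Rightarrow> real" where
 "bumpE n x = (if x \<le> 0 then 0 else inverse x ^ n * exp (- inverse x))"

text \<open>The exponent in \<open>bumpE\<close> is there for this formula: the functions x^(-n)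
  exp(-1/x), extended by 0, are closed under differentiation up to linear combinations, so that
  smoothness follows by induction for all n at once.\<close>

lemma bumpE_deriv: "(bumpE n has_real_derivative bumpE (n+2) x - real n * bumpE (n+1) x) (at x)"
proof -
 consider "x < 0" | "x > 0" | "x = 0" by linarith
 then show ?thesis
 proof cases
  case 1
  have "(bumpE n has_real_derivative 0) (at x)"
   by (rule has_field_derivative_transform_within_open[where f="\<lambda>x. 0" and S="{..<0}"])
     (use 1 in \<open>auto simp: bumpE_def\<close>)
  then show ?thesis using 1 by (simp add: bumpE_def)
 next
  case 2
  have "((\<lambda>x. inverse x ^ n * exp (- inverse x)) has_real_derivative
    bumpE (n+2) x - real n * bumpE (n+1) x) (at x)"
  proof -
   have "((\<lambda>x. inverse x ^ n * exp (- inverse x)) has_real_derivative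
    (real n * (- (inverse x * 1 * inverse x)) * inverse x ^ (n - Suc 0)) * exp (- inverse x)
     + exp (- inverse x) * inverse x * inverse x * inverse x ^ n) (at x)"
    using 2 by (auto intro!: derivative_eq_intros)
   then show ?thesis using 2 by (cases n) (simp_all add: bumpE_def algebra_simps)
  qed
  then show ?thesis
   by (rule has_field_derivative_transform_within_open[where S="{0<..}"]) (use 2 in \<open>auto simp: bumpE_def\<close>)
 next
  case 3
  \<comment> \<open>At 0 the difference quotient of \<open>bumpE n\<close> is
    \<open>bumpE (n+1)\<close>; it tends to 0 from the right because the exponential beats every
    power at infinity.\<close>
  let ?A = "((\<lambda>h. bumpE (n+1) h) \<longlongrightarrow> 0)"
  have "?A (at 0)"
  proof (rule filterlim_split_at)
   show "?A (at_left 0)"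
    by (rule tendsto_eventually) (auto simp: bumpE_def eventually_at_filter)
   have "((\<lambda>y::real. y ^ (n+1) / exp y) \<longlongrightarrow> 0) at_top" by (rule tendsto_power_div_exp_0)
   then have "((\<lambda>h::real. inverse h ^ (n+1) / exp (inverse h)) \<longlongrightarrow> 0) (at_right 0)"
    by (rule filterlim_compose[OF _ filterlim_inverse_at_top_right])
   then show "?A (at_right 0)"
    by (rule Lim_transform_eventually)
      (auto simp: bumpE_def exp_minus divide_inverse eventually_at_filter)
  qed
  then have "((\<lambda>h. (bumpE n h - bumpE n 0) / h) \<longlongrightarrow> 0) (at 0)"
   by (rule Lim_transform_eventually) (auto simp: bumpE_def eventually_at_filter divide_inverse)
  then show ?thesis using 3 unfolding has_field_derivative_iff by (simp add: bumpE_def)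
 qed
qed

lemma bumpE_Ck: "Ck_on k UNIV (bumpE n)"
proof (induction k arbitrary: n)
 case 0
 have "isCont (bumpE n) x" for x using bumpE_deriv by (rule DERIV_isCont)
 then show ?case by (simp add: continuous_at_imp_continuous_on)
next
 case (Suc k)
 let ?A = "(\<lambda>x. bumpE (n+2) x + (- real n) * bumpE (n+1) x)"
 have "partial 1 (bumpE n) = ?A"
  using partial_real_deriv[OF bumpE_deriv] by auto
 moreover have "Ck_on k UNIV ?A"
  by (intro Ck_on_add Ck_on_mult Ck_on_const Suc.IH) auto
 moreover have "bumpE n differentiable (at x)" for x
  using bumpE_deriv[of n x] unfolding real_differentiable_def by blast
 ultimately show ?case by simp
qed

definition bump :: "real \<Rightarrow> real" where "bump = bumpE 0"

lemma smooth_on_bump: "smooth_on UNIV bump"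
 by (simp add: smooth_on_def bump_def bumpE_Ck del: Ck_on.simps)

lemma bump_eq_0: "x \<le> 0 \<Longrightarrow> bump x = 0" by (simp add: bump_def bumpE_def)
lemma bump_pos: "0 < x \<Longrightarrow> bump x > 0" by (simp add: bump_def bumpE_def)
lemma bump_nonneg: "bump x \<ge> 0" by (simp add: bump_def bumpE_def)

text \<open>A step that rises from 0 to 1 on [-1,1] and satisfies sstep(-s) = 1 - sstep(s). The
  symmetry makes its derivative even, and this is what lets the boundary terms of paired sides
  cancel after a change of sign of the argument.\<close>

definition sstep :: "real \<Rightarrow> real" where
 "sstep s = bump (1 + s) / (bump (1 + s) + bump (1 - s))"

lemma sstep_denom_pos: "bump (1 + s) + bump (1 - s) > 0"
proof (cases "s \<le> 0")
 case True
 then show ?thesis by (intro add_nonneg_pos bump_pos bump_nonneg) auto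
next
 case False
 then show ?thesis by (intro add_pos_nonneg bump_pos bump_nonneg) auto
qed

lemma smooth_on_sstep: "smooth_on UNIV sstep"
proof -
 have 1: "smooth_on UNIV (\<lambda>s. bump (1 + s))"
  by (rule smooth_on_compose[OF smooth_on_bump]) (use smooth_on_add[OF open_UNIV smooth_on_const smooth_on_linear[OF bounded_linear_ident]] in auto)
 have 2: "smooth_on UNIV (\<lambda>s. bump (1 - s))"
  by (rule smooth_on_compose[OF smooth_on_bump]) (use smooth_on_diff[OF open_UNIV smooth_on_const smooth_on_linear[OF bounded_linear_ident]] in auto)
 have "smooth_on UNIV (\<lambda>s. bump (1 + s) / (bump (1 + s) + bump (1 - s)))"
  using sstep_denom_pos by (intro smooth_on_divide[OF open_UNIV 1 smooth_on_add[OF open_UNIV 1 2]]) (metis less_irrefl)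
 then show ?thesis by (simp add: sstep_def[abs_def])
qed

lemma sstep_0: "s \<le> -1 \<Longrightarrow> sstep s = 0" by (simp add: sstep_def bump_eq_0)

lemma sstep_1: "s \<ge> 1 \<Longrightarrow> sstep s = 1"
 using bump_pos[of "1+s"] by (simp add: sstep_def bump_eq_0)

lemma sstep_nonneg: "0 \<le> sstep s"
 using sstep_denom_pos[of s] by (simp add: sstep_def bump_nonneg)

lemma sstep_le_1: "sstep s \<le> 1"
 using sstep_denom_pos[of s] bump_nonneg[of "1-s"] by (simp add: sstep_def)

lemma sstep_symm: "sstep (-s) = 1 - sstep s"
 using sstep_denom_pos[of s] by (simp add: sstep_def field_simps)

text \<open>The extension is smooth on \<open>U\<close> and on the complement of \<open>C\<close>,
  two open sets that cover the space.\<close>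

lemma test_fun_extend:
 assumes U: "open U" and C: "compact C" "C \<subseteq> U" and f: "smooth_on U f" "\<And>x. x \<in> U - C \<Longrightarrow> f x = 0"
 shows "test_fun U (\<lambda>x. if x \<in> U then f x else 0)"
proof -
 define g where "g = (\<lambda>x. if x \<in> U then f x else 0)"
 have oC: "open (- C)" using C(1) by (simp add: compact_imp_closed open_Compl)
 have 1: "smooth_on U g" by (rule smooth_on_cong[OF U _ f(1)]) (simp add: g_def)
 have 2: "smooth_on (-C) g"
  by (rule smooth_on_cong[OF oC _ smooth_on_const[of _ 0]]) (use f in \<open>auto simp: g_def\<close>)
 have "U \<union> - C = UNIV" using C(2) by auto
 then have 3: "smooth_on UNIV g" using smooth_on_Un[OF U oC 1 2] by simp
 have "{x. g x \<noteq> 0} \<subseteq> C" using f(2) by (auto simp: g_def)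
 then have 4: "closure {x. g x \<noteq> 0} \<subseteq> C"
  by (rule closure_minimal) (simp add: C(1) compact_imp_closed)
 then have 5: "compact (closure {x. g x \<noteq> 0})"
  using C(1) by (metis bounded_subset closed_closure compact_eq_bounded_closed)
 have "test_fun U g" unfolding test_fun_def using 3 4 5 C(2) by blast
 then show ?thesis by (simp add: g_def)
qed

section \<open>Integration by parts, parametric integrals and the fundamental lemma\<close>

lemma smooth_on_imp_Ck: "smooth_on S f \<Longrightarrow> Ck_on k S f"
 by (simp add: smooth_on_def)

lemma partial_eq_0_open:
 assumes "open S" "x \<in> S" "\<And>y. y \<in> S \<Longrightarrow> f y = 0"
 shows "partial b f x = 0"
 using partial_cong_open[OF assms(1,2), of f "\<lambda>_. 0" b] assms(3)
  partial_eqI[OF has_derivative_const[of 0 "at x"], of b] by simp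

lemma dir_deriv:
 assumes "f differentiable (at (x + t *\<^sub>R b))"
 shows "((\<lambda>t. f (x + t *\<^sub>R b)) has_real_derivative partial b f (x + t *\<^sub>R b)) (at t)"
proof -
 define D where "D = frechet_derivative f (at (x + t *\<^sub>R b))"
 have D: "(f has_derivative D) (at (x + t *\<^sub>R b))"
  using assms frechet_derivative_works unfolding D_def by blast
 have "((\<lambda>t. x + t *\<^sub>R b) has_derivative (\<lambda>s. s *\<^sub>R b)) (at t)"
  by (auto intro!: derivative_eq_intros)
 from has_derivative_compose[OF this D]
 have "((\<lambda>t. f (x + t *\<^sub>R b)) has_derivative (\<lambda>s. D (s *\<^sub>R b))) (at t)" .
 moreover have "D (s *\<^sub>R b) = partial b f (x + t *\<^sub>R b) * s" for s
  using bounded_linear.linear[OF has_derivative_bounded_linear[OF D]] partial_eqI[OF D, of b]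
  by (simp add: linear_cmul)
 ultimately show ?thesis by (simp add: has_field_derivative_def)
qed

lemma integrable_continuous_compact_support:
 fixes f :: "'a::euclidean_space \<Rightarrow> 'b::{banach, second_countable_topology}"
 assumes "continuous_on UNIV f" "compact C" "\<And>x. x \<notin> C \<Longrightarrow> f x = 0"
 shows "integrable lborel f"
proof -
 have "integrable lborel (\<lambda>x. indicator C x *\<^sub>R f x)"
  using assms by (intro borel_integrable_compact) (auto intro: continuous_on_subset)
 moreover have "(\<lambda>x. indicator C x *\<^sub>R f x) = f" using assms(3) by (auto simp: indicator_def)
 ultimately show ?thesis by simp
qed

lemma bounded_continuous_compact_support:
 fixes f :: "'a::euclidean_space \<Rightarrow> real"
 assumes "continuous_on UNIV f" "compact C" "\<And>x. x \<notin> C \<Longrightarrow> f x = 0"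
 obtains M where "M \<ge> 0" "\<And>x. \<bar>f x\<bar> \<le> M"
proof -
 have "bounded (f ` C)" using assms by (intro compact_imp_bounded compact_continuous_image) (auto intro: continuous_on_subset)
 then obtain M where M: "\<And>x. x \<in> C \<Longrightarrow> \<bar>f x\<bar> \<le> M" by (auto simp: bounded_iff)
 have "\<bar>f x\<bar> \<le> max M 0" for x using M[of x] assms(3)[of x] by (cases "x \<in> C") auto
 then show ?thesis using that[of "max M 0"] by auto
qed

text \<open>Differentiate under the integral sign the translation invariance of the integral of f.\<close>

lemma integral_partial_eq_0:
 fixes f :: "'a::euclidean_space \<Rightarrow> real"
 assumes f: "Ck_on 1 UNIV f" and C: "compact C" "\<And>x. x \<notin> C \<Longrightarrow> f x = 0" and b: "b \<in> Basis"
 shows "(LINT x|lebesgue. partial b f x) = 0"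
proof -
 have df: "f differentiable (at x)" for x using f by simp
 have pc: "continuous_on UNIV (partial b f)" using f b by simp
 have fc: "continuous_on UNIV f" using Ck_on_le[OF f, of 0] by simp
 have p0: "partial b f x = 0" if "x \<notin> C" for x
  using that C by (intro partial_eq_0_open[of "-C"]) (auto simp: compact_imp_closed open_Compl)
 obtain M where M: "M \<ge> 0" "\<And>x. \<bar>partial b f x\<bar> \<le> M"
  using bounded_continuous_compact_support[OF pc C(1) p0] by blast
 obtain R where R: "\<And>x. x \<in> C \<Longrightarrow> norm x \<le> R"
  using compact_imp_bounded[OF C(1)] by (auto simp: bounded_iff)
 define h where "h = (\<lambda>n. inverse (real (Suc n)))"
 define s where "s = (\<lambda>n x. (f (h n *\<^sub>R b + x) - f x) / h n)"
 have h: "0 < h n" "h n \<le> 1" for n by (auto simp: h_def field_simps)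
 have fi: "integrable lborel f" by (rule integrable_continuous_compact_support[OF fc C])
 have fti: "integrable lborel (\<lambda>x. f (c + x)) \<and> integral\<^sup>L lborel (\<lambda>x. f (c + x)) = integral\<^sup>L lborel f" for c
 proof -
  have m: "f \<in> borel_measurable borel" using fc by (rule borel_measurable_continuous_onI)
  have "integrable (distr lborel borel ((+) c)) f" using fi by (simp add: lborel_distr_plus)
  then have "integrable lborel (\<lambda>x. f (c + x))" by (subst (asm) integrable_distr_eq) (use m in auto)
  moreover have "integral\<^sup>L (distr lborel borel ((+) c)) f = integral\<^sup>L lborel (\<lambda>x. f (c + x))"
   by (subst integral_distr) (use m in auto)
  ultimately show ?thesis by (simp add: lborel_distr_plus)
 qed
 \<comment> \<open>The increments h n are at most 1, so all difference quotients vanish off the ball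
   of radius R + 1, and the mean value theorem bounds them by M.\<close>
 have "(\<lambda>n. integral\<^sup>L lborel (s n)) \<longlonglongrightarrow> integral\<^sup>L lborel (partial b f)"
 proof (rule integral_dominated_convergence[where w="\<lambda>x. indicator (cball 0 (R+1)) x *\<^sub>R M"])
  show "partial b f \<in> borel_measurable lborel" using pc by (simp add: borel_measurable_continuous_onI)
  show "s n \<in> borel_measurable lborel" for n
   unfolding s_def using fti[of "h n *\<^sub>R b"] fi
   by (intro borel_measurable_divide borel_measurable_diff) (auto dest: borel_measurable_integrable)
  show "integrable lborel (\<lambda>x::'a. indicator (cball 0 (R+1)) x *\<^sub>R M)"
   by (rule borel_integrable_compact) auto
  have "(\<lambda>n. s n x) \<longlonglongrightarrow> partial b f x" for x
  proof -
   have "((\<lambda>t. f (x + t *\<^sub>R b)) has_real_derivative partial b f (x + 0 *\<^sub>R b)) (at 0)"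
    by (rule dir_deriv[OF df])
   then have "(\<lambda>t. (f (x + t *\<^sub>R b) - f x) / t) \<midarrow>0\<rightarrow> partial b f x"
    by (simp add: DERIV_def)
   moreover have "filterlim h (at 0) sequentially"
    unfolding filterlim_at h_def using LIMSEQ_inverse_real_of_nat by auto
   ultimately have "(\<lambda>n. (f (x + h n *\<^sub>R b) - f x) / h n) \<longlonglongrightarrow> partial b f x"
    by (rule filterlim_compose)
   then show ?thesis unfolding s_def by (simp add: add.commute)
  qed
  then show "AE x in lborel. (\<lambda>n. s n x) \<longlonglongrightarrow> partial b f x" by simp
  have "norm (s n x) \<le> indicator (cball 0 (R+1)) x *\<^sub>R M" for n x
  proof (cases "norm x \<le> R + 1")
   case True
   have "\<exists>z. 0 < z \<and> z < h n \<and> f (x + h n *\<^sub>R b) - f (x + 0 *\<^sub>R b) = (h n - 0) * partial b f (x + z *\<^sub>R b)"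
    by (rule MVT2[OF h(1)]) (rule dir_deriv[OF df])
   then obtain z where "f (x + h n *\<^sub>R b) - f x = h n * partial b f (x + z *\<^sub>R b)" by auto
   then have "s n x = partial b f (x + z *\<^sub>R b)" using h(1)[of n] by (simp add: s_def add.commute)
   then show ?thesis using M True by simp
  next
   case False
   have "norm (x) \<le> norm (h n *\<^sub>R b + x) + norm (h n *\<^sub>R b)"
    using norm_triangle_ineq4[of "h n *\<^sub>R b + x" "h n *\<^sub>R b"] by simp
   then have "norm (h n *\<^sub>R b + x) > R" using False h[of n] b by simp
   then have "h n *\<^sub>R b + x \<notin> C" "x \<notin> C" using R[of "h n *\<^sub>R b + x"] R[of x] False by auto
   then show ?thesis using C(2) False by (simp add: s_def)
  qed
  then show "AE x in lborel. norm (s n x) \<le> indicator (cball 0 (R+1)) x *\<^sub>R M" for n by simp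
 qed
 moreover have "integral\<^sup>L lborel (s n) = 0" for n
  using fti[of "h n *\<^sub>R b"] fi by (simp add: s_def[abs_def] integral_diff)
 ultimately have "integral\<^sup>L lborel (partial b f) = 0"
  by (simp add: LIMSEQ_const_iff)
 then show ?thesis
  using pc by (subst integral_completion) (auto intro: borel_measurable_continuous_onI)
qed

section \<open>Locally integrable functions and integrals depending on a parameter\<close>

lemma restrict_zero_outside:
 fixes f :: "'a::euclidean_space \<Rightarrow> 'b::{banach, second_countable_topology}"
 assumes "S \<in> sets lebesgue" "T \<in> sets lebesgue" "S \<subseteq> T" "\<And>x. x \<in> T - S \<Longrightarrow> f x = 0"
 shows "integrable (lebesgue_on T) f \<longleftrightarrow> integrable (lebesgue_on S) f"
  and "integral\<^sup>L (lebesgue_on T) f = integral\<^sup>L (lebesgue_on S) f"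
proof -
 have "(\<lambda>x. indicator T x *\<^sub>R f x) = (\<lambda>x. indicator S x *\<^sub>R f x)"
 proof
  fix x show "indicator T x *\<^sub>R f x = indicator S x *\<^sub>R f x"
   using assms(3,4) by (cases "x \<in> S"; cases "x \<in> T") auto
 qed
 note eq = this
 have S: "S \<inter> space lebesgue \<in> sets lebesgue" and T: "T \<inter> space lebesgue \<in> sets lebesgue"
  using assms(1,2) by auto
 show "integrable (lebesgue_on T) f \<longleftrightarrow> integrable (lebesgue_on S) f"
  unfolding integrable_restrict_space[OF S] integrable_restrict_space[OF T] eq ..
 show "integral\<^sup>L (lebesgue_on T) f = integral\<^sup>L (lebesgue_on S) f"
  unfolding integral_restrict_space[OF S] integral_restrict_space[OF T] eq ..
qed

text \<open>The real counterpart of \<open>L1_loc\<close>; complex functions are treated through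
  their real and imaginary parts.\<close>

definition l1loc :: "'a::euclidean_space set \<Rightarrow> ('a \<Rightarrow> real) \<Rightarrow> bool" where
 "l1loc U u \<longleftrightarrow> (\<forall>C. compact C \<and> C \<subseteq> U \<longrightarrow> integrable (lebesgue_on C) u)"

lemma integrable_mult_l1loc:
 assumes U: "open U" and C: "compact C" "C \<subseteq> U" and u: "l1loc U u"
  and g: "continuous_on U g" "\<And>x. x \<in> U - C \<Longrightarrow> g x = 0"
 shows "integrable (lebesgue_on U) (\<lambda>x. g x * u x)"
proof -
 have Cm: "C \<in> sets lebesgue" using C(1) by (simp add: borel_compact)
 have iu: "integrable (lebesgue_on C) u" using u C by (simp add: l1loc_def)
 have gC: "continuous_on C g" using g(1) C(2) continuous_on_subset by blast
 then have "bounded (g ` C)" by (intro compact_imp_bounded compact_continuous_image C)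
 then obtain M where M: "\<And>x. x \<in> C \<Longrightarrow> \<bar>g x\<bar> \<le> M" by (auto simp: bounded_iff)
 have "integrable (lebesgue_on C) (\<lambda>x. g x * u x)"
 proof (rule Bochner_Integration.integrable_bound[where f="\<lambda>x. M * u x"])
  show "integrable (lebesgue_on C) (\<lambda>x. M * u x)" using iu by simp
  show "(\<lambda>x. g x * u x) \<in> borel_measurable (lebesgue_on C)"
   using continuous_imp_measurable_on_sets_lebesgue[OF gC Cm] iu
   by (intro borel_measurable_times) auto
  have "norm (g x * u x) \<le> norm (M * u x)" if "x \<in> C" for x
   using M[OF that] by (auto simp: abs_mult intro!: mult_right_mono)
  then show "AE x in lebesgue_on C. norm (g x * u x) \<le> norm (M * u x)"
   by (intro AE_I2) simp
 qed
 then show ?thesis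
  by (subst restrict_zero_outside(1)[OF Cm _ C(2)]) (use U g(2) in auto)
qed

text \<open>Kernels that can be integrated against any locally integrable function and
  differentiated under the integral sign: locally uniformly in the first variable, the support in
  the second stays in a compact subset of \<open>U\<close>. The class is stable under derivatives in
  the first variable.\<close>

definition adm :: "'a::euclidean_space set \<Rightarrow> 'b::euclidean_space set \<Rightarrow> ('a \<times> 'b \<Rightarrow> real) \<Rightarrow> bool" where
 "adm V U q \<longleftrightarrow> smooth_on (V \<times> U) q \<and>
  (\<forall>z0\<in>V. \<exists>r>0. \<exists>C. compact C \<and> C \<subseteq> U \<and> (\<forall>z\<in>V \<inter> ball z0 r. \<forall>w\<in>U - C. q (z, w) = 0))"

lemma admE:
 assumes "adm V U q" "open V" "z0 \<in> V"
 obtains r C where "r > 0" "compact C" "C \<subseteq> U" "cball z0 r \<subseteq> V"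
  "\<And>z w. z \<in> cball z0 r \<Longrightarrow> w \<in> U - C \<Longrightarrow> q (z, w) = 0"
proof -
 obtain r C where r: "r > 0" "compact C" "C \<subseteq> U" "\<forall>z\<in>V \<inter> ball z0 r. \<forall>w\<in>U - C. q (z, w) = 0"
  using assms unfolding adm_def by blast
 obtain e where e: "e > 0" "cball z0 e \<subseteq> V" using assms open_contains_cball by blast
 define d where "d = min e (r/2)"
 have "cball z0 d \<subseteq> V \<inter> ball z0 r"
  using e r(1) by (auto simp: d_def subset_iff)
 moreover have "d > 0" using e r by (simp add: d_def)
 ultimately show ?thesis using that[of d C] r by blast
qed

lemma adm_partial:
 assumes "adm V U q" "open V" "open U" "b \<in> Basis"
 shows "adm V U (partial (b, 0) q)"
 unfolding adm_def
proof (intro conjI ballI)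
 show "smooth_on (V \<times> U) (partial (b, 0) q)"
  using assms by (intro smooth_on_partial) (auto simp: adm_def Basis_prod_def)
 fix z0 assume "z0 \<in> V"
 then obtain r C where r: "r > 0" "compact C" "C \<subseteq> U" "cball z0 r \<subseteq> V"
  "\<And>z w. z \<in> cball z0 r \<Longrightarrow> w \<in> U - C \<Longrightarrow> q (z, w) = 0" using admE[OF assms(1,2)] by metis
 have "partial (b, 0) q (z, w) = 0" if "z \<in> V \<inter> ball z0 r" "w \<in> U - C" for z w
  by (rule partial_eq_0_open[of "ball z0 r \<times> (U - C)"])
    (use r that assms in \<open>auto intro!: open_Times open_Diff compact_imp_closed\<close>)
 then show "\<exists>r>0. \<exists>C. compact C \<and> C \<subseteq> U \<and> (\<forall>z\<in>V \<inter> ball z0 r. \<forall>w\<in>U - C. partial (b, 0) q (z, w) = 0)"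
  using r by blast
qed

lemma has_derivative_fst_partial:
 assumes "q differentiable (at (z, w))"
 shows "((\<lambda>z. q (z, w)) has_derivative (\<lambda>h. \<Sum>b\<in>Basis. (h \<bullet> b) * partial (b, 0) q (z, w))) (at z)"
proof -
 define D where "D = frechet_derivative q (at (z, w))"
 have D: "(q has_derivative D) (at (z, w))"
  using assms frechet_derivative_works unfolding D_def by blast
 interpret D: bounded_linear D using D by (rule has_derivative_bounded_linear)
 have "((\<lambda>z. (z, w)) has_derivative (\<lambda>h. (h, 0))) (at z)"
  by (auto intro!: derivative_eq_intros)
 from has_derivative_compose[OF this D]
 have "((\<lambda>z. q (z, w)) has_derivative (\<lambda>h. D (h, 0))) (at z)" .
 moreover have "D (h, 0) = (\<Sum>b\<in>Basis. (h \<bullet> b) * partial (b, 0) q (z, w))" for h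
 proof -
  let ?A = "(\<Sum>b\<in>Basis. (h \<bullet> b) *\<^sub>R (b, 0::'b))"
  have "(h, 0) = ?A"
   by (simp add: prod_eq_iff fst_sum snd_sum euclidean_representation)
  then have "D (h, 0) = D ?A" by (rule arg_cong)
  then show ?thesis by (simp only: D.sum D.scaleR partial_eqI[OF D] real_scaleR_def)
 qed
 ultimately show ?thesis by simp
qed

context
 fixes V :: "'a::euclidean_space set" and U :: "'b::euclidean_space set"
  and q :: "'a \<times> 'b \<Rightarrow> real" and u :: "'b \<Rightarrow> real"
 assumes V: "open V" and U: "open U" and q: "adm V U q" and u: "l1loc U u"
begin

lemma adm_integrable:
 assumes "z \<in> V"
 shows "integrable (lebesgue_on U) (\<lambda>w. q (z, w) * u w)"
proof -
 obtain r C where r: "r > 0" "compact C" "C \<subseteq> U" "cball z r \<subseteq> V"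
  "\<And>z' w. z' \<in> cball z r \<Longrightarrow> w \<in> U - C \<Longrightarrow> q (z', w) = 0" using admE[OF q V assms] by metis
 have "continuous_on (V \<times> U) q" using q by (simp add: adm_def smooth_on_continuous)
 then have "continuous_on U (\<lambda>w. q (z, w))"
  by (rule continuous_on_compose2) (use assms in \<open>auto intro!: continuous_intros\<close>)
 then show ?thesis using r assms by (intro integrable_mult_l1loc[OF U r(2,3) u]) auto
qed

end

text \<open>Dominated convergence for the first order Taylor remainder of the kernel, divided by the
  norm of the increment. It tends to 0 pointwise since \<open>q\<close> is differentiable, it
  vanishes off the compact set \<open>C\<close>, and on \<open>C\<close> the mean value theorem
  along the segment bounds it by 2 M'.\<close>

lemma parametric_has_derivative:
 fixes V :: "'a::euclidean_space set" and U :: "'b::euclidean_space set"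
  and q :: "'a \<times> 'b \<Rightarrow> real" and u :: "'b \<Rightarrow> real"
 assumes V: "open V" and U: "open U" and q: "adm V U q" and u: "l1loc U u" and z0: "z0 \<in> V"
 shows "((\<lambda>z. LINT w|lebesgue_on U. q (z, w) * u w) has_derivative
   (\<lambda>h. \<Sum>b\<in>Basis. (h \<bullet> b) * (LINT w|lebesgue_on U. partial (b, 0) q (z0, w) * u w))) (at z0)"
proof -
 let ?p = "\<lambda>b. partial (b, 0) q"
 let ?L = "lebesgue_on U"
 obtain r C where r: "r > 0" "compact C" "C \<subseteq> U" "cball z0 r \<subseteq> V"
  "\<And>z w. z \<in> cball z0 r \<Longrightarrow> w \<in> U - C \<Longrightarrow> q (z, w) = 0" using admE[OF q V z0] by metis
 have qd: "q differentiable (at (z, w))" if "z \<in> V" "w \<in> U" for z w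
  using q that smooth_on_differentiable[of "V \<times> U"] by (auto simp: adm_def)
 have "\<exists>M. \<forall>b\<in>Basis. \<forall>z\<in>cball z0 r. \<forall>w\<in>C. \<bar>?p b (z, w)\<bar> \<le> M"
 proof -
  have "\<exists>M. \<forall>x\<in>cball z0 r \<times> C. \<bar>?p b x\<bar> \<le> M" if "b \<in> Basis" for b
  proof -
   have "continuous_on (cball z0 r \<times> C) (?p b)"
    using adm_partial[OF q V U that] r
    by (auto simp: adm_def intro!: continuous_on_subset[OF smooth_on_continuous])
   then have "bounded (?p b ` (cball z0 r \<times> C))"
    by (intro compact_imp_bounded compact_continuous_image compact_Times r) auto
   then show ?thesis by (auto simp: bounded_iff)
  qed
  then obtain M where M: "\<And>b x. b \<in> Basis \<Longrightarrow> x \<in> cball z0 r \<times> C \<Longrightarrow> \<bar>?p b x\<bar> \<le> M b" by metis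
  have "\<bar>?p b (z, w)\<bar> \<le> (\<Sum>b\<in>Basis. \<bar>M b\<bar>)" if "b \<in> Basis" "z \<in> cball z0 r" "w \<in> C" for b z w
   using M[OF that(1), of "(z, w)"] that member_le_sum[of b Basis "\<lambda>b. \<bar>M b\<bar>"] by fastforce
  then show ?thesis by blast
 qed
 then obtain M where M: "\<And>b z w. b \<in> Basis \<Longrightarrow> z \<in> cball z0 r \<Longrightarrow> w \<in> C \<Longrightarrow> \<bar>?p b (z, w)\<bar> \<le> M" by blast
 define M' where "M' = DIM('a) * \<bar>M\<bar>"
 have lin: "\<bar>\<Sum>b\<in>Basis. (h \<bullet> b) * ?p b (z, w)\<bar> \<le> M' * norm h"
  if "z \<in> cball z0 r" "w \<in> C" for h z w
 proof -
  have "\<bar>\<Sum>b\<in>Basis. (h \<bullet> b) * ?p b (z, w)\<bar> \<le> (\<Sum>b\<in>Basis. \<bar>(h \<bullet> b) * ?p b (z, w)\<bar>)" by (rule sum_abs)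
  also have "\<dots> \<le> (\<Sum>b\<in>(Basis::'a set). norm h * \<bar>M\<bar>)"
  proof (rule sum_mono)
   fix b :: 'a assume b: "b \<in> Basis"
   have "\<bar>?p b (z, w)\<bar> \<le> \<bar>M\<bar>" using M[OF b that] by linarith
   then show "\<bar>(h \<bullet> b) * ?p b (z, w)\<bar> \<le> norm h * \<bar>M\<bar>"
    unfolding abs_mult using Basis_le_norm[OF b, of h] by (intro mult_mono) auto
  qed
  finally show ?thesis by (simp add: M'_def mult_ac)
 qed
 have qdz: "((\<lambda>z. q (z, w)) has_derivative (\<lambda>h. \<Sum>b\<in>Basis. (h \<bullet> b) * ?p b (z, w))) (at z)"
  if "z \<in> V" "w \<in> U" for z w by (rule has_derivative_fst_partial[OF qd[OF that]])
 have inc: "\<bar>q (z0 + h, w) - q (z0, w)\<bar> \<le> M' * norm h" if h: "norm h < r" and w: "w \<in> C" for h w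
 proof -
  have in_c: "z0 + t *\<^sub>R h \<in> cball z0 r" if "0 \<le> t" "t \<le> 1" for t
  proof -
   have "\<bar>t\<bar> * norm h \<le> 1 * r" using h that by (intro mult_mono) auto
   then show ?thesis by (simp add: dist_norm)
  qed
  have "\<exists>t. 0 < t \<and> t < 1 \<and> q (z0 + 1 *\<^sub>R h, w) - q (z0 + 0 *\<^sub>R h, w)
    = (1 - 0) * (\<Sum>b\<in>Basis. (h \<bullet> b) * ?p b (z0 + t *\<^sub>R h, w))"
  proof (rule MVT2[OF zero_less_one])
   fix t :: real assume t: "0 \<le> t" "t \<le> 1"
   have 1: "((\<lambda>t. z0 + t *\<^sub>R h) has_derivative (\<lambda>s. s *\<^sub>R h)) (at t)"
    by (auto intro!: derivative_eq_intros)
   have 2: "z0 + t *\<^sub>R h \<in> V" "w \<in> U" using in_c[OF t] r w by auto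
   have "(\<lambda>s. \<Sum>b\<in>Basis. (s *\<^sub>R h \<bullet> b) * ?p b (z0 + t *\<^sub>R h, w))
     = (*) (\<Sum>b\<in>Basis. (h \<bullet> b) * ?p b (z0 + t *\<^sub>R h, w))"
    by (rule ext) (simp add: sum_distrib_left mult_ac)
   then show "((\<lambda>t. q (z0 + t *\<^sub>R h, w)) has_real_derivative
     (\<Sum>b\<in>Basis. (h \<bullet> b) * ?p b (z0 + t *\<^sub>R h, w))) (at t)"
    using has_derivative_compose[OF 1 qdz[OF 2]] by (simp add: has_field_derivative_def)
  qed
  then obtain t where t: "0 < t" "t < 1"
   "q (z0 + h, w) - q (z0, w) = (\<Sum>b\<in>Basis. (h \<bullet> b) * ?p b (z0 + t *\<^sub>R h, w))" by auto
  then show ?thesis using lin[OF in_c[of t] w, of h] by simp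
 qed
 define I where "I = (\<lambda>h w. (q (z0 + h, w) - q (z0, w) - (\<Sum>b\<in>Basis. (h \<bullet> b) * ?p b (z0, w))) / norm h * u w)"
 define F where "F = (\<lambda>z. LINT w|?L. q (z, w) * u w)"
 define F' where "F' = (\<lambda>h. \<Sum>b\<in>Basis. (h \<bullet> b) * (LINT w|?L. ?p b (z0, w) * u w))"
 have ip: "integrable ?L (\<lambda>w. (h \<bullet> b) * (?p b (z0, w) * u w))" if "b \<in> Basis" for b h
  using adm_integrable[OF V U adm_partial[OF q V U that] u z0] by simp
 have iq: "integrable ?L (\<lambda>w. q (z0 + h, w) * u w)" if "norm h < r" for h
  using adm_integrable[OF V U q u, of "z0 + h"] r(4) that by (auto simp: dist_norm subset_iff)
 have I_eq: "I h = (\<lambda>w. (q (z0 + h, w) * u w - q (z0, w) * u w - (\<Sum>b\<in>Basis. (h \<bullet> b) * (?p b (z0, w) * u w))) / norm h)" for h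
 proof
  fix w
  have "(\<Sum>b\<in>Basis. (h \<bullet> b) * (?p b (z0, w) * u w)) = (\<Sum>b\<in>Basis. (h \<bullet> b) * ?p b (z0, w)) * u w"
   by (simp add: sum_distrib_right mult.assoc)
  then show "I h w = (q (z0 + h, w) * u w - q (z0, w) * u w - (\<Sum>b\<in>Basis. (h \<bullet> b) * (?p b (z0, w) * u w))) / norm h"
   by (simp add: I_def left_diff_distrib)
 qed
 have Ii: "integrable ?L (I h)" if "norm h < r" for h
  unfolding I_eq using iq[of 0] r(1) iq[OF that] ip
  by (intro integrable_divide Bochner_Integration.integrable_diff Bochner_Integration.integrable_sum) auto
 have I_int: "(F (z0 + h) - F z0 - F' h) / norm h = (LINT w|?L. I h w)" if "norm h < r" for h
 proof -
  have "(LINT w|?L. I h w) = (LINT w|?L. q (z0 + h, w) * u w - q (z0, w) * u w - (\<Sum>b\<in>Basis. (h \<bullet> b) * (?p b (z0, w) * u w))) / norm h"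
   unfolding I_eq by simp
  also have "(LINT w|?L. q (z0 + h, w) * u w - q (z0, w) * u w - (\<Sum>b\<in>Basis. (h \<bullet> b) * (?p b (z0, w) * u w)))
   = F (z0 + h) - F z0 - F' h"
   unfolding F_def F'_def using iq[of 0] r(1) iq[OF that] ip
   by (subst Bochner_Integration.integral_diff Bochner_Integration.integral_sum; (intro Bochner_Integration.integrable_diff Bochner_Integration.integrable_sum)?; simp)+
  finally show ?thesis by simp
 qed
 let ?B = "(\<lambda>h. (F (z0 + h) - F z0 - F' h) / norm h)"
 have lim: "(?B \<longlongrightarrow> 0) (at 0)"
  unfolding tendsto_at_iff_sequentially
 proof (intro allI impI)
  fix X :: "nat \<Rightarrow> 'a" assume X0: "\<forall>i. X i \<in> UNIV - {0}" and X: "X \<longlonglongrightarrow> 0"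
  \<comment> \<open>Increments that leave the ball of radius r get the value 0. This concerns
    finitely many n only, and makes the domination hold for every n.\<close>
  define s where "s = (\<lambda>n w. if norm (X n) < r then I (X n) w else 0)"
  have ev: "\<forall>\<^sub>F n in sequentially. norm (X n) < r"
   using X r(1) by (metis (no_types, lifting) LIMSEQ_iff diff_zero eventually_sequentiallyI)
  have "(\<lambda>n. LINT w|?L. s n w) \<longlonglongrightarrow> (LINT w|?L. 0)"
  proof (rule integral_dominated_convergence[where w="\<lambda>w. 2 * M' * (indicator C w * \<bar>u w\<bar>)"])
   show "s n \<in> borel_measurable ?L" for n
    using Ii[of "X n"] by (cases "norm (X n) < r") (auto simp: s_def[abs_def])
   let ?A = "(\<lambda>w. indicator C w * \<bar>u w\<bar>)"
   have "integrable (lebesgue_on C) (\<lambda>w. \<bar>u w\<bar>)" using u r by (auto simp: l1loc_def)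
   moreover have "integrable (lebesgue_on C) (\<lambda>w. \<bar>u w\<bar>) \<longleftrightarrow> integrable (lebesgue_on C) ?A"
    by (rule Bochner_Integration.integrable_cong) auto
   ultimately have "integrable (lebesgue_on C) ?A" by blast
   then have "integrable ?L ?A"
    by (subst restrict_zero_outside(1)[OF _ _ r(3)]) (use U r(2) in \<open>auto simp: borel_compact\<close>)
   then show "integrable ?L (\<lambda>w. 2 * M' * (indicator C w * \<bar>u w\<bar>))" by (rule integrable_mult_right)
   have "(\<lambda>n. s n w) \<longlonglongrightarrow> 0" if w: "w \<in> U" for w
   proof -
    have "((\<lambda>h. \<bar>(q (z0 + h, w) - q (z0, w) - (\<Sum>b\<in>Basis. (h \<bullet> b) * ?p b (z0, w))) / norm h\<bar>) \<longlongrightarrow> 0) (at 0)"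
     using qdz[OF z0 w] unfolding has_derivative_at by (simp add: abs_divide)
    from tendsto_rabs_zero_cancel[OF this]
    have "((\<lambda>h. I h w) \<longlongrightarrow> 0 * u w) (at 0)"
     unfolding I_def by (intro tendsto_mult tendsto_const)
    then have "(\<lambda>n. I (X n) w) \<longlonglongrightarrow> 0"
     using X0 X unfolding tendsto_at_iff_sequentially by (auto simp: o_def)
    then show ?thesis
     by (rule Lim_transform_eventually) (use ev in \<open>auto simp: s_def elim!: eventually_mono\<close>)
   qed
   then show "AE w in ?L. (\<lambda>n. s n w) \<longlonglongrightarrow> 0" by (intro AE_I2) simp
   have "norm (s n w) \<le> 2 * M' * (indicator C w * \<bar>u w\<bar>)" if w: "w \<in> U" for n w
   proof (cases "norm (X n) < r \<and> w \<in> C")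
    case True
    have n0: "norm (X n) > 0" using X0 by simp
    have "\<bar>q (z0 + X n, w) - q (z0, w) - (\<Sum>b\<in>Basis. (X n \<bullet> b) * ?p b (z0, w))\<bar> \<le> 2 * M' * norm (X n)"
     using inc[of "X n" w] lin[of z0 w "X n"] True r(1) by auto
    then have "\<bar>(q (z0 + X n, w) - q (z0, w) - (\<Sum>b\<in>Basis. (X n \<bullet> b) * ?p b (z0, w))) / norm (X n)\<bar> \<le> 2 * M'"
     using n0 by (simp add: divide_le_eq)
    from mult_right_mono[OF this, of "\<bar>u w\<bar>"]
    have "\<bar>(q (z0 + X n, w) - q (z0, w) - (\<Sum>b\<in>Basis. (X n \<bullet> b) * ?p b (z0, w))) / norm (X n) * u w\<bar> \<le> 2 * M' * \<bar>u w\<bar>"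
     unfolding abs_mult by simp
    then show ?thesis using True by (simp add: s_def I_def)
   next
    case False
    have "s n w = 0"
    proof (cases "norm (X n) < r")
     case True
     then have wC: "w \<in> U - C" using False w by auto
     have "?p b (z0, w) = 0" if "b \<in> Basis" for b
      by (rule partial_eq_0_open[of "ball z0 r \<times> (U - C)"])
        (use r wC U in \<open>auto intro!: open_Times open_Diff compact_imp_closed\<close>)
     then show ?thesis using r(5)[OF _ wC, of "z0 + X n"] r(5)[OF _ wC, of z0] True r(1)
      by (simp add: s_def I_def dist_norm)
    qed (simp add: s_def)
    then show ?thesis by (simp add: M'_def)
   qed
   then show "AE w in ?L. norm (s n w) \<le> 2 * M' * (indicator C w * \<bar>u w\<bar>)" for n
    by (intro AE_I2) simp
  qed simp
  then have "(\<lambda>n. LINT w|?L. s n w) \<longlonglongrightarrow> 0" by simp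
  then show "(?B \<circ> X) \<longlonglongrightarrow> 0"
   by (rule Lim_transform_eventually)
     (use ev I_int in \<open>auto simp: s_def o_def elim!: eventually_mono\<close>)
 qed
 have "bounded_linear F'"
  unfolding F'_def by (intro bounded_linear_sum bounded_linear_mult_const bounded_linear_inner_left)
 then have "(F has_derivative F') (at z0)"
  unfolding has_derivative_at using tendsto_norm_zero[OF lim] by (simp add: norm_divide)
 then show ?thesis unfolding F_def F'_def .
qed

lemma parametric_partial:
 assumes "open V" "open U" "adm V U q" "l1loc U u" "z \<in> V" "b \<in> Basis"
 shows "partial b (\<lambda>z. LINT w|lebesgue_on U. q (z, w) * u w) z = (LINT w|lebesgue_on U. partial (b, 0) q (z, w) * u w)"
 using partial_eqI[OF parametric_has_derivative[OF assms(1-5)], of b] assms(6)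
 by (simp add: inner_Basis if_distrib if_distribR sum.delta cong: if_cong)

text \<open>The integrals of a fixed \<open>u\<close> against admissible kernels form a class that
  is closed under partial derivatives.\<close>

lemma parametric_smooth:
 assumes "open V" "open U" "adm V U q" "l1loc U u"
 shows "smooth_on V (\<lambda>z. LINT w|lebesgue_on U. q (z, w) * u w)"
proof (rule smooth_on_coinduct[where P="\<lambda>f. \<exists>q. adm V U q \<and> (\<forall>z\<in>V. f z = (LINT w|lebesgue_on U. q (z, w) * u w))"])
 show "\<exists>q'. adm V U q' \<and> (\<forall>z\<in>V. (LINT w|lebesgue_on U. q (z, w) * u w) = (LINT w|lebesgue_on U. q' (z, w) * u w))"
  using assms by blast
next
 fix f z assume "\<exists>q. adm V U q \<and> (\<forall>z\<in>V. f z = (LINT w|lebesgue_on U. q (z, w) * u w))" and z: "z \<in> V"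
 then obtain q where q: "adm V U q" "\<forall>z\<in>V. f z = (LINT w|lebesgue_on U. q (z, w) * u w)" by blast
 show "f differentiable (at z)"
  by (rule differentiable_cong_open[OF assms(1) z _ differentiableI[OF parametric_has_derivative[OF assms(1,2) q(1) assms(4) z]]])
    (use q in auto)
next
 fix f :: "'a \<Rightarrow> real" and b :: 'a
 assume "\<exists>q. adm V U q \<and> (\<forall>z\<in>V. f z = (LINT w|lebesgue_on U. q (z, w) * u w))" and b: "b \<in> Basis"
 then obtain q where q: "adm V U q" "\<forall>z\<in>V. f z = (LINT w|lebesgue_on U. q (z, w) * u w)" by blast
 have "partial b f z = (LINT w|lebesgue_on U. partial (b, 0) q (z, w) * u w)" if "z \<in> V" for z
  using partial_cong_open[OF assms(1) that, of f "\<lambda>z. LINT w|lebesgue_on U. q (z, w) * u w" b]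
   q(2) parametric_partial[OF assms(1,2) q(1) assms(4) that b] by simp
 then show "\<exists>g. (\<exists>q. adm V U q \<and> (\<forall>z\<in>V. g z = (LINT w|lebesgue_on U. q (z, w) * u w))) \<and> (\<forall>z\<in>V. partial b f z = g z)"
  using adm_partial[OF q(1) assms(1,2) b]
  by (intro exI[of _ "\<lambda>z. LINT w|lebesgue_on U. partial (b, 0) q (z, w) * u w"]) blast
qed (rule assms(1))

section \<open>The fundamental lemma of the calculus of variations\<close>

lemma AE_eq_0_if_integral_boxes_eq_0:
 fixes v :: "'a::euclidean_space \<Rightarrow> real"
 assumes v: "integrable lborel v" and 0: "\<And>c d. (LINT x|lborel. indicator (box c d) x * v x) = 0"
 shows "AE x in lborel. v x = 0"
proof -
 let ?p = "\<lambda>x. ennreal (v x)" and ?n = "\<lambda>x. ennreal (- v x)"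
 have vm: "v \<in> borel_measurable lborel" using v by simp
 have eq: "(\<integral>\<^sup>+x. ?p x * indicator (box c d) x \<partial>lborel) = (\<integral>\<^sup>+x. ?n x * indicator (box c d) x \<partial>lborel)
   \<and> (\<integral>\<^sup>+x. ?p x * indicator (box c d) x \<partial>lborel) \<noteq> \<infinity>" for c d
 proof -
  let ?B = "indicator (box c d) :: 'a \<Rightarrow> real"
  let ?w = "\<lambda>x. ?B x * v x"
  have iw: "integrable lborel ?w" using integrable_mult_indicator[of "box c d" lborel v] v by simp
  have 1: "(\<integral>\<^sup>+x. ?p x * indicator (box c d) x \<partial>lborel) = (\<integral>\<^sup>+x. ennreal (?w x) \<partial>lborel)"
   by (intro nn_integral_cong) (auto simp: indicator_def)
  have 2: "(\<integral>\<^sup>+x. ?n x * indicator (box c d) x \<partial>lborel) = (\<integral>\<^sup>+x. ennreal (- ?w x) \<partial>lborel)"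
   by (intro nn_integral_cong) (auto simp: indicator_def)
  have f1: "(\<integral>\<^sup>+x. ennreal (?w x) \<partial>lborel) \<noteq> \<infinity>" and f2: "(\<integral>\<^sup>+x. ennreal (- ?w x) \<partial>lborel) \<noteq> \<infinity>"
   using iw by (auto simp: real_integrable_def)
  have "enn2real (\<integral>\<^sup>+x. ennreal (?w x) \<partial>lborel) = enn2real (\<integral>\<^sup>+x. ennreal (- ?w x) \<partial>lborel)"
   using real_lebesgue_integral_def[OF iw] 0[of c d] by simp
  then have "ennreal (enn2real (\<integral>\<^sup>+x. ennreal (?w x) \<partial>lborel)) = ennreal (enn2real (\<integral>\<^sup>+x. ennreal (- ?w x) \<partial>lborel))"
   by (rule arg_cong)
  then have "(\<integral>\<^sup>+x. ennreal (?w x) \<partial>lborel) = (\<integral>\<^sup>+x. ennreal (- ?w x) \<partial>lborel)"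
   using f1 f2 by (subst (asm) (1 2) ennreal_enn2real) (auto simp: less_top)
  then show ?thesis using 1 2 f1 by simp
 qed
 \<comment> \<open>The positive and the negative part of v are densities of two measures that agree
   on boxes, a generator stable under intersection. Uniqueness of densities makes the two parts
   equal almost everywhere; as one of them always vanishes, both do.\<close>
 have "density lborel ?p = density lborel ?n"
 proof (rule measure_eqI_generator_eq)
  let ?E = "range (\<lambda>(a, b). box a b::'a set)"
  show "Int_stable ?E" by (auto simp: Int_stable_def box_Int_box)
  show "?E \<subseteq> Pow UNIV" "sets (density lborel ?p) = sigma_sets UNIV ?E" "sets (density lborel ?n) = sigma_sets UNIV ?E"
   by (simp_all add: borel_eq_box)
  let ?A = "\<lambda>n::nat. box (- (real n *\<^sub>R One)) (real n *\<^sub>R One) :: 'a set"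
  show "range ?A \<subseteq> ?E" "(\<Union>i. ?A i) = UNIV" unfolding UN_box_eq_UNIV by auto
  show "emeasure (density lborel ?p) (?A i) \<noteq> \<infinity>" for i
   using vm eq[of "- (real i *\<^sub>R One)" "real i *\<^sub>R One", THEN conjunct2] by (subst emeasure_density) simp_all
  show "emeasure (density lborel ?p) X = emeasure (density lborel ?n) X" if XE: "X \<in> ?E" for X
  proof -
   obtain c d where X: "X = box c d" using XE by auto
   show ?thesis unfolding X using vm eq[of c d] by (simp add: emeasure_density)
  qed
 qed
 then have "AE x in lborel. ?p x = ?n x"
  by (intro sigma_finite_measure.density_unique[OF sigma_finite_lborel]) (use vm in auto)
 then show ?thesis
 proof (eventually_elim)
  case (elim x)
  then show ?case by (cases "v x" "0::real" rule: linorder_cases) (auto simp: ennreal_neg)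
 qed
qed

text \<open>Smooth functions that vanish off the open box and tend to its indicator. The shift by -1
  starts the rise of \<open>sstep\<close> exactly at the faces, so the support never leaves the
  closed box.\<close>

definition boxf :: "'a::euclidean_space \<Rightarrow> 'a \<Rightarrow> nat \<Rightarrow> 'a \<Rightarrow> real" where
 "boxf a b n x = (\<Prod>i\<in>Basis. sstep (real n * (x \<bullet> i - a \<bullet> i) - 1) * sstep (real n * (b \<bullet> i - x \<bullet> i) - 1))"

lemma smooth_on_boxf: "smooth_on UNIV (boxf a b n)"
proof -
 have l: "smooth_on UNIV (\<lambda>x::'a. x \<bullet> i)" for i :: 'a
  by (rule smooth_on_linear[OF bounded_linear_inner_left])
 have "smooth_on UNIV (\<lambda>x::'a. real n * (x \<bullet> i - a \<bullet> i) - 1)" for i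
  by (rule smooth_on_diff[OF open_UNIV smooth_on_cmult[OF open_UNIV smooth_on_diff[OF open_UNIV l smooth_on_const]] smooth_on_const])
 then have 1: "smooth_on UNIV (\<lambda>x::'a. sstep (real n * (x \<bullet> i - a \<bullet> i) - 1))" for i
  by (rule smooth_on_compose[OF smooth_on_sstep open_UNIV open_UNIV subset_UNIV])
 have "smooth_on UNIV (\<lambda>x::'a. real n * (b \<bullet> i - x \<bullet> i) - 1)" for i
  by (rule smooth_on_diff[OF open_UNIV smooth_on_cmult[OF open_UNIV smooth_on_diff[OF open_UNIV smooth_on_const l]] smooth_on_const])
 then have 2: "smooth_on UNIV (\<lambda>x::'a. sstep (real n * (b \<bullet> i - x \<bullet> i) - 1))" for i
  by (rule smooth_on_compose[OF smooth_on_sstep open_UNIV open_UNIV subset_UNIV])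
 show ?thesis unfolding boxf_def[abs_def]
  by (rule smooth_on_prod[OF open_UNIV smooth_on_mult[OF open_UNIV 1 2]])
qed

lemma boxf_bounds: "0 \<le> boxf a b n x" "boxf a b n x \<le> 1"
 unfolding boxf_def
 by (auto intro!: prod_nonneg prod_le_1 mult_le_one simp: sstep_nonneg sstep_le_1)

lemma boxf_eq_0:
 assumes "x \<notin> box a b" shows "boxf a b n x = 0"
proof -
 obtain i where i: "i \<in> Basis" "x \<bullet> i \<le> a \<bullet> i \<or> b \<bullet> i \<le> x \<bullet> i"
  using assms by (auto simp: mem_box not_less)
 have "sstep (real n * (x \<bullet> i - a \<bullet> i) - 1) * sstep (real n * (b \<bullet> i - x \<bullet> i) - 1) = 0"
  using i(2) by (auto intro!: sstep_0 simp: mult_nonneg_nonpos)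
 then show ?thesis unfolding boxf_def using i(1) by (auto intro!: prod_zero)
qed

lemma boxf_tendsto: "(\<lambda>n. boxf a b n x) \<longlonglongrightarrow> indicator (box a b) x"
proof (cases "x \<in> box a b")
 case False
 then show ?thesis by (simp add: boxf_eq_0)
next
 case True
 have ev: "\<forall>\<^sub>F n in sequentially. sstep (real n * s - 1) = 1" if "s > 0" for s
 proof -
  obtain N :: nat where N: "2 / s < N" using reals_Archimedean2 by blast
  show ?thesis
  proof (rule eventually_sequentiallyI[of N])
   fix n assume "n \<ge> N"
   then have "2 / s \<le> real n" using N by linarith
   then have "2 \<le> real n * s" using that by (simp add: field_simps)
   then show "sstep (real n * s - 1) = 1" by (intro sstep_1) simp
  qed
 qed
 have "\<forall>\<^sub>F n in sequentially. \<forall>i\<in>Basis. sstep (real n * (x \<bullet> i - a \<bullet> i) - 1) = 1 \<and> sstep (real n * (b \<bullet> i - x \<bullet> i) - 1) = 1"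
  using True by (intro eventually_ball_finite ballI eventually_conj ev) (auto simp: mem_box)
 then have "\<forall>\<^sub>F n in sequentially. boxf a b n x = 1"
  by eventually_elim (simp add: boxf_def)
 then show ?thesis using True by (auto intro: tendsto_eventually)
qed

lemma test_fun_boxf:
 assumes "cbox a b \<subseteq> U" shows "test_fun U (boxf a b n)"
proof -
 have "{x. boxf a b n x \<noteq> 0} \<subseteq> cbox a b" using boxf_eq_0 box_subset_cbox by blast
 then have 1: "closure {x. boxf a b n x \<noteq> 0} \<subseteq> cbox a b" by (rule closure_minimal) (rule closed_cbox)
 then have "compact (closure {x. boxf a b n x \<noteq> 0})"
  by (metis bounded_cbox bounded_subset closed_closure compact_eq_bounded_closed)
 then show ?thesis unfolding test_fun_def using 1 assms smooth_on_boxf by auto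
qed

text \<open>Testing with \<open>boxf\<close> and letting n grow shows that u has integral 0 over
  every box whose closure lies in \<open>U\<close>. On a closed box, u is replaced by a Borel
  function that is equal almost everywhere, to which the uniqueness of densities applies; countably
  many closed boxes cover \<open>U\<close>.\<close>

lemma fundamental_lemma:
 fixes u :: "'a::euclidean_space \<Rightarrow> real"
 assumes U: "open U" and u: "l1loc U u"
  and 0: "\<And>\<phi>. test_fun U \<phi> \<Longrightarrow> (LINT x|lebesgue_on U. \<phi> x * u x) = 0"
 shows "AE x in lebesgue_on U. u x = 0"
proof -
 have box0: "(LINT x|lebesgue. indicator (box a b) x * u x) = 0" if ab: "cbox a b \<subseteq> U" for a b
 proof -
  have iu: "integrable lebesgue (\<lambda>x. indicator (cbox a b) x *\<^sub>R u x)"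
   using u[unfolded l1loc_def, rule_format, OF conjI, OF compact_cbox ab] by (simp add: integrable_restrict_space)
  have iu': "integrable lebesgue (\<lambda>x. indicator (cbox a b) x * u x)" using iu by simp
  have ind: "indicator (box a b) x * u x = indicator (box a b) x * (indicator (cbox a b) x * u x)" for x
   using box_subset_cbox[of a b] by (auto simp: indicator_def)
  have bc: "boxf a b n x * u x = boxf a b n x * (indicator (cbox a b) x * u x)" for n x
   using boxf_eq_0[of x a b n] box_subset_cbox[of a b] by (auto simp: indicator_def)
  have "(\<lambda>n. LINT x|lebesgue. boxf a b n x * u x) \<longlonglongrightarrow> (LINT x|lebesgue. indicator (box a b) x * u x)"
  proof (rule integral_dominated_convergence[where w="\<lambda>x. \<bar>indicator (cbox a b) x * u x\<bar>"])
   have "boxf a b n \<in> borel_measurable lebesgue" for n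
    using smooth_on_continuous[OF smooth_on_boxf, of a b n]
    by (intro measurable_completion) (simp add: borel_measurable_continuous_onI)
   then show "(\<lambda>x. boxf a b n x * u x) \<in> borel_measurable lebesgue" for n
    unfolding bc using iu' by (intro borel_measurable_times[OF _ borel_measurable_integrable[OF iu']])
   show "(\<lambda>x. indicator (box a b) x * u x) \<in> borel_measurable lebesgue"
    unfolding ind by (intro borel_measurable_times[OF _ borel_measurable_integrable[OF iu']]) (intro borel_measurable_indicator fmeasurableD lmeasurable_box)
   show "integrable lebesgue (\<lambda>x. \<bar>indicator (cbox a b) x * u x\<bar>)" using iu' by (rule integrable_abs)
   show "AE x in lebesgue. (\<lambda>n. boxf a b n x * u x) \<longlonglongrightarrow> indicator (box a b) x * u x"
    by (intro AE_I2 tendsto_mult boxf_tendsto tendsto_const)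
   have "norm (boxf a b n x * u x) \<le> \<bar>indicator (cbox a b) x * u x\<bar>" for n x
    unfolding bc[of n x] using boxf_bounds[of a b n x]
    by (simp add: abs_mult mult_left_le_one_le)
   then show "AE x in lebesgue. norm (boxf a b n x * u x) \<le> \<bar>indicator (cbox a b) x * u x\<bar>" for n
    by simp
  qed
  moreover have "(LINT x|lebesgue. boxf a b n x * u x) = 0" for n
  proof -
   have "boxf a b n x * u x = 0" if "x \<notin> U" for x
    using boxf_eq_0[of x a b n] box_subset_cbox[of a b] ab that by auto
   then have "(LINT x|lebesgue_on UNIV. boxf a b n x * u x) = (LINT x|lebesgue_on U. boxf a b n x * u x)"
    using U by (intro restrict_zero_outside(2)) auto
   then show ?thesis using 0[OF test_fun_boxf[OF ab]] by (simp add: lebesgue_on_UNIV_eq)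
  qed
  ultimately show ?thesis by (simp add: LIMSEQ_const_iff)
 qed
 have cb: "AE x in lebesgue. x \<in> cbox a b \<longrightarrow> u x = 0" if ab: "cbox a b \<subseteq> U" for a b
 proof -
  have iu: "integrable lebesgue (\<lambda>x. indicator (cbox a b) x * u x)"
   using u[unfolded l1loc_def, rule_format, OF conjI, OF compact_cbox ab] by (simp add: integrable_restrict_space)
  then have "(\<lambda>x. indicator (cbox a b) x * u x) \<in> borel_measurable (completion lborel)" by auto
  then obtain v where v: "v \<in> borel_measurable lborel" "AE x in lborel. indicator (cbox a b) x * u x = v x"
   using completion_ex_borel_measurable_real by blast
  have vL: "v \<in> borel_measurable lebesgue" using v(1) by (rule measurable_completion)
  have "integrable lebesgue v"
   by (rule integrable_cong_AE[THEN iffD1, OF borel_measurable_integrable[OF iu] vL AE_completion[OF v(2)] iu])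
  then have vi: "integrable lborel v" using v(1) by (simp add: integrable_completion)
  have "(LINT x|lborel. indicator (box c d) x * v x) = 0" for c d
  proof -
   \<comment> \<open>The intersection of two boxes is a box, so the integral of v over an arbitrary
     box is an integral of u over a box inside \<open>U\<close>.\<close>
   define e f where "e = (\<Sum>i\<in>Basis. max (c\<bullet>i) (a\<bullet>i) *\<^sub>R i)" and "f = (\<Sum>i\<in>Basis. min (d\<bullet>i) (b\<bullet>i) *\<^sub>R i)"
   have ef: "box c d \<inter> box a b = box e f" unfolding e_def f_def by (rule box_Int_box)
   have cef: "cbox e f \<subseteq> cbox a b" using Int_interval[of c d a b] unfolding e_def f_def by blast
   have "(LINT x|lborel. indicator (box c d) x * v x) = (LINT x|lebesgue. indicator (box c d) x * v x)"
    using v(1) by (intro integral_completion[symmetric]) auto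
   also have "\<dots> = (LINT x|lebesgue. indicator (box e f) x * u x)"
   proof (rule integral_cong_AE)
    show "(\<lambda>x. indicator (box c d) x * v x) \<in> borel_measurable lebesgue"
     by (intro borel_measurable_times vL borel_measurable_indicator fmeasurableD lmeasurable_box)
    let ?A = "(\<lambda>x. indicator (box e f) x * (indicator (cbox a b) x * u x))"
    have "(\<lambda>x. indicator (box e f) x * u x) = ?A"
    proof
     fix x show "indicator (box e f) x * u x = indicator (box e f) x * (indicator (cbox a b) x * u x)"
      using cef box_subset_cbox[of e f] by (cases "x \<in> box e f") auto
    qed
    moreover have "?A \<in> borel_measurable lebesgue"
     by (intro borel_measurable_times[OF _ borel_measurable_integrable[OF iu]]) (intro borel_measurable_indicator fmeasurableD lmeasurable_box)
    ultimately show "(\<lambda>x. indicator (box e f) x * u x) \<in> borel_measurable lebesgue" by simp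
    have "cbox a b - box a b \<in> null_sets lebesgue"
     using null_sets_cbox_Diff_box null_sets_completionI by blast
    then have "AE x in lebesgue. x \<notin> cbox a b - box a b" by (rule AE_not_in)
    then show "AE x in lebesgue. indicator (box c d) x * v x = indicator (box e f) x * u x"
     using AE_completion[OF v(2)]
    proof eventually_elim
     case (elim x)
     have "indicator (box e f) x = indicator (box c d) x * (indicator (box a b) x :: real)"
      unfolding ef[symmetric] by (simp add: indicator_inter_arith)
     moreover have "v x = indicator (box a b) x * u x"
      using elim box_subset_cbox[of a b] by (auto simp: indicator_def split: if_splits)
     ultimately show ?case by simp
    qed
   qed
   also have "\<dots> = 0" using box0[of e f] cef ab by auto
   finally show ?thesis .
  qed
  from AE_eq_0_if_integral_boxes_eq_0[OF vi this]
  have "AE x in lborel. indicator (cbox a b) x * u x = 0" using v(2) by eventually_elim simp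
  then have "AE x in lebesgue. indicator (cbox a b) x * u x = 0" by (rule AE_completion)
  then show ?thesis by eventually_elim (auto simp: indicator_def)
 qed
 obtain \<D> where D: "countable \<D>" "\<D> \<subseteq> Pow U" "\<And>X. X \<in> \<D> \<Longrightarrow> \<exists>a b. X = cbox a b" "\<Union>\<D> = U"
  using open_countable_Union_open_cbox[OF U] by metis
 have "AE x in lebesgue. x \<in> X \<longrightarrow> u x = 0" if X: "X \<in> \<D>" for X
 proof -
  obtain a b where "X = cbox a b" using D(3)[OF X] by blast
  then show ?thesis using cb[of a b] D(2) X by blast
 qed
 then have "AE x in lebesgue. \<forall>X\<in>\<D>. x \<in> X \<longrightarrow> u x = 0"
  by (subst AE_ball_countable[OF D(1)]) blast
 then have "AE x in lebesgue. x \<in> U \<longrightarrow> u x = 0"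
  by eventually_elim (use D(4) in auto)
 then show ?thesis using U by (simp add: AE_restrict_space_iff)
qed

section \<open>The octagon\<close>

definition ga :: real where "ga = 1 + sqrt 2"
definition gb :: real where "gb = sqrt (2 + 2 * sqrt 2)"
definition dir :: "nat \<Rightarrow> complex" where "dir i = cis (real i * pi / 4)"
text \<open>For i < 4, gen i is the transformation of the matrix gmat i and gen (i + 4) is its inverse; the
 i-th side of the octagon lies on the curve den i z = 1.\<close>

definition gen :: "nat \<Rightarrow> complex \<Rightarrow> complex" where
 "gen i z = (of_real ga * z + of_real gb * dir i) / (of_real gb * cnj (dir i) * z + of_real ga)"
definition cden :: "nat \<Rightarrow> complex \<Rightarrow> complex" where
 "cden i z = of_real gb * cnj (dir i) * z + of_real ga"
text \<open>The derivative of \<open>gen i\<close> is 1 / (cden i)^2, hence \<open>den i\<close> is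
  the reciprocal of the modulus of the derivative, and den i z = 1 is the isometric circle of
  \<open>gen i\<close>.\<close>

definition den :: "nat \<Rightarrow> complex \<Rightarrow> real" where
 "den i z = (cmod (cden i z))^2"

lemma gb2: "gb^2 = 2 * ga" by (simp add: gb_def ga_def)
lemma ga2: "ga^2 = 2 * ga + 1" by (simp add: ga_def power2_eq_square algebra_simps)
lemma ga_pos: "ga > 2" by (simp add: ga_def)
lemma gb_pos: "gb > 0" by (simp add: gb_def add_pos_nonneg)
lemma gab: "ga^2 - gb\<^sup>2 = 1" by (simp add: gb2 ga2)
lemma gb_less_ga: "gb < ga"
 by (rule power_less_imp_less_base[of _ 2]) (use gab ga_pos in auto)

lemma norm_dir [simp]: "cmod (dir i) = 1" by (simp add: dir_def)
lemma dir_cnj: "dir i * cnj (dir i) = 1" "cnj (dir i) * dir i = 1"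
 using complex_norm_square[of "dir i"] by (simp_all add: mult.commute)
lemma dir_add: "dir (i + j) = dir i * dir j"
 by (simp add: dir_def cis_mult add_divide_distrib distrib_right)
lemma dir_4: "dir 4 = -1" by (simp add: dir_def complex_eq_iff)
lemma dir_opp: "dir (i + 4) = - dir i" by (simp add: dir_add dir_4)
lemma dir_8: "dir (i + 8) = dir i"
 using dir_opp[of "i+4"] dir_opp[of i] by (simp add: numeral_eq_Suc)
lemma dir_mod_8: "dir (i mod 8) = dir i"
proof -
 have "dir (j + 8 * k) = dir j" for j k
  by (induction k) (use dir_8 in \<open>auto simp: add.assoc[symmetric] add.commute[of 8] add.left_commute\<close>)
 then have "dir (i mod 8 + 8 * (i div 8)) = dir (i mod 8)" by blast
 then show ?thesis by simp
qed

lemma gen_eq: "gen i z = (of_real ga * z + of_real gb * dir i) / cden i z"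
 by (simp add: gen_def cden_def)

lemma disc_iff: "z \<in> disc \<longleftrightarrow> (cmod z)\<^sup>2 < 1"
 by (simp add: disc_def abs_square_less_1)

lemma open_disc [simp]: "open disc" by (simp add: disc_def)

lemma cden_nz: assumes "z \<in> disc" shows "cden i z \<noteq> 0"
proof
 assume "cden i z = 0"
 then have "of_real gb * cnj (dir i) * z = - of_real ga" by (simp add: cden_def add_eq_0_iff2)
 then have "cmod (of_real gb * cnj (dir i) * z) = cmod (- of_real ga)" by simp
 then have "gb * cmod z = ga" using ga_pos gb_pos by (simp add: norm_mult)
 moreover have "gb * cmod z \<le> gb * 1" using assms gb_pos by (intro mult_left_mono) (auto simp: disc_def)
 ultimately show False using gb_less_ga by simp
qed

lemma den_pos: "z \<in> disc \<Longrightarrow> den i z > 0"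
 by (simp add: den_def cden_nz)

lemma cmod_add_sq: "(cmod (u + v))^2 = (cmod u)^2 + (cmod v)^2 + 2 * Re (u * cnj v)"
 unfolding cmod_power2 by (simp add: power2_eq_square algebra_simps)

lemma den_eq: "den i z = gb^2 * (cmod z)^2 + ga^2 + 2 * ga * gb * Re (cnj (dir i) * z)"
proof -
 have "den i z = (cmod (of_real gb * cnj (dir i) * z))^2 + ga^2 + 2 * Re (of_real gb * cnj (dir i) * z * cnj (of_real ga))"
  unfolding den_def cden_def cmod_add_sq by simp
 also have "cmod (of_real gb * cnj (dir i) * z) = gb * cmod z"
  using gb_pos by (simp add: norm_mult)
 finally show ?thesis by (simp add: power_mult_distrib algebra_simps)
qed

text \<open>The relations gb^2 = 2 ga and ga^2 = 2 ga + 1 make 2 ga a common factor of den - 1,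
  which leaves the single constant gb in the equation of the side.\<close>

lemma den_ge_1_iff: "den i z \<ge> 1 \<longleftrightarrow> 1 + (cmod z)^2 + gb * Re (cnj (dir i) * z) \<ge> 0"
proof -
 have "den i z - 1 = 2 * ga * (1 + (cmod z)^2 + gb * Re (cnj (dir i) * z))"
  unfolding den_eq gb2 ga2 by (simp add: algebra_simps)
 then show ?thesis using ga_pos
  by (smt (verit) zero_le_mult_iff)
qed

text \<open>The infinitesimal isometry property 1 - |g z|^2 = |g'(z)| (1 - |z|^2), which rests on
  ga^2 - gb^2 = 1. It reduces comparisons of moduli to comparisons of \<open>den i\<close> with
  1.\<close>

lemma one_minus_gen:
 assumes "z \<in> disc"
 shows "1 - (cmod (gen i z))\<^sup>2 = (1 - (cmod z)\<^sup>2) / den i z"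
proof -
 have d: "den i z > 0" using assms by (rule den_pos)
 have n: "(cmod (of_real ga * z + of_real gb * dir i))^2 = ga^2 * (cmod z)^2 + gb^2 + 2 * ga * gb * Re (cnj (dir i) * z)"
  unfolding cmod_add_sq using ga_pos gb_pos by (simp add: norm_mult power_mult_distrib) (simp add: algebra_simps)
 have "(cmod (gen i z))^2 * den i z = ga^2 * (cmod z)^2 + gb^2 + 2 * ga * gb * Re (cnj (dir i) * z)"
  unfolding gen_eq n[symmetric] using cden_nz[OF assms, of i] by (simp add: den_def norm_divide power_divide)
 then have "(1 - (cmod (gen i z))\<^sup>2) * den i z = (ga^2 - gb\<^sup>2) * (1 - (cmod z)\<^sup>2)"
  unfolding left_diff_distrib by (simp add: den_eq algebra_simps)
 then show ?thesis using d by (simp add: gab eq_divide_eq)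
qed

lemma gen_disc: assumes "z \<in> disc" shows "gen i z \<in> disc"
proof -
 have "1 - (cmod (gen i z))\<^sup>2 > 0" unfolding one_minus_gen[OF assms]
  using assms den_pos[OF assms, of i] by (simp add: disc_iff)
 then show ?thesis by (simp add: disc_iff)
qed

lemma gab_complex: "of_real ga * of_real ga - of_real gb * of_real gb = (1::complex)"
 using gab by (metis of_real_1 of_real_diff of_real_mult power2_eq_square)

lemma cden_opp: assumes "z \<in> disc" shows "cden (i + 4) (gen i z) = 1 / cden i z"
proof -
 have nz: "cden i z \<noteq> 0" by (rule cden_nz[OF assms])
 have "cden (i + 4) (gen i z) * cden i z
   = - of_real gb * cnj (dir i) * (of_real ga * z + of_real gb * dir i) + of_real ga * cden i z"
 proof -
  have "gen i z * cden i z = of_real ga * z + of_real gb * dir i" using nz by (simp add: gen_eq)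
  moreover have "cden (i + 4) (gen i z) * cden i z
   = - of_real gb * cnj (dir i) * (gen i z * cden i z) + of_real ga * cden i z"
   by (simp add: cden_def[of "i+4"] dir_opp left_diff_distrib mult.assoc)
  ultimately show ?thesis by simp
 qed
 also have "\<dots> = of_real ga * of_real ga - of_real gb * of_real gb * (cnj (dir i) * dir i)"
  by (simp add: cden_def algebra_simps)
 also have "\<dots> = 1" using gab_complex by (simp add: dir_cnj)
 finally show ?thesis using nz by (simp add: eq_divide_eq)
qed

lemma den_opp: assumes "z \<in> disc" shows "den (i + 4) (gen i z) = 1 / den i z"
 by (simp add: den_def cden_opp[OF assms] norm_divide power_divide)

lemma gen_opp: assumes "z \<in> disc" shows "gen (i + 4) (gen i z) = z"
proof -
 have nz: "cden i z \<noteq> 0" by (rule cden_nz[OF assms])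
 have "gen (i + 4) (gen i z) = (of_real ga * gen i z - of_real gb * dir i) * cden i z"
  unfolding gen_eq[of "i+4"] cden_opp[OF assms] by (simp add: dir_opp)
 also have "\<dots> = of_real ga * (of_real ga * z + of_real gb * dir i) - of_real gb * dir i * cden i z"
  using nz by (simp add: gen_eq left_diff_distrib)
 also have "\<dots> = (of_real ga * of_real ga - of_real gb * of_real gb * (cnj (dir i) * dir i)) * z"
  by (simp add: cden_def algebra_simps)
 also have "\<dots> = z" using gab_complex by (simp add: dir_cnj)
 finally show ?thesis .
qed

lemma gen_8: "gen (i + 8) = gen i"
 unfolding gen_def by (simp only: dir_8)

lemma gen_opp': assumes "z \<in> disc" shows "gen i (gen (i + 4) z) = z"
 using gen_opp[OF assms, of "i + 4"] gen_8[of i] by (simp add: add.assoc)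

lemma gen_bij: "bij_betw (gen i) disc disc"
 by (rule bij_betw_byWitness[where f'="gen (i + 4)"]) (auto simp: gen_opp gen_opp' gen_disc)

lemma gen_image: "gen i ` disc = disc" using gen_bij by (simp add: bij_betw_def)

lemma gen_has_field_derivative:
 assumes "z \<in> disc"
 shows "(gen i has_field_derivative 1 / (cden i z)^2) (at z)"
proof -
 have nz: "cden i z \<noteq> 0" by (rule cden_nz[OF assms])
 have 1: "((\<lambda>z. of_real ga * z + of_real gb * dir i) has_field_derivative of_real ga) (at z)"
  by (auto intro!: derivative_eq_intros)
 have 2: "(cden i has_field_derivative of_real gb * cnj (dir i)) (at z)"
  unfolding cden_def[abs_def] by (auto intro!: derivative_eq_intros)
 have "of_real ga * cden i z - (of_real ga * z + of_real gb * dir i) * (of_real gb * cnj (dir i))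
   = of_real ga * of_real ga - of_real gb * of_real gb * (cnj (dir i) * dir i)"
  by (simp add: cden_def algebra_simps)
 also have "\<dots> = 1" using gab_complex by (simp add: dir_cnj)
 finally show ?thesis
  using DERIV_divide[OF 1 2 nz] unfolding gen_eq[abs_def] by (simp add: power2_eq_square)
qed

lemma moebius_gen: "moebius (of_real ga) (of_real gb * dir i) (of_real gb * cnj (dir i)) (of_real ga) = gen i"
 by (simp add: moebius_def gen_def fun_eq_iff)

lemma gmat_nth: "gmat k $ 1 $ 1 = of_real ga" "gmat k $ 1 $ 2 = of_real gb * dir k"
 "gmat k $ 2 $ 1 = of_real gb * cnj (dir k)" "gmat k $ 2 $ 2 = of_real ga"
 by (simp_all add: gmat_def ga_def gb_def dir_def cis_cnj)

lemma act_gmat: "act (gmat k) = gen k"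
 by (simp add: act_def gmat_nth moebius_gen)

text \<open>The determinant of \<open>gmat k\<close> is 1, so the adjugate is an inverse on both
  sides, and it coincides with the one chosen by \<open>matrix_inv\<close>.\<close>

lemma matrix_inv_gmat:
 "matrix_inv (gmat k) = vector [vector [of_real ga, - (of_real gb * dir k)], vector [- (of_real gb * cnj (dir k)), of_real ga]]"
  (is "_ = ?B")
proof -
 let ?A = "gmat k"
 have d: "of_real gb * dir k * (of_real gb * cnj (dir k)) = of_real gb * of_real gb"
  using dir_cnj(1)[of k] by (simp add: mult_ac)
 have e: "of_real ga * of_real ga - of_real gb * dir k * (of_real gb * cnj (dir k)) = (1::complex)"
  unfolding d by (rule gab_complex)
 have AB: "?A ** ?B = mat 1" "?B ** ?A = mat 1"
  using e by (simp_all add: vec_eq_iff matrix_matrix_mult_def mat_def forall_2 sum_2 gmat_nth algebra_simps)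
 have inv: "?A ** matrix_inv ?A = mat 1 \<and> matrix_inv ?A ** ?A = mat 1"
  unfolding matrix_inv_def by (rule someI[of _ ?B]) (use AB in simp)
 have "matrix_inv ?A = (?B ** ?A) ** matrix_inv ?A" unfolding AB(2) by simp
 also have "\<dots> = ?B ** (?A ** matrix_inv ?A)" by (rule matrix_mul_assoc[symmetric])
 also have "\<dots> = ?B" using inv by simp
 finally show ?thesis .
qed

lemma act_gmat_inv: "act (matrix_inv (gmat k)) = gen (k + 4)"
 unfolding matrix_inv_gmat act_def by (simp add: moebius_gen[symmetric] dir_opp)

lemma norm_gen_ge_iff:
 assumes "z \<in> disc"
 shows "cmod (gen i z) \<ge> cmod z \<longleftrightarrow> den i z \<ge> 1"
proof -
 have d: "den i z > 0" using assms by (rule den_pos)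
 have z: "1 - (cmod z)\<^sup>2 > 0" using assms by (simp add: disc_iff)
 have "cmod (gen i z) \<ge> cmod z \<longleftrightarrow> 1 - (cmod (gen i z))\<^sup>2 \<le> 1 - (cmod z)\<^sup>2"
  by (simp add: power_mono_iff)
 also have "\<dots> \<longleftrightarrow> (1 - (cmod z)\<^sup>2) * 1 \<le> (1 - (cmod z)\<^sup>2) * den i z"
  unfolding one_minus_gen[OF assms] using d by (simp add: divide_le_eq)
 also have "\<dots> \<longleftrightarrow> den i z \<ge> 1"
  using z by (simp only: mult_le_cancel_left_pos)
 finally show ?thesis .
qed

lemma less_8_cases: "i < 8 \<longleftrightarrow> i \<in> {0..3} \<or> (\<exists>j\<in>{0..3::nat}. i = j + 4)"
 by (auto simp: atLeastAtMost_iff intro: exI[of _ "i - 4"]) presburger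

text \<open>The octagon is the part of the disc outside or on the eight isometric circles, those of
  the generators and of their inverses. All later arguments start from this description.\<close>

lemma Fund_eq: "Fund = {z \<in> disc. \<forall>i<8. den i z \<ge> 1}"
proof -
 have "(\<forall>i\<in>{0..3}. cmod (act (gmat i) z) \<ge> cmod z \<and> cmod (act (matrix_inv (gmat i)) z) \<ge> cmod z)
   \<longleftrightarrow> (\<forall>i<8. den i z \<ge> 1)" if "z \<in> disc" for z
  unfolding act_gmat act_gmat_inv norm_gen_ge_iff[OF that] less_8_cases by auto
 then show ?thesis unfolding Fund_def by auto
qed

section \<open>Sides, sectors and vertices of the octagon\<close>

lemma sqrt2_bounds: "1.41 < sqrt 2" "sqrt 2 < 1.42"
 by (rule real_less_rsqrt real_less_lsqrt; simp add: power2_eq_square)+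

lemma dir_1: "dir 1 = Complex (sqrt 2 / 2) (sqrt 2 / 2)"
 by (simp add: dir_def complex_eq_iff cos_45 sin_45)

lemma dir_values:
 "dir 0 = 1" "dir (Suc 0) = Complex (sqrt 2 / 2) (sqrt 2 / 2)" "dir 2 = \<i>" "dir 3 = Complex (- sqrt 2 / 2) (sqrt 2 / 2)"
 "dir 4 = -1" "dir 5 = Complex (- sqrt 2 / 2) (- sqrt 2 / 2)" "dir 6 = -\<i>" "dir 7 = Complex (sqrt 2 / 2) (- sqrt 2 / 2)"
proof -
 show 0: "dir 0 = 1" and 1: "dir (Suc 0) = Complex (sqrt 2 / 2) (sqrt 2 / 2)"
  using dir_1 by (auto simp: dir_def)
 show 2: "dir 2 = \<i>" by (simp add: dir_def complex_eq_iff)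
 have "dir 3 = dir 2 * dir 1" using dir_add[of 2 1] by simp
 then show 3: "dir 3 = Complex (- sqrt 2 / 2) (sqrt 2 / 2)" using 2 dir_1 by (simp add: complex_eq_iff)
 show "dir 4 = -1" by (rule dir_4)
 show "dir 5 = Complex (- sqrt 2 / 2) (- sqrt 2 / 2)" using dir_opp[of 1] dir_1 by (simp add: complex_eq_iff)
 show "dir 6 = -\<i>" using dir_opp[of 2] 2 by simp
 show "dir 7 = Complex (sqrt 2 / 2) (- sqrt 2 / 2)" using dir_opp[of 3] 3 by (simp add: complex_eq_iff)
qed

lemma less_8: "i < 8 \<longleftrightarrow> i = 0 \<or> i = Suc 0 \<or> i = 2 \<or> i = 3 \<or> i = 4 \<or> i = 5 \<or> i = 6 \<or> i = (7::nat)"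
 by auto

lemma Re_dir_dir:
 assumes "i < 8" "j < 8" "i \<noteq> j"
 shows "Re (cnj (dir i) * dir j) \<le> sqrt 2 / 2"
proof -
 have m: "-2 \<le> sqrt (2::real)" using real_sqrt_ge_zero[of 2] by linarith
 have "\<forall>i\<in>{0,1,2,3,4,5,6,7}. \<forall>j\<in>{0,1,2,3,4,5,6,7}. i \<noteq> j \<longrightarrow> Re (cnj (dir i) * dir j) \<le> sqrt 2 / 2"
  by (simp add: dir_values m)
 moreover have "i \<in> {0,1,2,3,4,5,6,7}" "j \<in> {0,1,2,3,4,5,6,7}" using assms(1,2) by (auto simp: less_8)
 ultimately show ?thesis using assms(3) by blast
qed

lemma norm_dir_add:
 assumes "i < 8" "j < 8" "i \<noteq> j"
 shows "(cmod (cnj (dir i) + cnj (dir j)))^2 \<le> 2 + sqrt 2"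
 using Re_dir_dir[OF assms] unfolding cmod_add_sq by simp

text \<open>The quadratic polynomial has the roots sqrt 2 / 2, the squared modulus of the vertices,
  and sqrt 2, which is out of range in the disc.\<close>

lemma quad_root:
 assumes "0 \<le> R" "R < 1" "(1 + R)^2 \<ge> R * (2 + 3 * sqrt 2 / 2)"
 shows "R \<le> sqrt 2 / 2"
proof -
 have "(1 + R)^2 - R * (2 + 3 * sqrt 2 / 2) = (R - sqrt 2 / 2) * (R - sqrt 2)"
  by (simp add: field_simps power2_eq_square)
 then have "(R - sqrt 2 / 2) * (R - sqrt 2) \<ge> 0" using assms by simp
 moreover have "R - sqrt 2 < 0" using assms sqrt2_bounds by simp
 ultimately show ?thesis by (simp add: zero_le_mult_iff)
qed

text \<open>If two side conditions fail, adding them gives 2 (1 + |z|^2) < gb |z| |dir i + dir j|.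
  The last factor is largest for adjacent directions, where its square is 2 + sqrt 2. Squaring
  yields the quadratic inequality that fails below sqrt 2 / 2: two isometric discs overlap only
  beyond the circle through the vertices.\<close>

lemma at_most_one_den:
 assumes z: "z \<in> disc" "(cmod z)^2 < sqrt 2 / 2" and ij: "i < 8" "j < 8" "i \<noteq> j" "den i z < 1"
 shows "den j z \<ge> 1"
proof (rule ccontr)
 assume "\<not> den j z \<ge> 1"
 then have "1 + (cmod z)^2 + gb * Re (cnj (dir j) * z) < 0" "1 + (cmod z)^2 + gb * Re (cnj (dir i) * z) < 0"
  using ij(4) den_ge_1_iff by (auto simp: not_le[symmetric])
 then have "2 * (1 + (cmod z)^2) < gb * - Re ((cnj (dir i) + cnj (dir j)) * z)"
  by (simp add: algebra_simps)
 also have "\<dots> \<le> gb * cmod ((cnj (dir i) + cnj (dir j)) * z)"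
  using gb_pos abs_Re_le_cmod[of "(cnj (dir i) + cnj (dir j)) * z"] by (intro mult_left_mono) auto
 finally have "(2 * (1 + (cmod z)^2))^2 < (gb * cmod ((cnj (dir i) + cnj (dir j)) * z))^2"
  by (intro power_strict_mono) auto
 also have "\<dots> = gb^2 * (cmod z)^2 * (cmod (cnj (dir i) + cnj (dir j)))^2"
  by (simp add: norm_mult power_mult_distrib mult_ac)
 also have "\<dots> \<le> gb^2 * (cmod z)^2 * (2 + sqrt 2)"
  using norm_dir_add[OF ij(1-3)] by (intro mult_left_mono) auto
 also have "\<dots> = 4 * ((cmod z)^2 * (2 + 3 * sqrt 2 / 2))"
  by (simp add: gb2 ga_def algebra_simps)
 finally have "(1 + (cmod z)^2)^2 < (cmod z)^2 * (2 + 3 * sqrt 2 / 2)"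
  unfolding power_mult_distrib by simp
 moreover have "(1 + (cmod z)^2)^2 - (cmod z)\<^sup>2 * (2 + 3 * sqrt 2 / 2) = ((cmod z)^2 - sqrt 2 / 2) * ((cmod z)^2 - sqrt 2)"
  by (simp add: field_simps power2_eq_square)
 moreover have "((cmod z)^2 - sqrt 2 / 2) * ((cmod z)^2 - sqrt 2) \<ge> 0"
  using z sqrt2_bounds by (intro mult_nonpos_nonpos) auto
 ultimately show False by simp
qed

text \<open>A rotation by a multiple of pi/4 brings z into the sector of half-angle pi/8 about the
  positive real axis, and tan(pi/8) = sqrt 2 - 1. The direction that maximises the real part does
  it: comparison with the opposite direction gives the sign, comparison with the two neighbours i +
  1 and i + 7 gives the two bounds.\<close>

lemma max_dir:
 fixes z :: complex
 shows "\<exists>i<8. \<bar>Im (cnj (dir i) * z)\<bar> \<le> (sqrt 2 - 1) * Re (cnj (dir i) * z) \<and> 0 \<le> Re (cnj (dir i) * z)"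
proof -
 define f where "f = (\<lambda>i. Re (cnj (dir i) * z))"
 have "Max (f ` {..<8}) \<in> f ` {..<8}" by (rule Max_in) (auto simp: lessThan_empty_iff)
 then obtain i where "i < 8" "Max (f ` {..<8}) = f i" by auto
 then have i: "i < 8" "\<And>j. j < 8 \<Longrightarrow> f j \<le> f i"
  using Max_ge[of "f ` {..<8}"] by (auto simp del: Max_ge)
 define p q where "p = Re (cnj (dir i) * z)" and "q = Im (cnj (dir i) * z)"
 have mx: "f j \<le> p" for j
  using i(2)[of "j mod 8"] by (simp add: f_def p_def dir_mod_8)
 have dz: "cnj (dir (i + j)) * z = cnj (dir j) * (cnj (dir i) * z)" for j
  by (simp add: dir_add mult_ac)
 have "f (i + 4) = - p" unfolding f_def dz p_def dir_4 by simp
 then have p0: "0 \<le> p" using mx[of "i + 4"] by simp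
 have "f (i + 1) = (p + q) * (sqrt 2 / 2)" unfolding f_def dz p_def q_def dir_1 by (simp add: algebra_simps add_divide_distrib)
 then have 1: "(p + q) * (sqrt 2 / 2) \<le> p" using mx[of "i + 1"] by simp
 have "f (i + 7) = (p - q) * (sqrt 2 / 2)" unfolding f_def dz p_def q_def dir_values by (simp add: algebra_simps diff_divide_distrib)
 then have 2: "(p - q) * (sqrt 2 / 2) \<le> p" using mx[of "i + 7"] by simp
 have "(p + q) * (sqrt 2 / 2) * sqrt 2 \<le> p * sqrt 2" using 1 by (intro mult_right_mono) auto
 then have q1: "q \<le> (sqrt 2 - 1) * p" by (simp add: algebra_simps)
 have "(p - q) * (sqrt 2 / 2) * sqrt 2 \<le> p * sqrt 2" using 2 by (intro mult_right_mono) auto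
 then have q2: "- q \<le> (sqrt 2 - 1) * p" by (simp add: algebra_simps)
 show ?thesis using i(1) p0 q1 q2 unfolding p_def q_def by (intro exI[of _ i]) auto
qed

text \<open>The vertices of the octagon are dir i * Complex vp vq; conjugation gives the same set.\<close>

definition vp :: real where "vp = (1 + sqrt 2 / 2) / gb"
definition vq :: real where "vq = (sqrt 2 - 1) * vp"

text \<open>The number vp solves gb p = 1 + |z|^2 with |z|^2 = sqrt 2 / 2, and 1 + (sqrt 2 - 1)^2 =
  4 - 2 sqrt 2, so the equation gives the vertices the squared modulus sqrt 2 / 2. The lower bounds
  serve to pass from differences of squares to differences.\<close>

lemma vp_sq: "vp^2 * (4 - 2 * sqrt 2) = sqrt 2 / 2" and vp_ge: "vp \<ge> 1/2" and vq_ge: "vq \<ge> 1/5"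
proof -
 have g: "gb^2 = 2 + 2 * sqrt 2" by (simp add: gb_def)
 have "(1 + sqrt 2 / 2)^2 * (4 - 2 * sqrt 2) = sqrt 2 / 2 * gb^2"
  unfolding g by (simp add: power2_eq_square algebra_simps)
 then show "vp^2 * (4 - 2 * sqrt 2) = sqrt 2 / 2"
  using gb_pos by (simp add: vp_def power_divide divide_simps)
 have "gb \<le> 2.4" unfolding gb_def using sqrt2_bounds by (intro real_le_lsqrt) (auto simp: power2_eq_square)
 moreover have "1 + sqrt 2 / 2 \<ge> 1.7" using sqrt2_bounds by simp
 ultimately have "vp \<ge> 0.6" unfolding vp_def using gb_pos by (simp add: le_divide_eq)
 then show "vp \<ge> 1/2" by simp
 have "vq \<ge> 0.41 * 0.6" unfolding vq_def
  using \<open>vp \<ge> 0.6\<close> sqrt2_bounds by (intro mult_mono) auto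
 then show "vq \<ge> 1/5" by simp
qed

text \<open>In the coordinates of its sector, a point of the octagon satisfies one side condition,
  gb p <= 1 + |z|^2, and the sector bound |z|^2 <= p^2 (4 - 2 sqrt 2). Eliminating p leaves the
  inequality of \<open>quad_root\<close>, hence the bound on the modulus.\<close>

lemma Fund_coords:
 assumes "z \<in> Fund"
 obtains i p q where "i < 8" "z = dir i * Complex p q" "\<bar>q\<bar> \<le> (sqrt 2 - 1) * p" "0 \<le> p"
  "(cmod z)^2 = p^2 + q^2" "gb * p \<le> 1 + (cmod z)^2" "(cmod z)^2 \<le> p^2 * (4 - 2 * sqrt 2)" "(cmod z)^2 \<le> sqrt 2 / 2"
proof -
 obtain i where i: "i < 8" "\<bar>Im (cnj (dir i) * z)\<bar> \<le> (sqrt 2 - 1) * Re (cnj (dir i) * z)" "0 \<le> Re (cnj (dir i) * z)"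
  using max_dir by blast
 define p q where "p = Re (cnj (dir i) * z)" and "q = Im (cnj (dir i) * z)"
 have zd: "z \<in> disc" and dn: "\<And>j. j < 8 \<Longrightarrow> den j z \<ge> 1" using assms by (auto simp: Fund_eq)
 have c: "cnj (dir i) * z = Complex p q" by (simp add: p_def q_def complex_eq_iff)
 have z: "z = dir i * Complex p q" unfolding c[symmetric] using dir_cnj(1)[of i] by (simp add: mult.assoc[symmetric])
 have n: "(cmod z)^2 = p^2 + q^2" unfolding z by (simp add: norm_mult cmod_power2)
 \<comment> \<open>The side that lies in the direction dir i has the index i + 4; the index is
   reduced modulo 8 because the octagon is described with i < 8.\<close>
 have "den ((i + 4) mod 8) z = den (i + 4) z" by (simp add: den_def cden_def dir_mod_8)
 then have "den (i + 4) z \<ge> 1" using dn[of "(i + 4) mod 8"] by simp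
 then have k: "gb * p \<le> 1 + (cmod z)^2"
  unfolding den_ge_1_iff dir_opp p_def by (simp add: algebra_simps)
 have "q^2 \<le> ((sqrt 2 - 1) * p)^2" using i(2) unfolding p_def[symmetric] q_def[symmetric]
  by (metis abs_ge_zero power2_abs power_mono)
 then have r: "(cmod z)^2 \<le> p^2 * (4 - 2 * sqrt 2)"
  unfolding n by (simp add: power2_eq_square algebra_simps)
 have "(gb * p)^2 \<le> (1 + (cmod z)^2)^2" using k gb_pos i(3) by (intro power_mono) (auto simp: p_def)
 moreover have "(cmod z)^2 * (2 + 3 * sqrt 2 / 2) \<le> (gb * p)^2"
 proof -
  have "(cmod z)^2 * (2 + 3 * sqrt 2 / 2) \<le> p^2 * (4 - 2 * sqrt 2) * (2 + 3 * sqrt 2 / 2)"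
   using r by (intro mult_right_mono) auto
  also have "\<dots> = gb^2 * p^2" by (simp add: gb2 ga_def algebra_simps)
  finally show ?thesis by (simp add: power_mult_distrib)
 qed
 ultimately have "(cmod z)^2 \<le> sqrt 2 / 2" using zd by (intro quad_root) (auto simp: disc_iff)
 then show ?thesis using that[OF i(1) z _ _ n k r] i by (simp add: p_def q_def)
qed

lemma Fund_norm: "z \<in> Fund \<Longrightarrow> (cmod z)\<^sup>2 \<le> sqrt 2 / 2"
 by (elim Fund_coords)

text \<open>A point of nearly maximal modulus is close to a vertex, at a linear rate, so that the
  corner regions have area of order delta^2. The constant 7 is 2 + 5: the sums vp + p and vq + |q|
  are at least 1/2 and 1/5, which bounds the errors in p and q by 2 delta and 5 delta.\<close>

lemma Fund_corner:
 assumes "z \<in> Fund" "(cmod z)^2 \<ge> sqrt 2 / 2 - \<delta>" "\<delta> > 0"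
 shows "\<exists>i<8. dist z (dir i * Complex vp vq) \<le> 7 * \<delta> \<or> dist z (dir i * Complex vp (- vq)) \<le> 7 * \<delta>"
proof -
 obtain i p q where i: "i < 8" and z: "z = dir i * Complex p q" and q: "\<bar>q\<bar> \<le> (sqrt 2 - 1) * p" and p0: "0 \<le> p"
  and n: "(cmod z)^2 = p^2 + q^2" and k: "gb * p \<le> 1 + (cmod z)^2" and r: "(cmod z)^2 \<le> p^2 * (4 - 2 * sqrt 2)"
  and R: "(cmod z)^2 \<le> sqrt 2 / 2" using Fund_coords[OF assms(1)] by metis
 have "gb * p \<le> gb * vp" using k R gb_pos by (simp add: vp_def)
 then have pv: "p \<le> vp" using gb_pos by simp
 have qv: "\<bar>q\<bar> \<le> vq" unfolding vq_def
  by (rule order_trans[OF q mult_left_mono[OF pv]]) simp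
 have vpq: "vp^2 + vq^2 = sqrt 2 / 2"
  using vp_sq unfolding vq_def by (simp add: power2_eq_square algebra_simps)
 have "(vp^2 - p\<^sup>2) * (4 - 2 * sqrt 2) \<le> \<delta>" using r assms(2) vp_sq by (simp add: left_diff_distrib)
 moreover have "(vp^2 - p\<^sup>2) * 1 \<le> (vp^2 - p\<^sup>2) * (4 - 2 * sqrt 2)"
  using pv p0 sqrt2_bounds by (intro mult_left_mono) (auto simp: power_mono)
 ultimately have dp2: "vp^2 - p\<^sup>2 \<le> \<delta>" by simp
 have "(vp - p) * (1/2) \<le> (vp - p) * (vp + p)" using pv p0 vp_ge by (intro mult_left_mono) auto
 also have "\<dots> = vp^2 - p\<^sup>2" by (simp add: power2_eq_square algebra_simps)
 also note dp2
 finally have dp: "vp - p \<le> 2 * \<delta>" by simp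
 have "p^2 \<le> vp^2" using pv p0 by (simp add: power_mono)
 then have dq2: "vq^2 - \<bar>q\<bar>\<^sup>2 \<le> \<delta>" using assms(2) n vpq by simp
 have "(vq - \<bar>q\<bar>) * (1/5) \<le> (vq - \<bar>q\<bar>) * (vq + \<bar>q\<bar>)" using qv vq_ge by (intro mult_left_mono) auto
 also have "\<dots> = vq^2 - \<bar>q\<bar>\<^sup>2" by (simp add: power2_eq_square algebra_simps)
 also note dq2
 finally have dq: "vq - \<bar>q\<bar> \<le> 5 * \<delta>" by simp
 have dd: "dist z (dir i * Complex vp v) = cmod (Complex (p - vp) (q - v))" for v
 proof -
  have "z - dir i * Complex vp v = dir i * Complex (p - vp) (q - v)"
   unfolding z by (simp add: right_diff_distrib[symmetric] complex_eq_iff)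
  then show ?thesis by (simp add: dist_norm norm_mult)
 qed
 have "cmod (Complex (p - vp) (q - v)) \<le> 7 * \<delta>" if "\<bar>q - v\<bar> \<le> 5 * \<delta>" for v
  using cmod_le[of "Complex (p - vp) (q - v)"] dp pv that by simp
 then have *: "dist z (dir i * Complex vp v) \<le> 7 * \<delta>" if "\<bar>q - v\<bar> \<le> 5 * \<delta>" for v
  using that dd by simp
 show ?thesis
 proof (cases "q \<ge> 0")
  case True
  then show ?thesis using *[of vq] dq qv i by (intro exI[of _ i]) auto
 next
  case False
  then show ?thesis using *[of "-vq"] dq qv i by (intro exI[of _ i]) auto
 qed
qed

section \<open>Compactness, boundary and interior of the octagon\<close>

lemma continuous_den: "continuous_on S (den i)"
 unfolding den_def[abs_def] cden_def[abs_def] by (intro continuous_intros)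

lemma compact_Fund: "compact Fund"
proof -
 have "Fund = {z. (cmod z)^2 \<le> sqrt 2 / 2} \<inter> (\<Inter>i\<in>{..<8}. {z. den i z \<ge> 1})"
  using Fund_norm sqrt2_bounds by (auto simp: Fund_eq disc_iff)
 moreover have "closed {z. (cmod z)^2 \<le> sqrt 2 / 2}" "\<And>i. closed {z. den i z \<ge> 1}"
  by (intro closed_Collect_le continuous_intros continuous_den)+
 ultimately have "closed Fund" by (metis closed_INT closed_Int)
 moreover have "bounded Fund" by (rule bounded_subset[OF bounded_ball[of 0 1]]) (auto simp: Fund_eq disc_def)
 ultimately show ?thesis by (simp add: compact_eq_bounded_closed)
qed

lemma Fund_disc: "Fund \<subseteq> disc" by (auto simp: Fund_eq)

lemma Fund_lebesgue [simp]: "Fund \<in> sets lebesgue"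
 using compact_Fund by (simp add: borel_compact)

lemma disc_lebesgue [simp]: "disc \<in> sets lebesgue" by simp

lemma negligible_den_1: "negligible {z. den i z = 1}"
proof (rule negligible_subset[OF negligible_sphere])
 let ?A = "(of_real ga * dir i / of_real gb)"
 show "{z. den i z = 1} \<subseteq> sphere (- ?A) (1 / gb)"
 proof
  fix z assume "z \<in> {z. den i z = 1}"
  then have "cmod (cden i z) = 1" by (simp add: den_def abs_square_eq_1)
  moreover have "cden i z = of_real gb * cnj (dir i) * (z + of_real ga * dir i / of_real gb)"
   using gb_pos dir_cnj[of i] by (simp add: cden_def distrib_left field_simps)
  ultimately have "gb * cmod (z + of_real ga * dir i / of_real gb) = 1"
   using gb_pos by (simp add: norm_mult)
  moreover have "- ?A - z = - (z + of_real ga * dir i / of_real gb)" by simp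
  then have "cmod (- ?A - z) = cmod (z + of_real ga * dir i / of_real gb)"
   by (simp only: norm_minus_cancel)
  ultimately show "z \<in> sphere (- ?A) (1 / gb)"
   using gb_pos by (simp add: dist_norm eq_divide_eq mult.commute)
 qed
qed

lemma AE_den_neq_1: "AE z in lebesgue. den i z \<noteq> 1"
 using AE_not_in[OF negligible_den_1[of i, unfolded negligible_iff_null_sets]] by simp

lemma Fund_interior: "z \<in> Fund \<Longrightarrow> (\<And>i. i < 8 \<Longrightarrow> den i z \<noteq> 1) \<Longrightarrow> z \<in> interior Fund"
proof -
 assume z: "z \<in> Fund" and n: "\<And>i. i < 8 \<Longrightarrow> den i z \<noteq> 1"
 let ?A = "(\<Inter>i\<in>{..<8}. {z. 1 < den i z})"
 have "open (disc \<inter> ?A)"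
  by (intro open_Int open_INT finite_lessThan ballI open_disc open_Collect_less continuous_intros continuous_den)
 moreover have "z \<in> disc \<inter> ?A"
  using z n by (force simp: Fund_eq)
 moreover have "disc \<inter> ?A \<subseteq> Fund"
  by (auto simp: Fund_eq less_imp_le)
 ultimately show ?thesis by (meson interiorI)
qed

lemma Fund_boundary_null: "Fund - interior Fund \<in> null_sets lebesgue"
proof -
 have "negligible (\<Union>i\<in>{..<8}. {z. den i z = 1})"
  by (rule negligible_Union) (auto simp: negligible_den_1)
 then have "negligible (Fund - interior Fund)"
  by (rule negligible_subset) (use Fund_interior in auto)
 then show ?thesis by (simp add: negligible_iff_null_sets)
qed

section \<open>The generated group\<close>

lemma gen_in_DDGroup_aux: "restrict (gen i) disc \<in> Bij disc"
 using gen_bij[of i] by (auto simp: Bij_def bij_betw_restrict_eq)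

lemma gen_in_DDGroup: assumes "k < 4" shows "restrict (gen k) disc \<in> DDGroup"
proof -
 have "k \<in> {0..3}" using assms by auto
 then show ?thesis unfolding DDGroup_def act_gmat by (intro generate.incl) auto
qed

text \<open>Induction over the generated group. The inverse of a generator in
  \<open>BijGroup\<close> is a restricted \<open>inv_into\<close>, and invariance under it is the
  invariance under the generator at the preimage.\<close>

lemma DDGroup_invariant:
 assumes inv: "\<And>k z. k < 4 \<Longrightarrow> z \<in> disc \<Longrightarrow> \<phi> (gen k z) = \<phi> z" and g: "g \<in> DDGroup"
 shows "\<forall>z\<in>disc. g z \<in> disc \<and> \<phi> (g z) = \<phi> z"
 using g unfolding DDGroup_def
proof (induction rule: generate.induct)
 case one
 then show ?case by (simp add: BijGroup_def)
next
 case (incl h)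
 then show ?case using inv gen_disc by (auto simp: act_gmat)
next
 case (inv h)
 then obtain k where "k \<in> {0..3}" "h = restrict (act (gmat k)) disc" by blast
 then have k: "k < 4" "h = restrict (gen k) disc" by (auto simp: act_gmat)
 have "m_inv (BijGroup disc) h = (\<lambda>x\<in>disc. inv_into disc h x)"
  unfolding k by (rule inv_BijGroup[OF gen_in_DDGroup_aux])
 moreover have "inv_into disc h z \<in> disc \<and> \<phi> (inv_into disc h z) = \<phi> z" if z: "z \<in> disc" for z
 proof -
  have im: "h ` disc = disc" unfolding k using gen_image[of k] by simp
  have 1: "inv_into disc h z \<in> disc" using z im by (simp add: inv_into_into)
  have "h (inv_into disc h z) = z" using z im by (simp add: f_inv_into_f)
  then have "gen k (inv_into disc h z) = z" using 1 by (simp add: k)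
  then show ?thesis using 1 assms(1)[OF k(1) 1] by simp
 qed
 ultimately show ?case by simp
next
 case (eng h1 h2)
 have "h1 \<in> carrier (BijGroup disc)" "h2 \<in> carrier (BijGroup disc)"
  using eng.hyps group.generate_in_carrier[OF group_BijGroup, of "(\<lambda>k. restrict (act (gmat k)) disc) ` {0..3}" disc] gen_in_DDGroup_aux
  by (auto simp: act_gmat BijGroup_def)
 then show ?case using eng.IH by (simp add: BijGroup_def compose_def)
qed

section \<open>Change of variables\<close>

text \<open>The identification of the plane with real^2, in which Jacobian determinants are computed
  and the area formula is applied. It preserves Lebesgue measure.\<close>

definition c2v :: "complex \<Rightarrow> real^2" where "c2v z = vector [Re z, Im z]"
definition v2c :: "real^2 \<Rightarrow> complex" where "v2c v = Complex (v $ 1) (v $ 2)"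

lemma v2c_c2v [simp]: "v2c (c2v z) = z" by (simp add: v2c_def c2v_def)
lemma c2v_v2c [simp]: "c2v (v2c v) = v" by (simp add: v2c_def c2v_def vec_eq_iff forall_2)
lemma c2v_image: "c2v ` A = v2c -` A" by (force simp: image_iff intro: c2v_v2c[symmetric])
lemma inj_c2v: "inj c2v" by (rule inj_on_inverseI[of _ v2c]) simp

lemma bounded_linear_c2v: "bounded_linear c2v"
 unfolding linear_conv_bounded_linear[symmetric]
 by (rule linearI) (auto simp: c2v_def vec_eq_iff forall_2)
lemma bounded_linear_v2c: "bounded_linear v2c"
 unfolding linear_conv_bounded_linear[symmetric]
 by (rule linearI) (auto simp: v2c_def complex_eq_iff)

lemma c2v_measurable: "c2v \<in> borel_measurable borel"
 using bounded_linear.linear[OF bounded_linear_c2v] linear_continuous_on[OF bounded_linear_c2v]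
 by (intro borel_measurable_continuous_onI)
lemma v2c_measurable: "v2c \<in> borel_measurable borel"
 using linear_continuous_on[OF bounded_linear_v2c] by (intro borel_measurable_continuous_onI)

lemma Basis_real2: "(Basis :: (real^2) set) = {axis 1 1, axis 2 1}"
 by (auto simp: Basis_vec_def UNIV_2)

lemma distr_c2v: "distr lborel borel c2v = lborel"
proof (rule lborel_eqI[symmetric])
 fix l u :: "real^2" assume le: "\<And>b. b \<in> Basis \<Longrightarrow> l \<bullet> b \<le> u \<bullet> b"
 have ne: "axis 1 1 \<noteq> (axis 2 1 :: real^2)" by (simp add: axis_eq_axis)
 have "c2v -` box l u = box (v2c l) (v2c u)"
  by (auto simp: mem_box Basis_real2 Basis_complex_def c2v_def v2c_def inner_axis)
 moreover have "\<And>b. b \<in> Basis \<Longrightarrow> v2c l \<bullet> b \<le> v2c u \<bullet> b"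
  using le[of "axis 1 1"] le[of "axis 2 1"] by (auto simp: Basis_real2 Basis_complex_def v2c_def inner_axis)
 ultimately have "emeasure (distr lborel borel c2v) (box l u) = (\<Prod>b\<in>Basis. (v2c u - v2c l) \<bullet> b)"
  using c2v_measurable by (simp add: emeasure_distr)
 also have "\<dots> = (\<Prod>b\<in>Basis. (u - l) \<bullet> b)"
  using ne by (simp add: Basis_real2 Basis_complex_def v2c_def inner_axis)
 finally show "emeasure (distr lborel borel c2v) (box l u) = (\<Prod>b\<in>Basis. (u - l) \<bullet> b)" .
qed simp

lemma emeasure_c2v_image: "A \<in> sets borel \<Longrightarrow> emeasure lborel (c2v ` A) = emeasure lborel A"
proof -
 assume A: "A \<in> sets borel"
 have b: "c2v ` A \<in> sets borel"
  unfolding c2v_image using measurable_sets_borel[OF v2c_measurable A] by simp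
 have "emeasure lborel (c2v ` A) = emeasure (distr lborel borel c2v) (c2v ` A)" by (simp add: distr_c2v)
 also have "\<dots> = emeasure lborel (c2v -` (c2v ` A))"
  using b c2v_measurable by (simp add: emeasure_distr)
 also have "c2v -` (c2v ` A) = A" using inj_c2v by (rule inj_vimage_image_eq)
 finally show ?thesis .
qed

lemma nn_integral_c2v:
 "f \<in> borel_measurable borel \<Longrightarrow> (\<integral>\<^sup>+x. f (c2v x) \<partial>lborel) = (\<integral>\<^sup>+x. f x \<partial>lborel)"
proof -
 assume f: "f \<in> borel_measurable borel"
 have "(\<integral>\<^sup>+x. f x \<partial>lborel) = (\<integral>\<^sup>+x. f x \<partial>(distr lborel borel c2v))" by (simp add: distr_c2v)
 also have "\<dots> = (\<integral>\<^sup>+x. f (c2v x) \<partial>lborel)"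
  using f c2v_measurable by (subst nn_integral_distr) auto
 finally show ?thesis by simp
qed

lemma det_complex_mult: "\<bar>det (matrix (\<lambda>v. c2v (c * v2c v)))\<bar> = (cmod c)^2"
proof -
 have a: "v2c (axis 1 1) = 1" "v2c (axis 2 1) = \<i>" by (auto simp: v2c_def axis_def complex_eq_iff)
 have "det (matrix (\<lambda>v. c2v (c * v2c v))) = Re c * Re c + Im c * Im c"
  by (simp add: det_2 matrix_def a c2v_def)
 also have "\<dots> = (cmod c)^2" unfolding cmod_power2 by (simp add: power2_eq_square)
 finally have "det (matrix (\<lambda>v. c2v (c * v2c v))) = (cmod c)^2" .
 then show ?thesis by simp
qed

lemma gen_measurable: "gen i \<in> borel_measurable borel"
 unfolding gen_def[abs_def] by measurable

lemma den_measurable: "den i \<in> borel_measurable borel"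
 using continuous_den by (rule borel_measurable_continuous_onI)

lemma disc_borel: "disc \<in> sets borel" by simp

lemma gen_image_eq: "A \<subseteq> disc \<Longrightarrow> gen i ` A = disc \<inter> gen (i + 4) -` A"
proof -
 assume A: "A \<subseteq> disc"
 show ?thesis
 proof (intro equalityI subsetI)
  fix w assume "w \<in> gen i ` A"
  then show "w \<in> disc \<inter> gen (i + 4) -` A" using A gen_disc gen_opp by auto
 next
  fix w assume "w \<in> disc \<inter> gen (i + 4) -` A"
  then show "w \<in> gen i ` A" using gen_opp'[of w i] by (auto intro!: image_eqI[of _ _ "gen (i + 4) w"])
 qed
qed

text \<open>The area formula for an injective differentiable map. The differential is multiplication
  by 1 / (cden i z)^2, whose determinant is the square of the modulus, that is 1 / (den i z)^2. The
  image has finite measure because it stays in the disc.\<close>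

lemma emeasure_gen_image:
 assumes A: "A \<in> sets borel" "A \<subseteq> disc"
 shows "emeasure lborel (gen i ` A) = (\<integral>\<^sup>+z. indicator A z * ennreal (1 / (den i z)^2) \<partial>lborel)"
proof -
 define f where "f = (\<lambda>v. c2v (gen i (v2c v)))"
 define f' where "f' = (\<lambda>v h. c2v (1 / (cden i (v2c v))^2 * v2c h))"
 have inv: "v2c v \<in> disc" if "v \<in> c2v ` A" for v using that A(2) by auto
 have gA: "gen i ` A \<in> sets borel"
  unfolding gen_image_eq[OF A(2)]
  using measurable_sets_borel[OF gen_measurable A(1), of "i+4"] by auto
 have fS: "f ` (c2v ` A) = c2v ` (gen i ` A)" by (auto simp: f_def image_image)
 have Sb: "c2v ` A \<in> sets borel"
  unfolding c2v_image using measurable_sets_borel[OF v2c_measurable A(1)] by simp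
 have fSb: "f ` (c2v ` A) \<in> sets borel"
  unfolding fS using measurable_sets_borel[OF v2c_measurable gA] by (simp add: c2v_image[of "gen i ` A"])
 let ?A = "(f ` (c2v ` A))"
 have em: "emeasure lborel ?A = emeasure lborel (gen i ` A)"
  unfolding fS by (rule emeasure_c2v_image[OF gA])
 have "emeasure lborel (gen i ` A) \<le> emeasure lborel disc"
  using A(2) gen_disc by (intro emeasure_mono) auto
 also have "\<dots> < \<infinity>" unfolding disc_def by (rule emeasure_lborel_ball_finite)
 finally have fin: "emeasure lborel (gen i ` A) < \<infinity>" .
 have lm: "f ` (c2v ` A) \<in> lmeasurable"
  using fin em fSb by (simp add: fmeasurable_def)
 have der: "(f has_derivative f' v) (at v within c2v ` A)" if v: "v \<in> c2v ` A" for v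
 proof -
  have "(gen i has_derivative (*) (1 / (cden i (v2c v))^2)) (at (v2c v))"
   using gen_has_field_derivative[OF inv[OF v]] by (simp add: has_field_derivative_def)
  from has_derivative_compose[OF bounded_linear_imp_has_derivative[OF bounded_linear_v2c] this]
  have "((\<lambda>x. gen i (v2c x)) has_derivative (\<lambda>h. 1 / (cden i (v2c v))^2 * v2c h)) (at v within c2v ` A)" .
  from bounded_linear.has_derivative[OF bounded_linear_c2v this]
  show ?thesis by (simp add: f_def f'_def)
 qed
 have "inj_on (gen i) A" using gen_bij[of i] A(2) by (meson bij_betw_def inj_on_subset)
 then have inj: "inj_on f (c2v ` A)"
  by (auto simp: f_def inj_on_def inj_eq[OF inj_c2v])
 have det: "\<bar>det (matrix (f' v))\<bar> = 1 / (den i (v2c v))^2" for v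
  unfolding f'_def det_complex_mult by (simp add: den_def norm_divide norm_power power_divide)
 have "((\<lambda>v. 1 / (den i (v2c v))^2) has_integral measure lebesgue ?A) (c2v ` A)"
  using has_measure_differentiable_image[OF _ der inj, of "measure lebesgue ?A"] Sb lm
  unfolding det by simp
 from nn_integral_has_integral_lebesgue[OF _ this]
 have "(\<integral>\<^sup>+v. ennreal (indicator (c2v ` A) v * (1 / (den i (v2c v))^2)) \<partial>lborel) = ennreal (measure lebesgue ?A)"
  by (simp add: nn_integral_completion)
 also have "\<dots> = emeasure lborel ?A"
  using emeasure_eq_measure2[OF lm] fSb by simp
 also have "(\<lambda>v. ennreal (indicator (c2v ` A) v * (1 / (den i (v2c v))^2)))
   = (\<lambda>v. indicator (c2v ` A) v * ennreal (1 / (den i (v2c v))^2))"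
  by (rule ext) (simp add: indicator_def)
 finally have "(\<integral>\<^sup>+v. indicator (c2v ` A) v * ennreal (1 / (den i (v2c v))^2) \<partial>lborel) = emeasure lborel ?A" .
 moreover have "(\<integral>\<^sup>+v. indicator (c2v ` A) v * ennreal (1 / (den i (v2c v))^2) \<partial>lborel)
   = (\<integral>\<^sup>+z. indicator (c2v ` A) (c2v z) * ennreal (1 / (den i (v2c (c2v z)))^2) \<partial>lborel)"
 proof (rule nn_integral_c2v[symmetric])
  note [measurable] = Sb v2c_measurable den_measurable
  show "(\<lambda>v. indicator (c2v ` A) v * ennreal (1 / (den i (v2c v))^2)) \<in> borel_measurable borel"
   by measurable
 qed
 moreover have "indicator (c2v ` A) (c2v z) = (indicator A z :: ennreal)" for z
  using inj_c2v by (auto simp: indicator_def inj_image_mem_iff)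
 ultimately show ?thesis using em by simp
qed

text \<open>The formula for Borel sets as an identity of measures; the statements on null sets and
  on integrals are read off from it.\<close>

lemma distr_gen:
 "distr (density lborel (\<lambda>z. ennreal (indicator disc z / (den i z)^2))) borel (gen i) = density lborel (\<lambda>z. ennreal (indicator disc z))"
  (is "distr ?M1 borel _ = ?M2")
proof (rule measure_eqI)
 fix A assume "A \<in> sets (distr ?M1 borel (gen i))"
 then have A: "A \<in> sets borel" by simp
 have gA: "gen i -` A \<in> sets borel" using measurable_sets_borel[OF gen_measurable A] by simp
 let ?A = "(disc \<inter> gen i -` A)"
 have "emeasure (distr ?M1 borel (gen i)) A = emeasure ?M1 (gen i -` A)"
  using A gen_measurable by (subst emeasure_distr) auto
 also have "\<dots> = (\<integral>\<^sup>+z. ennreal (indicator disc z / (den i z)^2) * indicator (gen i -` A) z \<partial>lborel)"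
  using gA den_measurable disc_borel by (subst emeasure_density) (auto intro!: measurable_compose[OF _ measurable_ennreal] borel_measurable_divide borel_measurable_power)
 also have "\<dots> = (\<integral>\<^sup>+z. indicator ?A z * ennreal (1 / (den i z)^2) \<partial>lborel)"
  by (intro nn_integral_cong) (auto simp: indicator_def)
 also have "\<dots> = emeasure lborel (gen i ` ?A)"
  using gA disc_borel by (intro emeasure_gen_image[symmetric]) auto
 also have "gen i ` ?A = disc \<inter> A"
  using gen_image[of i] by (auto simp: image_iff) (metis gen_disc gen_opp' vimageI Int_iff gen_image image_iff)
 also have "emeasure lborel (disc \<inter> A) = emeasure ?M2 A"
 proof -
  have "emeasure ?M2 A = (\<integral>\<^sup>+z. ennreal (indicator disc z) * indicator A z \<partial>lborel)"
   using A disc_borel by (intro emeasure_density) auto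
  also have "\<dots> = (\<integral>\<^sup>+z. indicator (disc \<inter> A) z \<partial>lborel)"
   by (intro nn_integral_cong) (auto simp: indicator_def)
  also have "\<dots> = emeasure lborel (disc \<inter> A)" using A disc_borel by (intro nn_integral_indicator) auto
  finally show ?thesis by simp
 qed
 finally show "emeasure (distr ?M1 borel (gen i)) A = emeasure ?M2 A" .
qed simp

text \<open>The Jacobian is positive on the disc, so preimages of null sets under
  \<open>gen i\<close> are null sets.\<close>

lemma AE_disc_gen:
 assumes "AE z in lD. P z"
 shows "AE z in lD. P (gen i z)"
proof -
 have "AE z in lborel. z \<in> disc \<longrightarrow> P z"
  using assms by (simp add: AE_restrict_space_iff AE_completion_iff)
 then obtain N where N0: "{z \<in> space lborel. \<not> (z \<in> disc \<longrightarrow> P z)} \<subseteq> N" "emeasure lborel N = 0" "N \<in> sets lborel"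
  by (rule AE_E)
 have N: "N \<in> null_sets lborel" "\<And>z. z \<notin> N \<Longrightarrow> z \<in> disc \<longrightarrow> P z"
  using N0 by (auto simp: null_sets_def)
 have Nb: "N \<in> sets borel" using N(1) by (auto simp: null_sets_def)
 let ?A = "(\<lambda>z. ennreal (indicator disc z / (den i z)^2))"
 have dm: "?A \<in> borel_measurable lborel"
  using den_measurable disc_borel by (auto intro!: measurable_compose[OF _ measurable_ennreal] borel_measurable_divide borel_measurable_power)
 have "AE z in density lborel (\<lambda>z. ennreal (indicator disc z)). z \<notin> N"
  using AE_not_in[OF N(1)] disc_borel by (subst AE_density) auto
 then have "AE z in distr (density lborel ?A) borel (gen i). z \<notin> N"
  unfolding distr_gen .
 then have "AE z in density lborel ?A. gen i z \<notin> N"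
  using gen_measurable Nb by (subst (asm) AE_distr_iff) auto
 then have "AE z in lborel. 0 < ennreal (indicator disc z / (den i z)^2) \<longrightarrow> gen i z \<notin> N"
  using dm by (subst (asm) AE_density) auto
 then have "AE z in lborel. z \<in> disc \<longrightarrow> P (gen i z)"
 proof eventually_elim
  case (elim z)
  then show ?case using N(2)[of "gen i z"] gen_disc[of z i] den_pos[of z i] by auto
 qed
 then show ?thesis by (simp add: AE_restrict_space_iff AE_completion_iff)
qed

text \<open>The image measure handles Borel functions, but f is only Lebesgue measurable. A Borel
  function F replaces it, and \<open>AE_disc_gen\<close> guarantees that the compositions of f and F
  with \<open>gen i\<close> still agree almost everywhere.\<close>

lemma gen_change_of_variables:
 fixes f :: "complex \<Rightarrow> real"
 assumes f: "integrable lD f"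
 shows "integrable lD (\<lambda>z. f (gen i z) / (den i z)^2)"
  and "(LINT z|lD. f (gen i z) / (den i z)^2) = (LINT z|lD. f z)"
proof -
 define f0 where "f0 = (\<lambda>z. indicator disc z *\<^sub>R f z)"
 have f0i: "integrable lebesgue f0" using f by (simp add: f0_def integrable_restrict_space)
 then obtain F where F: "F \<in> borel_measurable lborel" "AE z in lborel. f0 z = F z"
  using completion_ex_borel_measurable_real[of f0 lborel] by auto
 have F': "F \<in> borel_measurable borel" using F(1) by simp
 have FL: "F \<in> borel_measurable lebesgue" using F(1) by (rule measurable_completion)
 have FiL: "integrable lebesgue F"
  by (rule integrable_cong_AE[THEN iffD1, OF borel_measurable_integrable[OF f0i] FL AE_completion[OF F(2)] f0i])
 then have Fi: "integrable lborel F" using F(1) by (simp add: integrable_completion)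
 let ?h = "\<lambda>z. indicator disc z / (den i z)^2"
 have hm: "?h \<in> borel_measurable lborel"
  using den_measurable disc_borel by (auto intro!: borel_measurable_divide borel_measurable_power)
 let ?M1 = "density lborel (\<lambda>z. ennreal (?h z))" and ?M2 = "density lborel (\<lambda>z. ennreal (indicator disc z))"
 have dm: "(indicator disc :: complex \<Rightarrow> real) \<in> borel_measurable lborel" using disc_borel by simp
 have iM2: "integrable ?M2 F"
  using Fi F(1) dm by (subst integrable_density) (auto intro: integrable_mult_indicator[of disc lborel F, simplified])
 have gm: "gen i \<in> measurable ?M1 borel" using gen_measurable by simp
 have iM1: "integrable ?M1 (\<lambda>z. F (gen i z))"
  using iM2 gm F' unfolding distr_gen[of i, symmetric] by (subst (asm) integrable_distr_eq) auto
 have eM: "(LINT z|?M2. F z) = (LINT z|?M1. F (gen i z))"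
  unfolding distr_gen[of i, symmetric] using gm F' by (subst integral_distr) auto
 have Fg: "(\<lambda>z. F (gen i z)) \<in> borel_measurable lborel"
  using measurable_compose[OF gen_measurable F'] by simp
 have i1: "integrable lborel (\<lambda>z. ?h z *\<^sub>R F (gen i z))"
  using iM1 Fg hm by (subst (asm) integrable_density) auto
 have e1: "(LINT z|?M1. F (gen i z)) = (LINT z|lborel. ?h z *\<^sub>R F (gen i z))"
  using Fg hm by (intro integral_density) auto
 have m1: "(\<lambda>z. ?h z *\<^sub>R F (gen i z)) \<in> borel_measurable lborel" using i1 by auto
 have i1L: "integrable lebesgue (\<lambda>z. ?h z *\<^sub>R F (gen i z))"
  using i1 m1 by (simp add: integrable_completion)
 have e1L: "(LINT z|lebesgue. ?h z *\<^sub>R F (gen i z)) = (LINT z|lborel. ?h z *\<^sub>R F (gen i z))"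
  using m1 by (rule integral_completion)
 have "AE z in lD. f z = F z"
  using F(2) by (simp add: AE_restrict_space_iff AE_completion_iff) (auto simp: f0_def elim!: eventually_mono)
 from AE_disc_gen[OF this, of i]
 have AEf: "AE z in lebesgue. ?h z *\<^sub>R F (gen i z) = indicator disc z *\<^sub>R (f (gen i z) / (den i z)^2)"
  by (simp add: AE_restrict_space_iff) (auto simp: indicator_def elim!: eventually_mono)
 have m1L: "(\<lambda>z. ?h z *\<^sub>R F (gen i z)) \<in> borel_measurable lebesgue" using i1L by auto
 have m2L: "(\<lambda>z. indicator disc z *\<^sub>R (f (gen i z) / (den i z)^2)) \<in> borel_measurable lebesgue"
  by (rule borel_measurable_AE[OF m1L AEf])
 show "integrable lD (\<lambda>z. f (gen i z) / (den i z)^2)"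
  using integrable_cong_AE[OF m1L m2L AEf] i1L by (simp add: integrable_restrict_space)
 let ?A = "(LINT z|lD. f (gen i z) / (den i z)^2)"
 have "?A = (LINT z|lebesgue. indicator disc z *\<^sub>R (f (gen i z) / (den i z)^2))"
  by (simp add: integral_restrict_space)
 also have "\<dots> = (LINT z|lebesgue. ?h z *\<^sub>R F (gen i z))"
  by (rule integral_cong_AE[OF m1L m2L AEf, symmetric])
 also have "\<dots> = (LINT z|?M2. F z)" unfolding e1L eM e1 ..
 also have "\<dots> = (LINT z|lborel. indicator disc z *\<^sub>R F z)" using F(1) dm by (intro integral_density) auto
 also have "\<dots> = (LINT z|lebesgue. indicator disc z *\<^sub>R F z)"
  using F(1) dm by (intro integral_completion[symmetric]) auto
 also have "\<dots> = (LINT z|lebesgue. f0 z)"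
 proof (rule integral_cong_AE)
  show "(\<lambda>z. indicator disc z *\<^sub>R F z) \<in> borel_measurable lebesgue"
   using integrable_mult_indicator[OF _ FiL, of disc] by auto
  show "f0 \<in> borel_measurable lebesgue" using f0i by auto
  show "AE z in lebesgue. indicator disc z *\<^sub>R F z = f0 z"
   using AE_completion[OF F(2)] by eventually_elim (auto simp: f0_def indicator_def)
 qed
 also have "\<dots> = (LINT z|lD. f z)" by (simp add: f0_def integral_restrict_space)
 finally show "?A = (LINT z|lD. f z)" .
qed

section \<open>Invariant kernels\<close>

text \<open>This is sinh(d/2)^2, where d is the hyperbolic distance of the two points. Unlike d, it
  is smooth on the diagonal.\<close>

definition hdist :: "complex \<times> complex \<Rightarrow> real" where
 "hdist x = (cmod (fst x - snd x))^2 / ((1 - (cmod (fst x))\<^sup>2) * (1 - (cmod (snd x))\<^sup>2))"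

definition kern :: "real \<Rightarrow> complex \<times> complex \<Rightarrow> real" where
 "kern \<epsilon> x = bump (1 - hdist x / \<epsilon>)"

text \<open>The weight in the second variable turns integration for dx dy into integration for the
  hyperbolic area; \<open>kern\<close> is symmetric, \<open>qk\<close> is not.\<close>

definition qk :: "real \<Rightarrow> complex \<times> complex \<Rightarrow> real" where
 "qk \<epsilon> x = kern \<epsilon> x * hyp_weight (snd x)"

lemma disc_pos: "z \<in> disc \<Longrightarrow> 1 - (cmod z)\<^sup>2 > 0" by (simp add: disc_iff)

lemma open_disc2 [simp]: "open (disc \<times> disc)" by (intro open_Times open_disc)

lemma smooth_cmod_sq_linear:
 assumes "open S" "bounded_linear L"
 shows "smooth_on S (\<lambda>x. (cmod (L x))^2)"
 unfolding cmod_power2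
 by (intro smooth_on_add smooth_on_power assms smooth_on_linear
   bounded_linear_compose[OF bounded_linear_Re assms(2)] bounded_linear_compose[OF bounded_linear_Im assms(2)])

lemma smooth_cmod_sq: "open S \<Longrightarrow> smooth_on S (\<lambda>z. (cmod z)^2)"
 by (rule smooth_cmod_sq_linear[OF _ bounded_linear_ident])

lemma smooth_hdist: "smooth_on (disc \<times> disc) hdist"
 unfolding hdist_def[abs_def]
 by (intro smooth_on_divide smooth_on_mult smooth_on_diff smooth_on_const open_disc2
    smooth_cmod_sq_linear bounded_linear_sub bounded_linear_fst bounded_linear_snd)
   (use disc_pos in force)

lemma smooth_kern: "smooth_on (disc \<times> disc) (kern \<epsilon>)"
proof -
 have "smooth_on (disc \<times> disc) (\<lambda>x. 1 - inverse \<epsilon> * hdist x)"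
  by (intro smooth_on_diff smooth_on_const smooth_on_cmult open_disc2 smooth_hdist)
 then have "smooth_on (disc \<times> disc) (\<lambda>x. bump (1 - inverse \<epsilon> * hdist x))"
  by (rule smooth_on_compose[OF smooth_on_bump open_disc2 open_UNIV subset_UNIV])
 then show ?thesis unfolding kern_def[abs_def] by (simp add: divide_inverse mult.commute)
qed

lemma smooth_weight_snd: "smooth_on (disc \<times> disc) (\<lambda>x. hyp_weight (snd x))"
 unfolding hyp_weight_def
 by (intro smooth_on_divide smooth_on_power smooth_on_diff smooth_on_const open_disc2
    smooth_cmod_sq_linear bounded_linear_snd)
   (use disc_pos in force)

lemma smooth_weight: "smooth_on disc hyp_weight"
 unfolding hyp_weight_def[abs_def]
 by (intro smooth_on_divide smooth_on_power smooth_on_diff smooth_on_const open_disc smooth_cmod_sq)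
   (use disc_pos in force)

lemma smooth_qk: "smooth_on (disc \<times> disc) (qk \<epsilon>)"
 unfolding qk_def[abs_def] by (intro smooth_on_mult open_disc2 smooth_kern smooth_weight_snd)

lemma hyp_weight_pos: "z \<in> disc \<Longrightarrow> hyp_weight z > 0"
 using disc_pos[of z] by (simp add: hyp_weight_def)

lemma kern_nonneg: "kern \<epsilon> x \<ge> 0" by (simp add: kern_def bump_nonneg)

lemma kern_commute: "kern \<epsilon> (z, w) = kern \<epsilon> (w, z)"
 by (simp add: kern_def hdist_def norm_minus_commute mult.commute)

lemma kern_nonzero:
 assumes "kern \<epsilon> (z, w) \<noteq> 0" "\<epsilon> > 0" "z \<in> disc" "w \<in> disc"
 shows "(cmod (z - w))^2 < \<epsilon> * ((1 - (cmod z)\<^sup>2) * (1 - (cmod w)\<^sup>2))"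
proof -
 have "\<not> (1 - hdist (z, w) / \<epsilon> \<le> 0)" using assms(1) bump_eq_0 by (auto simp: kern_def)
 then have "hdist (z, w) < \<epsilon>" using assms(2) by (simp add: field_simps)
 then show ?thesis using disc_pos[OF assms(3)] disc_pos[OF assms(4)]
  by (simp add: hdist_def divide_less_eq)
qed

text \<open>Hyperbolic balls of a fixed radius centred in a compact part of the disc stay in a
  compact part of the disc.\<close>

lemma kern_support:
 assumes "\<epsilon> > 0" "\<rho> < 1"
 shows "\<exists>\<rho>'<1. \<forall>z\<in>cball 0 \<rho> \<inter> disc. \<forall>w\<in>disc - cball 0 \<rho>'. kern \<epsilon> (z, w) = 0"
proof -
 \<comment> \<open>If |w| > 1 - t, the first bound keeps |z - w| above (1 - \<rho>)/2, while 1 -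
   |w|^2 <= 2 t. The second bound makes \<epsilon> 2 t at most ((1 - \<rho>)/2)^2, so w cannot be in
   the support.\<close>
 define t where "t = min ((1 - \<rho>) / 2) ((1 - \<rho>)^2 / (8 * \<epsilon>))"
 have t: "t > 0" "t \<le> (1 - \<rho>) / 2" "t \<le> (1 - \<rho>)^2 / (8 * \<epsilon>)" unfolding t_def using assms by (intro min.cobounded1 min.cobounded2 | simp)+
 have "kern \<epsilon> (z, w) = 0" if z: "z \<in> cball 0 \<rho> \<inter> disc" and w: "w \<in> disc - cball 0 (1 - t)" for z w
 proof (rule ccontr)
  assume "kern \<epsilon> (z, w) \<noteq> 0"
  then have *: "(cmod (z - w))^2 < \<epsilon> * ((1 - (cmod z)\<^sup>2) * (1 - (cmod w)\<^sup>2))"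
   using kern_nonzero assms z w by auto
  have zn: "cmod z \<le> \<rho>" and wn: "1 - t < cmod w" "cmod w < 1" using z w by (auto simp: disc_def)
  have "(1 - \<rho>) / 2 \<le> cmod w - cmod z" using zn wn t by (simp add: field_simps)
  also have "\<dots> \<le> cmod (z - w)" using norm_triangle_ineq2[of w z] by (simp add: norm_minus_commute)
  finally have "((1 - \<rho>) / 2)^2 \<le> (cmod (z - w))^2" using assms by (intro power_mono) auto
  moreover have "1 - (cmod w)\<^sup>2 \<le> 2 * t"
  proof -
   have "1 - (cmod w)\<^sup>2 = (1 - cmod w) * (1 + cmod w)" by (simp add: power2_eq_square algebra_simps)
   also have "\<dots> \<le> t * 2" using wn t by (intro mult_mono) auto
   finally show ?thesis by simp
  qed
  then have "(1 - (cmod z)\<^sup>2) * (1 - (cmod w)\<^sup>2) \<le> 1 * (2 * t)"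
   using disc_pos[of w] w t by (intro mult_mono) auto
  then have "\<epsilon> * ((1 - (cmod z)\<^sup>2) * (1 - (cmod w)\<^sup>2)) \<le> \<epsilon> * (2 * t)" using assms by simp
  moreover have "\<epsilon> * (2 * t) \<le> ((1 - \<rho>) / 2)^2"
   using t(3) assms(1) by (simp add: field_simps power2_eq_square)
  ultimately show False using * by linarith
 qed
 then show ?thesis using t(1) by (intro exI[of _ "1 - t"]) auto
qed

lemma cball_disc: "\<rho> < 1 \<Longrightarrow> cball 0 \<rho> \<subseteq> disc" by (auto simp: disc_def)

lemma adm_qk: assumes "\<epsilon> > 0" shows "adm disc disc (qk \<epsilon>)"
 unfolding adm_def
proof (intro conjI ballI)
 show "smooth_on (disc \<times> disc) (qk \<epsilon>)" by (rule smooth_qk)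
 fix z0 assume z0: "z0 \<in> disc"
 define r where "r = (1 - cmod z0) / 2"
 have r: "r > 0" "cmod z0 + r < 1" using z0 by (auto simp: r_def disc_def field_simps)
 obtain \<rho> where \<rho>: "\<rho> < 1" "\<And>z w. z \<in> cball 0 (cmod z0 + r) \<inter> disc \<Longrightarrow> w \<in> disc - cball 0 \<rho> \<Longrightarrow> kern \<epsilon> (z, w) = 0"
  using kern_support[OF assms r(2)] by blast
 have "cmod z \<le> cmod z0 + r" if "z \<in> ball z0 r" for z
  using that norm_triangle_ineq2[of z z0] by (simp add: dist_norm norm_minus_commute)
 then have "\<forall>z\<in>disc \<inter> ball z0 r. \<forall>w\<in>disc - cball 0 \<rho>. qk \<epsilon> (z, w) = 0"
  using \<rho>(2) by (auto simp: qk_def)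
 then show "\<exists>r>0. \<exists>C. compact C \<and> C \<subseteq> disc \<and> (\<forall>z\<in>disc \<inter> ball z0 r. \<forall>w\<in>disc - C. qk \<epsilon> (z, w) = 0)"
  by (intro exI[of _ r] conjI exI[of _ "cball 0 \<rho>"] r(1) compact_cball cball_disc[OF \<rho>(1)])
qed

text \<open>The velocity at t = 0 of the maps z -> (z + t c) / (1 + t cnj(c) z): a Killing field of
  the disc, namely the infinitesimal hyperbolic translation with value c at the origin.\<close>

definition xi :: "complex \<Rightarrow> complex \<Rightarrow> complex" where "xi c z = c - cnj c * z^2"

lemma inner_xi: "z \<bullet> xi c z = (1 - (cmod z)\<^sup>2) * Re (cnj c * z)"
 unfolding cmod_power2 by (simp add: xi_def inner_complex_def power2_eq_square algebra_simps)

lemma inner_xi_diff: "(z - w) \<bullet> (xi c z - xi c w) = - (cmod (z - w))\<^sup>2 * Re (cnj c * (z + w))"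
 unfolding cmod_power2 by (simp add: xi_def inner_complex_def power2_eq_square algebra_simps)

lemma hdist_inner: "hdist x = ((fst x - snd x) \<bullet> (fst x - snd x)) / ((1 - fst x \<bullet> fst x) * (1 - snd x \<bullet> snd x))"
 by (simp add: hdist_def power2_norm_eq_inner)

text \<open>Along the field acting on both points, numerator and denominator of \<open>hdist\<close>
  have the same logarithmic derivative -2 Re(cnj(c) (z + w)), so the quotient is stationary.\<close>

lemma hdist_killing:
 assumes z: "z \<in> disc" and w: "w \<in> disc" and D: "(hdist has_derivative D) (at (z, w))"
 shows "D (xi c z, xi c w) = 0"
proof -
 define P where "P = (\<lambda>x::complex\<times>complex. (fst x - snd x) \<bullet> (fst x - snd x))"
 define Q where "Q = (\<lambda>x::complex\<times>complex. (1 - fst x \<bullet> fst x) * (1 - snd x \<bullet> snd x))"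
 define P' where "P' = (\<lambda>h::complex\<times>complex. 2 * ((z - w) \<bullet> (fst h - snd h)))"
 define Q' where "Q' = (\<lambda>h::complex\<times>complex. (1 - z \<bullet> z) * (- 2 * (w \<bullet> snd h)) + (- 2 * (z \<bullet> fst h)) * (1 - w \<bullet> w))"
 have nz: "Q (z, w) \<noteq> 0" using disc_pos[OF z] disc_pos[OF w] by (simp add: Q_def power2_norm_eq_inner[symmetric])
 have P: "(P has_derivative P') (at (z, w))"
  unfolding P_def P'_def by (auto intro!: derivative_eq_intros simp: inner_commute)
 have Q: "(Q has_derivative Q') (at (z, w))"
  unfolding Q_def Q'_def by (auto intro!: derivative_eq_intros simp: inner_commute)
 let ?A = "(\<lambda>h. - P (z, w) * (inverse (Q (z, w)) * Q' h * inverse (Q (z, w))) + P' h / Q (z, w))"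
 have "hdist = (\<lambda>x. P x / Q x)" by (auto simp: hdist_inner P_def Q_def)
 then have "(hdist has_derivative ?A) (at (z, w))"
  using has_derivative_divide[OF P Q nz] by simp
 then have De: "D = ?A"
  using D has_derivative_unique by blast
 let ?h = "(xi c z, xi c w)"
 have zz: "z \<bullet> z = (cmod z)^2" "w \<bullet> w = (cmod w)^2" by (simp_all add: power2_norm_eq_inner)
 have P1: "P' ?h = - 2 * P (z, w) * Re (cnj c * (z + w))"
  using inner_xi_diff[of z w c] by (simp add: P_def P'_def power2_norm_eq_inner)
 have Q1: "Q' ?h = - 2 * Q (z, w) * Re (cnj c * (z + w))"
  unfolding Q'_def Q_def by (simp add: zz inner_xi algebra_simps)
 show ?thesis unfolding De P1 Q1 using nz by (simp add: field_simps)
qed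

text \<open>By \<open>partial_xi\<close>, the Euclidean divergence of the field is -4 Re(cnj(c) w).
  The formula therefore says that the weight times the field is divergence free.\<close>

lemma weight_killing:
 assumes w: "w \<in> disc" and D: "(hyp_weight has_derivative D) (at w)"
 shows "D (xi c w) = 4 * Re (cnj c * w) * hyp_weight w"
proof -
 define R where "R = (\<lambda>w::complex. 1 - w \<bullet> w)"
 have nz: "R w \<noteq> 0" using disc_pos[OF w] by (simp add: R_def power2_norm_eq_inner[symmetric])
 have R: "(R has_derivative (\<lambda>h. - 2 * (w \<bullet> h))) (at w)"
  unfolding R_def by (auto intro!: derivative_eq_intros simp: inner_commute)
 have eq: "hyp_weight = (\<lambda>w. 4 / (R w * R w))" by (auto simp: hyp_weight_def R_def power2_norm_eq_inner[symmetric] power2_eq_square)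
 have "((\<lambda>w. 4 / (R w * R w)) has_derivative (\<lambda>h. 16 * (w \<bullet> h) / (R w * R w * R w))) (at w)"
  using nz by (auto intro!: derivative_eq_intros R simp: field_simps)
 then have "D = (\<lambda>h. 16 * (w \<bullet> h) / (R w * R w * R w))"
  using D eq has_derivative_unique by metis
 then have "D (xi c w) = 16 * (R w * Re (cnj c * w)) / (R w * R w * R w)"
  by (simp add: inner_xi R_def power2_norm_eq_inner)
 also have "\<dots> = 4 * Re (cnj c * w) * (4 / (R w * R w))" using nz by (simp add: field_simps)
 finally show ?thesis by (simp add: eq)
qed

text \<open>The kernel is invariant under the flow of the Killing field xi acting on both variables,
 and the field has divergence zero for the hyperbolic area.\<close>

lemma qk_killing:
 assumes z: "z \<in> disc" and w: "w \<in> disc" and D: "(qk \<epsilon> has_derivative D) (at (z, w))"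
 shows "D (xi c z, xi c w) = 4 * Re (cnj c * w) * qk \<epsilon> (z, w)"
proof -
 have "(z, w) \<in> disc \<times> disc" using z w by simp
 then obtain H where H: "(hdist has_derivative H) (at (z, w))"
  using smooth_on_differentiable[OF smooth_hdist] unfolding differentiable_def by blast
 obtain B where B: "(bump has_derivative B) (at (1 - hdist (z, w) / \<epsilon>))"
  using smooth_on_differentiable[OF smooth_on_bump UNIV_I] unfolding differentiable_def by blast
 obtain V where V: "(hyp_weight has_derivative V) (at w)"
  using smooth_on_differentiable[OF smooth_weight w] unfolding differentiable_def by blast
 have V': "((\<lambda>x. hyp_weight (snd x)) has_derivative (\<lambda>h. V (snd h))) (at (z, w))"
  by (rule has_derivative_compose[of snd, OF _ ]) (use V in \<open>auto intro!: derivative_eq_intros\<close>)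
 have "((\<lambda>x. 1 - hdist x / \<epsilon>) has_derivative (\<lambda>h. - (H h / \<epsilon>))) (at (z, w))"
  by (auto intro!: derivative_eq_intros H simp: divide_inverse)
 from has_derivative_compose[OF this B]
 have K: "(kern \<epsilon> has_derivative (\<lambda>h. B (- (H h / \<epsilon>)))) (at (z, w))" by (simp add: kern_def[abs_def])
 let ?A = "(\<lambda>h. kern \<epsilon> (z, w) * V (snd h) + B (- (H h / \<epsilon>)) * hyp_weight (snd (z, w)))"
 have "(qk \<epsilon> has_derivative ?A) (at (z, w))"
  unfolding qk_def[abs_def] by (rule has_derivative_mult[OF K V'])
 then have De: "D = ?A"
  using D has_derivative_unique by blast
 have B0: "B 0 = 0" using has_derivative_bounded_linear[OF B] by (simp add: bounded_linear.linear linear_0)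
 show ?thesis unfolding De using hdist_killing[OF z w H] weight_killing[OF w V] B0 by (simp add: qk_def)
qed

section \<open>Weak gradients and the averaging operator\<close>

definition wp :: "(complex \<Rightarrow> real) \<Rightarrow> (complex \<Rightarrow> real) \<Rightarrow> (complex \<Rightarrow> real) \<Rightarrow> bool" where
 "wp f fx fy \<longleftrightarrow> l1loc disc f \<and> l1loc disc fx \<and> l1loc disc fy \<and>
  (\<forall>\<phi>. test_fun disc \<phi> \<longrightarrow>
   (LINT z|lD. partial 1 \<phi> z * f z) = - (LINT z|lD. \<phi> z * fx z) \<and>
   (LINT z|lD. partial \<i> \<phi> z * f z) = - (LINT z|lD. \<phi> z * fy z))"

lemma has_derivative_partial_complex:
 assumes "(f has_derivative D) (at x)"
 shows "D h = Re h * partial 1 f x + Im h * partial \<i> f x"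
proof -
 have "D h = D (Re h *\<^sub>R 1 + Im h *\<^sub>R \<i>)" by (rule arg_cong[of _ _ D]) (simp add: complex_eq_iff)
 also have "\<dots> = Re h * D 1 + Im h * D \<i>"
  using bounded_linear.linear[OF has_derivative_bounded_linear[OF assms]] by (simp add: linear_add linear_cmul)
 finally show ?thesis using partial_eqI[OF assms] by simp
qed

lemma smooth_xi: "open S \<Longrightarrow> smooth_on S (\<lambda>w. Re (xi c w))" "open S \<Longrightarrow> smooth_on S (\<lambda>w. Im (xi c w))"
proof -
 assume S: "open S"
 have r: "smooth_on S Re" "smooth_on S Im"
  by (auto intro: smooth_on_linear bounded_linear_Re bounded_linear_Im)
 let ?A = "(\<lambda>w. Re c - (Re c * (Re w * Re w - Im w * Im w) + Im c * (2 * (Re w * Im w))))"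
 have "(\<lambda>w. Re (xi c w)) = ?A"
  by (auto simp: xi_def power2_eq_square algebra_simps)
 moreover have "smooth_on S ?A"
  by (intro smooth_on_diff smooth_on_add smooth_on_mult smooth_on_const S r)
 ultimately show "smooth_on S (\<lambda>w. Re (xi c w))" by simp
 let ?B = "(\<lambda>w. Im c - (Re c * (2 * (Re w * Im w)) - Im c * (Re w * Re w - Im w * Im w)))"
 have "(\<lambda>w. Im (xi c w)) = ?B"
  by (auto simp: xi_def power2_eq_square algebra_simps)
 moreover have "smooth_on S ?B"
  by (intro smooth_on_diff smooth_on_add smooth_on_mult smooth_on_const S r)
 ultimately show "smooth_on S (\<lambda>w. Im (xi c w))" by simp
qed

lemma partial_xi: "partial 1 (\<lambda>w. Re (xi c w)) w = - 2 * Re (cnj c * w)" "partial \<i> (\<lambda>w. Im (xi c w)) w = - 2 * Re (cnj c * w)"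
proof -
 have "(xi c has_derivative (\<lambda>h. - (cnj c * (2 * w * h)))) (at w)"
  unfolding xi_def[abs_def] by (auto intro!: derivative_eq_intros simp: algebra_simps)
 note has_derivative_Re[OF this] has_derivative_Im[OF this]
 from partial_eqI[OF this(1), of 1] partial_eqI[OF this(2), of \<i>]
 show "partial 1 (\<lambda>w. Re (xi c w)) w = - 2 * Re (cnj c * w)" "partial \<i> (\<lambda>w. Im (xi c w)) w = - 2 * Re (cnj c * w)"
  by (auto simp: algebra_simps)
qed

lemma l1loc_mult:
 assumes "open U" "l1loc U u" "continuous_on U g"
 shows "l1loc U (\<lambda>x. g x * u x)"
 unfolding l1loc_def
proof (intro allI impI)
 fix C assume C: "compact C \<and> C \<subseteq> U"
 have Cm: "C \<in> sets lebesgue" using C by (simp add: borel_compact)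
 have iu: "integrable (lebesgue_on C) u" using assms(2) C by (simp add: l1loc_def)
 have gC: "continuous_on C g" using assms(3) C continuous_on_subset by blast
 then have "bounded (g ` C)" using C by (intro compact_imp_bounded compact_continuous_image) auto
 then obtain M where M: "\<And>x. x \<in> C \<Longrightarrow> \<bar>g x\<bar> \<le> M" by (auto simp: bounded_iff)
 show "integrable (lebesgue_on C) (\<lambda>x. g x * u x)"
 proof (rule Bochner_Integration.integrable_bound[where f="\<lambda>x. M * u x"])
  show "integrable (lebesgue_on C) (\<lambda>x. M * u x)" using iu by simp
  show "(\<lambda>x. g x * u x) \<in> borel_measurable (lebesgue_on C)"
   by (rule borel_measurable_times[OF continuous_imp_measurable_on_sets_lebesgue[OF gC Cm] borel_measurable_integrable[OF iu]])
  have "norm (g x * u x) \<le> norm (M * u x)" if "x \<in> C" for x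
   using M[OF that] by (auto simp: abs_mult intro!: mult_right_mono)
  then show "AE x in lebesgue_on C. norm (g x * u x) \<le> norm (M * u x)"
   by (intro AE_I2) simp
 qed
qed

lemma l1loc_add: "l1loc U u \<Longrightarrow> l1loc U v \<Longrightarrow> l1loc U (\<lambda>x. u x + v x)"
 by (simp add: l1loc_def)

definition Kop :: "real \<Rightarrow> (complex \<Rightarrow> real) \<Rightarrow> complex \<Rightarrow> real" where
 "Kop \<epsilon> f z = (LINT w|lD. qk \<epsilon> (z, w) * f w)"

text \<open>The weak derivative along the field \<open>xi c\<close> of a function with weak gradient
  (fx, fy).\<close>

definition Xder :: "complex \<Rightarrow> (complex \<Rightarrow> real) \<Rightarrow> (complex \<Rightarrow> real) \<Rightarrow> complex \<Rightarrow> real" where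
 "Xder c fx fy z = Re (xi c z) * fx z + Im (xi c z) * fy z"

lemma qk_fixed:
 assumes "\<epsilon> > 0" "z \<in> disc"
 obtains C where "compact C" "C \<subseteq> disc" "\<And>w. w \<in> disc - C \<Longrightarrow> qk \<epsilon> (z, w) = 0"
 using admE[OF adm_qk[OF assms(1)] open_disc assms(2)] by (metis centre_in_cball less_imp_le)

lemma has_derivative_Pair_const: "((\<lambda>w. (z, w)) has_derivative (\<lambda>h. (0, h))) (at w)"
 by (auto intro!: derivative_eq_intros)

text \<open>Since \<open>smooth_on_compose\<close> has a function of one real variable on the
  outside, the construction of \<open>qk\<close> is repeated with the first point frozen.\<close>

lemma smooth_qk_fixed: assumes "\<epsilon> > 0" "z \<in> disc" shows "smooth_on disc (\<lambda>w. qk \<epsilon> (z, w))"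
proof -
 have S: "open disc" by simp
 have "smooth_on disc (\<lambda>w. (cmod (w - z))^2)"
  unfolding cmod_power2
  by (simp, intro smooth_on_add smooth_on_power smooth_on_diff smooth_on_const smooth_on_linear bounded_linear_Re bounded_linear_Im open_disc)
 then have h: "smooth_on disc (\<lambda>w. hdist (z, w))"
  unfolding hdist_def using assms disc_pos
  by (simp add: norm_minus_commute[of z]) (intro smooth_on_divide smooth_on_mult smooth_on_diff smooth_on_const smooth_cmod_sq open_disc; force)
 have "smooth_on disc (\<lambda>w. 1 - inverse \<epsilon> * hdist (z, w))"
  by (intro smooth_on_diff smooth_on_const smooth_on_cmult open_disc h)
 then have "smooth_on disc (\<lambda>w. bump (1 - inverse \<epsilon> * hdist (z, w)))"
  by (rule smooth_on_compose[OF smooth_on_bump open_disc open_UNIV subset_UNIV])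
 then have "smooth_on disc (\<lambda>w. kern \<epsilon> (z, w))" unfolding kern_def[abs_def] by (simp add: divide_inverse mult.commute)
 then show ?thesis unfolding qk_def by (simp add: smooth_on_mult smooth_weight)
qed

lemma lebesgue_on_cong_int:
 assumes "\<And>x. x \<in> S \<Longrightarrow> f x = g x"
 shows "integral\<^sup>L (lebesgue_on S) f = integral\<^sup>L (lebesgue_on S) g"
 using assms by (intro Bochner_Integration.integral_cong) auto

lemma Kop_smooth: "\<epsilon> > 0 \<Longrightarrow> l1loc disc f \<Longrightarrow> smooth_on disc (Kop \<epsilon> f)"
 unfolding Kop_def[abs_def] by (rule parametric_smooth[OF open_disc open_disc adm_qk])

text \<open>The derivative falls on the kernel in z; invariance of the kernel moves it to w, where
  it becomes minus a divergence, and the definition of the weak gradient moves it on to f. The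
  average of a weakly differentiable function thus has derivatives along the fields that are
  themselves averages.\<close>

lemma Kop_killing:
 assumes e: "\<epsilon> > 0" and f: "wp f fx fy" and z: "z \<in> disc"
 shows "Re (xi c z) * partial 1 (Kop \<epsilon> f) z + Im (xi c z) * partial \<i> (Kop \<epsilon> f) z = Kop \<epsilon> (Xder c fx fy) z"
proof -
 let ?L = "lD"
 have lf: "l1loc disc f" "l1loc disc fx" "l1loc disc fy" using f by (auto simp: wp_def)
 define q where "q = (\<lambda>w. qk \<epsilon> (z, w))"
 obtain C where C: "compact C" "C \<subseteq> disc" "\<And>w. w \<in> disc - C \<Longrightarrow> q w = 0"
  using qk_fixed[OF e z] unfolding q_def by metis
 have qs: "smooth_on disc q" unfolding q_def by (rule smooth_qk_fixed[OF e z])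
 define a where "a = (\<lambda>w. Re (xi c w) * q w)"
 define b where "b = (\<lambda>w. Im (xi c w) * q w)"
 have as: "smooth_on disc a" and bs: "smooth_on disc b"
  unfolding a_def b_def by (intro smooth_on_mult open_disc smooth_xi qs)+
 have a0: "a w = 0" "b w = 0" if "w \<in> disc - C" for w using C(3)[OF that] by (auto simp: a_def b_def)
 let ?e = "\<lambda>f w. if w \<in> disc then f w else (0::real)"
 have ta: "test_fun disc (?e a)" and tb: "test_fun disc (?e b)"
  by (rule test_fun_extend[OF open_disc C(1,2)]; use as bs a0 in auto)+
 have pe: "partial d (?e g) w = partial d g w" if "w \<in> disc" for d g w
  by (rule partial_cong_open[OF open_disc that]) auto
 have 1: "(LINT w|?L. partial 1 a w * f w) = - (LINT w|?L. a w * fx w)"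
 proof -
  have "(LINT w|?L. partial 1 a w * f w) = (LINT w|?L. partial 1 (?e a) w * f w)"
   by (rule lebesgue_on_cong_int) (simp add: pe)
  also have "\<dots> = - (LINT w|?L. ?e a w * fx w)" using f ta unfolding wp_def by blast
  also have "(LINT w|?L. ?e a w * fx w) = (LINT w|?L. a w * fx w)"
   by (rule lebesgue_on_cong_int) simp
  finally show ?thesis .
 qed
 have 2: "(LINT w|?L. partial \<i> b w * f w) = - (LINT w|?L. b w * fy w)"
 proof -
  have "(LINT w|?L. partial \<i> b w * f w) = (LINT w|?L. partial \<i> (?e b) w * f w)"
   by (rule lebesgue_on_cong_int) (simp add: pe)
  also have "\<dots> = - (LINT w|?L. ?e b w * fy w)" using f tb unfolding wp_def by blast
  also have "(LINT w|?L. ?e b w * fy w) = (LINT w|?L. b w * fy w)"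
   by (rule lebesgue_on_cong_int) simp
  finally show ?thesis .
 qed
 have p0: "partial d g w = 0" if "w \<in> disc - C" "\<And>w. w \<in> disc - C \<Longrightarrow> g w = 0" for d g w
  by (rule partial_eq_0_open[of "disc - C"]) (use that C(1) in \<open>auto intro!: open_Diff compact_imp_closed\<close>)
 have cont: "continuous_on disc (partial d g)" if "smooth_on disc g" "d \<in> Basis" for d g
  using that by (intro smooth_on_continuous smooth_on_partial)
 have i1: "integrable ?L (\<lambda>w. partial 1 a w * f w)"
  by (rule integrable_mult_l1loc[OF open_disc C(1,2) lf(1) cont[OF as]]) (use p0[OF _ a0(1)] in auto)
 have i2: "integrable ?L (\<lambda>w. partial \<i> b w * f w)"
  by (rule integrable_mult_l1loc[OF open_disc C(1,2) lf(1) cont[OF bs]]) (use p0[OF _ a0(2)] in auto)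
 have i3: "integrable ?L (\<lambda>w. a w * fx w)"
  by (rule integrable_mult_l1loc[OF open_disc C(1,2) lf(2) smooth_on_continuous[OF as]]) (use a0 in auto)
 have i4: "integrable ?L (\<lambda>w. b w * fy w)"
  by (rule integrable_mult_l1loc[OF open_disc C(1,2) lf(3) smooth_on_continuous[OF bs]]) (use a0 in auto)
 have B: "(1::complex) \<in> Basis" "\<i> \<in> Basis" by (auto simp: Basis_complex_def)
 have i5: "integrable ?L (\<lambda>w. partial (d, 0) (qk \<epsilon>) (z, w) * f w)" if "d \<in> Basis" for d
  by (rule adm_integrable[OF open_disc open_disc adm_partial[OF adm_qk[OF e] open_disc open_disc that] lf(1) z])
 have pp: "partial d (Kop \<epsilon> f) z = (LINT w|?L. partial (d, 0) (qk \<epsilon>) (z, w) * f w)" if "d \<in> Basis" for d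
  unfolding Kop_def[abs_def] by (rule parametric_partial[OF open_disc open_disc adm_qk[OF e] lf(1) z that])
 \<comment> \<open>The derivative of the kernel along the field in z is minus the divergence in w of
   the kernel times the field: the factor 4 Re(cnj(c) w) of \<open>qk_killing\<close> is exactly the
   divergence term.\<close>
 have point: "Re (xi c z) * partial (1, 0) (qk \<epsilon>) (z, w) + Im (xi c z) * partial (\<i>, 0) (qk \<epsilon>) (z, w)
   = - (partial 1 a w + partial \<i> b w)" if w: "w \<in> disc" for w
 proof -
  have "(z, w) \<in> disc \<times> disc" using z w by simp
  then obtain D where D: "(qk \<epsilon> has_derivative D) (at (z, w))"
   using smooth_on_differentiable[OF smooth_qk] unfolding differentiable_def by blast
  interpret D: bounded_linear D using D by (rule has_derivative_bounded_linear)
  have Dq: "(q has_derivative (\<lambda>h. D (0, h))) (at w)"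
   unfolding q_def by (rule has_derivative_compose[OF has_derivative_Pair_const D])
  have pq: "partial d q w = D (0, d)" for d using partial_eqI[OF Dq] .
  have dq: "q differentiable (at w)" using Dq unfolding differentiable_def by blast
  have dx: "(\<lambda>w. Re (xi c w)) differentiable (at w)" "(\<lambda>w. Im (xi c w)) differentiable (at w)"
   using smooth_xi[OF open_disc] smooth_on_differentiable w by blast+
  have "partial 1 a w + partial \<i> b w = Re (xi c w) * D (0, 1) + Im (xi c w) * D (0, \<i>) - 4 * Re (cnj c * w) * q w"
   unfolding a_def b_def partial_mult[OF dx(1) dq] partial_mult[OF dx(2) dq] partial_xi pq by (simp add: algebra_simps)
  moreover have "D (xi c z, xi c w) = Re (xi c z) * D (1, 0) + Im (xi c z) * D (\<i>, 0) + (Re (xi c w) * D (0, 1) + Im (xi c w) * D (0, \<i>))"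
  proof -
   let ?A = "(Re (xi c w) *\<^sub>R (0, 1) + Im (xi c w) *\<^sub>R (0, \<i>))"
   have "(xi c z, xi c w) = Re (xi c z) *\<^sub>R (1, 0) + Im (xi c z) *\<^sub>R (\<i>, 0) + ?A"
    by (simp add: prod_eq_iff complex_eq_iff)
   then have "D (xi c z, xi c w) = D (Re (xi c z) *\<^sub>R (1, 0) + Im (xi c z) *\<^sub>R (\<i>, 0) + ?A)"
    by (rule arg_cong)
   then show ?thesis by (simp only: D.add D.scaleR real_scaleR_def)
  qed
  moreover have "partial d (qk \<epsilon>) (z, w) = D d" for d by (rule partial_eqI[OF D])
  ultimately show ?thesis using qk_killing[OF z w D, of c] by (simp add: q_def)
 qed
 have "Re (xi c z) * partial 1 (Kop \<epsilon> f) z + Im (xi c z) * partial \<i> (Kop \<epsilon> f) z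
  = (LINT w|?L. Re (xi c z) * (partial (1, 0) (qk \<epsilon>) (z, w) * f w) + Im (xi c z) * (partial (\<i>, 0) (qk \<epsilon>) (z, w) * f w))"
  unfolding pp[OF B(1)] pp[OF B(2)] using i5[OF B(1)] i5[OF B(2)] by simp
 also have "\<dots> = (LINT w|?L. - (partial 1 a w * f w + partial \<i> b w * f w))"
 proof (rule lebesgue_on_cong_int)
  fix w assume w: "w \<in> disc"
  have "Re (xi c z) * (partial (1, 0) (qk \<epsilon>) (z, w) * f w) + Im (xi c z) * (partial (\<i>, 0) (qk \<epsilon>) (z, w) * f w)
    = (Re (xi c z) * partial (1, 0) (qk \<epsilon>) (z, w) + Im (xi c z) * partial (\<i>, 0) (qk \<epsilon>) (z, w)) * f w"
   by (simp add: distrib_right)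
  then show "Re (xi c z) * (partial (1, 0) (qk \<epsilon>) (z, w) * f w) + Im (xi c z) * (partial (\<i>, 0) (qk \<epsilon>) (z, w) * f w)
    = - (partial 1 a w * f w + partial \<i> b w * f w)"
   unfolding point[OF w] by (simp add: algebra_simps)
 qed
 also have "\<dots> = (LINT w|?L. a w * fx w + b w * fy w)"
  using i1 i2 i3 i4 1 2 by simp
 also have "\<dots> = Kop \<epsilon> (Xder c fx fy) z"
  unfolding Kop_def by (rule lebesgue_on_cong_int) (simp add: a_def b_def q_def Xder_def algebra_simps)
 finally show ?thesis .
qed

lemma test_fun_support:
 assumes "test_fun U \<phi>"
 obtains C where "compact C" "C \<subseteq> U" "\<And>x. x \<notin> C \<Longrightarrow> \<phi> x = 0"
proof -
 have "\<phi> x = 0" if "x \<notin> closure {x. \<phi> x \<noteq> 0}" for x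
  using closure_subset[of "{x. \<phi> x \<noteq> 0}"] that by auto
 then show ?thesis using assms that unfolding test_fun_def by metis
qed

lemma partial_zero_outside:
 assumes "closed C" "\<And>x. x \<notin> C \<Longrightarrow> \<phi> x = 0" "x \<notin> C"
 shows "partial b \<phi> x = 0"
 by (rule partial_eq_0_open[of "- C"]) (use assms in auto)

lemma wp_const: "wp (\<lambda>_. c) (\<lambda>_. 0) (\<lambda>_. 0)"
proof -
 have l: "l1loc disc (\<lambda>_. d)" for d
  unfolding l1loc_def by (auto simp: finite_measure.integrable_const finite_measure_lebesgue_on lmeasurable_compact)
 have "(LINT z|lD. partial b \<phi> z * c) = 0" if t: "test_fun disc \<phi>" and b: "b \<in> Basis" for \<phi> b
 proof -
  have s: "smooth_on UNIV \<phi>" using t by (simp add: test_fun_def)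
  obtain C where C: "compact C" "C \<subseteq> disc" and z0: "\<And>x. x \<notin> C \<Longrightarrow> \<phi> x = 0"
   using test_fun_support[OF t] by blast
  have p0: "partial b \<phi> x = 0" if "x \<notin> C" for x
   by (rule partial_zero_outside[OF compact_imp_closed[OF C(1)] z0 that])
  have "(LINT z|lebesgue_on UNIV. partial b \<phi> z) = (LINT z|lD. partial b \<phi> z)"
   by (rule restrict_zero_outside(2)) (use p0 C in auto)
  then show ?thesis using integral_partial_eq_0[OF smooth_on_imp_Ck[OF s] C(1) z0 b] by (simp add: lebesgue_on_UNIV_eq)
 qed
 then show ?thesis unfolding wp_def using l by (auto simp: Basis_complex_def)
qed

text \<open>Cramer's rule. The fields for c = 1 and c = \<i> have determinant 1 - |z|^4, which is
  positive in the disc.\<close>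

lemma killing_solve:
 fixes px py :: real
 assumes "z \<in> disc" "Re (xi 1 z) * px + Im (xi 1 z) * py = A" "Re (xi \<i> z) * px + Im (xi \<i> z) * py = B"
 shows "px = (Im (xi \<i> z) * A - Im (xi 1 z) * B) / (1 - (cmod z)^4)"
  and "py = (Re (xi 1 z) * B - Re (xi \<i> z) * A) / (1 - (cmod z)^4)"
proof -
 have det: "Re (xi 1 z) * Im (xi \<i> z) - Im (xi 1 z) * Re (xi \<i> z) = 1 - (cmod z)^4"
 proof -
  have "(cmod z)^4 = ((cmod z)^2)^2" by simp
  then show ?thesis unfolding cmod_power2 by (simp add: xi_def power2_eq_square algebra_simps)
 qed
 have "(cmod z)^4 < 1" using assms(1) by (simp add: disc_def power_less_one_iff)
 then have nz: "1 - (cmod z)^4 \<noteq> 0" by simp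
 have "px * (1 - (cmod z)^4) = Im (xi \<i> z) * A - Im (xi 1 z) * B"
  unfolding det[symmetric] assms(2,3)[symmetric] by (simp add: algebra_simps)
 then show "px = (Im (xi \<i> z) * A - Im (xi 1 z) * B) / (1 - (cmod z)^4)" using nz by (simp add: eq_divide_eq)
 have "py * (1 - (cmod z)^4) = Re (xi 1 z) * B - Re (xi \<i> z) * A"
  unfolding det[symmetric] assms(2,3)[symmetric] by (simp add: algebra_simps)
 then show "py = (Re (xi 1 z) * B - Re (xi \<i> z) * A) / (1 - (cmod z)^4)" using nz by (simp add: eq_divide_eq)
qed

text \<open>A constant has zero weak gradient, so its average has zero derivative along all the
  fields. These span the plane at each point, and the disc is connected.\<close>

lemma Kop_one_const:
 assumes "\<epsilon> > 0" "z \<in> disc"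
 shows "Kop \<epsilon> (\<lambda>_. 1) z = Kop \<epsilon> (\<lambda>_. 1) 0"
proof -
 let ?k = "Kop \<epsilon> (\<lambda>_. 1)"
 have w: "wp (\<lambda>_. 1) (\<lambda>_. 0) (\<lambda>_. 0)" by (rule wp_const)
 have K0: "Kop \<epsilon> (Xder c (\<lambda>_. 0) (\<lambda>_. 0)) z = 0" for c z by (simp add: Kop_def Xder_def)
 have "(?k has_derivative (\<lambda>h. 0)) (at z within disc)" if z: "z \<in> disc" for z
 proof -
  have "partial 1 ?k z = 0" "partial \<i> ?k z = 0"
   using killing_solve[OF z Kop_killing[OF assms(1) w z, of 1] Kop_killing[OF assms(1) w z, of \<i>]] K0 by auto
  moreover obtain D where D: "(?k has_derivative D) (at z)"
   using smooth_on_differentiable[OF Kop_smooth z] assms(1) w unfolding differentiable_def wp_def by blast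
  ultimately have "D = (\<lambda>h. 0)" using has_derivative_partial_complex[OF D] by auto
  then show ?thesis using D has_derivative_at_withinI by blast
 qed
 from has_derivative_zero_constant[OF _ this] obtain c where "\<And>x. x \<in> disc \<Longrightarrow> ?k x = c"
  by (auto simp: disc_def)
 then show ?thesis using assms(2) by (simp add: disc_def)
qed

section \<open>Square integrable functions\<close>

text \<open>\<open>L2\<close> for real or complex scalars on any Euclidean space. It serves for the
  components of complex functions, and for time intervals as well.\<close>

definition sqi :: "'a::euclidean_space set \<Rightarrow> ('a \<Rightarrow> 'b::{real_normed_field, banach, second_countable_topology}) \<Rightarrow> bool" where
 "sqi S f \<longleftrightarrow> f \<in> borel_measurable (lebesgue_on S) \<and> integrable (lebesgue_on S) (\<lambda>x. (norm (f x))^2)"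

definition nrm :: "'a::euclidean_space set \<Rightarrow> ('a \<Rightarrow> 'b::{real_normed_field, banach, second_countable_topology}) \<Rightarrow> real" where
 "nrm S f = sqrt (LINT x|lebesgue_on S. (norm (f x))^2)"

lemma nrm_nonneg: "nrm S f \<ge> 0" by (simp add: nrm_def)

lemma nrm_sq: "(nrm S f)^2 = (LINT x|lebesgue_on S. (norm (f x))^2)"
 by (simp add: nrm_def)

lemma sqiD: "sqi S f \<Longrightarrow> f \<in> borel_measurable (lebesgue_on S)" "sqi S f \<Longrightarrow> integrable (lebesgue_on S) (\<lambda>x. (norm (f x))^2)"
 by (auto simp: sqi_def)

lemma borel_measurable_norm_sq:
 "f \<in> borel_measurable M \<Longrightarrow> (\<lambda>x. (norm (f x))^2) \<in> borel_measurable M"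
 by (rule borel_measurable_power[OF measurable_compose[OF _ borel_measurable_norm]])

lemma sqi_mult_integrable:
 assumes f: "sqi S f" and g: "sqi S g"
 shows "integrable (lebesgue_on S) (\<lambda>x. f x * g x)" "integrable (lebesgue_on S) (\<lambda>x. norm (f x) * norm (g x))"
proof -
 have i: "integrable (lebesgue_on S) (\<lambda>x. (norm (f x))^2 + (norm (g x))^2)"
  using sqiD(2)[OF f] sqiD(2)[OF g] by (rule Bochner_Integration.integrable_add)
 have b: "norm (f x) * norm (g x) \<le> (norm (f x))^2 + (norm (g x))^2" for x
 proof -
  have "2 * (norm (f x) * norm (g x)) \<le> (norm (f x))^2 + (norm (g x))^2"
   using sum_squares_bound[of "norm (f x)" "norm (g x)"] by (simp add: mult.assoc)
  moreover have "0 \<le> norm (f x) * norm (g x)" by simp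
  ultimately show ?thesis by linarith
 qed
 have m: "(\<lambda>x. f x * g x) \<in> borel_measurable (lebesgue_on S)"
  by (rule borel_measurable_times[OF sqiD(1)[OF f] sqiD(1)[OF g]])
 show 1: "integrable (lebesgue_on S) (\<lambda>x. f x * g x)"
  by (rule Bochner_Integration.integrable_bound[OF i m]) (use b in \<open>auto simp: norm_mult intro!: AE_I2\<close>)
 show "integrable (lebesgue_on S) (\<lambda>x. norm (f x) * norm (g x))"
  using integrable_norm[OF 1] by (simp add: norm_mult)
qed

lemma quadratic_nonneg_discriminant:
 fixes A I B :: real
 assumes "\<And>t. t^2 * A + 2 * t * I + B \<ge> 0" "A \<ge> 0"
 shows "I^2 \<le> A * B"
proof (cases "A = 0")
 case True
 have "I = 0"
 proof (rule ccontr)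
  assume "I \<noteq> 0"
  \<comment> \<open>With A = 0 the expression is affine in t, and at this t it equals -1.\<close>
  then show False using assms(1)[of "- (B + 1) / (2 * I)"] True by (simp add: field_simps)
 qed
 then show ?thesis using True by simp
next
 case False
 have "0 \<le> A * ((- I / A)^2 * A + 2 * (- I / A) * I + B)"
  by (rule mult_nonneg_nonneg[OF assms(2) assms(1)])
 also have "\<dots> = A * B - I\<^sup>2" using False by (simp add: field_simps power2_eq_square)
 finally show ?thesis by simp
qed

lemma Cauchy_Schwarz_nrm:
 fixes f g :: "'a::euclidean_space \<Rightarrow> 'b::{real_normed_field, banach, second_countable_topology}"
 assumes f: "sqi S f" and g: "sqi S g"
 shows "(LINT x|lebesgue_on S. norm (f x) * norm (g x)) \<le> nrm S f * nrm S g"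
proof -
 let ?I = "LINT x|lebesgue_on S. norm (f x) * norm (g x)"
 have "t^2 * (nrm S f)^2 + 2 * t * ?I + (nrm S g)^2 \<ge> 0" for t
 proof -
  have "0 \<le> (LINT x|lebesgue_on S. (t * norm (f x) + norm (g x))^2)" by (rule Bochner_Integration.integral_nonneg) simp
  also have "\<dots> = (LINT x|lebesgue_on S. t^2 * (norm (f x))^2 + 2 * t * (norm (f x) * norm (g x)) + (norm (g x))^2)"
   by (rule Bochner_Integration.integral_cong) (auto simp: power2_eq_square algebra_simps)
  also have "\<dots> = t^2 * (nrm S f)^2 + 2 * t * ?I + (nrm S g)^2"
   unfolding nrm_sq using sqiD(2)[OF f] sqiD(2)[OF g] sqi_mult_integrable(2)[OF f g] by simp
  finally show ?thesis .
 qed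
 then have "?I^2 \<le> (nrm S f)^2 * (nrm S g)^2" by (rule quadratic_nonneg_discriminant) simp
 then have "?I^2 \<le> (nrm S f * nrm S g)^2" by (simp add: power_mult_distrib)
 then show ?thesis by (rule power2_le_imp_le) (simp add: nrm_nonneg)
qed

lemma Cauchy_Schwarz_integral:
 assumes f: "sqi S f" and g: "sqi S g"
 shows "norm (LINT x|lebesgue_on S. f x * g x) \<le> nrm S f * nrm S g"
proof -
 have "norm (LINT x|lebesgue_on S. f x * g x) \<le> (LINT x|lebesgue_on S. norm (f x * g x))" by (rule integral_norm_bound)
 then show ?thesis using Cauchy_Schwarz_nrm[OF f g] by (simp add: norm_mult)
qed

lemma sqi_add: assumes f: "sqi S f" and g: "sqi S g" shows "sqi S (\<lambda>x. f x + g x)"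
 unfolding sqi_def
proof
 show m: "(\<lambda>x. f x + g x) \<in> borel_measurable (lebesgue_on S)"
  by (rule borel_measurable_add[OF sqiD(1)[OF f] sqiD(1)[OF g]])
 have i: "integrable (lebesgue_on S) (\<lambda>x. (norm (f x))^2 + 2 * (norm (f x) * norm (g x)) + (norm (g x))^2)"
  using sqiD(2)[OF f] sqiD(2)[OF g] sqi_mult_integrable(2)[OF f g] by simp
 have b: "(norm (f x + g x))^2 \<le> (norm (f x))^2 + 2 * (norm (f x) * norm (g x)) + (norm (g x))^2" for x
 proof -
  have "(norm (f x + g x))^2 \<le> (norm (f x) + norm (g x))^2" by (intro power_mono norm_triangle_ineq) simp
  then show ?thesis by (simp add: power2_eq_square algebra_simps)
 qed
 show "integrable (lebesgue_on S) (\<lambda>x. (norm (f x + g x))^2)"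
  by (rule Bochner_Integration.integrable_bound[OF i borel_measurable_norm_sq[OF m]])
    (use b in \<open>auto intro!: AE_I2 order_trans[OF _ abs_ge_self]\<close>)
qed

lemma sqi_bounded_mult:
 assumes f: "sqi S f" and g: "g \<in> borel_measurable (lebesgue_on S)" and B: "AE x in lebesgue_on S. norm (g x) \<le> B"
 shows "sqi S (\<lambda>x. g x * f x)"
 unfolding sqi_def
proof
 show m: "(\<lambda>x. g x * f x) \<in> borel_measurable (lebesgue_on S)"
  by (rule borel_measurable_times[OF g sqiD(1)[OF f]])
 have i: "integrable (lebesgue_on S) (\<lambda>x. B^2 * (norm (f x))^2)" using sqiD(2)[OF f] by simp
 show "integrable (lebesgue_on S) (\<lambda>x. (norm (g x * f x))^2)"
 proof (rule Bochner_Integration.integrable_bound[OF i borel_measurable_norm_sq[OF m]])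
  show "AE x in lebesgue_on S. norm ((norm (g x * f x))^2) \<le> norm (B^2 * (norm (f x))^2)"
   using B
  proof eventually_elim
   case (elim x)
   have "(norm (g x * f x))^2 = (norm (g x))^2 * (norm (f x))^2" by (simp add: norm_mult power_mult_distrib)
   also have "\<dots> \<le> B^2 * (norm (f x))^2" using elim by (intro mult_right_mono power_mono) auto
   finally show ?case by simp
  qed
 qed
qed

lemma nrm_bounded_mult:
 assumes f: "sqi S f" and g: "g \<in> borel_measurable (lebesgue_on S)" and B: "AE x in lebesgue_on S. norm (g x) \<le> B" "B \<ge> 0"
 shows "nrm S (\<lambda>x. g x * f x) \<le> B * nrm S f"
proof -
 have "(nrm S (\<lambda>x. g x * f x))^2 \<le> (LINT x|lebesgue_on S. B^2 * (norm (f x))^2)"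
  unfolding nrm_sq
 proof (rule integral_mono_AE)
  show "integrable (lebesgue_on S) (\<lambda>x. (norm (g x * f x))^2)" using sqi_bounded_mult[OF f g B(1)] by (rule sqiD)
  show "integrable (lebesgue_on S) (\<lambda>x. B^2 * (norm (f x))^2)" using sqiD(2)[OF f] by simp
  show "AE x in lebesgue_on S. (norm (g x * f x))^2 \<le> B^2 * (norm (f x))^2"
   using B(1)
  proof eventually_elim
   case (elim x)
   have "(norm (g x * f x))^2 = (norm (g x))^2 * (norm (f x))^2" by (simp add: norm_mult power_mult_distrib)
   also have "\<dots> \<le> B^2 * (norm (f x))^2" using elim by (intro mult_right_mono power_mono) auto
   finally show ?case .
  qed
 qed
 also have "\<dots> = (B * nrm S f)^2" by (simp add: nrm_sq power_mult_distrib)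
 finally show ?thesis by (rule power2_le_imp_le) (simp add: B(2) nrm_nonneg)
qed

lemma sqi_cmult: "sqi S f \<Longrightarrow> sqi S (\<lambda>x. c * f x)"
 by (rule sqi_bounded_mult[where B="norm c"]) auto

lemma sqi_diff: assumes "sqi S f" "sqi S g" shows "sqi S (\<lambda>x. f x - g x)"
 using sqi_add[OF assms(1) sqi_cmult[OF assms(2), of "-1"]] by simp

lemma sqi_cong_AE:
 assumes "sqi S f" "AE x in lebesgue_on S. f x = g x" "g \<in> borel_measurable (lebesgue_on S)"
 shows "sqi S g"
 unfolding sqi_def
proof
 have "integrable (lebesgue_on S) (\<lambda>x. (norm (f x))^2) \<longleftrightarrow> integrable (lebesgue_on S) (\<lambda>x. (norm (g x))^2)"
  by (rule integrable_cong_AE[OF borel_measurable_norm_sq[OF sqiD(1)[OF assms(1)]] borel_measurable_norm_sq[OF assms(3)]])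
    (use assms(2) in \<open>auto elim!: eventually_mono\<close>)
 then show "integrable (lebesgue_on S) (\<lambda>x. (norm (g x))^2)" using assms(1) by (simp add: sqi_def)
qed (rule assms)

lemma nrm_cong_AE:
 assumes "AE x in lebesgue_on S. norm (f x) = norm (g x)" "f \<in> borel_measurable (lebesgue_on S)" "g \<in> borel_measurable (lebesgue_on S)"
 shows "nrm S f = nrm S g"
proof -
 have "(LINT x|lebesgue_on S. (norm (f x))^2) = (LINT x|lebesgue_on S. (norm (g x))^2)"
  by (rule integral_cong_AE[OF borel_measurable_norm_sq[OF assms(2)] borel_measurable_norm_sq[OF assms(3)]])
    (use assms(1) in \<open>auto elim!: eventually_mono\<close>)
 then show ?thesis by (simp add: nrm_def)
qed

lemma nrm_triangle:
 assumes f: "sqi S f" and g: "sqi S g" shows "nrm S (\<lambda>x. f x + g x) \<le> nrm S f + nrm S g"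
proof -
 have "(nrm S (\<lambda>x. f x + g x))^2 \<le> (LINT x|lebesgue_on S. (norm (f x))^2 + 2 * (norm (f x) * norm (g x)) + (norm (g x))^2)"
  unfolding nrm_sq
 proof (rule integral_mono)
  show "integrable (lebesgue_on S) (\<lambda>x. (norm (f x + g x))^2)" using sqi_add[OF f g] by (rule sqiD)
  show "integrable (lebesgue_on S) (\<lambda>x. (norm (f x))^2 + 2 * (norm (f x) * norm (g x)) + (norm (g x))^2)"
   using sqiD(2)[OF f] sqiD(2)[OF g] sqi_mult_integrable(2)[OF f g] by simp
  show "(norm (f x + g x))^2 \<le> (norm (f x))^2 + 2 * (norm (f x) * norm (g x)) + (norm (g x))^2" for x
  proof -
   have "(norm (f x + g x))^2 \<le> (norm (f x) + norm (g x))^2" by (intro power_mono norm_triangle_ineq) simp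
   then show ?thesis by (simp add: power2_eq_square algebra_simps)
  qed
 qed
 also have "\<dots> = (nrm S f)^2 + 2 * (LINT x|lebesgue_on S. norm (f x) * norm (g x)) + (nrm S g)^2"
  unfolding nrm_sq using sqiD(2)[OF f] sqiD(2)[OF g] sqi_mult_integrable(2)[OF f g] by simp
 also have "\<dots> \<le> (nrm S f + nrm S g)^2"
  using Cauchy_Schwarz_nrm[OF f g] by (simp add: power2_eq_square algebra_simps)
 finally show ?thesis by (rule power2_le_imp_le) (simp add: nrm_nonneg)
qed

lemma nrm_cmult: "nrm S (\<lambda>x. c * f x) = norm c * nrm S f"
 by (simp add: nrm_def norm_mult power_mult_distrib real_sqrt_mult)

lemma nrm_minus_commute: "nrm S (\<lambda>x. f x - g x) = nrm S (\<lambda>x. g x - f x)"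
 by (simp add: nrm_def norm_minus_commute)

lemma nrm_diff_triangle:
 assumes "sqi S f" "sqi S g" "sqi S h"
 shows "nrm S (\<lambda>x. f x - h x) \<le> nrm S (\<lambda>x. f x - g x) + nrm S (\<lambda>x. g x - h x)"
 using nrm_triangle[OF sqi_diff[OF assms(1,2)] sqi_diff[OF assms(2,3)]] by simp

lemma sqi_subset:
 assumes "sqi T f" "S \<subseteq> T" "S \<in> sets lebesgue" "T \<in> sets lebesgue"
 shows "sqi S f" "nrm S f \<le> nrm T f"
proof -
 have m: "f \<in> borel_measurable (lebesgue_on S)"
  using assms sqiD(1) measurable_restrict_mono by blast
 let ?A = "(\<lambda>x. (norm (f x))^2)"
 have "integrable (lebesgue_on S) ?A"
 proof -
  have "set_integrable lebesgue T ?A"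
   using sqiD(2)[OF assms(1)] assms(4) by (simp add: set_integrable_def integrable_restrict_space)
  then have "set_integrable lebesgue S ?A"
   by (rule set_integrable_subset) (use assms in auto)
  then show ?thesis using assms(3) by (simp add: set_integrable_def integrable_restrict_space)
 qed
 then show "sqi S f" using m by (simp add: sqi_def)
 have "(LINT x|lebesgue_on S. (norm (f x))^2) \<le> (LINT x|lebesgue_on T. (norm (f x))^2)"
  by (rule integral_mono_lebesgue_on_AE) (use sqiD(2)[OF assms(1)] assms in auto)
 then show "nrm S f \<le> nrm T f" by (simp add: nrm_def)
qed

lemma sqi_bounded:
 assumes "S \<in> lmeasurable" "f \<in> borel_measurable (lebesgue_on S)" "AE x in lebesgue_on S. norm (f x) \<le> B"
 shows "sqi S f"
proof -
 have "sqi S (\<lambda>x. 1 :: 'b)"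
  unfolding sqi_def using finite_measure.integrable_const[OF finite_measure_lebesgue_on[OF assms(1)]] by auto
 from sqi_bounded_mult[OF this assms(2,3)] show ?thesis by simp
qed

lemma sqi_integrable:
 fixes f :: "'a::euclidean_space \<Rightarrow> 'b::{real_normed_field, banach, second_countable_topology}"
 assumes "S \<in> lmeasurable" "sqi S f" shows "integrable (lebesgue_on S) f"
proof -
 have "sqi S (\<lambda>x. 1 :: 'b)" by (rule sqi_bounded[OF assms(1), of _ 1]) auto
 from sqi_mult_integrable(1)[OF this assms(2)] show ?thesis by simp
qed

lemma nrm_eq_0_AE: assumes "sqi S f" "nrm S f = 0" shows "AE x in lebesgue_on S. f x = 0"
proof -
 have "(LINT x|lebesgue_on S. (norm (f x))^2) = 0" using assms(2) nrm_sq[of S f] by simp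
 then have "AE x in lebesgue_on S. (norm (f x))^2 = 0"
  using integral_nonneg_eq_0_iff_AE[OF sqiD(2)[OF assms(1)]] by simp
 then show ?thesis by eventually_elim simp
qed

lemma nrm_bound:
 assumes "S \<in> lmeasurable" "f \<in> borel_measurable (lebesgue_on S)" "\<And>x. x \<in> S \<Longrightarrow> norm (f x) \<le> B" "B \<ge> 0"
 shows "nrm S f \<le> B * sqrt (measure lebesgue S)"
proof -
 have S: "S \<in> sets lebesgue" using assms(1) by auto
 have "(LINT x|lebesgue_on S. (norm (f x))^2) \<le> (LINT x|lebesgue_on S. B^2)"
 proof (rule integral_mono)
  show "integrable (lebesgue_on S) (\<lambda>x. (norm (f x))^2)"
   by (rule sqiD(2)[OF sqi_bounded[OF assms(1,2)]]) (use assms(3) in \<open>auto intro!: AE_I2\<close>)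
  show "integrable (lebesgue_on S) (\<lambda>x. B^2)"
   using finite_measure.integrable_const[OF finite_measure_lebesgue_on[OF assms(1)]] .
  show "(norm (f x))^2 \<le> B^2" if "x \<in> space (lebesgue_on S)" for x
   using assms(3)[of x] that by (intro power_mono) auto
 qed
 also have "\<dots> = B^2 * measure lebesgue S" using S by (simp add: measure_restrict_space)
 finally have "nrm S f \<le> sqrt (B^2 * measure lebesgue S)" by (simp add: nrm_def)
 then show ?thesis using assms(4) by (simp add: real_sqrt_mult)
qed

lemma sqi_dominated_tendsto_0:
 fixes s :: "nat \<Rightarrow> 'a::euclidean_space \<Rightarrow> real"
 assumes "\<And>n. s n \<in> borel_measurable (lebesgue_on S)" "integrable (lebesgue_on S) w"
  "AE x in lebesgue_on S. (\<lambda>n. s n x) \<longlonglongrightarrow> 0" "\<And>n. AE x in lebesgue_on S. (s n x)^2 \<le> w x"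
 shows "(\<lambda>n. nrm S (s n)) \<longlonglongrightarrow> 0"
proof -
 have "(\<lambda>n. LINT x|lebesgue_on S. (s n x)^2) \<longlonglongrightarrow> (LINT x|lebesgue_on S. 0)"
 proof (rule integral_dominated_convergence[where w=w])
  show "AE x in lebesgue_on S. (\<lambda>n. (s n x)^2) \<longlonglongrightarrow> 0"
   using assms(3) by eventually_elim (auto intro!: tendsto_eq_intros)
  show "(\<lambda>x. (s n x)^2) \<in> borel_measurable (lebesgue_on S)" for n
   by (rule borel_measurable_power[OF assms(1)])
  show "AE x in lebesgue_on S. norm ((s n x)^2) \<le> w x" for n using assms(4)[of n] by simp
 qed (use assms in auto)
 then have "(\<lambda>n. sqrt (LINT x|lebesgue_on S. (s n x)^2)) \<longlonglongrightarrow> sqrt 0"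
  by (intro tendsto_real_sqrt) simp
 then show ?thesis by (simp add: nrm_def)
qed

section \<open>Approximation by continuous functions\<close>

definition clamp1 :: "real \<Rightarrow> real \<Rightarrow> real" where "clamp1 M x = max (- M) (min M x)"

lemma clamp1_bounds: "M \<ge> 0 \<Longrightarrow> \<bar>clamp1 M x\<bar> \<le> M" by (auto simp: clamp1_def)
lemma clamp1_diff: "M \<ge> 0 \<Longrightarrow> \<bar>x - clamp1 M x\<bar> \<le> \<bar>x\<bar>" by (auto simp: clamp1_def)
lemma clamp1_id: "\<bar>x\<bar> \<le> M \<Longrightarrow> clamp1 M x = x" by (auto simp: clamp1_def)
lemma clamp1_continuous: "continuous_on S g \<Longrightarrow> continuous_on S (\<lambda>x. clamp1 M (g x))"
 unfolding clamp1_def by (intro continuous_intros)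

text \<open>Truncate, then use the pointwise almost everywhere approximation by continuous functions and
 dominated convergence.\<close>

lemma continuous_dense_L2:
 fixes f :: "'a::euclidean_space \<Rightarrow> real"
 assumes C: "compact C" and f: "sqi C f" and e: "e > 0"
 shows "\<exists>g. continuous_on UNIV g \<and> sqi C g \<and> nrm C (\<lambda>x. f x - g x) < e"
proof -
 have Cm: "C \<in> lmeasurable" using C by (rule lmeasurable_compact)
 have Cs: "C \<in> sets lebesgue" using Cm by auto
 let ?A = "(lebesgue_on C)"
 have fm: "f \<in> borel_measurable ?A" using f by (rule sqiD)
 have clm: "(\<lambda>x. clamp1 M (g x)) \<in> borel_measurable ?A" if "g \<in> borel_measurable ?A" for g M
  unfolding clamp1_def using that by (intro borel_measurable_max borel_measurable_min borel_measurable_const)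
 have "(\<lambda>n. nrm C (\<lambda>x. f x - clamp1 (real n) (f x))) \<longlonglongrightarrow> 0"
 proof (rule sqi_dominated_tendsto_0[where w="\<lambda>x. (norm (f x))^2"])
  show "(\<lambda>x. f x - clamp1 (real n) (f x)) \<in> borel_measurable ?A" for n
   by (rule borel_measurable_diff[OF fm clm[OF fm]])
  show "integrable ?A (\<lambda>x. (norm (f x))^2)" using f by (rule sqiD)
  have "(\<lambda>n. f x - clamp1 (real n) (f x)) \<longlonglongrightarrow> 0" for x
  proof (rule tendsto_eventually)
   obtain N :: nat where "\<bar>f x\<bar> \<le> real N" using real_arch_simple by blast
   then show "\<forall>\<^sub>F n in sequentially. f x - clamp1 (real n) (f x) = 0"
    by (intro eventually_sequentiallyI[of N]) (simp add: clamp1_id)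
  qed
  then show "AE x in lebesgue_on C. (\<lambda>n. f x - clamp1 (real n) (f x)) \<longlonglongrightarrow> 0" by simp
  have "(f x - clamp1 (real n) (f x))^2 \<le> (norm (f x))^2" for n x
   using clamp1_diff[of "real n" "f x"] by (simp add: abs_le_square_iff)
  then show "AE x in lebesgue_on C. (f x - clamp1 (real n) (f x))^2 \<le> (norm (f x))^2" for n by simp
 qed
 from order_tendstoD(2)[OF this, of "e / 2"]
 have "\<forall>\<^sub>F n in sequentially. nrm C (\<lambda>x. f x - clamp1 (real n) (f x)) < e / 2" using e by simp
 then obtain n where n: "nrm C (\<lambda>x. f x - clamp1 (real n) (f x)) < e / 2"
  unfolding eventually_sequentially by blast
 define M where "M = real n"
 define F where "F = (\<lambda>x. clamp1 M (f x))"
 have Fm: "F \<in> borel_measurable ?A" unfolding F_def by (rule clm[OF fm])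
 have Fs: "sqi C F" by (rule sqi_bounded[OF Cm Fm, where B=M]) (simp add: F_def M_def clamp1_bounds)
 have "f measurable_on C" using fm measurable_on_iff_borel_measurable[OF Cs, of f] by simp
 then obtain N g where N: "negligible N" and g: "\<And>k. continuous_on UNIV (g k)"
  and lim: "\<And>x. x \<notin> N \<Longrightarrow> (\<lambda>k. g k x) \<longlonglongrightarrow> (if x \<in> C then f x else 0)"
  unfolding measurable_on_def by blast
 define G where "G = (\<lambda>k x. clamp1 M (g k x))"
 have Gc: "continuous_on UNIV (G k)" for k unfolding G_def by (rule clamp1_continuous[OF g])
 have Gm: "G k \<in> borel_measurable ?A" for k
  using Gc by (intro continuous_imp_measurable_on_sets_lebesgue[OF _ Cs]) (auto intro: continuous_on_subset)
 have Gs: "sqi C (G k)" for k by (rule sqi_bounded[OF Cm Gm, where B=M]) (simp add: G_def M_def clamp1_bounds)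
 have "(\<lambda>k. nrm C (\<lambda>x. F x - G k x)) \<longlonglongrightarrow> 0"
 proof (rule sqi_dominated_tendsto_0[where w="\<lambda>x. (2 * M)^2"])
  show "(\<lambda>x. F x - G k x) \<in> borel_measurable ?A" for k
   by (rule borel_measurable_diff[OF Fm Gm])
  show "integrable ?A (\<lambda>x. (2 * M)^2)"
   using finite_measure.integrable_const[OF finite_measure_lebesgue_on[OF Cm]] .
  have "AE x in lebesgue. x \<notin> N" using N by (simp add: AE_not_in negligible_iff_null_sets)
  then have "AE x in lebesgue_on C. x \<notin> N" using Cs by (auto simp: AE_restrict_space_iff elim!: eventually_mono)
  then have "AE x in lebesgue_on C. x \<in> C \<longrightarrow> (\<lambda>k. F x - G k x) \<longlonglongrightarrow> 0"
  proof eventually_elim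
   case (elim x)
   show ?case
   proof
    assume x: "x \<in> C"
    have "(\<lambda>k. clamp1 M (g k x)) \<longlonglongrightarrow> clamp1 M (f x)"
     using lim[OF elim] x unfolding clamp1_def by (intro tendsto_max tendsto_min tendsto_const) simp
    then have "(\<lambda>k. F x - G k x) \<longlonglongrightarrow> F x - F x"
     unfolding F_def G_def by (intro tendsto_diff tendsto_const)
    then show "(\<lambda>k. F x - G k x) \<longlonglongrightarrow> 0" by simp
   qed
  qed
  then show "AE x in lebesgue_on C. (\<lambda>k. F x - G k x) \<longlonglongrightarrow> 0"
   by (rule lebesgue_on_mono) auto
  have "(F x - G k x)^2 \<le> (2 * M)^2" for k x
  proof -
   have "\<bar>F x\<bar> \<le> M" "\<bar>G k x\<bar> \<le> M" by (auto simp: F_def G_def M_def clamp1_bounds)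
   then have "\<bar>F x - G k x\<bar> \<le> \<bar>2 * M\<bar>" by linarith
   then show ?thesis by (simp add: abs_le_square_iff del: abs_mult)
  qed
  then show "AE x in lebesgue_on C. (F x - G k x)^2 \<le> (2 * M)^2" for k by simp
 qed
 from order_tendstoD(2)[OF this, of "e / 2"]
 have "\<forall>\<^sub>F k in sequentially. nrm C (\<lambda>x. F x - G k x) < e / 2" using e by simp
 then obtain k where k: "nrm C (\<lambda>x. F x - G k x) < e / 2"
  unfolding eventually_sequentially by blast
 have "nrm C (\<lambda>x. f x - G k x) \<le> nrm C (\<lambda>x. f x - F x) + nrm C (\<lambda>x. F x - G k x)"
  by (rule nrm_diff_triangle[OF f Fs Gs])
 also have "\<dots> < e" using n k unfolding F_def M_def by simp
 finally show ?thesis using Gc Gs by blast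
qed

section \<open>Invariant smoothing\<close>

lemma gen_diff:
 assumes z: "z \<in> disc" and w: "w \<in> disc"
 shows "gen i z - gen i w = (z - w) / (cden i z * cden i w)"
proof -
 have nz: "cden i z \<noteq> 0" "cden i w \<noteq> 0" using cden_nz z w by auto
 have "(of_real ga * z + of_real gb * dir i) * cden i w - (of_real ga * w + of_real gb * dir i) * cden i z
   = (of_real ga * of_real ga - of_real gb * of_real gb * (cnj (dir i) * dir i)) * (z - w)"
  by (simp add: cden_def algebra_simps)
 also have "\<dots> = z - w" using gab_complex by (simp add: dir_cnj)
 finally show ?thesis unfolding gen_eq using nz by (simp add: diff_frac_eq)
qed

lemma hdist_gen:
 assumes z: "z \<in> disc" and w: "w \<in> disc"
 shows "hdist (gen i z, gen i w) = hdist (z, w)"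
proof -
 have d: "den i z > 0" "den i w > 0" using den_pos z w by auto
 have "(cmod (gen i z - gen i w))^2 = (cmod (z - w))^2 / (den i z * den i w)"
  unfolding gen_diff[OF z w] by (simp add: den_def norm_divide norm_mult power_divide power_mult_distrib)
 then show ?thesis unfolding hdist_def using d
  by (simp add: one_minus_gen[OF z] one_minus_gen[OF w])
qed

lemma weight_gen:
 assumes "w \<in> disc" shows "hyp_weight (gen i w) = hyp_weight w * (den i w)^2"
 unfolding hyp_weight_def one_minus_gen[OF assms] using den_pos[OF assms, of i] by (simp add: power_divide)

text \<open>The Jacobian of \<open>gen i\<close> is absorbed by the transformation rule of the
  weight, and \<open>hdist\<close> does not change.\<close>

lemma qk_gen:
 assumes z: "z \<in> disc" and w: "w \<in> disc"
 shows "qk \<epsilon> (gen i z, gen i w) / (den i w)^2 = qk \<epsilon> (z, w)"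
 using den_pos[OF w, of i] by (simp add: qk_def kern_def hdist_gen[OF z w] weight_gen[OF w])

lemma qk_integrable:
 assumes "\<epsilon> > 0" "l1loc disc f" "z \<in> disc"
 shows "integrable lD (\<lambda>w. qk \<epsilon> (z, w) * f w)"
 by (rule adm_integrable[OF open_disc open_disc adm_qk[OF assms(1)] assms(2,3)])

text \<open>Substituting \<open>gen i w\<close> for w in the integral. The function f is invariant
  only almost everywhere, but its average is invariant at every point, as \<open>Green\<close>
  requires.\<close>

lemma Kop_gen:
 assumes e: "\<epsilon> > 0" and f: "l1loc disc f" and inv: "AE w in lD. f (gen i w) = f w" and z: "z \<in> disc"
 shows "Kop \<epsilon> f (gen i z) = Kop \<epsilon> f z"
proof -
 define F where "F = (\<lambda>w. qk \<epsilon> (gen i z, w) * f w)"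
 have Fi: "integrable lD F"
  unfolding F_def by (rule qk_integrable[OF e f gen_disc[OF z]])
 have "Kop \<epsilon> f (gen i z) = (LINT w|lD. F w)" by (simp add: Kop_def F_def)
 also have "\<dots> = (LINT w|lD. F (gen i w) / (den i w)^2)"
  by (rule gen_change_of_variables(2)[OF Fi, symmetric])
 also have "\<dots> = (LINT w|lD. qk \<epsilon> (z, w) * f w)"
 proof (rule integral_cong_AE)
  show "(\<lambda>w. F (gen i w) / (den i w)^2) \<in> borel_measurable lD"
   using gen_change_of_variables(1)[OF Fi] by (rule borel_measurable_integrable)
  show "(\<lambda>w. qk \<epsilon> (z, w) * f w) \<in> borel_measurable lD"
   using qk_integrable[OF e f z] by (rule borel_measurable_integrable)
  have "AE w in lD. w \<in> disc \<longrightarrow> F (gen i w) / (den i w)^2 = qk \<epsilon> (z, w) * f w"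
   using inv
  proof eventually_elim
   case (elim w)
   show ?case
   proof
    assume w: "w \<in> disc"
    show "F (gen i w) / (den i w)^2 = qk \<epsilon> (z, w) * f w"
     unfolding F_def elim using qk_gen[OF z w, of \<epsilon> i] by (simp flip: times_divide_eq_left)
   qed
  qed
  then show "AE w in lD. F (gen i w) / (den i w)^2 = qk \<epsilon> (z, w) * f w"
   by (rule lebesgue_on_mono) simp
 qed
 finally show ?thesis by (simp add: Kop_def)
qed

section \<open>Mass and support of the kernels\<close>

definition cker :: "real \<Rightarrow> real" where "cker \<epsilon> = Kop \<epsilon> (\<lambda>_. 1) 0"

lemma l1loc_const: "l1loc disc (\<lambda>_. c)"
 using wp_const[of c] by (simp add: wp_def)

lemma zero_disc: "0 \<in> disc" by (simp add: disc_def)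

lemma qk_nonneg: "w \<in> disc \<Longrightarrow> qk \<epsilon> (z, w) \<ge> 0"
 using hyp_weight_pos[of w] by (simp add: qk_def kern_nonneg)

lemma cker_pos: assumes e: "\<epsilon> > 0" shows "cker \<epsilon> > 0"
proof -
 have i: "integrable lD (\<lambda>w. qk \<epsilon> (0, w) * 1)"
  by (rule qk_integrable[OF e l1loc_const zero_disc])
 have n: "AE w in lD. 0 \<le> qk \<epsilon> (0, w) * 1"
  by (rule AE_I2) (simp add: qk_nonneg)
 have "cker \<epsilon> \<ge> 0" unfolding cker_def Kop_def by (rule integral_nonneg_AE[OF n])
 moreover have "cker \<epsilon> \<noteq> 0"
 proof
  assume "cker \<epsilon> = 0"
  then have "AE w in lD. qk \<epsilon> (0, w) * 1 = 0"
   unfolding cker_def Kop_def using integral_nonneg_eq_0_iff_AE[OF i n] by simp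
  then have AE0: "AE w in lebesgue. \<not> (w \<in> disc \<and> qk \<epsilon> (0, w) \<noteq> 0)"
   by (simp add: AE_restrict_space_iff)
  \<comment> \<open>A kernel of mass 0 would vanish almost everywhere. On this ball it does not: for
    R = |w|^2 < 1/4, hdist(0, w) = R / (1 - R) <= 2 R < \<epsilon>.\<close>
  define r where "r = min (1/2) (sqrt (\<epsilon>/2))"
  have r: "r > 0" using e by (simp add: r_def)
  have sub: "w \<in> disc \<and> qk \<epsilon> (0, w) \<noteq> 0" if w: "w \<in> ball 0 r" for w
  proof -
   have wr: "cmod w < 1/2" "cmod w < sqrt (\<epsilon>/2)" using w by (auto simp: r_def)
   have wd: "w \<in> disc" using wr by (simp add: disc_def)
   have w2: "(cmod w)^2 < \<epsilon>/2"
    using power_strict_mono[OF wr(2), of 2] e by simp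
   have w4: "(cmod w)^2 < (1/2)^2" using wr(1) by (intro power_strict_mono) auto
   define R where "R = (cmod w)^2"
   have R: "0 \<le> R" "R < 1/4" using w4 by (auto simp: R_def power2_eq_square)
   then have "0 \<le> R * (1 - 2 * R)" by (intro mult_nonneg_nonneg) auto
   then have "R \<le> 2 * R * (1 - R)" by (simp add: algebra_simps)
   then have "R / (1 - R) \<le> 2 * R" using R by (simp add: divide_le_eq)
   then have "hdist (0, w) \<le> 2 * (cmod w)^2" by (simp add: hdist_def R_def)
   then have "hdist (0, w) / \<epsilon> < 1" using w2 e by (simp add: divide_less_eq)
   then have "kern \<epsilon> (0, w) > 0" unfolding kern_def by (intro bump_pos) simp
   then show ?thesis using wd hyp_weight_pos[OF wd] by (simp add: qk_def)
  qed
  have "AE w in lebesgue. w \<notin> ball (0::complex) r"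
   using AE0
  proof eventually_elim
   case (elim w)
   show ?case using elim sub[of w] by blast
  qed
  then have "ball (0::complex) r \<in> null_sets lebesgue"
   by (simp add: AE_iff_null_sets)
  then have "negligible (ball (0::complex) r)" by (simp add: negligible_iff_null_sets)
  then show False using open_not_negligible[of "ball (0::complex) r"] r by simp
 qed
 ultimately show ?thesis by simp
qed

lemma Kop_one: "\<epsilon> > 0 \<Longrightarrow> z \<in> disc \<Longrightarrow> Kop \<epsilon> (\<lambda>_. 1) z = cker \<epsilon>"
 unfolding cker_def by (rule Kop_one_const)

text \<open>The support of \<open>kern \<epsilon>\<close> shrinks with \<epsilon>, so a radius that
  works for the parameter 1 works for all smaller ones.\<close>

lemma Fund_support:
 "\<exists>\<rho><1. Fund \<subseteq> cball 0 \<rho> \<and> (\<forall>\<epsilon>. 0 < \<epsilon> \<and> \<epsilon> \<le> 1 \<longrightarrow> (\<forall>z\<in>Fund. \<forall>w\<in>disc - cball 0 \<rho>. kern \<epsilon> (z, w) = 0))"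
proof -
 define \<rho>0 where "\<rho>0 = sqrt (sqrt 2 / 2)"
 have r0: "\<rho>0 < 1" unfolding \<rho>0_def using sqrt2_bounds by (simp add: real_sqrt_lt_1_iff)
 have F: "Fund \<subseteq> cball 0 \<rho>0"
 proof
  fix z assume "z \<in> Fund"
  then have "cmod z \<le> \<rho>0" unfolding \<rho>0_def by (intro real_le_rsqrt Fund_norm)
  then show "z \<in> cball 0 \<rho>0" by simp
 qed
 obtain \<rho>1 where \<rho>1: "\<rho>1 < 1" "\<forall>z\<in>cball 0 \<rho>0 \<inter> disc. \<forall>w\<in>disc - cball 0 \<rho>1. kern 1 (z, w) = 0"
  using kern_support[OF zero_less_one r0] by blast
 have "kern \<epsilon> (z, w) = 0" if \<epsilon>: "0 < \<epsilon>" "\<epsilon> \<le> 1" and z: "z \<in> Fund" and w: "w \<in> disc - cball 0 (max \<rho>0 \<rho>1)" for \<epsilon> z w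
 proof (rule ccontr)
  assume n: "kern \<epsilon> (z, w) \<noteq> 0"
  have zd: "z \<in> disc" using z Fund_disc by auto
  have "\<not> (1 - hdist (z, w) / \<epsilon> \<le> 0)" using n bump_eq_0 by (auto simp: kern_def)
  then have "hdist (z, w) < \<epsilon>" using \<epsilon> by (simp add: field_simps)
  then have "kern 1 (z, w) > 0" unfolding kern_def using \<epsilon> by (intro bump_pos) simp
  moreover have "kern 1 (z, w) = 0" using \<rho>1(2) z w zd F by auto
  ultimately show False by simp
 qed
 then show ?thesis using r0 \<rho>1(1) F by (intro exI[of _ "max \<rho>0 \<rho>1"]) force
qed

definition rF :: real where
 "rF = (SOME \<rho>. \<rho> < 1 \<and> Fund \<subseteq> cball 0 \<rho> \<and> (\<forall>\<epsilon>. 0 < \<epsilon> \<and> \<epsilon> \<le> 1 \<longrightarrow> (\<forall>z\<in>Fund. \<forall>w\<in>disc - cball 0 \<rho>. kern \<epsilon> (z, w) = 0)))"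

text \<open>A compact disc that contains the octagon together with all the points that kernels of
  parameter at most 1 reach from it. Averages are estimated on the octagon by norms on
  \<open>CF\<close>, where lifts are square integrable because they are so on compact sets.\<close>

definition CF :: "complex set" where "CF = cball 0 rF"

lemma rF: "rF < 1" "Fund \<subseteq> CF" "0 < \<epsilon> \<Longrightarrow> \<epsilon> \<le> 1 \<Longrightarrow> z \<in> Fund \<Longrightarrow> w \<in> disc - CF \<Longrightarrow> kern \<epsilon> (z, w) = 0"
proof -
 have "rF < 1 \<and> Fund \<subseteq> cball 0 rF \<and> (\<forall>\<epsilon>. 0 < \<epsilon> \<and> \<epsilon> \<le> 1 \<longrightarrow> (\<forall>z\<in>Fund. \<forall>w\<in>disc - cball 0 rF. kern \<epsilon> (z, w) = 0))"
  unfolding rF_def by (rule someI_ex) (use Fund_support in blast)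
 then show "rF < 1" "Fund \<subseteq> CF" "0 < \<epsilon> \<Longrightarrow> \<epsilon> \<le> 1 \<Longrightarrow> z \<in> Fund \<Longrightarrow> w \<in> disc - CF \<Longrightarrow> kern \<epsilon> (z, w) = 0"
  unfolding CF_def by blast+
qed

lemma CF_compact: "compact CF" by (simp add: CF_def)
lemma CF_disc: "CF \<subseteq> disc" unfolding CF_def by (rule cball_disc[OF rF(1)])
lemma CF_lmeasurable: "CF \<in> lmeasurable" using CF_compact by (rule lmeasurable_compact)
lemma CF_sets: "CF \<in> sets lebesgue" using CF_lmeasurable by auto
lemma Fund_lmeasurable: "Fund \<in> lmeasurable" using compact_Fund by (rule lmeasurable_compact)

section \<open>The L2 bound for the averages, by a Schur test\<close>

lemma Kop_CF:
 assumes "0 < \<epsilon>" "\<epsilon> \<le> 1" "z \<in> Fund"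
 shows "Kop \<epsilon> f z = (LINT w|lebesgue_on CF. qk \<epsilon> (z, w) * f w)"
 unfolding Kop_def
 by (rule restrict_zero_outside(2)[OF CF_sets disc_lebesgue CF_disc]) (simp add: qk_def rF(3)[OF assms])

lemma qk_continuous: "continuous_on (disc \<times> disc) (qk \<epsilon>)"
 by (rule smooth_on_continuous[OF smooth_qk])

lemma qk_continuous_snd: "z \<in> disc \<Longrightarrow> continuous_on disc (\<lambda>w. qk \<epsilon> (z, w))"
 by (rule continuous_on_compose2[OF qk_continuous]) (auto intro!: continuous_intros)

lemma continuous_measurable_on: "continuous_on T f \<Longrightarrow> S \<subseteq> T \<Longrightarrow> S \<in> sets lebesgue \<Longrightarrow> f \<in> borel_measurable (lebesgue_on S)"
 by (rule continuous_imp_measurable_on_sets_lebesgue) (auto intro: continuous_on_subset)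

lemma continuous_sqi:
 fixes f :: "'a::euclidean_space \<Rightarrow> 'b::{real_normed_field, banach, second_countable_topology}"
 assumes "compact C" "continuous_on C f"
 shows "sqi C f"
proof -
 have "bounded (f ` C)" using assms by (intro compact_imp_bounded compact_continuous_image)
 then obtain B where B: "\<And>x. x \<in> C \<Longrightarrow> norm (f x) \<le> B" by (auto simp: bounded_iff)
 have Cm: "C \<in> lmeasurable" using assms(1) by (rule lmeasurable_compact)
 show ?thesis
  by (rule sqi_bounded[OF Cm, of _ B]) (use assms(2) Cm B in \<open>auto intro!: continuous_imp_measurable_on_sets_lebesgue AE_I2\<close>)
qed

text \<open>One half of the Schur test: Cauchy-Schwarz with the kernel split into two square roots.
  The first factor contributes the mass of the kernel, which is \<open>cker \<epsilon>\<close> at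
  every z.\<close>

lemma Kop_sq_le:
 assumes e: "0 < \<epsilon>" "\<epsilon> \<le> 1" and f: "sqi CF f" and z: "z \<in> Fund"
 shows "(Kop \<epsilon> f z)^2 \<le> cker \<epsilon> * (LINT w|lebesgue_on CF. qk \<epsilon> (z, w) * (f w)^2)"
  and "integrable (lebesgue_on CF) (\<lambda>w. qk \<epsilon> (z, w) * (f w)^2)"
proof -
 have zd: "z \<in> disc" using z Fund_disc by auto
 define s where "s = (\<lambda>w. sqrt (qk \<epsilon> (z, w)))"
 have sc: "continuous_on CF s"
  unfolding s_def using qk_continuous_snd[OF zd] CF_disc by (intro continuous_intros) (rule continuous_on_subset)
 have ss: "sqi CF s" by (rule continuous_sqi[OF CF_compact sc])
 have q0: "qk \<epsilon> (z, w) \<ge> 0" if "w \<in> CF" for w using that CF_disc qk_nonneg by auto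
 have s2: "(s w)^2 = qk \<epsilon> (z, w)" if "w \<in> CF" for w using q0[OF that] by (simp add: s_def)
 have "bounded (s ` CF)" using CF_compact sc by (intro compact_imp_bounded compact_continuous_image)
 then obtain B where B: "\<And>x. x \<in> CF \<Longrightarrow> \<bar>s x\<bar> \<le> B" by (auto simp: bounded_iff)
 let ?A = "(\<lambda>w. s w * f w)"
 have sf: "sqi CF ?A"
  by (rule sqi_bounded_mult[OF f sqiD(1)[OF ss], of B]) (use B in \<open>auto intro!: AE_I2\<close>)
 have 1: "(LINT w|lebesgue_on CF. s w * (s w * f w)) = Kop \<epsilon> f z"
  unfolding Kop_CF[OF e z] by (rule lebesgue_on_cong_int) (simp add: mult.assoc[symmetric] s2[unfolded power2_eq_square])
 let ?B = "(LINT w|lebesgue_on CF. qk \<epsilon> (z, w) * (f w)^2)"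
 have "(Kop \<epsilon> f z)^2 \<le> (nrm CF s * nrm CF ?A)^2"
  using power_mono[OF Cauchy_Schwarz_integral[OF ss sf], of 2] unfolding 1 by simp
 also have "\<dots> = (nrm CF s)^2 * (nrm CF ?A)^2" by (rule power_mult_distrib)
 also have "(nrm CF s)^2 = cker \<epsilon>"
 proof -
  have "(nrm CF s)^2 = (LINT w|lebesgue_on CF. qk \<epsilon> (z, w) * 1)"
   unfolding nrm_sq by (rule lebesgue_on_cong_int) (simp add: s2)
  also have "\<dots> = cker \<epsilon>" using Kop_CF[OF e z, of "\<lambda>_. 1"] Kop_one[OF e(1) zd] by simp
  finally show ?thesis .
 qed
 also have eq: "(nrm CF ?A)^2 = ?B"
  unfolding nrm_sq by (rule lebesgue_on_cong_int) (simp add: s2[symmetric] power_mult_distrib)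
 finally show "(Kop \<epsilon> f z)^2 \<le> cker \<epsilon> * ?B" .
 have "integrable (lebesgue_on CF) (\<lambda>w. (norm (s w * f w))^2)" using sf by (rule sqiD)
 then show "integrable (lebesgue_on CF) (\<lambda>w. qk \<epsilon> (z, w) * (f w)^2)"
  by (rule Bochner_Integration.integrable_cong[THEN iffD1, rotated 2]) (auto simp: s2[symmetric] power_mult_distrib)
qed

lemma weight_ge_4: "w \<in> disc \<Longrightarrow> hyp_weight w \<ge> 4"
proof -
 assume "w \<in> disc"
 then have "0 < 1 - (cmod w)\<^sup>2" "1 - (cmod w)\<^sup>2 \<le> 1" by (auto simp: disc_iff)
 then have "0 < (1 - (cmod w)\<^sup>2)^2" "(1 - (cmod w)\<^sup>2)^2 \<le> 1" by (auto simp: power_le_one)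
 then show ?thesis by (simp add: hyp_weight_def le_divide_eq)
qed

lemma weight_continuous: "continuous_on disc hyp_weight"
 by (rule smooth_on_continuous[OF smooth_weight])

definition wB :: real where "wB = 4 / (1 - rF\<^sup>2)^2"

lemma weight_le: assumes "w \<in> CF" shows "hyp_weight w \<le> wB"
proof -
 have "0 \<le> rF" using assms order_trans[OF norm_ge_zero, of w rF] by (simp add: CF_def)
 then have "rF^2 < 1" using rF(1) by (simp add: power_less_one_iff)
 moreover have "(cmod w)^2 \<le> rF^2" using assms by (intro power_mono) (auto simp: CF_def)
 ultimately have "0 < 1 - rF\<^sup>2" "1 - rF\<^sup>2 \<le> 1 - (cmod w)\<^sup>2" by auto
 then have "0 < (1 - rF\<^sup>2)^2" "(1 - rF\<^sup>2)^2 \<le> (1 - (cmod w)\<^sup>2)^2" by (auto intro: power_mono)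
 moreover from this have "0 < (1 - (cmod w)\<^sup>2)^2" by linarith
 ultimately show ?thesis unfolding hyp_weight_def wB_def by (intro divide_left_mono mult_pos_pos) auto
qed

lemma wB_pos: "wB > 0"
proof -
 have "0 \<in> Fund" using gb_pos by (auto simp: Fund_eq zero_disc den_ge_1_iff)
 then have "0 \<in> CF" using rF(2) by auto
 then show ?thesis using weight_le[of 0] weight_ge_4[OF zero_disc] by simp
qed

text \<open>The other half of the Schur test, integration in the first variable. By symmetry of
  \<open>kern\<close> the mass formula applies once the weight at z is inserted; since the weight is
  at least 4, this gives the factor 1/4.\<close>

lemma kern_Fund_integral_le:
 assumes e: "0 < \<epsilon>" and w: "w \<in> disc"
 shows "(\<integral>\<^sup>+z. ennreal (indicator Fund z * kern \<epsilon> (z, w)) \<partial>lborel) \<le> ennreal (cker \<epsilon> / 4)"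
proof -
 have i: "integrable lD (\<lambda>z. qk \<epsilon> (w, z) * (1/4))"
  by (rule qk_integrable[OF e l1loc_const w])
 have i': "integrable lebesgue (\<lambda>z. indicator disc z *\<^sub>R (qk \<epsilon> (w, z) * (1/4)))"
  using i by (simp add: integrable_restrict_space)
 let ?A = "(LINT z|lebesgue. indicator disc z *\<^sub>R (qk \<epsilon> (w, z) * (1/4)))"
 have "(\<integral>\<^sup>+z. ennreal (indicator Fund z * kern \<epsilon> (z, w)) \<partial>lborel)
   \<le> (\<integral>\<^sup>+z. ennreal (indicator disc z *\<^sub>R (qk \<epsilon> (w, z) * (1/4))) \<partial>lborel)"
 proof (rule nn_integral_mono)
  fix z
  show "ennreal (indicator Fund z * kern \<epsilon> (z, w)) \<le> ennreal (indicator disc z *\<^sub>R (qk \<epsilon> (w, z) * (1/4)))"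
  proof (cases "z \<in> Fund")
   case True
   then have zd: "z \<in> disc" using Fund_disc by auto
   have "kern \<epsilon> (z, w) * 4 \<le> kern \<epsilon> (w, z) * hyp_weight z"
    using weight_ge_4[OF zd] kern_nonneg by (simp add: kern_commute[of \<epsilon> z w] mult_left_mono)
   then show ?thesis using True zd by (intro ennreal_leI) (simp add: qk_def)
  qed simp
 qed
 also have "\<dots> = (\<integral>\<^sup>+z. ennreal (indicator disc z *\<^sub>R (qk \<epsilon> (w, z) * (1/4))) \<partial>lebesgue)"
  by (rule nn_integral_completion[symmetric])
 also have "\<dots> = ennreal ?A"
  by (rule nn_integral_eq_integral[OF i']) (auto simp: indicator_def qk_nonneg)
 also have "?A = (LINT z|lD. qk \<epsilon> (w, z) * (1/4))"
  by (simp add: integral_restrict_space)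
 also have "\<dots> = cker \<epsilon> / 4" using Kop_one[OF e w] by (simp add: Kop_def)
 finally show ?thesis .
qed

text \<open>The Schur test, with Tonelli for the nonnegative integrand qk(z, w) f(w)^2. The bound is
  proportional to \<open>cker \<epsilon>\<close>, so after division by this mass it is uniform in
  \<epsilon>.\<close>

lemma Kop_L2_bound:
 assumes e: "0 < \<epsilon>" "\<epsilon> \<le> 1" and f: "sqi CF f" and fl: "l1loc disc f"
 shows "nrm Fund (Kop \<epsilon> f) \<le> cker \<epsilon> * sqrt wB * nrm CF f" "sqi Fund (Kop \<epsilon> f)"
proof -
 let ?c = "cker \<epsilon>"
 have c: "?c > 0" by (rule cker_pos[OF e(1)])
 let ?D = "(Kop \<epsilon> f)"
 have Kc: "continuous_on Fund ?D"
  using smooth_on_continuous[OF Kop_smooth[OF e(1) fl]] Fund_disc by (rule continuous_on_subset)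
 show Ks: "sqi Fund ?D" by (rule continuous_sqi[OF compact_Fund Kc])
 have ui: "integrable lebesgue (\<lambda>w. indicator CF w *\<^sub>R (f w)\<^sup>2)"
  using sqiD(2)[OF f] CF_sets by (simp add: integrable_restrict_space)
 then obtain U0 where U0: "U0 \<in> borel_measurable lborel" "AE w in lborel. indicator CF w *\<^sub>R (f w)\<^sup>2 = U0 w"
  using completion_ex_borel_measurable_real[of "\<lambda>w. indicator CF w *\<^sub>R (f w)\<^sup>2" lborel] by auto
 \<comment> \<open>Tonelli is applied for Borel measures, so f^2 on \<open>CF\<close> is replaced by
   a nonnegative Borel function that is equal almost everywhere.\<close>
 define U where "U = (\<lambda>w. max 0 (U0 w))"
 have Um: "U \<in> borel_measurable borel" unfolding U_def using U0(1) by simp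
 have UAE: "AE w in lborel. indicator CF w *\<^sub>R (f w)\<^sup>2 = U w"
  using U0(2)
 proof eventually_elim
  case (elim w)
  have "0 \<le> U0 w" unfolding elim[symmetric] by (simp add: indicator_def)
  then show ?case using elim by (simp add: U_def max_def)
 qed
 have U0': "U w \<ge> 0" for w by (simp add: U_def)
 define g where "g = (\<lambda>x. indicator (Fund \<times> CF) x *\<^sub>R qk \<epsilon> x)"
 have cp: "compact (Fund \<times> CF)" by (intro compact_Times compact_Fund CF_compact)
 have gm: "g \<in> borel_measurable borel"
  unfolding g_def
 proof (rule borel_measurable_continuous_on_indicator)
  show "Fund \<times> CF \<in> sets borel" using cp by (rule borel_compact)
  show "continuous_on (Fund \<times> CF) (qk \<epsilon>)"
   by (rule continuous_on_subset[OF qk_continuous]) (use Fund_disc CF_disc in auto)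
 qed
 define H where "H = (\<lambda>z w. ennreal (g (z, w) * U w))"
 let ?G = "(lborel \<Otimes>\<^sub>M lborel)"
 have Hm: "(\<lambda>(z, w). H z w) \<in> borel_measurable ?G"
 proof -
  have "(\<lambda>x. ennreal (g x * U (snd x))) \<in> borel_measurable borel"
   using gm measurable_compose[OF measurable_snd'[OF measurable_ident_sets[OF refl]] Um]
   by (intro measurable_compose[OF _ measurable_ennreal] borel_measurable_times gm measurable_compose[OF _ Um] borel_measurable_continuous_onI continuous_intros)
  moreover have "sets ?G = sets (borel :: (complex \<times> complex) measure)"
   by (metis borel_prod sets_lborel sets_pair_measure_cong)
  then have "borel_measurable ?G = (borel_measurable borel :: (complex \<times> complex \<Rightarrow> ennreal) set)"
   by (rule measurable_cong_sets[OF _ refl])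
  moreover have "(\<lambda>(z, w). H z w) = (\<lambda>x. ennreal (g x * U (snd x)))"
   by (rule ext) (simp add: H_def case_prod_unfold)
  ultimately show ?thesis by (simp only:)
 qed
 have inner: "ennreal (indicator Fund z * (Kop \<epsilon> f z)^2) \<le> ennreal ?c * (\<integral>\<^sup>+w. H z w \<partial>lborel)" for z
 proof (cases "z \<in> Fund")
  case True
  note sq = Kop_sq_le[OF e f True]
  have i1: "integrable lebesgue (\<lambda>w. indicator CF w *\<^sub>R (qk \<epsilon> (z, w) * (f w)^2))"
   using sq(2) CF_sets by (simp add: integrable_restrict_space)
  let ?B = "(LINT w|lebesgue_on CF. qk \<epsilon> (z, w) * (f w)^2)"
  have "ennreal ?B = ennreal (LINT w|lebesgue. indicator CF w *\<^sub>R (qk \<epsilon> (z, w) * (f w)^2))"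
   using CF_sets by (simp add: integral_restrict_space)
  also have "\<dots> = (\<integral>\<^sup>+w. ennreal (indicator CF w *\<^sub>R (qk \<epsilon> (z, w) * (f w)^2)) \<partial>lebesgue)"
  proof (rule nn_integral_eq_integral[OF i1, symmetric])
   have "0 \<le> indicator CF w *\<^sub>R (qk \<epsilon> (z, w) * (f w)^2)" for w
    using CF_disc qk_nonneg[of w \<epsilon> z] by (cases "w \<in> CF") auto
   then show "AE w in lebesgue. 0 \<le> indicator CF w *\<^sub>R (qk \<epsilon> (z, w) * (f w)^2)" by (intro AE_I2)
  qed
  also have "\<dots> = (\<integral>\<^sup>+w. ennreal (indicator CF w *\<^sub>R (qk \<epsilon> (z, w) * (f w)^2)) \<partial>lborel)"
   by (rule nn_integral_completion)
  also have "\<dots> = (\<integral>\<^sup>+w. H z w \<partial>lborel)"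
  proof (rule nn_integral_cong_AE)
   show "AE w in lborel. ennreal (indicator CF w *\<^sub>R (qk \<epsilon> (z, w) * (f w)^2)) = H z w"
    using UAE
   proof eventually_elim
    case (elim w)
    then show ?case using True by (cases "w \<in> CF") (simp_all add: H_def g_def)
   qed
  qed
  finally have "ennreal ?B = (\<integral>\<^sup>+w. H z w \<partial>lborel)" .
  moreover have "ennreal ((Kop \<epsilon> f z)^2) \<le> ennreal ?c * ennreal ?B"
  proof -
   have "ennreal ((Kop \<epsilon> f z)^2) \<le> ennreal (?c * ?B)"
    by (rule ennreal_leI[OF sq(1)])
   then show ?thesis using c by (simp add: ennreal_mult')
  qed
  ultimately show ?thesis using True by simp
 qed simp
 \<comment> \<open>The weight in \<open>qk\<close> belongs to w, so it leaves the integral in z, and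
   on \<open>CF\<close> it is at most \<open>wB\<close>.\<close>
 have outer: "(\<integral>\<^sup>+z. H z w \<partial>lborel) \<le> ennreal (?c * wB / 4) * ennreal (U w)" for w
 proof (cases "w \<in> CF")
  case True
  then have wd: "w \<in> disc" using CF_disc by auto
  let ?J = "(hyp_weight w * U w)"
  have "(\<integral>\<^sup>+z. H z w \<partial>lborel) = (\<integral>\<^sup>+z. ennreal ?J * ennreal (indicator Fund z * kern \<epsilon> (z, w)) \<partial>lborel)"
  proof (rule nn_integral_cong)
   fix z
   have eq: "g (z, w) * U w = ?J * (indicator Fund z * kern \<epsilon> (z, w))"
    using True by (simp add: g_def qk_def indicator_def)
   have "0 \<le> hyp_weight w * U w" using hyp_weight_pos[OF wd] U0'[of w] by simp
   then show "H z w = ennreal ?J * ennreal (indicator Fund z * kern \<epsilon> (z, w))"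
    unfolding H_def eq by (rule ennreal_mult')
  qed
  also have "\<dots> = ennreal ?J * (\<integral>\<^sup>+z. ennreal (indicator Fund z * kern \<epsilon> (z, w)) \<partial>lborel)"
  proof (rule nn_integral_cmult)
   have "(\<lambda>z. indicator Fund z *\<^sub>R kern \<epsilon> (z, w)) \<in> borel_measurable borel"
   proof (rule borel_measurable_continuous_on_indicator)
    show "Fund \<in> sets borel" using compact_Fund by (rule borel_compact)
    have "continuous_on (disc \<times> disc) (kern \<epsilon>)" by (rule smooth_on_continuous[OF smooth_kern])
    then show "continuous_on Fund (\<lambda>z. kern \<epsilon> (z, w))"
     by (rule continuous_on_compose2) (use Fund_disc wd in \<open>auto intro!: continuous_intros\<close>)
   qed
   then show "(\<lambda>z. ennreal (indicator Fund z * kern \<epsilon> (z, w))) \<in> borel_measurable lborel" by simp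
  qed
  also have "\<dots> \<le> ennreal (wB * U w) * ennreal (?c / 4)"
   using kern_Fund_integral_le[OF e(1) wd] weight_le[OF True] U0'[of w]
   by (intro mult_mono ennreal_leI mult_right_mono) auto
  also have "\<dots> = ennreal (wB * U w * (?c / 4))" using c by (intro ennreal_mult''[symmetric]) simp
  also have "wB * U w * (?c / 4) = ?c * wB / 4 * U w" by simp
  also have "ennreal (?c * wB / 4 * U w) = ennreal (?c * wB / 4) * ennreal (U w)"
   using U0'[of w] by (intro ennreal_mult'') simp
  finally show ?thesis .
 next
  case False
  then have "H z w = 0" for z by (simp add: H_def g_def)
  then show ?thesis by simp
 qed
 let ?C = "(\<integral>\<^sup>+z. \<integral>\<^sup>+w. H z w \<partial>lborel \<partial>lborel)"
 let ?H = "(LINT w|lebesgue. indicator CF w *\<^sub>R (f w)\<^sup>2)"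
 let ?K = "(\<integral>\<^sup>+w. ennreal (U w) \<partial>lborel)"
 have "?C = (\<integral>\<^sup>+w. \<integral>\<^sup>+z. H z w \<partial>lborel \<partial>lborel)"
  by (rule lborel_pair.Fubini'[OF Hm, symmetric])
 also have "\<dots> \<le> (\<integral>\<^sup>+w. ennreal (?c * wB / 4) * ennreal (U w) \<partial>lborel)"
  by (rule nn_integral_mono) (rule outer)
 also have "\<dots> = ennreal (?c * wB / 4) * ?K"
  by (rule nn_integral_cmult) (use Um in simp)
 also have "?K = (\<integral>\<^sup>+w. ennreal (indicator CF w *\<^sub>R (f w)\<^sup>2) \<partial>lborel)"
  using UAE by (intro nn_integral_cong_AE) (auto elim!: eventually_mono)
 also have "\<dots> = (\<integral>\<^sup>+w. ennreal (indicator CF w *\<^sub>R (f w)\<^sup>2) \<partial>lebesgue)"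
  by (rule nn_integral_completion[symmetric])
 also have "\<dots> = ennreal ?H"
  by (rule nn_integral_eq_integral[OF ui]) (simp add: indicator_def)
 also have "?H = (nrm CF f)^2"
  using CF_sets by (simp add: nrm_sq integral_restrict_space)
 finally have HH: "?C \<le> ennreal (?c * wB / 4) * ennreal ((nrm CF f)^2)" .
 let ?A = "(\<integral>\<^sup>+z. ennreal (indicator Fund z * (Kop \<epsilon> f z)^2) \<partial>lborel)"
 have "?A \<le> (\<integral>\<^sup>+z. ennreal ?c * (\<integral>\<^sup>+w. H z w \<partial>lborel) \<partial>lborel)"
  by (rule nn_integral_mono) (rule inner)
 also have "\<dots> = ennreal ?c * ?C"
  by (rule nn_integral_cmult) (rule lborel.borel_measurable_nn_integral[OF Hm])
 also have "\<dots> \<le> ennreal ?c * (ennreal (?c * wB / 4) * ennreal ((nrm CF f)^2))"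
  by (rule mult_left_mono[OF HH]) simp
 also have "ennreal ?c * (ennreal (?c * wB / 4) * ennreal ((nrm CF f)^2)) = ennreal (?c * (?c * wB / 4 * (nrm CF f)^2))"
 proof -
  have c0: "0 \<le> ?c" "0 \<le> ?c * wB / 4" "0 \<le> (nrm CF f)^2" "0 \<le> ?c * wB / 4 * (nrm CF f)^2"
   using c wB_pos by auto
  show ?thesis unfolding ennreal_mult[OF c0(1,4)] ennreal_mult[OF c0(2,3)] ..
 qed
 finally have "?A \<le> ennreal (?c * (?c * wB / 4 * (nrm CF f)^2))" .
 moreover have "?A = ennreal ((nrm Fund ?D)^2)"
 proof -
  have i: "integrable lebesgue (\<lambda>z. indicator Fund z *\<^sub>R (Kop \<epsilon> f z)\<^sup>2)"
   using sqiD(2)[OF Ks] by (simp add: integrable_restrict_space)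
  let ?E = "(LINT z|lebesgue. indicator Fund z *\<^sub>R (Kop \<epsilon> f z)\<^sup>2)"
  have "?A = (\<integral>\<^sup>+z. ennreal (indicator Fund z *\<^sub>R (Kop \<epsilon> f z)\<^sup>2) \<partial>lebesgue)"
   by (simp add: nn_integral_completion)
  also have "\<dots> = ennreal ?E"
   by (rule nn_integral_eq_integral[OF i]) (simp add: indicator_def)
  also have "?E = (nrm Fund ?D)^2"
   by (simp add: nrm_sq integral_restrict_space)
  finally show ?thesis .
 qed
 ultimately have le: "ennreal ((nrm Fund ?D)^2) \<le> ennreal (?c * (?c * wB / 4 * (nrm CF f)^2))" by simp
 have "0 \<le> ?c * (?c * wB / 4 * (nrm CF f)^2)" using c wB_pos by simp
 from ennreal_le_iff[OF this] le
 have "(nrm Fund ?D)^2 \<le> ?c * (?c * wB / 4 * (nrm CF f)^2)" by blast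
 also have "\<dots> = (?c^2 * wB * (nrm CF f)^2) / 4" by (simp add: power2_eq_square)
 also have "\<dots> \<le> ?c^2 * wB * (nrm CF f)^2" using c wB_pos by simp
 also have "\<dots> = (?c * sqrt wB * nrm CF f)^2" using wB_pos by (simp add: power_mult_distrib)
 finally show "nrm Fund ?D \<le> ?c * sqrt wB * nrm CF f"
  by (rule power2_le_imp_le) (intro mult_nonneg_nonneg real_sqrt_ge_zero nrm_nonneg less_imp_le c wB_pos)
qed

section \<open>Convergence of the normalised averages\<close>

definition Kn :: "nat \<Rightarrow> (complex \<Rightarrow> real) \<Rightarrow> complex \<Rightarrow> real" where
 "Kn n f z = inverse (cker (1 / real (Suc n))) * Kop (1 / real (Suc n)) f z"

lemma Kn_smooth: "l1loc disc f \<Longrightarrow> smooth_on disc (Kn n f)"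
 unfolding Kn_def[abs_def] by (intro smooth_on_cmult open_disc Kop_smooth) auto

lemma Kn_sqi: assumes "l1loc disc f" shows "sqi Fund (Kn n f)"
 by (rule continuous_sqi[OF compact_Fund continuous_on_subset[OF smooth_on_continuous[OF Kn_smooth[OF assms]] Fund_disc]])

lemma Kn_L2_bound:
 assumes "sqi CF f" "l1loc disc f"
 shows "nrm Fund (Kn n f) \<le> sqrt wB * nrm CF f"
proof -
 let ?e = "1 / real (Suc n)"
 have e: "0 < ?e" "?e \<le> 1" by auto
 have c: "cker ?e > 0" by (rule cker_pos[OF e(1)])
 have "nrm Fund (Kn n f) = inverse (cker ?e) * nrm Fund (Kop ?e f)"
  unfolding Kn_def[abs_def] using c by (subst nrm_cmult) simp
 also have "\<dots> \<le> inverse (cker ?e) * (cker ?e * sqrt wB * nrm CF f)"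
  using c Kop_L2_bound(1)[OF e assms] by (intro mult_left_mono) auto
 also have "\<dots> = sqrt wB * nrm CF f" using c by simp
 finally show ?thesis .
qed

lemma Kn_diff:
 assumes "l1loc disc f" "l1loc disc g" "z \<in> disc"
 shows "Kn n (\<lambda>w. f w - g w) z = Kn n f z - Kn n g z"
proof -
 let ?e = "1 / real (Suc n)"
 have e: "0 < ?e" by auto
 have "Kop ?e (\<lambda>w. f w - g w) z = Kop ?e f z - Kop ?e g z"
  unfolding Kop_def right_diff_distrib
  by (rule Bochner_Integration.integral_diff[OF qk_integrable[OF e assms(1,3)] qk_integrable[OF e assms(2,3)]])
 then show ?thesis unfolding Kn_def by (simp only: right_diff_distrib)
qed

text \<open>The normalised average at z is a mean over points w with |z - w|^2 < 1/(n+1), by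
  \<open>kern_nonzero\<close>. Uniform continuity on the compact set \<open>CF\<close> bounds the
  oscillation there.\<close>

lemma Kn_uniform:
 assumes g: "continuous_on UNIV g" and d: "\<delta> > 0"
 shows "\<exists>N. \<forall>n\<ge>N. \<forall>z\<in>Fund. \<bar>Kn n g z - g z\<bar> \<le> \<delta>"
proof -
 have "uniformly_continuous_on CF g"
  by (rule compact_uniformly_continuous[OF continuous_on_subset[OF g] CF_compact]) simp
 then obtain \<eta> where \<eta>: "\<eta> > 0" "\<And>x y. x \<in> CF \<Longrightarrow> y \<in> CF \<Longrightarrow> dist y x < \<eta> \<Longrightarrow> dist (g y) (g x) < \<delta>"
  using d unfolding uniformly_continuous_on_def by metis
 obtain N :: nat where N: "inverse (\<eta>^2) < real N" using reals_Archimedean2 by blast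
 have lg: "l1loc disc g"
  using l1loc_mult[OF open_disc l1loc_const[of 1] continuous_on_subset[OF g]] by simp
 have "\<bar>Kn n g z - g z\<bar> \<le> \<delta>" if n: "n \<ge> N" and z: "z \<in> Fund" for n z
 proof -
  let ?e = "1 / real (Suc n)"
  have e: "0 < ?e" "?e \<le> 1" by auto
  have e2: "?e < \<eta>^2"
  proof -
   have "inverse (\<eta>^2) < real (Suc n)" using N n by simp
   then show ?thesis using \<eta>(1) by (simp add: field_simps)
  qed
  have c: "cker ?e > 0" by (rule cker_pos[OF e(1)])
  have zd: "z \<in> disc" and zC: "z \<in> CF" using z Fund_disc rF(2) by auto
  let ?A = "lD"
  have ig: "integrable ?A (\<lambda>w. qk ?e (z, w) * g w)" by (rule qk_integrable[OF e(1) lg zd])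
  have i1: "integrable ?A (\<lambda>w. qk ?e (z, w) * 1)" by (rule qk_integrable[OF e(1) l1loc_const zd])
  have i2: "integrable ?A (\<lambda>w. qk ?e (z, w) * g w - g z * (qk ?e (z, w) * 1))"
   using ig i1 by (intro Bochner_Integration.integrable_diff integrable_mult_right)
  have "Kop ?e g z - g z * cker ?e = (LINT w|lD. qk ?e (z, w) * g w - g z * (qk ?e (z, w) * 1))"
   using ig i1 Kop_one[OF e(1) zd] unfolding Kop_def by simp
  also have "\<bar>\<dots>\<bar> \<le> (LINT w|lD. \<bar>qk ?e (z, w) * g w - g z * (qk ?e (z, w) * 1)\<bar>)"
   by (rule integral_abs_bound)
  also have "\<dots> \<le> (LINT w|lD. \<delta> * (qk ?e (z, w) * 1))"
  proof (rule integral_mono)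
   show "integrable ?A (\<lambda>w. \<bar>qk ?e (z, w) * g w - g z * (qk ?e (z, w) * 1)\<bar>)"
    using i2 by (rule integrable_abs)
   show "integrable ?A (\<lambda>w. \<delta> * (qk ?e (z, w) * 1))"
    using i1 by (rule integrable_mult_right)
   fix w assume "w \<in> space ?A"
   then have w: "w \<in> disc" by simp
   have "qk ?e (z, w) * g w - g z * (qk ?e (z, w) * 1) = qk ?e (z, w) * (g w - g z)"
    by (simp add: algebra_simps)
   then have "\<bar>qk ?e (z, w) * g w - g z * (qk ?e (z, w) * 1)\<bar> = qk ?e (z, w) * \<bar>g w - g z\<bar>"
    using qk_nonneg[OF w, of ?e z] by (simp only: abs_mult abs_of_nonneg)
   also have "\<dots> \<le> qk ?e (z, w) * \<delta>"
   proof (cases "qk ?e (z, w) = 0")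
    case False
    then have k: "kern ?e (z, w) \<noteq> 0" by (auto simp: qk_def)
    have wC: "w \<in> CF" using rF(3)[OF e z, of w] k w by blast
    have "(cmod (z - w))^2 < ?e * ((1 - (cmod z)\<^sup>2) * (1 - (cmod w)\<^sup>2))"
     by (rule kern_nonzero[OF k e(1) zd w])
    also have "\<dots> \<le> ?e * (1 * 1)"
     using disc_pos[OF zd] disc_pos[OF w] by (intro mult_left_mono mult_mono) auto
    finally have "(cmod (z - w))^2 < \<eta>^2" using e2 by simp
    then have "cmod (z - w) < \<eta>" by (rule power_less_imp_less_base) (use \<eta>(1) in linarith)
    then have "dist w z < \<eta>" by (simp add: dist_norm norm_minus_commute)
    then have "dist (g w) (g z) < \<delta>" by (rule \<eta>(2)[OF zC wC])
    then show ?thesis using qk_nonneg[OF w, of ?e z] by (intro mult_left_mono) (auto simp: dist_real_def)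
   qed simp
   finally show "\<bar>qk ?e (z, w) * g w - g z * (qk ?e (z, w) * 1)\<bar> \<le> \<delta> * (qk ?e (z, w) * 1)"
    by (simp add: mult.commute)
  qed
  also have "\<dots> = \<delta> * cker ?e" using Kop_one[OF e(1) zd] unfolding Kop_def by simp
  finally have b: "\<bar>Kop ?e g z - g z * cker ?e\<bar> \<le> \<delta> * cker ?e" .
  have "Kn n g z - g z = inverse (cker ?e) * (Kop ?e g z - g z * cker ?e)"
   using c unfolding Kn_def by (simp add: right_diff_distrib)
  then have "\<bar>Kn n g z - g z\<bar> = inverse (cker ?e) * \<bar>Kop ?e g z - g z * cker ?e\<bar>"
   using c by (simp only: abs_mult) simp
  also have "\<dots> \<le> inverse (cker ?e) * (\<delta> * cker ?e)" using b c by (intro mult_left_mono) auto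
  also have "\<dots> = \<delta>" using c by simp
  finally show ?thesis .
 qed
 then show ?thesis by blast
qed

lemma Kn_tendsto:
 assumes f: "sqi CF f" and fl: "l1loc disc f"
 shows "(\<lambda>n. nrm Fund (\<lambda>z. Kn n f z - f z)) \<longlonglongrightarrow> 0"
proof (rule LIMSEQ_I)
 fix e :: real assume e: "e > 0"
 \<comment> \<open>The distance of f to a continuous g is paid twice: with the factor sqrt wB for
   the averages and with the factor 1 for the functions themselves. The number m below converts a
   uniform bound on the octagon into an L2 bound, and is positive thanks to the added 1.\<close>
 define B where "B = sqrt wB + 1"
 have B: "B > 0" using wB_pos by (simp add: B_def add_nonneg_pos)
 define m where "m = sqrt (measure lebesgue Fund) + 1"
 have m: "m > 0" by (simp add: m_def add_nonneg_pos)
 obtain g where g: "continuous_on UNIV g" "sqi CF g" "nrm CF (\<lambda>x. f x - g x) < e / (2 * B)"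
  using continuous_dense_L2[OF CF_compact f, of "e / (2 * B)"] e B by auto
 obtain N where N: "\<And>n z. n \<ge> N \<Longrightarrow> z \<in> Fund \<Longrightarrow> \<bar>Kn n g z - g z\<bar> \<le> e / (2 * m)"
  using Kn_uniform[OF g(1), of "e / (2 * m)"] e m by auto
 have lg: "l1loc disc g"
  using l1loc_mult[OF open_disc l1loc_const[of 1] continuous_on_subset[OF g(1)]] by simp
 have fg: "sqi CF (\<lambda>x. f x - g x)" by (rule sqi_diff[OF f g(2)])
 have fgl: "l1loc disc (\<lambda>x. f x - g x)" using fl lg by (simp add: l1loc_def)
 have fF: "sqi Fund f" "sqi Fund g" using sqi_subset(1)[OF _ rF(2) Fund_lebesgue CF_sets] f g(2) by auto
 have "nrm Fund (\<lambda>z. Kn n f z - f z) < e" if n: "n \<ge> N" for n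
 proof -
  have Ks: "sqi Fund (Kn n f)" "sqi Fund (Kn n g)" "sqi Fund (Kn n (\<lambda>x. f x - g x))"
   using Kn_sqi fl lg fgl by auto
  have "nrm Fund (\<lambda>z. Kn n f z - f z) \<le> nrm Fund (\<lambda>z. Kn n f z - Kn n g z) + nrm Fund (\<lambda>z. Kn n g z - f z)"
   by (rule nrm_diff_triangle[OF Ks(1,2) fF(1)])
  also have "nrm Fund (\<lambda>z. Kn n g z - f z) \<le> nrm Fund (\<lambda>z. Kn n g z - g z) + nrm Fund (\<lambda>z. g z - f z)"
   by (rule nrm_diff_triangle[OF Ks(2) fF(2,1)])
  also have "nrm Fund (\<lambda>z. g z - f z) \<le> nrm CF (\<lambda>x. f x - g x)"
   unfolding nrm_minus_commute[of Fund g f] by (rule sqi_subset(2)[OF fg rF(2) Fund_lebesgue CF_sets])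
  also have "nrm Fund (\<lambda>z. Kn n f z - Kn n g z) = nrm Fund (Kn n (\<lambda>x. f x - g x))"
  proof (rule nrm_cong_AE)
   show "AE x in lF. norm (Kn n f x - Kn n g x) = norm (Kn n (\<lambda>x. f x - g x) x)"
    by (rule AE_I2) (use Kn_diff[OF fl lg] Fund_disc in auto)
   show "(\<lambda>x. Kn n f x - Kn n g x) \<in> borel_measurable lF"
    using sqi_diff[OF Ks(1,2)] by (rule sqiD)
   show "Kn n (\<lambda>x. f x - g x) \<in> borel_measurable lF" using Ks(3) by (rule sqiD)
  qed
  also have "nrm Fund (Kn n (\<lambda>x. f x - g x)) \<le> sqrt wB * nrm CF (\<lambda>x. f x - g x)"
   by (rule Kn_L2_bound[OF fg fgl])
  also have "nrm Fund (\<lambda>z. Kn n g z - g z) \<le> e / (2 * m) * sqrt (measure lebesgue Fund)"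
   by (rule nrm_bound[OF Fund_lmeasurable sqiD(1)[OF sqi_diff[OF Ks(2) fF(2)]]]) (use N[OF n] e m in auto)
  finally have "nrm Fund (\<lambda>z. Kn n f z - f z) \<le> B * nrm CF (\<lambda>x. f x - g x) + e / (2 * m) * sqrt (measure lebesgue Fund)"
   by (simp add: B_def algebra_simps)
  also have "B * nrm CF (\<lambda>x. f x - g x) < B * (e / (2 * B))" using g(3) B by (intro mult_strict_left_mono)
  also have "B * (e / (2 * B)) = e / 2" using B by simp
  also have "e / (2 * m) * sqrt (measure lebesgue Fund) \<le> e / (2 * m) * m"
   using e m by (intro mult_left_mono) (auto simp: m_def)
  also have "e / (2 * m) * m = e / 2" using m by simp
  finally show ?thesis by simp
 qed
 then show "\<exists>no. \<forall>n\<ge>no. norm (nrm Fund (\<lambda>z. Kn n f z - f z) - 0) < e"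
  by (intro exI[of _ N]) (simp add: nrm_nonneg)
qed

lemma sqi_CF_mult:
 fixes f :: "complex \<Rightarrow> real"
 assumes "sqi CF f" "continuous_on CF g" shows "sqi CF (\<lambda>x. g x * f x)"
proof -
 have "bounded (g ` CF)" using assms CF_compact by (intro compact_imp_bounded compact_continuous_image)
 then obtain B where B: "\<And>x. x \<in> CF \<Longrightarrow> \<bar>g x\<bar> \<le> B" by (auto simp: bounded_iff)
 show ?thesis
  by (rule sqi_bounded_mult[OF assms(1), of _ B])
    (use B continuous_imp_measurable_on_sets_lebesgue[OF assms(2) CF_sets] in \<open>auto intro!: AE_I2\<close>)
qed

lemma xi_continuous: "continuous_on S (\<lambda>z. Re (xi c z))" "continuous_on S (\<lambda>z. Im (xi c z))"
 unfolding xi_def by (intro continuous_intros)+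

lemma xi_Fund_bound: assumes "z \<in> disc" "cmod c = 1" shows "\<bar>Re (xi c z)\<bar> \<le> 2" "\<bar>Im (xi c z)\<bar> \<le> 2"
proof -
 have "cmod (xi c z) \<le> cmod c + cmod (cnj c * z^2)" unfolding xi_def by (rule norm_triangle_ineq4)
 also have "\<dots> = 1 + (cmod z)^2" using assms(2) by (simp add: norm_mult norm_power)
 also have "\<dots> \<le> 2" using assms(1) by (simp add: disc_iff)
 finally show "\<bar>Re (xi c z)\<bar> \<le> 2" "\<bar>Im (xi c z)\<bar> \<le> 2"
  using abs_Re_le_cmod[of "xi c z"] abs_Im_le_cmod[of "xi c z"] by auto
qed

text \<open>Averaging with the invariant kernel commutes with the Killing fields, so it converges in
 the Sobolev norm; the gradient is recovered from two Killing fields that are independent at every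
 point of the disc.\<close>

lemma Kn_gradient_tendsto:
 assumes w: "wp f fx fy" and sf: "sqi CF fx" "sqi CF fy"
 shows "(\<lambda>n. nrm Fund (\<lambda>z. partial 1 (Kn n f) z - fx z)) \<longlonglongrightarrow> 0"
  and "(\<lambda>n. nrm Fund (\<lambda>z. partial \<i> (Kn n f) z - fy z)) \<longlonglongrightarrow> 0"
proof -
 have lf: "l1loc disc f" "l1loc disc fx" "l1loc disc fy" using w by (auto simp: wp_def)
 define X where "X = (\<lambda>c. Xder c fx fy)"
 have Xl: "l1loc disc (X c)" for c
  unfolding X_def Xder_def by (intro l1loc_add l1loc_mult open_disc lf xi_continuous)
 have Xs: "sqi CF (X c)" for c
  unfolding X_def Xder_def by (intro sqi_add sqi_CF_mult sf xi_continuous)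
 define E where "E = (\<lambda>c n z. Kn n (X c) z - X c z)"
 have Elim: "(\<lambda>n. nrm Fund (E c n)) \<longlonglongrightarrow> 0" for c
  unfolding E_def by (rule Kn_tendsto[OF Xs Xl])
 have XF: "sqi Fund (X c)" for c by (rule sqi_subset(1)[OF Xs rF(2) Fund_lebesgue CF_sets])
 have Es: "sqi Fund (E c n)" for c n
  unfolding E_def by (rule sqi_diff[OF Kn_sqi[OF Xl] XF])
 \<comment> \<open>On the octagon |z|^4 <= 1/2, so the determinant of the two fields is at least
   1/2. The fields have components at most 2, whence the bound 4 for the coefficients in Cramer's
   rule.\<close>
 have D: "1 / (1 - (cmod z)^4) \<le> 2" "0 < 1 - (cmod z)^4" if "z \<in> Fund" for z
 proof -
  have "((cmod z)^2)^2 \<le> (sqrt 2 / 2)^2" using Fund_norm[OF that] by (intro power_mono) auto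
  then have "(cmod z)^4 \<le> 1/2" by (simp add: power_divide flip: power_mult)
  then show "1 / (1 - (cmod z)^4) \<le> 2" "0 < 1 - (cmod z)^4" by (auto simp: divide_le_eq)
 qed
 have killK: "Re (xi c z) * partial 1 (Kn n f) z + Im (xi c z) * partial \<i> (Kn n f) z = Kn n (X c) z" if z: "z \<in> disc" for c n z
 proof -
  let ?e = "1 / real (Suc n)"
  have e: "?e > 0" by simp
  have dK: "Kop ?e f differentiable (at z)"
   by (rule smooth_on_differentiable[OF Kop_smooth[OF e lf(1)] z])
  have "partial b (Kn n f) z = inverse (cker ?e) * partial b (Kop ?e f) z" for b
  proof -
   have p0: "partial b (\<lambda>z::complex. inverse (cker ?e)) z = 0"
    using partial_eqI[OF has_derivative_const[of "inverse (cker ?e)" "at z"], of b] by simp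
   have "(\<lambda>z::complex. inverse (cker ?e)) differentiable (at z)" by simp
   from partial_mult[OF this dK, of b] show ?thesis unfolding Kn_def[abs_def] p0 by simp
  qed
  then have "Re (xi c z) * partial 1 (Kn n f) z + Im (xi c z) * partial \<i> (Kn n f) z
   = inverse (cker ?e) * (Re (xi c z) * partial 1 (Kop ?e f) z + Im (xi c z) * partial \<i> (Kop ?e f) z)"
   by (simp add: algebra_simps)
  then show ?thesis unfolding Kop_killing[OF e w z] by (simp add: Kn_def X_def)
 qed
 \<comment> \<open>The errors of the two partial derivatives solve a linear system whose right-hand
   sides are the errors of averaging the derivatives along the fields.\<close>
 have sys: "Re (xi c z) * (partial 1 (Kn n f) z - fx z) + Im (xi c z) * (partial \<i> (Kn n f) z - fy z) = E c n z" if "z \<in> disc" for c n z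
  using killK[OF that, of c n] unfolding E_def X_def Xder_def by (simp add: algebra_simps)
 define a where "a = (\<lambda>c z. Re (xi c z) / (1 - (cmod z)^4))"
 define b where "b = (\<lambda>c z. Im (xi c z) / (1 - (cmod z)^4))"
 have nz: "1 - (cmod z)^4 \<noteq> 0" if "z \<in> Fund" for z using D(2)[OF that] by simp
 let ?A = "lF"
 have am: "a c \<in> borel_measurable ?A" "b c \<in> borel_measurable ?A" for c
  unfolding a_def b_def
  by (rule continuous_measurable_on[where T=Fund], intro continuous_intros xi_continuous, use nz in auto)+
 have ab: "\<bar>a c z\<bar> \<le> 4" "\<bar>b c z\<bar> \<le> 4" if z: "z \<in> Fund" and c: "cmod c = 1" for c z
 proof -
  have zd: "z \<in> disc" using z Fund_disc by auto
  have "\<bar>Re (xi c z)\<bar> * (1 / (1 - (cmod z)^4)) \<le> 2 * 2" "\<bar>Im (xi c z)\<bar> * (1 / (1 - (cmod z)^4)) \<le> 2 * 2"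
   using xi_Fund_bound[OF zd c] D[OF z] by (intro mult_mono; simp)+
  then show "\<bar>a c z\<bar> \<le> 4" "\<bar>b c z\<bar> \<le> 4" using D(2)[OF z] by (simp_all add: a_def b_def abs_divide)
 qed
 have abAE: "AE z in lF. norm (a c z) \<le> 4" "AE z in lF. norm (b c z) \<le> 4" if "cmod c = 1" for c
  using ab that by (auto intro!: AE_I2)
 have bnd: "nrm Fund (\<lambda>z. g z * E c n z) \<le> 4 * nrm Fund (E c n)" "sqi Fund (\<lambda>z. g z * E c n z)"
  if "g \<in> borel_measurable ?A" "AE z in lF. norm (g z) \<le> 4" for g c n
  using nrm_bounded_mult[OF Es that] sqi_bounded_mult[OF Es that] by auto
 have main: "(\<lambda>n. nrm Fund (F n)) \<longlonglongrightarrow> 0"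
  if F: "\<And>n z. z \<in> Fund \<Longrightarrow> F n z = g z * E c n z + h z * E d n z"
   and g: "g \<in> borel_measurable ?A" "AE z in lF. norm (g z) \<le> 4"
   and h: "h \<in> borel_measurable ?A" "AE z in lF. norm (h z) \<le> 4"
  for F :: "nat \<Rightarrow> complex \<Rightarrow> real" and g h c d
 proof (rule tendsto_sandwich[OF _ _ tendsto_const])
  show "(\<lambda>n. 4 * nrm Fund (E c n) + 4 * nrm Fund (E d n)) \<longlonglongrightarrow> 0"
   using tendsto_add[OF tendsto_mult[OF tendsto_const[of 4] Elim[of c]] tendsto_mult[OF tendsto_const[of 4] Elim[of d]]] by simp
  show "\<forall>\<^sub>F n in sequentially. 0 \<le> nrm Fund (F n)" by (simp add: nrm_nonneg)
  have "nrm Fund (F n) \<le> 4 * nrm Fund (E c n) + 4 * nrm Fund (E d n)" for n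
  proof -
   have "nrm Fund (F n) = nrm Fund (\<lambda>z. g z * E c n z + h z * E d n z)"
    unfolding nrm_def using lebesgue_on_cong_int[of Fund "\<lambda>z. (norm (F n z))^2" "\<lambda>z. (norm (g z * E c n z + h z * E d n z))^2"] F by simp
   also have "\<dots> \<le> nrm Fund (\<lambda>z. g z * E c n z) + nrm Fund (\<lambda>z. h z * E d n z)"
    by (rule nrm_triangle[OF bnd(2)[OF g] bnd(2)[OF h]])
   also have "\<dots> \<le> 4 * nrm Fund (E c n) + 4 * nrm Fund (E d n)"
    by (rule add_mono[OF bnd(1)[OF g] bnd(1)[OF h]])
   finally show ?thesis .
  qed
  then show "\<forall>\<^sub>F n in sequentially. nrm Fund (F n) \<le> 4 * nrm Fund (E c n) + 4 * nrm Fund (E d n)" by simp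
 qed
 show "(\<lambda>n. nrm Fund (\<lambda>z. partial 1 (Kn n f) z - fx z)) \<longlonglongrightarrow> 0"
 proof (rule main[where g="b \<i>" and h="\<lambda>z. - b 1 z" and c=1 and d=\<i>])
  fix n z assume "z \<in> Fund"
  then have zd: "z \<in> disc" using Fund_disc by auto
  show "partial 1 (Kn n f) z - fx z = b \<i> z * E 1 n z + - b 1 z * E \<i> n z"
   using killing_solve(1)[OF zd sys[OF zd, of 1 n] sys[OF zd, of \<i> n]] by (simp add: b_def diff_divide_distrib)
 qed (use am abAE in auto)
 show "(\<lambda>n. nrm Fund (\<lambda>z. partial \<i> (Kn n f) z - fy z)) \<longlonglongrightarrow> 0"
 proof (rule main[where g="a 1" and h="\<lambda>z. - a \<i> z" and c=\<i> and d=1])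
  fix n z assume "z \<in> Fund"
  then have zd: "z \<in> disc" using Fund_disc by auto
  show "partial \<i> (Kn n f) z - fy z = a 1 z * E \<i> n z + - a \<i> z * E 1 n z"
   using killing_solve(2)[OF zd sys[OF zd, of 1 n] sys[OF zd, of \<i> n]] by (simp add: a_def diff_divide_distrib)
 qed (use am abAE in auto)
qed

lemma Kn_gen:
 assumes "l1loc disc f" "AE w in lD. f (gen i w) = f w" "z \<in> disc"
 shows "Kn n f (gen i z) = Kn n f z"
 unfolding Kn_def by (subst Kop_gen[OF _ assms]) auto

section \<open>Green's formula on the octagon\<close>

definition gdot :: "(complex \<Rightarrow> real) \<Rightarrow> (complex \<Rightarrow> real) \<Rightarrow> complex \<Rightarrow> real" where
 "gdot a b z = partial 1 a z * partial 1 b z + partial \<i> a z * partial \<i> b z"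

definition lap :: "(complex \<Rightarrow> real) \<Rightarrow> complex \<Rightarrow> real" where
 "lap \<phi> z = partial 1 (partial 1 \<phi>) z + partial \<i> (partial \<i> \<phi>) z"

lemma Basis_c: "(1::complex) \<in> Basis" "\<i> \<in> Basis" by (auto simp: Basis_complex_def)

lemma integral_partial_disc:
 assumes f: "smooth_on disc f" and C: "compact C" "C \<subseteq> disc" "\<And>z. z \<in> disc - C \<Longrightarrow> f z = 0" and b: "b \<in> Basis"
 shows "(LINT z|lD. partial b f z) = 0"
proof -
 define g where "g = (\<lambda>z. if z \<in> disc then f z else 0)"
 have t: "test_fun disc g" unfolding g_def by (rule test_fun_extend[OF open_disc C(1,2) f C(3)])
 then have s: "smooth_on UNIV g" by (simp add: test_fun_def)
 have g0: "g x = 0" if "x \<notin> C" for x using C(3)[of x] that by (auto simp: g_def)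
 have pg: "partial b g x = 0" if "x \<notin> C" for x
  by (rule partial_zero_outside[OF compact_imp_closed[OF C(1)] g0 that])
 have "(LINT z|lD. partial b f z) = (LINT z|lD. partial b g z)"
  by (rule lebesgue_on_cong_int, rule partial_cong_open[OF open_disc]) (auto simp: g_def)
 also have "\<dots> = (LINT z|lebesgue_on UNIV. partial b g z)"
  by (rule restrict_zero_outside(2)[symmetric])
    (use pg C in auto)
 also have "\<dots> = 0"
  using integral_partial_eq_0[OF smooth_on_imp_Ck[OF s] C(1) g0 b] by (simp add: lebesgue_on_UNIV_eq)
 finally show ?thesis .
qed

lemma integrable_continuous_disc:
 fixes g :: "complex \<Rightarrow> real"
 assumes "compact C" "C \<subseteq> disc" "continuous_on disc g" "\<And>z. z \<in> disc - C \<Longrightarrow> g z = 0"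
 shows "integrable lD g"
 using integrable_mult_l1loc[OF open_disc assms(1,2) l1loc_const[of 1] assms(3,4)] by simp

lemma smooth_continuous_partial: "smooth_on disc f \<Longrightarrow> b \<in> Basis \<Longrightarrow> continuous_on disc (partial b f)"
 by (intro smooth_on_continuous smooth_on_partial)

lemma gdot_continuous: "smooth_on disc a \<Longrightarrow> smooth_on disc b \<Longrightarrow> continuous_on disc (gdot a b)"
 unfolding gdot_def[abs_def] by (intro continuous_intros smooth_continuous_partial Basis_c)

lemma lap_continuous: "smooth_on disc a \<Longrightarrow> continuous_on disc (lap a)"
 unfolding lap_def[abs_def] by (intro continuous_intros smooth_continuous_partial smooth_on_partial Basis_c)

lemma gdot_mult:
 assumes "a differentiable (at z)" "b differentiable (at z)"
 shows "gdot (\<lambda>z. a z * b z) \<phi> z = a z * gdot b \<phi> z + b z * gdot a \<phi> z"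
 unfolding gdot_def partial_mult[OF assms] by (simp add: algebra_simps)

lemma gdot_compose:
 fixes h :: "real \<Rightarrow> real"
 assumes "a differentiable (at z)" "h differentiable (at (a z))"
 shows "gdot (\<lambda>z. h (a z)) \<phi> z = partial 1 h (a z) * gdot a \<phi> z"
 unfolding gdot_def partial_compose[OF assms] by (simp add: algebra_simps)

lemma gdot_cong:
 assumes "\<And>z. z \<in> disc \<Longrightarrow> a z = a' z" "\<And>z. z \<in> disc \<Longrightarrow> b z = b' z" "z \<in> disc"
 shows "gdot a b z = gdot a' b' z"
 unfolding gdot_def using partial_cong_open[OF open_disc assms(3) assms(1)] partial_cong_open[OF open_disc assms(3) assms(2)] by simp

lemma gdot_zero_outside:
 assumes "compact C" "\<And>z. z \<in> disc - C \<Longrightarrow> a z = 0" "z \<in> disc - C"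
 shows "gdot a b z = 0"
proof -
 have "partial d a z = 0" for d
  by (rule partial_eq_0_open[of "disc - C"]) (use assms in \<open>auto intro!: open_Diff compact_imp_closed\<close>)
 then show ?thesis by (simp add: gdot_def)
qed

text \<open>The divergence of \<omega> v times the gradient of \<phi> has integral 0. With \<omega>
  approaching an indicator function, the right-hand side is a smooth substitute for the boundary
  integral.\<close>

lemma integration_by_parts_disc:
 assumes w: "smooth_on disc \<omega>" and v: "smooth_on disc v" and p: "smooth_on disc \<phi>"
  and C: "compact C" "C \<subseteq> disc" "\<And>z. z \<in> disc - C \<Longrightarrow> \<omega> z = 0"
 shows "(LINT z|lD. \<omega> z * (gdot v \<phi> z + v z * lap \<phi> z)) = - (LINT z|lD. v z * gdot \<omega> \<phi> z)"
proof -
 let ?L = "lD"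
 have wv: "smooth_on disc (\<lambda>z. \<omega> z * v z)" by (rule smooth_on_mult[OF open_disc w v])
 have dp: "smooth_on disc (partial b \<phi>)" if "b \<in> Basis" for b by (rule smooth_on_partial[OF p that])
 have f: "smooth_on disc (\<lambda>z. (\<omega> z * v z) * partial b \<phi> z)" if "b \<in> Basis" for b
  by (rule smooth_on_mult[OF open_disc wv dp[OF that]])
 have z: "(LINT z|?L. partial b (\<lambda>z. (\<omega> z * v z) * partial b \<phi> z) z) = 0" if "b \<in> Basis" for b
  by (rule integral_partial_disc[OF f[OF that] C(1,2) _ that]) (use C(3) in auto)
 have i: "integrable ?L (partial b (\<lambda>z. (\<omega> z * v z) * partial b \<phi> z))" if "b \<in> Basis" for b
 proof (rule integrable_continuous_disc[OF C(1,2) smooth_continuous_partial[OF f[OF that] that]])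
  fix z assume z: "z \<in> disc - C"
  show "partial b (\<lambda>z. (\<omega> z * v z) * partial b \<phi> z) z = 0"
   by (rule partial_eq_0_open[of "disc - C"]) (use C z in \<open>auto intro!: open_Diff compact_imp_closed\<close>)
 qed
 have "(LINT z|?L. partial 1 (\<lambda>z. (\<omega> z * v z) * partial 1 \<phi> z) z + partial \<i> (\<lambda>z. (\<omega> z * v z) * partial \<i> \<phi> z) z) = 0"
  using z[OF Basis_c(1)] z[OF Basis_c(2)] i[OF Basis_c(1)] i[OF Basis_c(2)] by simp
 moreover have "(LINT z|?L. partial 1 (\<lambda>z. (\<omega> z * v z) * partial 1 \<phi> z) z + partial \<i> (\<lambda>z. (\<omega> z * v z) * partial \<i> \<phi> z) z)
   = (LINT z|?L. \<omega> z * (gdot v \<phi> z + v z * lap \<phi> z) + v z * gdot \<omega> \<phi> z)"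
 proof (rule lebesgue_on_cong_int)
  fix z assume z: "z \<in> disc"
  have d: "\<omega> differentiable (at z)" "v differentiable (at z)" "(\<lambda>z. \<omega> z * v z) differentiable (at z)"
   using smooth_on_differentiable w v wv z by blast+
  have dd: "partial b \<phi> differentiable (at z)" if "b \<in> Basis" for b
   using smooth_on_differentiable[OF dp[OF that] z] .
  show "partial 1 (\<lambda>z. (\<omega> z * v z) * partial 1 \<phi> z) z + partial \<i> (\<lambda>z. (\<omega> z * v z) * partial \<i> \<phi> z) z
   = \<omega> z * (gdot v \<phi> z + v z * lap \<phi> z) + v z * gdot \<omega> \<phi> z"
   unfolding partial_mult[OF d(3) dd[OF Basis_c(1)]] partial_mult[OF d(3) dd[OF Basis_c(2)]] partial_mult[OF d(1,2)] gdot_def lap_def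
   by (simp add: algebra_simps)
 qed
 moreover have "(LINT z|?L. \<omega> z * (gdot v \<phi> z + v z * lap \<phi> z) + v z * gdot \<omega> \<phi> z)
   = (LINT z|?L. \<omega> z * (gdot v \<phi> z + v z * lap \<phi> z)) + (LINT z|?L. v z * gdot \<omega> \<phi> z)"
 proof (rule Bochner_Integration.integral_add)
  show "integrable ?L (\<lambda>z. \<omega> z * (gdot v \<phi> z + v z * lap \<phi> z))"
   by (rule integrable_continuous_disc[OF C(1,2)])
     (use C(3) in \<open>auto intro!: continuous_on_mult continuous_on_add gdot_continuous[OF v p] lap_continuous[OF p] smooth_on_continuous[OF w] smooth_on_continuous[OF v]\<close>)
  show "integrable ?L (\<lambda>z. v z * gdot \<omega> \<phi> z)"
   by (rule integrable_continuous_disc[OF C(1,2)])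
     (use gdot_zero_outside[OF C(1,3)] in \<open>auto intro!: continuous_on_mult gdot_continuous[OF w p] smooth_on_continuous[OF v]\<close>)
 qed
 ultimately show ?thesis by linarith
qed

text \<open>Conformal invariance of the Dirichlet integrand: by the Cauchy-Riemann equations the
  differential is a similarity, and the square of its ratio, 1 / (den i z)^2, is also the
  Jacobian.\<close>

lemma gdot_gen:
 assumes z: "z \<in> disc" and a: "a differentiable (at (gen i z))" and b: "b differentiable (at (gen i z))"
 shows "gdot (\<lambda>z. a (gen i z)) (\<lambda>z. b (gen i z)) z = gdot a b (gen i z) / (den i z)^2"
proof -
 define c where "c = 1 / (cden i z)^2"
 have g: "(gen i has_derivative (*) c) (at z)"
  using gen_has_field_derivative[OF z] by (simp add: has_field_derivative_def c_def)
 have p: "partial 1 (\<lambda>z. f (gen i z)) z = Re c * partial 1 f (gen i z) + Im c * partial \<i> f (gen i z)"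
  "partial \<i> (\<lambda>z. f (gen i z)) z = - Im c * partial 1 f (gen i z) + Re c * partial \<i> f (gen i z)"
  if df: "f differentiable (at (gen i z))" for f
 proof -
  obtain D where D: "(f has_derivative D) (at (gen i z))" using df unfolding differentiable_def by blast
  have "((\<lambda>z. f (gen i z)) has_derivative (\<lambda>h. D (c * h))) (at z)"
   by (rule has_derivative_compose[OF g D])
  from partial_eqI[OF this] show
   "partial 1 (\<lambda>z. f (gen i z)) z = Re c * partial 1 f (gen i z) + Im c * partial \<i> f (gen i z)"
   "partial \<i> (\<lambda>z. f (gen i z)) z = - Im c * partial 1 f (gen i z) + Re c * partial \<i> f (gen i z)"
   using has_derivative_partial_complex[OF D] by simp_all
 qed
 have "1 / (den i z)^2 = (cmod c)^2" by (simp add: c_def den_def norm_divide norm_power power_divide)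
 also have "\<dots> = Re c * Re c + Im c * Im c" unfolding cmod_power2 by (simp add: power2_eq_square)
 finally have e: "1 / (den i z)^2 = Re c * Re c + Im c * Im c" .
 have cc: "gdot a b (gen i z) / (den i z)^2 = (Re c * Re c + Im c * Im c) * gdot a b (gen i z)"
  unfolding e[symmetric] by simp
 show ?thesis unfolding cc unfolding gdot_def p[OF a] p[OF b] by (simp add: algebra_simps)
qed

section \<open>Cutoff functions for the sides and the corners\<close>

definition dstep :: "real \<Rightarrow> real" where "dstep = partial 1 sstep"

lemma sstep_differentiable: "sstep differentiable (at x)"
 using smooth_on_differentiable[OF smooth_on_sstep] by simp

lemma sstep_deriv: "(sstep has_real_derivative dstep x) (at x)"
proof -
 obtain D where "(sstep has_real_derivative D) (at x)"
  using sstep_differentiable[of x] unfolding real_differentiable_def by blast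
 then show ?thesis using partial_real_deriv by (auto simp: dstep_def)
qed

lemma dstep_even: "dstep (- s) = dstep s"
proof -
 have 1: "((\<lambda>s. sstep (- s)) has_real_derivative dstep (- s) * (- 1)) (at s)"
  by (rule DERIV_chain'[OF _ sstep_deriv]) (auto intro!: derivative_eq_intros)
 have 2: "((\<lambda>s. 1 - sstep s) has_real_derivative - dstep s) (at s)"
  using sstep_deriv by (auto intro!: derivative_eq_intros)
 have "(\<lambda>s. sstep (- s)) = (\<lambda>s. 1 - sstep s)" by (rule ext) (rule sstep_symm)
 from DERIV_unique[OF 1[unfolded this] 2] show ?thesis by simp
qed

lemma dstep_eq_0: "\<bar>s\<bar> > 1 \<Longrightarrow> dstep s = 0"
proof -
 have *: "dstep s = 0" if "s > 1" for s
 proof -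
  have "((\<lambda>s. 1) has_real_derivative 0) (at s)" by simp
  then have "(sstep has_real_derivative 0) (at s)"
   by (rule has_field_derivative_transform_within_open[where S="{1<..}"]) (use that sstep_1 in auto)
  then show ?thesis using DERIV_unique sstep_deriv by blast
 qed
 assume "\<bar>s\<bar> > 1"
 then show ?thesis using *[of s] *[of "-s"] dstep_even[of s] by (auto simp: abs_if split: if_splits)
qed

lemma smooth_dstep: "smooth_on UNIV dstep"
 unfolding dstep_def by (rule smooth_on_partial[OF smooth_on_sstep]) simp

definition dB :: real where "dB = (SOME M. M \<ge> 0 \<and> (\<forall>x. \<bar>dstep x\<bar> \<le> M))"

lemma dB: "dB \<ge> 0" "\<bar>dstep x\<bar> \<le> dB"
proof -
 have "continuous_on UNIV dstep" by (rule smooth_on_continuous[OF smooth_dstep])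
 then obtain M where "M \<ge> 0" "\<And>x. \<bar>dstep x\<bar> \<le> M"
  by (rule bounded_continuous_compact_support[of _ "cball 0 1"]) (auto intro: dstep_eq_0)
 then have "\<exists>M. M \<ge> 0 \<and> (\<forall>x. \<bar>dstep x\<bar> \<le> M)" by blast
 then have "dB \<ge> 0 \<and> (\<forall>x. \<bar>dstep x\<bar> \<le> dB)" unfolding dB_def by (rule someI_ex)
 then show "dB \<ge> 0" "\<bar>dstep x\<bar> \<le> dB" by auto
qed

lemma sstep_lipschitz: "\<bar>sstep x - sstep y\<bar> \<le> dB * \<bar>x - y\<bar>"
proof -
 have *: "\<bar>sstep y - sstep x\<bar> \<le> dB * \<bar>y - x\<bar>" if xy: "x < y" for x y
 proof -
  have "\<exists>z. x < z \<and> z < y \<and> sstep y - sstep x = (y - x) * dstep z"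
   by (rule MVT2[OF xy]) (rule sstep_deriv)
  then obtain z where "sstep y - sstep x = (y - x) * dstep z" by blast
  then have "\<bar>sstep y - sstep x\<bar> = \<bar>dstep z\<bar> * \<bar>y - x\<bar>" by (simp add: abs_mult)
  also have "\<dots> \<le> dB * \<bar>y - x\<bar>" by (rule mult_right_mono[OF dB(2)]) simp
  finally show ?thesis .
 qed
 show ?thesis using *[of x y] *[of y x] by (cases x y rule: linorder_cases) (auto simp: abs_minus_commute)
qed

text \<open>Since \<open>gen i\<close> turns \<open>den i\<close> into the reciprocal of
  \<open>den (i + 4)\<close>, the difference den - 1/den changes sign exactly under the side
  pairing; den - 1 would do so only to first order.\<close>

definition mm :: "nat \<Rightarrow> complex \<Rightarrow> real" where "mm i z = den i z - 1 / den i z"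

lemma smooth_den: "smooth_on disc (den i)"
proof -
 have d: "den i = (\<lambda>z. gb^2 * (cmod z)^2 + ga^2 + 2 * ga * gb * Re (cnj (dir i) * z))"
  by (rule ext) (rule den_eq)
 show ?thesis unfolding d
  by (intro smooth_on_add smooth_on_cmult smooth_on_const open_disc smooth_cmod_sq smooth_on_linear
    bounded_linear_compose[OF bounded_linear_Re bounded_linear_mult_right])
qed

lemma smooth_mm: "smooth_on disc (mm i)"
 unfolding mm_def[abs_def]
 by (intro smooth_on_diff smooth_on_divide smooth_on_const open_disc smooth_den) (metis den_pos less_irrefl)

lemma mm_opp: "z \<in> disc \<Longrightarrow> mm (i + 4) (gen i z) = - mm i z"
 by (simp add: mm_def den_opp)

lemma mm_sign:
 assumes "z \<in> disc" shows "mm i z > 0 \<longleftrightarrow> den i z > 1" "mm i z < 0 \<longleftrightarrow> den i z < 1"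
proof -
 have d: "den i z > 0" by (rule den_pos[OF assms])
 have "mm i z = (den i z + 1) * (den i z - 1) / den i z"
  using d by (simp add: mm_def field_simps power2_eq_square)
 then show "mm i z > 0 \<longleftrightarrow> den i z > 1" "mm i z < 0 \<longleftrightarrow> den i z < 1"
  using d by (auto simp: zero_less_divide_iff divide_less_0_iff zero_less_mult_iff mult_less_0_iff)
qed

text \<open>The squared modulus changes by (1 - |z|^2) (1 - 1/den) up to sign, and mm = (den + 1) (1
  - 1/den). On the side itself den = 1 and the modulus is preserved.\<close>

lemma gen_norm_diff:
 assumes "z \<in> disc" shows "\<bar>(cmod z)^2 - (cmod (gen i z))\<^sup>2\<bar> \<le> \<bar>mm i z\<bar>"
proof -
 have d: "den i z > 0" by (rule den_pos[OF assms])
 have R: "0 \<le> 1 - (cmod z)\<^sup>2" "1 - (cmod z)\<^sup>2 \<le> 1" using disc_pos[OF assms] by auto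
 have "(cmod z)^2 - (cmod (gen i z))\<^sup>2 = - (1 - (cmod z)\<^sup>2) * (1 - 1 / den i z)"
  using one_minus_gen[OF assms, of i] by (simp add: algebra_simps diff_divide_distrib)
 then have "\<bar>(cmod z)^2 - (cmod (gen i z))\<^sup>2\<bar> = (1 - (cmod z)\<^sup>2) * \<bar>1 - 1 / den i z\<bar>"
  using R by (simp add: abs_mult)
 also have "\<dots> \<le> 1 * \<bar>1 - 1 / den i z\<bar>" using R by (intro mult_right_mono) auto
 also have "\<dots> \<le> (den i z + 1) * \<bar>1 - 1 / den i z\<bar>" using d by (intro mult_right_mono) auto
 also have "\<dots> = \<bar>mm i z\<bar>"
 proof -
  have "mm i z = (den i z + 1) * (1 - 1 / den i z)" using d by (simp add: mm_def field_simps)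
  then show ?thesis using d by (simp add: abs_mult)
 qed
 finally show ?thesis .
qed

text \<open>With s = (sqrt 2 / 2 - |z|^2) / \<delta>, the argument 2 s - 3 runs through [-1,1] as s
  runs through [1,2]: the cutoff is 0 for s <= 1, in particular on and beyond the circle through the
  vertices, and 1 for s >= 2.\<close>

definition cut :: "real \<Rightarrow> complex \<Rightarrow> real" where
 "cut \<delta> z = sstep (2 * ((sqrt 2 / 2 - (cmod z)\<^sup>2) / \<delta>) - 3)"

definition C0 :: "complex set" where "C0 = cball 0 (sqrt (sqrt 2 / 2))"

lemma C0: "compact C0" "C0 \<subseteq> disc"
proof -
 show "compact C0" by (simp add: C0_def)
 have "sqrt (sqrt 2 / 2) < 1" using sqrt2_bounds by (simp add: real_sqrt_lt_1_iff)
 then show "C0 \<subseteq> disc" unfolding C0_def by (rule cball_disc)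
qed

lemma C0_iff: "z \<in> C0 \<longleftrightarrow> (cmod z)\<^sup>2 \<le> sqrt 2 / 2"
 unfolding C0_def using real_le_rsqrt[of "cmod z" "sqrt 2 / 2"] power_mono[of "cmod z" "sqrt (sqrt 2 / 2)" 2] by auto

lemma smooth_cut: assumes "open S" shows "smooth_on S (cut \<delta>)"
proof -
 have "smooth_on S (\<lambda>z. (2 * inverse \<delta>) * (sqrt 2 / 2 - (cmod z)\<^sup>2) - 3)"
  by (intro smooth_on_diff smooth_on_cmult smooth_on_const assms smooth_cmod_sq)
 then have "smooth_on S (\<lambda>z. sstep ((2 * inverse \<delta>) * (sqrt 2 / 2 - (cmod z)\<^sup>2) - 3))"
  by (rule smooth_on_compose[OF smooth_on_sstep assms open_UNIV subset_UNIV])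
 moreover have "(2 * inverse \<delta>) * x = 2 * (x / \<delta>)" for x by (simp add: divide_inverse)
 ultimately show ?thesis unfolding cut_def[abs_def] by (simp only:)
qed

lemma cut_0: assumes "\<delta> > 0" "(cmod z)^2 \<ge> sqrt 2 / 2 - \<delta>" shows "cut \<delta> z = 0"
proof -
 have "(sqrt 2 / 2 - (cmod z)\<^sup>2) / \<delta> \<le> 1" using assms by (simp add: divide_le_eq)
 then show ?thesis unfolding cut_def by (intro sstep_0) linarith
qed

lemma cut_1: assumes "\<delta> > 0" "(cmod z)^2 \<le> sqrt 2 / 2 - 2 * \<delta>" shows "cut \<delta> z = 1"
proof -
 have "(sqrt 2 / 2 - (cmod z)\<^sup>2) / \<delta> \<ge> 2" using assms by (simp add: le_divide_eq)
 then show ?thesis unfolding cut_def by (intro sstep_1) linarith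
qed

lemma cut_bounds: "0 \<le> cut \<delta> z" "cut \<delta> z \<le> 1" by (simp_all add: cut_def sstep_nonneg sstep_le_1)

lemma cut_C0: "\<delta> > 0 \<Longrightarrow> z \<notin> C0 \<Longrightarrow> cut \<delta> z = 0"
 by (rule cut_0) (auto simp: C0_iff)

lemma cut_lipschitz:
 assumes "\<delta> > 0" shows "\<bar>cut \<delta> z - cut \<delta> w\<bar> \<le> 2 * dB / \<delta> * \<bar>(cmod z)^2 - (cmod w)\<^sup>2\<bar>"
proof -
 let ?A = "(2 * ((sqrt 2 / 2 - (cmod z)\<^sup>2) / \<delta>) - 3)"
 let ?B = "(2 * ((sqrt 2 / 2 - (cmod w)\<^sup>2) / \<delta>) - 3)"
 have "\<bar>cut \<delta> z - cut \<delta> w\<bar> \<le> dB * \<bar>?A - ?B\<bar>"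
  unfolding cut_def by (rule sstep_lipschitz)
 also have "?A - ?B = (2 / \<delta>) * ((cmod w)^2 - (cmod z)\<^sup>2)"
  by (simp add: diff_divide_distrib algebra_simps)
 also have "\<bar>\<dots>\<bar> = (2 / \<delta>) * \<bar>(cmod z)^2 - (cmod w)\<^sup>2\<bar>" unfolding abs_mult using assms by (simp add: abs_minus_commute)
 finally show ?thesis by (simp add: algebra_simps)
qed

lemma dct_disc:
 fixes s :: "nat \<Rightarrow> complex \<Rightarrow> real"
 assumes c: "\<And>n. continuous_on disc (s n)" and C: "compact C" "C \<subseteq> disc" "\<And>n z. z \<in> disc - C \<Longrightarrow> s n z = 0"
  and B: "\<And>n z. z \<in> C \<Longrightarrow> \<bar>s n z\<bar> \<le> B"
  and lim: "AE z in lD. (\<lambda>n. s n z) \<longlonglongrightarrow> f z" and f: "f \<in> borel_measurable lD"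
 shows "(\<lambda>n. LINT z|lD. s n z) \<longlonglongrightarrow> (LINT z|lD. f z)"
proof (rule integral_dominated_convergence[where w="\<lambda>z. indicator C z * B"])
 show "s n \<in> borel_measurable lD" for n
  by (rule continuous_measurable_on[OF c]) auto
 have "integrable (lebesgue_on C) (\<lambda>z. indicator C z * B)"
  using finite_measure.integrable_const[OF finite_measure_lebesgue_on[OF lmeasurable_compact[OF C(1)]], of B]
  by (rule Bochner_Integration.integrable_cong[THEN iffD1, rotated 2]) auto
 then show "integrable lD (\<lambda>z. indicator C z * B)"
  by (subst restrict_zero_outside(1)[OF _ _ C(2)]) (use C(1) in \<open>auto simp: borel_compact\<close>)
 have "norm (s n z) \<le> indicator C z * B" if "z \<in> disc" for n z
  using B[of z n] C(3)[of z n] that by (cases "z \<in> C") auto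
 then show "AE z in lD. norm (s n z) \<le> indicator C z * B" for n by (intro AE_I2) simp
qed (use lim f in auto)

lemma continuous_bounded_on:
 fixes f :: "complex \<Rightarrow> real"
 assumes "compact C" "C \<subseteq> disc" "continuous_on disc f"
 obtains B where "B \<ge> 0" "\<And>z. z \<in> C \<Longrightarrow> \<bar>f z\<bar> \<le> B"
proof -
 have "bounded (f ` C)" using assms by (intro compact_imp_bounded compact_continuous_image) (auto intro: continuous_on_subset)
 then obtain M where "\<And>z. z \<in> C \<Longrightarrow> \<bar>f z\<bar> \<le> M" by (auto simp: bounded_iff)
 then show ?thesis using that[of "max M 0"] by fastforce
qed

lemma AE_disc_den_neq: "AE z in lD. \<forall>i<8. den i z \<noteq> 1"
proof -
 have "AE z in lebesgue. \<forall>i\<in>{..<8}. den i z \<noteq> 1"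
  by (rule AE_finite_allI) (auto simp: AE_den_neq_1)
 then show ?thesis by (auto simp: AE_restrict_space_iff elim!: eventually_mono)
qed

lemma partial_affine:
 assumes "a differentiable (at z)"
 shows "partial b (\<lambda>z. k * a z + c) z = k * partial b a z"
proof -
 obtain D where D: "(a has_derivative D) (at z)" using assms unfolding differentiable_def by blast
 have "((\<lambda>z. k * a z + c) has_derivative (\<lambda>h. k * D h)) (at z)"
  by (auto intro!: derivative_eq_intros D)
 from partial_eqI[OF this] partial_eqI[OF D] show ?thesis by simp
qed

lemma gdot_affine:
 assumes "a differentiable (at z)"
 shows "gdot (\<lambda>z. k * a z + c) \<phi> z = k * gdot a \<phi> z"
 unfolding gdot_def partial_affine[OF assms] by (simp add: algebra_simps)

text \<open>This displays the factor 2 / \<delta>, which has to be compensated by the area of the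
  corner regions.\<close>

lemma gdot_cut:
 assumes z: "z \<in> disc" shows "gdot (cut \<delta>) \<phi> z = dstep (2 * ((sqrt 2 / 2 - (cmod z)\<^sup>2) / \<delta>) - 3) * ((- 2 / \<delta>) * gdot (\<lambda>z. (cmod z)^2) \<phi> z)"
proof -
 define R where "R = (\<lambda>z::complex. (cmod z)^2)"
 define a where "a = (\<lambda>z. (- 2 / \<delta>) * R z + (sqrt 2 / \<delta> - 3))"
 have dR: "R differentiable (at z)" unfolding R_def
  by (rule smooth_on_differentiable[OF smooth_cmod_sq[OF open_disc] z])
 have ae: "2 * ((sqrt 2 / 2 - (cmod w)\<^sup>2) / \<delta>) - 3 = a w" for w
  by (simp add: a_def R_def diff_divide_distrib)
 have da: "a differentiable (at z)" unfolding a_def using dR by (intro differentiable_add differentiable_mult differentiable_const)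
 have "gdot (cut \<delta>) \<phi> z = gdot (\<lambda>w. sstep (a w)) \<phi> z" unfolding cut_def[abs_def] ae ..
 also have "\<dots> = dstep (a z) * gdot a \<phi> z"
  unfolding dstep_def by (rule gdot_compose[OF da sstep_differentiable])
 also have "gdot a \<phi> z = (- 2 / \<delta>) * gdot R \<phi> z"
  unfolding a_def by (rule gdot_affine[OF dR])
 finally show ?thesis unfolding ae R_def .
qed

text \<open>Near the octagon and away from its corners, at most one den i z is below 1, hence HH n tends
 to the indicator function of the octagon.\<close>

definition HH :: "nat \<Rightarrow> complex \<Rightarrow> real" where
 "HH n z = (\<Sum>i<8. sstep (real (Suc n) * mm i z)) - 7"

lemma smooth_HH: "smooth_on disc (HH n)"
proof -
 have "smooth_on disc (\<lambda>z. sstep (real (Suc n) * mm i z))" for i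
  by (rule smooth_on_compose[OF smooth_on_sstep open_disc open_UNIV subset_UNIV smooth_on_cmult[OF open_disc smooth_mm]])
 then show ?thesis unfolding HH_def[abs_def]
  by (intro smooth_on_diff smooth_on_sum smooth_on_const open_disc)
qed

lemma HH_bound: "\<bar>HH n z\<bar> \<le> 15"
proof -
 have "(\<Sum>i<8. sstep (real (Suc n) * mm i z)) \<le> (\<Sum>i<8::nat. 1)" by (rule sum_mono) (rule sstep_le_1)
 moreover have "(\<Sum>i<8. sstep (real (Suc n) * mm i z)) \<ge> 0" by (rule sum_nonneg) (rule sstep_nonneg)
 ultimately show ?thesis unfolding HH_def by simp
qed

text \<open>In the limit each step is 1 or 0 according to its side condition. Eight ones minus 7 is
  the value 1 inside the octagon; outside, exactly one step is 0, by \<open>at_most_one_den\<close>,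
  and the value is 0.\<close>

lemma HH_limit:
 assumes z: "z \<in> disc" "(cmod z)^2 < sqrt 2 / 2" and d: "\<And>i. i < 8 \<Longrightarrow> den i z \<noteq> 1"
 shows "(\<lambda>n. HH n z) \<longlonglongrightarrow> indicator Fund z"
proof -
 have ev: "\<forall>\<^sub>F n in sequentially. sstep (real (Suc n) * mm i z) = (if den i z > 1 then 1 else 0)" if i: "i < 8" for i
 proof -
  have m: "mm i z \<noteq> 0" using mm_sign[OF z(1), of i] d[OF i] by (cases "den i z > 1") auto
  obtain N :: nat where N: "1 / \<bar>mm i z\<bar> < real N" using reals_Archimedean2 by blast
  show ?thesis
  proof (rule eventually_sequentiallyI[of N])
   fix n assume "n \<ge> N"
   then have "1 / \<bar>mm i z\<bar> \<le> real (Suc n)" using N by linarith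
   then have b: "1 \<le> real (Suc n) * \<bar>mm i z\<bar>" using m by (simp add: divide_le_eq)
   show "sstep (real (Suc n) * mm i z) = (if den i z > 1 then 1 else 0)"
   proof (cases "den i z > 1")
    case True
    then have "mm i z > 0" using mm_sign[OF z(1)] by blast
    then show ?thesis using True b by (simp add: sstep_1)
   next
    case False
    then have "mm i z < 0" using mm_sign[OF z(1), of i] d[OF i] by (metis linorder_neqE_linordered_idom)
    then have "real (Suc n) * mm i z \<le> - 1" using b by simp
    then show ?thesis using False sstep_0 by simp
   qed
  qed
 qed
 have "\<forall>\<^sub>F n in sequentially. \<forall>i\<in>{..<8}. sstep (real (Suc n) * mm i z) = (if den i z > 1 then 1 else 0)"
  by (rule eventually_ball_finite) (use ev in auto)
 then have "\<forall>\<^sub>F n in sequentially. HH n z = (\<Sum>i<8. if den i z > 1 then 1 else 0) - 7"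
  by eventually_elim (simp add: HH_def)
 moreover have "(\<Sum>i<8::nat. if den i z > 1 then 1 else 0) - 7 = (indicator Fund z :: real)"
 proof (cases "z \<in> Fund")
  case True
  then have "den i z > 1" if "i < 8" for i using d[OF that] that by (force simp: Fund_eq)
  then have "(\<Sum>i<8::nat. if den i z > 1 then 1 else 0) = (\<Sum>i<8::nat. 1::real)" by (intro sum.cong) auto
  then show ?thesis using True by simp
 next
  case False
  then obtain j where j: "j < 8" "den j z < 1" using z(1) by (force simp: Fund_eq)
  have "(if den i z > 1 then 1 else 0) = (if i = j then 0 else 1::real)" if "i < 8" for i
  proof (cases "i = j")
   case True then show ?thesis using j by simp
  next
   case False
   have "den i z \<ge> 1" by (rule at_most_one_den[OF z j(1) that]) (use False j in auto)
   then show ?thesis using d[OF that] False by simp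
  qed
  then have "(\<Sum>i<8::nat. if den i z > 1 then 1 else 0) = (\<Sum>i<8::nat. if i = j then 0 else 1::real)" by (intro sum.cong) auto
  also have "\<dots> = (\<Sum>i\<in>{..<8} - {j}. 1)" using j(1) by (subst sum.remove[of _ j]) auto
  also have "\<dots> = 7" using j(1) by simp
  finally show ?thesis using False by simp
 qed
 ultimately show ?thesis by (auto intro: tendsto_eventually)
qed

lemma continuous_gen: "continuous_on disc (gen i)"
 by (rule DERIV_continuous_on[OF has_field_derivative_at_within[OF gen_has_field_derivative]])

lemma integral_indicator_Fund:
 fixes f :: "complex \<Rightarrow> real"
 shows "(LINT z|lD. indicator Fund z * f z) = (LINT z|lF. f z)"
proof -
 have "(LINT z|lD. indicator Fund z * f z) = (LINT z|lF. indicator Fund z * f z)"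
  by (rule restrict_zero_outside(2)[OF Fund_lebesgue disc_lebesgue Fund_disc]) simp
 also have "\<dots> = (LINT z|lF. f z)" by (rule lebesgue_on_cong_int) simp
 finally show ?thesis .
qed

section \<open>Boundary terms and Green's formula\<close>

context
 fixes v \<phi> :: "complex \<Rightarrow> real"
 assumes v: "smooth_on disc v" and p: "smooth_on disc \<phi>"
  and vi: "\<And>k z. k < 4 \<Longrightarrow> z \<in> disc \<Longrightarrow> v (gen k z) = v z"
  and pinv: "\<And>k z. k < 4 \<Longrightarrow> z \<in> disc \<Longrightarrow> \<phi> (gen k z) = \<phi> z"
begin

text \<open>The contribution of the i-th step of \<open>HH n\<close> to the gradient of the product
  cutoff. As n grows it concentrates on the i-th side, where it stands for the integral of v times
  the normal derivative of \<phi>.\<close>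

definition bt :: "real \<Rightarrow> nat \<Rightarrow> nat \<Rightarrow> complex \<Rightarrow> real" where
 "bt \<delta> n i z = cut \<delta> z * v z * (dstep (real (Suc n) * mm i z) * (real (Suc n) * gdot (mm i) \<phi> z))"

lemma boundary_continuous: "continuous_on disc (\<lambda>z. v z * (dstep (real (Suc n) * mm j z) * (real (Suc n) * gdot (mm j) \<phi> z)))"
proof -
 have "continuous_on disc (\<lambda>z. dstep (real (Suc n) * mm j z))"
  by (rule smooth_on_continuous[OF smooth_on_compose[OF smooth_dstep open_disc open_UNIV subset_UNIV smooth_on_cmult[OF open_disc smooth_mm]]])
 then show ?thesis
  by (intro continuous_on_mult gdot_continuous[OF smooth_mm p] continuous_on_const smooth_on_continuous[OF v])
qed

lemma boundary_integrable:
 assumes \<delta>: "\<delta> > 0" shows "integrable lD (bt \<delta> n i)"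
proof (rule integrable_continuous_disc[OF C0])
 show "continuous_on disc (bt \<delta> n i)"
  unfolding bt_def[abs_def] mult.assoc by (intro continuous_on_mult boundary_continuous smooth_on_continuous[OF smooth_cut[OF open_disc]])
 show "bt \<delta> n i z = 0" if "z \<in> disc - C0" for z using cut_C0[OF \<delta>, of z] that by (simp add: bt_def)
qed

text \<open>The boundary terms on the sides of index i and i + 4 cancel, up to the variation of the
 cutoff function, which is controlled because paired boundary points have the same modulus.\<close>

lemma side_pairing_limit:
 assumes i: "i < 4" and \<delta>: "\<delta> > 0"
 shows "(\<lambda>n. (LINT z|lD. bt \<delta> n i z) + (LINT z|lD. bt \<delta> n (i + 4) z)) \<longlonglongrightarrow> 0"
proof -
 let ?L = "lD"
 note Ti = boundary_integrable[OF \<delta>]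
 define D where "D = (\<lambda>n z. (cut \<delta> z - cut \<delta> (gen i z)) * (v z * (dstep (real (Suc n) * mm i z) * (real (Suc n) * gdot (mm i) \<phi> z))))"
 \<comment> \<open>The pull-back by \<open>gen i\<close> of the term of side i + 4: conformal
   invariance absorbs the Jacobian, \<open>mm\<close> changes sign inside an even function and once
   more in its gradient, and v and \<phi> are invariant. Only the cutoff is evaluated at a different
   point.\<close>
 have pull: "bt \<delta> n (i + 4) (gen i z) / (den i z)^2 = - (cut \<delta> (gen i z) * (v z * (dstep (real (Suc n) * mm i z) * (real (Suc n) * gdot (mm i) \<phi> z))))" if z: "z \<in> disc" for n z
 proof -
  have gz: "gen i z \<in> disc" by (rule gen_disc[OF z])
  have "gdot (mm (i + 4)) \<phi> (gen i z) / (den i z)^2 = gdot (\<lambda>z. mm (i + 4) (gen i z)) (\<lambda>z. \<phi> (gen i z)) z"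
   by (rule gdot_gen[OF z smooth_on_differentiable[OF smooth_mm gz] smooth_on_differentiable[OF p gz], symmetric])
  also have "\<dots> = gdot (\<lambda>z. (- 1) * mm i z + 0) \<phi> z"
   by (rule gdot_cong[OF _ _ z]) (use mm_opp pinv[OF i] in auto)
  also have "\<dots> = (- 1) * gdot (mm i) \<phi> z"
   by (rule gdot_affine[OF smooth_on_differentiable[OF smooth_mm z]])
  finally have g: "gdot (mm (i + 4)) \<phi> (gen i z) / (den i z)^2 = - gdot (mm i) \<phi> z" by simp
  have e: "dstep (real (Suc n) * mm (i + 4) (gen i z)) = dstep (real (Suc n) * mm i z)"
   unfolding mm_opp[OF z] mult_minus_right by (rule dstep_even)
  have alg: "c * w * (d * (N * x)) / D = c * w * (d * (N * (x / D)))" "c * w * (d * (N * (- x))) = - (c * (w * (d * (N * x))))"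
   for c w d N x D :: real by simp_all
  have "bt \<delta> n (i + 4) (gen i z) / (den i z)^2 = cut \<delta> (gen i z) * v (gen i z) * (dstep (real (Suc n) * mm (i + 4) (gen i z)) * (real (Suc n) * (gdot (mm (i + 4)) \<phi> (gen i z) / (den i z)^2)))"
   unfolding bt_def by (rule alg(1))
  also have "\<dots> = - (cut \<delta> (gen i z) * (v z * (dstep (real (Suc n) * mm i z) * (real (Suc n) * gdot (mm i) \<phi> z))))"
   unfolding g e vi[OF i z] by (rule alg(2))
  finally show ?thesis .
 qed
 have sumD: "(LINT z|?L. bt \<delta> n i z) + (LINT z|?L. bt \<delta> n (i + 4) z) = (LINT z|?L. D n z)" for n
 proof -
  have "(LINT z|?L. bt \<delta> n i z) + (LINT z|?L. bt \<delta> n (i + 4) z) = (LINT z|?L. bt \<delta> n i z) + (LINT z|?L. bt \<delta> n (i + 4) (gen i z) / (den i z)^2)"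
   using gen_change_of_variables(2)[OF Ti[of n "i+4"], of i] by simp
  also have "\<dots> = (LINT z|?L. bt \<delta> n i z + bt \<delta> n (i + 4) (gen i z) / (den i z)^2)"
   by (rule Bochner_Integration.integral_add[symmetric, OF Ti gen_change_of_variables(1)[OF Ti]])
  also have "\<dots> = (LINT z|?L. D n z)"
  proof (rule lebesgue_on_cong_int)
   fix z assume z: "z \<in> disc"
   show "bt \<delta> n i z + bt \<delta> n (i + 4) (gen i z) / (den i z)^2 = D n z"
    unfolding pull[OF z] unfolding D_def bt_def by (simp only: left_diff_distrib mult.assoc add_uminus_conv_diff)
  qed
  finally show ?thesis .
 qed
 \<comment> \<open>The integrand involves the cutoff at z and at \<open>gen i z\<close>, so its
   support lies in \<open>C0\<close> and in the preimage of \<open>C0\<close>, the image under the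
   inverse map \<open>gen (i + 4)\<close>.\<close>
 define C' where "C' = C0 \<union> gen (i + 4) ` C0"
 have C': "compact C'" "C' \<subseteq> disc"
 proof -
  have "compact (gen (i + 4) ` C0)"
   by (rule compact_continuous_image[OF continuous_on_subset[OF continuous_gen C0(2)] C0(1)])
  then show "compact C'" unfolding C'_def using C0(1) by (rule compact_Un[rotated])
  show "C' \<subseteq> disc" unfolding C'_def using C0(2) gen_disc by auto
 qed
 have Dc: "continuous_on disc (D n)" for n
  unfolding D_def
  by (intro continuous_on_mult boundary_continuous continuous_on_diff smooth_on_continuous[OF smooth_cut[OF open_disc]]
    continuous_on_compose2[OF smooth_on_continuous[OF smooth_cut[OF open_disc]] continuous_gen])
    (use gen_disc in auto)
 have D0: "D n z = 0" if z: "z \<in> disc - C'" for n z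
 proof -
  have "gen i z \<notin> C0"
  proof
   assume "gen i z \<in> C0"
   then have "gen (i + 4) (gen i z) \<in> C'" by (simp add: C'_def)
   then show False using gen_opp z by auto
  qed
  then show ?thesis using cut_C0[OF \<delta>] z by (simp add: D_def C'_def)
 qed
 have "continuous_on disc (\<lambda>z. v z * gdot (mm i) \<phi> z)"
  by (intro continuous_on_mult gdot_continuous[OF smooth_mm p] smooth_on_continuous[OF v])
 then obtain B where B: "B \<ge> 0" "\<And>z. z \<in> C' \<Longrightarrow> \<bar>v z * gdot (mm i) \<phi> z\<bar> \<le> B"
  using continuous_bounded_on[OF C'] by blast
 define K where "K = 2 * dB / \<delta>"
 have K: "K \<ge> 0" using dB(1) \<delta> by (simp add: K_def)
 \<comment> \<open>Where \<open>dstep\<close> is not 0, (n+1) |mm i z| <= 1. The difference of the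
   two cutoff values is at most K |mm i z|, which absorbs the factor n + 1 from the
   gradient.\<close>
 have Db: "\<bar>D n z\<bar> \<le> K * (dB * B)" if z: "z \<in> C'" for n z
 proof (cases "dstep (real (Suc n) * mm i z) = 0")
  case True
  then show ?thesis using K dB(1) B(1) by (simp add: D_def)
 next
  case False
  have zd: "z \<in> disc" using z C' by auto
  have "\<not> \<bar>real (Suc n) * mm i z\<bar> > 1" using dstep_eq_0 False by blast
  then have N: "real (Suc n) * \<bar>mm i z\<bar> \<le> 1" by (simp add: abs_mult)
  have "\<bar>cut \<delta> z - cut \<delta> (gen i z)\<bar> \<le> K * \<bar>mm i z\<bar>"
   using order_trans[OF cut_lipschitz[OF \<delta>, of z "gen i z"] mult_left_mono[OF gen_norm_diff[OF zd, of i] K[unfolded K_def]]]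
   by (simp add: K_def)
  then have 1: "real (Suc n) * \<bar>cut \<delta> z - cut \<delta> (gen i z)\<bar> \<le> real (Suc n) * (K * \<bar>mm i z\<bar>)" by (rule mult_left_mono) simp
  also have "\<dots> = K * (real (Suc n) * \<bar>mm i z\<bar>)" by simp
  also have "\<dots> \<le> K * 1" using N K by (rule mult_left_mono)
  finally have 2: "real (Suc n) * \<bar>cut \<delta> z - cut \<delta> (gen i z)\<bar> \<le> K" by simp
  have "D n z = (real (Suc n) * (cut \<delta> z - cut \<delta> (gen i z))) * (dstep (real (Suc n) * mm i z) * (v z * gdot (mm i) \<phi> z))"
   by (simp add: D_def mult_ac)
  then have "\<bar>D n z\<bar> = (real (Suc n) * \<bar>cut \<delta> z - cut \<delta> (gen i z)\<bar>) * (\<bar>dstep (real (Suc n) * mm i z)\<bar> * \<bar>v z * gdot (mm i) \<phi> z\<bar>)"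
   by (simp only: abs_mult abs_of_nat)
  also have "\<dots> \<le> K * (dB * B)"
   by (intro mult_mono 2 dB(2) B(2)[OF z]) (use K dB(1) in auto)
  finally show ?thesis .
 qed
 have "(\<lambda>n. LINT z|?L. D n z) \<longlonglongrightarrow> (LINT z|?L. 0)"
 proof (rule dct_disc[OF Dc C' D0 Db])
  show "AE z in ?L. (\<lambda>n. D n z) \<longlonglongrightarrow> 0"
  proof (rule lebesgue_on_mono[OF AE_disc_den_neq])
   fix z assume d: "\<forall>i<8. den i z \<noteq> 1" and z: "z \<in> disc"
   have "den i z \<noteq> 1" using d i by simp
   then have m: "mm i z \<noteq> 0" using mm_sign[OF z, of i] by (cases "den i z > 1") auto
   obtain N :: nat where N: "1 / \<bar>mm i z\<bar> < real N" using reals_Archimedean2 by blast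
   show "(\<lambda>n. D n z) \<longlonglongrightarrow> 0"
   proof (rule tendsto_eventually, rule eventually_sequentiallyI[of N])
    fix n assume "n \<ge> N"
    then have "1 / \<bar>mm i z\<bar> < real (Suc n)" using N by linarith
    then have "1 < real (Suc n) * \<bar>mm i z\<bar>" using m by (simp add: divide_less_eq)
    then have "dstep (real (Suc n) * mm i z) = 0" by (intro dstep_eq_0) (simp add: abs_mult)
    then show "D n z = 0" by (simp add: D_def)
   qed
  qed
 qed auto
 then show ?thesis unfolding sumD by simp
qed

text \<open>Integration by parts with the cutoff \<open>cut \<delta>\<close> times
  \<open>HH n\<close>, and the limit n to infinity. The terms of opposite sides cancel in the limit,
  and only the gradient of the corner cutoff remains.\<close>

lemma Green_cut:
 assumes \<delta>: "\<delta> > 0"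
 shows "(LINT z|lF. cut \<delta> z * (gdot v \<phi> z + v z * lap \<phi> z)) = - (LINT z|lF. v z * gdot (cut \<delta>) \<phi> z)"
proof -
 let ?L = "lD"
 define G where "G = (\<lambda>z. gdot v \<phi> z + v z * lap \<phi> z)"
 have Gc: "continuous_on disc G"
  unfolding G_def by (intro continuous_on_add continuous_on_mult gdot_continuous[OF v p] lap_continuous[OF p] smooth_on_continuous[OF v])
 have cs: "smooth_on disc (cut \<delta>)" by (rule smooth_cut[OF open_disc])
 have cc: "continuous_on disc (cut \<delta>)" by (rule smooth_on_continuous[OF cs])
 have c0: "cut \<delta> z = 0" if "z \<in> disc - C0" for z using cut_C0[OF \<delta>] that by auto
 let ?B = "(cut \<delta>)"
 have gc: "continuous_on disc (\<lambda>z. v z * gdot ?B \<phi> z)"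
  by (intro continuous_on_mult gdot_continuous[OF cs p] smooth_on_continuous[OF v])
 have g0: "gdot ?B \<phi> z = 0" if "z \<in> disc - C0" for z
  by (rule gdot_zero_outside[OF C0(1) c0 that])
 \<comment> \<open>\<open>HH n\<close> converges to the indicator of the octagon only inside the
   circle through the vertices; beyond it the gradient of the cutoff has to vanish too.\<close>
 have g1: "gdot ?B \<phi> z = 0" if z: "z \<in> disc" "(cmod z)^2 > sqrt 2 / 2 - \<delta>" for z
 proof -
  have o: "open {z::complex. (cmod z)^2 > sqrt 2 / 2 - \<delta>}" by (intro open_Collect_less continuous_intros)
  have "partial d ?B z = 0" for d
   by (rule partial_eq_0_open[OF o]) (use z cut_0[OF \<delta>] in auto)
  then show ?thesis by (simp add: gdot_def)
 qed
 have Hc: "continuous_on disc (HH n)" for n by (rule smooth_on_continuous[OF smooth_HH])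
 note Ti = boundary_integrable[OF \<delta>]
 let ?P = "\<lambda>n z. (cut \<delta> z * HH n z) * G z"
 let ?Q = "\<lambda>n z. v z * HH n z * gdot (cut \<delta>) \<phi> z"
 let ?R = "\<lambda>z. indicator Fund z * (cut \<delta> z * G z)"
 let ?S = "\<lambda>z. indicator Fund z * (v z * gdot (cut \<delta>) \<phi> z)"
 have id: "(LINT z|?L. ?P n z) = - (LINT z|?L. ?Q n z) - (\<Sum>i<8. LINT z|?L. bt \<delta> n i z)" for n
 proof -
  let ?A = "(\<lambda>z. cut \<delta> z * HH n z)"
  have "(LINT z|?L. ?P n z) = - (LINT z|?L. v z * gdot ?A \<phi> z)"
   unfolding G_def by (rule integration_by_parts_disc[OF smooth_on_mult[OF open_disc cs smooth_HH] v p C0]) (use c0 in auto)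
  also have "(LINT z|?L. v z * gdot ?A \<phi> z) = (LINT z|?L. ?Q n z + (\<Sum>i<8. bt \<delta> n i z))"
  proof (rule lebesgue_on_cong_int)
   fix z assume z: "z \<in> disc"
   have md: "mm i differentiable (at z)" for i by (rule smooth_on_differentiable[OF smooth_mm z])
   have "((\<lambda>z. HH n z) has_derivative (\<lambda>h. \<Sum>i<8. frechet_derivative (\<lambda>z. sstep (real (Suc n) * mm i z)) (at z) h)) (at z)"
   proof -
    have sd: "(\<lambda>z. sstep (real (Suc n) * mm i z)) differentiable (at z)" for i
     by (rule smooth_on_differentiable[OF smooth_on_compose[OF smooth_on_sstep open_disc open_UNIV subset_UNIV smooth_on_cmult[OF open_disc smooth_mm]] z])
    have "((\<lambda>z. (\<Sum>i<8. sstep (real (Suc n) * mm i z)) - 7) has_derivative (\<lambda>h. (\<Sum>i<8. frechet_derivative (\<lambda>z. sstep (real (Suc n) * mm i z)) (at z) h) - 0)) (at z)"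
     by (intro has_derivative_diff has_derivative_sum has_derivative_const frechet_derivative_works[THEN iffD1] sd)
    then show ?thesis by (simp add: HH_def)
   qed
   from partial_eqI[OF this]
   have pH: "partial b (HH n) z = (\<Sum>i<8. partial b (\<lambda>z. sstep (real (Suc n) * mm i z)) z)" for b
    by (simp add: partial_def)
   have gi: "gdot (\<lambda>z. sstep (real (Suc n) * mm i z)) \<phi> z = dstep (real (Suc n) * mm i z) * (real (Suc n) * gdot (mm i) \<phi> z)" for i
   proof -
    let ?C = "(\<lambda>z. real (Suc n) * mm i z)"
    have "?C differentiable (at z)"
     by (rule smooth_on_differentiable[OF smooth_on_cmult[OF open_disc smooth_mm] z])
    from gdot_compose[OF this sstep_differentiable, of \<phi>]
    have "gdot (\<lambda>z. sstep (real (Suc n) * mm i z)) \<phi> z = dstep (real (Suc n) * mm i z) * gdot ?C \<phi> z"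
     by (simp only: dstep_def)
    also have "gdot ?C \<phi> z = real (Suc n) * gdot (mm i) \<phi> z"
     using gdot_affine[OF md, of "real (Suc n)" i 0 \<phi>] by simp
    finally show ?thesis .
   qed
   have gH: "gdot (HH n) \<phi> z = (\<Sum>i<8. gdot (\<lambda>z. sstep (real (Suc n) * mm i z)) \<phi> z)"
    unfolding gdot_def pH by (simp only: sum_distrib_right sum.distrib)
   have "gdot ?A \<phi> z = cut \<delta> z * gdot (HH n) \<phi> z + HH n z * gdot ?B \<phi> z"
    by (rule gdot_mult[OF smooth_on_differentiable[OF cs z] smooth_on_differentiable[OF smooth_HH z]])
   then have "v z * gdot ?A \<phi> z = ?Q n z + cut \<delta> z * v z * gdot (HH n) \<phi> z"
    by (simp add: algebra_simps)
   also have "cut \<delta> z * v z * gdot (HH n) \<phi> z = (\<Sum>i<8. bt \<delta> n i z)"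
    unfolding gH gi bt_def by (rule sum_distrib_left)
   finally show "v z * gdot ?A \<phi> z = ?Q n z + (\<Sum>i<8. bt \<delta> n i z)" .
  qed
  also have "\<dots> = (LINT z|?L. ?Q n z) + (LINT z|?L. (\<Sum>i<8. bt \<delta> n i z))"
  proof (rule Bochner_Integration.integral_add)
   show "integrable ?L (\<lambda>z. ?Q n z)"
    by (rule integrable_continuous_disc[OF C0])
      (use g0 in \<open>auto intro!: continuous_on_mult Hc gdot_continuous[OF cs p] smooth_on_continuous[OF v]\<close>)
   show "integrable ?L (\<lambda>z. \<Sum>i<8. bt \<delta> n i z)" by (rule Bochner_Integration.integrable_sum) (rule Ti)
  qed
  also have "(LINT z|?L. (\<Sum>i<8. bt \<delta> n i z)) = (\<Sum>i<8. LINT z|?L. bt \<delta> n i z)"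
   by (rule Bochner_Integration.integral_sum) (rule Ti)
  finally show ?thesis by simp
 qed
 obtain BG where BG: "BG \<ge> 0" "\<And>z. z \<in> C0 \<Longrightarrow> \<bar>G z\<bar> \<le> BG" using continuous_bounded_on[OF C0 Gc] by blast
 obtain Bg where Bg: "Bg \<ge> 0" "\<And>z. z \<in> C0 \<Longrightarrow> \<bar>v z * gdot ?B \<phi> z\<bar> \<le> Bg" using continuous_bounded_on[OF C0 gc] by blast
 have indm: "(\<lambda>z. indicator Fund z * f z) \<in> borel_measurable ?L" if "continuous_on disc f" for f :: "complex \<Rightarrow> real"
  by (intro borel_measurable_times continuous_measurable_on[OF that] borel_measurable_indicator)
    (auto simp: sets_restrict_space_iff Fund_disc)
 have L1: "(\<lambda>n. LINT z|?L. ?P n z) \<longlonglongrightarrow> (LINT z|?L. ?R z)"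
 proof (rule dct_disc[OF _ C0])
  show "continuous_on disc (\<lambda>z. ?P n z)" for n by (intro continuous_on_mult cc Hc Gc)
  show "?P n z = 0" if "z \<in> disc - C0" for n z using c0[OF that] by simp
  show "\<bar>?P n z\<bar> \<le> (1 * 15) * BG" if "z \<in> C0" for n z
   unfolding abs_mult using cut_bounds[of \<delta> z] HH_bound[of n z] BG(2)[OF that]
   by (intro mult_mono) auto
  show "AE z in ?L. (\<lambda>n. ?P n z) \<longlonglongrightarrow> ?R z"
  proof (rule lebesgue_on_mono[OF AE_disc_den_neq])
   fix z assume d: "\<forall>i<8. den i z \<noteq> 1" and z: "z \<in> disc"
   show "(\<lambda>n. ?P n z) \<longlonglongrightarrow> ?R z"
   proof (cases "(cmod z)^2 < sqrt 2 / 2")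
    case True
    have "(\<lambda>n. ?P n z) \<longlonglongrightarrow> (cut \<delta> z * indicator Fund z) * G z"
     by (intro tendsto_mult tendsto_const HH_limit[OF z True]) (use d in auto)
    then show ?thesis by (simp add: mult_ac)
   next
    case False
    then have "cut \<delta> z = 0" using cut_0[OF \<delta>, of z] \<delta> by auto
    then show ?thesis by simp
   qed
  qed
  show "(\<lambda>z. ?R z) \<in> borel_measurable ?L" by (intro indm continuous_on_mult cc Gc)
 qed
 have L2: "(\<lambda>n. LINT z|?L. ?Q n z) \<longlonglongrightarrow> (LINT z|?L. ?S z)"
 proof (rule dct_disc[OF _ C0])
  show "continuous_on disc (\<lambda>z. ?Q n z)" for n
   by (intro continuous_on_mult Hc gdot_continuous[OF cs p] smooth_on_continuous[OF v])
  show "?Q n z = 0" if "z \<in> disc - C0" for n z using g0[OF that] by simp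
  show "\<bar>?Q n z\<bar> \<le> 15 * Bg" if "z \<in> C0" for n z
  proof -
   have "\<bar>?Q n z\<bar> = \<bar>HH n z\<bar> * \<bar>v z * gdot ?B \<phi> z\<bar>" by (simp add: abs_mult)
   also have "\<dots> \<le> 15 * Bg" by (intro mult_mono HH_bound Bg(2)[OF that]) auto
   finally show ?thesis .
  qed
  show "AE z in ?L. (\<lambda>n. ?Q n z) \<longlonglongrightarrow> ?S z"
  proof (rule lebesgue_on_mono[OF AE_disc_den_neq])
   fix z assume d: "\<forall>i<8. den i z \<noteq> 1" and z: "z \<in> disc"
   show "(\<lambda>n. ?Q n z) \<longlonglongrightarrow> ?S z"
   proof (cases "(cmod z)^2 < sqrt 2 / 2")
    case True
    have "(\<lambda>n. ?Q n z) \<longlonglongrightarrow> v z * indicator Fund z * gdot ?B \<phi> z"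
     by (intro tendsto_mult tendsto_const HH_limit[OF z True]) (use d in auto)
    then show ?thesis by (simp add: mult_ac)
   next
    case False
    then have "gdot ?B \<phi> z = 0" using g1[OF z] \<delta> by auto
    then show ?thesis by simp
   qed
  qed
  show "(\<lambda>z. ?S z) \<in> borel_measurable ?L" by (rule indm[OF gc])
 qed
 have "(\<lambda>n. \<Sum>i<8. LINT z|?L. bt \<delta> n i z) \<longlonglongrightarrow> 0"
 proof -
  \<comment> \<open>The eight boundary terms are grouped into the four pairs i, i + 4.\<close>
  have "(\<lambda>n. \<Sum>i<4. (LINT z|?L. bt \<delta> n i z) + (LINT z|?L. bt \<delta> n (i + 4) z)) \<longlonglongrightarrow> (\<Sum>i<4::nat. 0)"
   by (rule tendsto_sum) (use side_pairing_limit[OF _ \<delta>] in auto)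
  moreover have s8: "(\<Sum>i<4. f i + f (i + 4)) = (\<Sum>i<8. f i)" for f :: "nat \<Rightarrow> real"
   by (simp add: eval_nat_numeral)
  have "(\<lambda>n. \<Sum>i<4. (LINT z|?L. bt \<delta> n i z) + (LINT z|?L. bt \<delta> n (i + 4) z)) = (\<lambda>n. \<Sum>i<8. LINT z|?L. bt \<delta> n i z)"
   by (rule ext) (rule s8)
  ultimately show ?thesis by (simp only: sum.neutral_const)
 qed
 from tendsto_diff[OF tendsto_minus[OF L2] this]
 have "(\<lambda>n. LINT z|?L. ?P n z) \<longlonglongrightarrow> - (LINT z|?L. ?S z) - 0"
  unfolding id .
 from LIMSEQ_unique[OF L1 this] show ?thesis unfolding integral_indicator_Fund G_def by simp
qed

text \<open>What the corner cutoff removes is of size O(1/\<delta>) on a set of area O(\<delta>^2),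
  so it disappears as \<delta> tends to 0.\<close>

theorem Green: "(LINT z|lF. gdot v \<phi> z + v z * lap \<phi> z) = 0"
proof -
 let ?F = "lF"
 define G where "G = (\<lambda>z. gdot v \<phi> z + v z * lap \<phi> z)"
 define Q where "Q = (\<lambda>z. v z * gdot (\<lambda>z. (cmod z)^2) \<phi> z)"
 have Gc: "continuous_on disc G"
  unfolding G_def by (intro continuous_on_add continuous_on_mult gdot_continuous[OF v p] lap_continuous[OF p] smooth_on_continuous[OF v])
 have Qc: "continuous_on disc Q"
  unfolding Q_def by (intro continuous_on_mult gdot_continuous[OF smooth_cmod_sq[OF open_disc] p] smooth_on_continuous[OF v])
 obtain B1 where B1: "B1 \<ge> 0" "\<And>z. z \<in> Fund \<Longrightarrow> \<bar>G z\<bar> \<le> B1"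
  using continuous_bounded_on[OF compact_Fund Fund_disc Gc] by blast
 obtain B2 where B2: "B2 \<ge> 0" "\<And>z. z \<in> Fund \<Longrightarrow> \<bar>Q z\<bar> \<le> B2"
  using continuous_bounded_on[OF compact_Fund Fund_disc Qc] by blast
 define u where "u = unit_ball_vol 2"
 have u: "u \<ge> 0" by (simp add: u_def)
 have ci: "integrable ?F f" if "continuous_on disc f" for f :: "complex \<Rightarrow> real"
  by (rule sqi_integrable[OF Fund_lmeasurable continuous_sqi[OF compact_Fund continuous_on_subset[OF that Fund_disc]]])
 have main: "\<bar>LINT z|?F. G z\<bar> \<le> (B1 + 2 * dB * B2 / \<delta>) * (16 * (u * (14 * \<delta>)^2))" if \<delta>: "0 < \<delta>" for \<delta>
 proof -
  define M where "M = B1 + 2 * dB * B2 / \<delta>"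
  have M: "M \<ge> 0" using B1 B2 dB(1) \<delta> by (simp add: M_def)
  \<comment> \<open>The cutoff is 1 up to squared modulus sqrt 2 / 2 - 2 \<delta>, so
    \<open>Fund_corner\<close> is applied with 2 \<delta> and gives the radius 14 \<delta>. The two
    families of balls are centred at the same set of vertices; counting each twice only affects the
    constant 16.\<close>
  define P where "P = (\<lambda>i. cball (dir i * Complex vp vq) (14 * \<delta>))"
  define P' where "P' = (\<lambda>i. cball (dir i * Complex vp (- vq)) (14 * \<delta>))"
  define f where "f = (\<lambda>z. (1 - cut \<delta> z) * G z - v z * gdot (cut \<delta>) \<phi> z)"
  have cc: "continuous_on disc (cut \<delta>)" by (rule smooth_on_continuous[OF smooth_cut[OF open_disc]])
  have gc: "continuous_on disc (\<lambda>z. v z * gdot (cut \<delta>) \<phi> z)"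
   by (intro continuous_on_mult gdot_continuous[OF smooth_cut[OF open_disc] p] smooth_on_continuous[OF v])
  have fc: "continuous_on disc f" unfolding f_def by (intro continuous_on_diff continuous_on_mult gc cc Gc continuous_on_const)
  have cG: "continuous_on disc (\<lambda>z. cut \<delta> z * G z)" by (intro continuous_on_mult cc Gc)
  have "(LINT z|?F. G z) = (LINT z|?F. f z + (cut \<delta> z * G z + v z * gdot (cut \<delta>) \<phi> z))"
   by (rule lebesgue_on_cong_int) (simp add: f_def algebra_simps)
  also have "\<dots> = (LINT z|?F. f z) + ((LINT z|?F. cut \<delta> z * G z) + (LINT z|?F. v z * gdot (cut \<delta>) \<phi> z))"
   using ci[OF fc] ci[OF cG] ci[OF gc] by (subst Bochner_Integration.integral_add) auto
  also have "\<dots> = (LINT z|?F. f z)" using Green_cut[OF \<delta>] by (simp add: G_def)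
  finally have e: "(LINT z|?F. G z) = (LINT z|?F. f z)" .
  have fb: "\<bar>f z\<bar> \<le> (\<Sum>i<8. M * indicator (P i) z + M * indicator (P' i) z)" if z: "z \<in> Fund" for z
  proof (cases "(cmod z)^2 < sqrt 2 / 2 - 2 * \<delta>")
   case True
   have "(sqrt 2 / 2 - (cmod z)\<^sup>2) / \<delta> > 2" using True \<delta> by (simp add: less_divide_eq)
   then have "dstep (2 * ((sqrt 2 / 2 - (cmod z)\<^sup>2) / \<delta>) - 3) = 0" by (intro dstep_eq_0) linarith
   then have "f z = 0" using z Fund_disc True cut_1[OF \<delta>] by (auto simp: f_def gdot_cut)
   then show ?thesis using M by (auto intro!: sum_nonneg)
  next
   case False
   then obtain i where i: "i < 8" "z \<in> P i \<or> z \<in> P' i"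
    using Fund_corner[OF z, of "2 * \<delta>"] \<delta> by (auto simp: P_def P'_def dist_commute)
   have zd: "z \<in> disc" using z Fund_disc by auto
   have 1: "\<bar>(1 - cut \<delta> z) * G z\<bar> \<le> 1 * B1"
    unfolding abs_mult by (intro mult_mono B1(2) z) (use cut_bounds[of \<delta> z] in auto)
   have 2: "\<bar>v z * gdot (cut \<delta>) \<phi> z\<bar> = \<bar>dstep (2 * ((sqrt 2 / 2 - (cmod z)\<^sup>2) / \<delta>) - 3)\<bar> * ((2 / \<delta>) * \<bar>Q z\<bar>)"
    unfolding gdot_cut[OF zd] Q_def using \<delta> by (simp add: abs_mult)
   have 3: "\<dots> \<le> dB * ((2 / \<delta>) * B2)"
    by (intro mult_mono dB B2(2) z order_refl) (use \<delta> in auto)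
   have "\<bar>f z\<bar> \<le> \<bar>(1 - cut \<delta> z) * G z\<bar> + \<bar>v z * gdot (cut \<delta>) \<phi> z\<bar>" unfolding f_def by (rule abs_triangle_ineq4)
   also have "\<dots> \<le> M" using 1 2 3 by (simp add: M_def mult_ac)
   also have "\<dots> \<le> M * indicator (P i) z + M * indicator (P' i) z" using i(2) M by (auto simp: indicator_def)
   also have "\<dots> \<le> (\<Sum>i<8. M * indicator (P i) z + M * indicator (P' i) z)"
    by (rule member_le_sum[where f="\<lambda>i. M * indicator (P i) z + M * indicator (P' i) z"]) (use i M in auto)
   finally show ?thesis .
  qed
  have ball_int: "integrable ?F (indicator (cball c (14 * \<delta>)) :: complex \<Rightarrow> real)"
   "(LINT z|?F. indicator (cball c (14 * \<delta>)) z) \<le> u * (14 * \<delta>)^2" for c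
  proof -
   have fin: "cball c (14 * \<delta>) \<inter> Fund \<in> lmeasurable"
    by (intro lmeasurable_compact compact_Int compact_Fund compact_cball)
   have "integrable lebesgue (indicator (cball c (14 * \<delta>) \<inter> Fund) :: complex \<Rightarrow> real)"
    using fin by (intro integrable_real_indicator) (auto simp: fmeasurable_def)
   moreover have "(indicator (cball c (14 * \<delta>) \<inter> Fund) :: complex \<Rightarrow> real) = (\<lambda>z. indicator Fund z *\<^sub>R indicator (cball c (14 * \<delta>)) z)"
    by (rule ext) (simp add: indicator_inter_arith mult.commute)
   ultimately have "integrable lebesgue (\<lambda>z. indicator Fund z *\<^sub>R (indicator (cball c (14 * \<delta>)) z :: real))"
    by (simp only:)
   then show "integrable ?F (indicator (cball c (14 * \<delta>)) :: complex \<Rightarrow> real)"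
    by (subst integrable_restrict_space) auto
   have "(LINT z|?F. indicator (cball c (14 * \<delta>)) z) = measure lebesgue (cball c (14 * \<delta>) \<inter> Fund)"
    using Fund_lebesgue by (simp add: measure_restrict_space)
   also have "\<dots> \<le> measure lebesgue (cball c (14 * \<delta>))"
    by (rule measure_mono_fmeasurable) (use Fund_lebesgue in auto)
   also have "\<dots> = u * (14 * \<delta>)^2" using content_cball[of "14 * \<delta>" c] \<delta> by (simp add: u_def power2_eq_square)
   finally show "(LINT z|?F. indicator (cball c (14 * \<delta>)) z) \<le> u * (14 * \<delta>)^2" .
  qed
  have si: "integrable ?F (\<lambda>z. \<Sum>i<8. M * indicator (P i) z + M * indicator (P' i) z)"
   unfolding P_def P'_def by (intro Bochner_Integration.integrable_sum Bochner_Integration.integrable_add integrable_mult_right ball_int)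
  have "\<bar>LINT z|?F. f z\<bar> \<le> (LINT z|?F. \<bar>f z\<bar>)"
   using integral_norm_bound[of ?F f] by simp
  also have "\<dots> \<le> (LINT z|?F. (\<Sum>i<8. M * indicator (P i) z + M * indicator (P' i) z))"
   by (rule integral_mono[OF integrable_abs[OF ci[OF fc]] si]) (use fb in auto)
  also have "\<dots> = (\<Sum>i<8. M * (LINT z|?F. indicator (P i) z) + M * (LINT z|?F. indicator (P' i) z))"
   unfolding P_def P'_def by (simp add: ball_int(1) Bochner_Integration.integral_sum Bochner_Integration.integral_add)
  also have "\<dots> \<le> (\<Sum>i<8::nat. M * (u * (14 * \<delta>)^2) + M * (u * (14 * \<delta>)^2))"
   unfolding P_def P'_def by (intro sum_mono add_mono mult_left_mono ball_int M)
  also have "\<dots> = M * (16 * (u * (14 * \<delta>)^2))" by simp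
  finally show ?thesis unfolding e M_def .
 qed
 have "((\<lambda>\<delta>::real. 16 * u * 196 * (B1 * \<delta>^2 + 2 * dB * B2 * \<delta>)) \<longlongrightarrow> 16 * u * 196 * (B1 * 0^2 + 2 * dB * B2 * 0)) (at_right 0)"
  by (intro tendsto_intros)
 moreover have "\<forall>\<^sub>F \<delta> in at_right 0. \<bar>LINT z|?F. G z\<bar> \<le> 16 * u * 196 * (B1 * \<delta>^2 + 2 * dB * B2 * \<delta>)"
 proof (rule eventually_at_right_less[THEN eventually_mono])
  fix \<delta> :: real assume d: "0 < \<delta>"
  have "(B1 + 2 * dB * B2 / \<delta>) * (16 * (u * (14 * \<delta>)^2)) = 16 * u * 196 * (B1 * \<delta>^2 + 2 * dB * B2 * \<delta>)"
   using d by (simp add: field_simps power2_eq_square)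
  then show "\<bar>LINT z|?F. G z\<bar> \<le> 16 * u * 196 * (B1 * \<delta>^2 + 2 * dB * B2 * \<delta>)" using main[OF d] by (simp only:)
 qed
 ultimately have "\<bar>LINT z|?F. G z\<bar> \<le> 16 * u * 196 * (B1 * 0^2 + 2 * dB * B2 * 0)"
  by (intro tendsto_lowerbound[of _ _ "at_right (0::real)"]) auto
 then show ?thesis by (simp add: G_def)
qed

end

section \<open>The energy space\<close>

lemma borel_measurable_AE_on:
 fixes f g :: "complex \<Rightarrow> 'b::euclidean_space"
 assumes S: "S \<in> sets lebesgue" and f: "f \<in> borel_measurable (lebesgue_on S)" and ae: "AE x in lebesgue_on S. g x = f x"
 shows "g \<in> borel_measurable (lebesgue_on S)"
proof -
 have "(\<lambda>x. if x \<in> S then f x else 0) \<in> borel_measurable lebesgue"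
  using f S by (simp add: borel_measurable_if)
 moreover have "AE x in lebesgue. (if x \<in> S then f x else 0) = (if x \<in> S then g x else 0)"
  using ae S by (auto simp: AE_restrict_space_iff elim!: eventually_mono)
 ultimately have "(\<lambda>x. if x \<in> S then g x else 0) \<in> borel_measurable lebesgue"
  by (rule borel_measurable_AE)
 then show ?thesis using S by (simp add: borel_measurable_if)
qed

lemma AE_lebesgue_on_subset:
 assumes "AE x in lebesgue_on T. P x" "S \<subseteq> T" "S \<in> sets lebesgue" "T \<in> sets lebesgue"
 shows "AE x in lebesgue_on S. P x"
 using assms by (auto simp: AE_restrict_space_iff elim!: eventually_mono)

lemma AE_Fund_interior:
 assumes "AE z in lebesgue_on (interior Fund). P z" shows "AE z in lF. P z"
proof -
 have "AE z in lebesgue. z \<notin> Fund - interior Fund"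
  by (rule AE_not_in[OF Fund_boundary_null])
 moreover have "AE z in lebesgue. z \<in> interior Fund \<longrightarrow> P z"
  using assms by (simp add: AE_restrict_space_iff)
 ultimately have "AE z in lebesgue. z \<in> Fund \<longrightarrow> P z" by eventually_elim auto
 then show ?thesis by (simp add: AE_restrict_space_iff)
qed

lemma integrable_complex_iff:
 fixes f :: "'a \<Rightarrow> complex"
 shows "integrable M f \<longleftrightarrow> integrable M (\<lambda>x. Re (f x)) \<and> integrable M (\<lambda>x. Im (f x))"
proof safe
 assume "integrable M (\<lambda>x. Re (f x))" "integrable M (\<lambda>x. Im (f x))"
 then have "integrable M (\<lambda>x. complex_of_real (Re (f x)) + \<i> * complex_of_real (Im (f x)))"
  by (intro Bochner_Integration.integrable_add integrable_mult_right integrable_of_real)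
 then show "integrable M f" by (simp add: complex_eq[symmetric])
qed auto

section \<open>Weak derivatives of complex functions\<close>

lemma L1_loc_iff: "u \<in> L1_loc U \<longleftrightarrow> l1loc U (\<lambda>z. Re (u z)) \<and> l1loc U (\<lambda>z. Im (u z))"
 unfolding L1_loc_def l1loc_def using integrable_complex_iff[of _ u] by blast

lemma test_fun_partial:
 assumes "test_fun U \<phi>" "b \<in> Basis" shows "test_fun U (partial b \<phi>)"
proof -
 obtain C where C: "compact C" "C \<subseteq> U" "\<And>x. x \<notin> C \<Longrightarrow> \<phi> x = 0" using test_fun_support[OF assms(1)] by blast
 have "{x. partial b \<phi> x \<noteq> 0} \<subseteq> C" using partial_zero_outside[of C \<phi>, OF compact_imp_closed[OF C(1)] C(3)] by blast
 then have s: "closure {x. partial b \<phi> x \<noteq> 0} \<subseteq> C" using C(1) by (simp add: closure_minimal compact_imp_closed)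
 moreover have "compact (closure {x. partial b \<phi> x \<noteq> 0})"
  using compact_Int_closed[OF C(1) closed_closure] s by (metis inf.absorb2)
 ultimately show ?thesis using assms C smooth_on_partial[of UNIV \<phi> b] by (auto simp: test_fun_def)
qed

lemma test_fun_funpow:
 assumes "test_fun U \<phi>" "b \<in> Basis" shows "test_fun U ((partial b ^^ i) \<phi>)"
 by (induction i) (use assms test_fun_partial in auto)

lemma test_fun_mono: "test_fun V \<phi> \<Longrightarrow> V \<subseteq> U \<Longrightarrow> test_fun U \<phi>"
 by (auto simp: test_fun_def)

lemma integrable_test_fun:
 assumes "open U" "test_fun U \<phi>" shows "l1loc U f \<Longrightarrow> integrable (lebesgue_on U) (\<lambda>z. \<phi> z * f z)"
  and "u \<in> L1_loc U \<Longrightarrow> integrable (lebesgue_on U) (\<lambda>z. \<phi> z *\<^sub>R u z)"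
proof -
 obtain C where C: "compact C" "C \<subseteq> U" "\<And>x. x \<notin> C \<Longrightarrow> \<phi> x = 0" using test_fun_support[OF assms(2)] by blast
 have "continuous_on U \<phi>" using assms(2) smooth_on_continuous continuous_on_subset unfolding test_fun_def by blast
 then have *: "l1loc U f \<Longrightarrow> integrable (lebesgue_on U) (\<lambda>z. \<phi> z * f z)" for f
  using integrable_mult_l1loc[OF assms(1) C(1,2)] C(3) by blast
 show "l1loc U f \<Longrightarrow> integrable (lebesgue_on U) (\<lambda>z. \<phi> z * f z)" by (rule *)
 assume u: "u \<in> L1_loc U"
 show "integrable (lebesgue_on U) (\<lambda>z. \<phi> z *\<^sub>R u z)"
  unfolding integrable_complex_iff using u *[of "\<lambda>z. Re (u z)"] *[of "\<lambda>z. Im (u z)"] by (auto simp: L1_loc_iff)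
qed

abbreviation "Dop i j \<phi> \<equiv> (partial 1 ^^ i) ((partial \<i> ^^ j) \<phi>)"

lemma test_fun_Dop: "test_fun U \<phi> \<Longrightarrow> test_fun U (Dop i j \<phi>)"
 by (intro test_fun_funpow Basis_c)

lemma weak_partial_Re_Im:
 assumes U: "open U" and w: "has_weak_partial U i j u v" and t: "test_fun U \<phi>"
 shows "(LINT z|lebesgue_on U. Dop i j \<phi> z * Re (u z)) = (- 1) ^ (i + j) * (LINT z|lebesgue_on U. \<phi> z * Re (v z))"
  and "(LINT z|lebesgue_on U. Dop i j \<phi> z * Im (u z)) = (- 1) ^ (i + j) * (LINT z|lebesgue_on U. \<phi> z * Im (v z))"
proof -
 have uv: "u \<in> L1_loc U" "v \<in> L1_loc U" using w by (auto simp: has_weak_partial_def)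
 have e: "(LINT z|lebesgue_on U. Dop i j \<phi> z *\<^sub>R u z) = complex_of_real ((- 1) ^ (i + j)) * (LINT z|lebesgue_on U. \<phi> z *\<^sub>R v z)"
  using w t by (simp add: has_weak_partial_def)
 have 1: "integrable (lebesgue_on U) (\<lambda>z. Dop i j \<phi> z *\<^sub>R u z)" by (rule integrable_test_fun(2)[OF U test_fun_Dop[OF t] uv(1)])
 have 2: "integrable (lebesgue_on U) (\<lambda>z. \<phi> z *\<^sub>R v z)" by (rule integrable_test_fun(2)[OF U t uv(2)])
 show "(LINT z|lebesgue_on U. Dop i j \<phi> z * Re (u z)) = (- 1) ^ (i + j) * (LINT z|lebesgue_on U. \<phi> z * Re (v z))"
  using arg_cong[OF e, of Re] integral_Re[OF 1] integral_Re[OF 2] unfolding Re_complex_of_real scaleR_complex.simps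
  by (simp only: times_complex.simps Re_complex_of_real Im_complex_of_real mult_zero_left diff_zero)
 show "(LINT z|lebesgue_on U. Dop i j \<phi> z * Im (u z)) = (- 1) ^ (i + j) * (LINT z|lebesgue_on U. \<phi> z * Im (v z))"
  using arg_cong[OF e, of Im] integral_Im[OF 1] integral_Im[OF 2] unfolding scaleR_complex.simps
  by (simp only: times_complex.simps Re_complex_of_real Im_complex_of_real mult_zero_left add_0_right)
qed

lemma l1loc_diff: "l1loc U u \<Longrightarrow> l1loc U v \<Longrightarrow> l1loc U (\<lambda>x. u x - v x)"
 by (simp add: l1loc_def)

text \<open>Test functions are real, so the defining identity splits into real and imaginary parts,
  and the fundamental lemma applies to each.\<close>

lemma weak_partial_unique:
 assumes U: "open U" and w: "has_weak_partial U i j u v" "has_weak_partial U i j u w"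
 shows "AE z in lebesgue_on U. v z = w z"
proof -
 have v: "l1loc U (\<lambda>z. Re (v z))" "l1loc U (\<lambda>z. Im (v z))" and ww: "l1loc U (\<lambda>z. Re (w z))" "l1loc U (\<lambda>z. Im (w z))"
  using w L1_loc_iff by (auto simp: has_weak_partial_def)
 have "AE z in lebesgue_on U. Re (v z) - Re (w z) = 0"
 proof (rule fundamental_lemma[OF U l1loc_diff[OF v(1) ww(1)]])
  fix \<phi> assume t: "test_fun U \<phi>"
  show "(LINT x|lebesgue_on U. \<phi> x * (Re (v x) - Re (w x))) = 0"
   using weak_partial_Re_Im(1)[OF U w(1) t] weak_partial_Re_Im(1)[OF U w(2) t]
    integrable_test_fun(1)[OF U t v(1)] integrable_test_fun(1)[OF U t ww(1)] by (simp add: right_diff_distrib)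
 qed
 moreover have "AE z in lebesgue_on U. Im (v z) - Im (w z) = 0"
 proof (rule fundamental_lemma[OF U l1loc_diff[OF v(2) ww(2)]])
  fix \<phi> assume t: "test_fun U \<phi>"
  show "(LINT x|lebesgue_on U. \<phi> x * (Im (v x) - Im (w x))) = 0"
   using weak_partial_Re_Im(2)[OF U w(1) t] weak_partial_Re_Im(2)[OF U w(2) t]
    integrable_test_fun(1)[OF U t v(2)] integrable_test_fun(1)[OF U t ww(2)] by (simp add: right_diff_distrib)
 qed
 ultimately show ?thesis by eventually_elim (simp add: complex_eq_iff)
qed

lemma L1_loc_cong_AE:
 assumes "open U" "u \<in> L1_loc U" "AE z in lebesgue_on U. u' z = u z" shows "u' \<in> L1_loc U"
 unfolding L1_loc_def
proof safe
 fix C assume C: "compact C" "C \<subseteq> U"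
 have CS: "C \<in> sets lebesgue" "U \<in> sets lebesgue" using C assms(1) by (auto simp: borel_compact borel_open)
 have a: "AE z in lebesgue_on C. u' z = u z" by (rule AE_lebesgue_on_subset[OF assms(3) C(2) CS])
 have i: "integrable (lebesgue_on C) u" using assms(2) C by (auto simp: L1_loc_def)
 have "u' \<in> borel_measurable (lebesgue_on C)"
  by (rule borel_measurable_AE_on[OF CS(1) borel_measurable_integrable[OF i] a])
 then show "integrable (lebesgue_on C) u'"
  using i a by (subst integrable_cong_AE[where g=u]) auto
qed

lemma L1_loc_mono: "u \<in> L1_loc U \<Longrightarrow> V \<subseteq> U \<Longrightarrow> u \<in> L1_loc V"
 by (auto simp: L1_loc_def)

lemma weak_partial_restrict:
 assumes U: "open U" and V: "open V" "V \<subseteq> U" and w: "has_weak_partial U i j u v" and e: "AE z in lebesgue_on V. u' z = u z"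
 shows "has_weak_partial V i j u' v"
 unfolding has_weak_partial_def
proof (intro conjI allI impI)
 have u: "u \<in> L1_loc V" and v: "v \<in> L1_loc V" using w V(2) L1_loc_mono by (auto simp: has_weak_partial_def)
 have S: "V \<in> sets lebesgue" "U \<in> sets lebesgue" using U V by auto
 show u': "u' \<in> L1_loc V" by (rule L1_loc_cong_AE[OF V(1) u e])
 show "v \<in> L1_loc V" by (rule v)
 fix \<phi> assume t: "test_fun V \<phi>"
 have tU: "test_fun U \<phi>" by (rule test_fun_mono[OF t V(2)])
 have z: "\<psi> x = 0" if "test_fun V \<psi>" "x \<notin> V" for \<psi> :: "complex \<Rightarrow> real" and x
  using that closure_subset[of "{x. \<psi> x \<noteq> 0}"] by (auto simp: test_fun_def)
 let ?A = "(LINT z|lebesgue_on V. Dop i j \<phi> z *\<^sub>R u' z)"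
 have "?A = (LINT z|lebesgue_on V. Dop i j \<phi> z *\<^sub>R u z)"
  by (rule integral_cong_AE)
    (use e borel_measurable_integrable[OF integrable_test_fun(2)[OF V(1) test_fun_Dop[OF t] u']]
     borel_measurable_integrable[OF integrable_test_fun(2)[OF V(1) test_fun_Dop[OF t] u]] in \<open>auto elim!: eventually_mono\<close>)
 also have "\<dots> = (LINT z|lebesgue_on U. Dop i j \<phi> z *\<^sub>R u z)"
  by (rule restrict_zero_outside(2)[symmetric, OF S V(2)]) (use z[OF test_fun_Dop[OF t]] in auto)
 also have "\<dots> = (- 1) ^ (i + j) * (LINT z|lebesgue_on U. \<phi> z *\<^sub>R v z)"
  using w tU by (simp add: has_weak_partial_def)
 also have "(LINT z|lebesgue_on U. \<phi> z *\<^sub>R v z) = (LINT z|lebesgue_on V. \<phi> z *\<^sub>R v z)"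
  by (rule restrict_zero_outside(2)[OF S V(2)]) (use z[OF t] in auto)
 finally show "?A = (- 1) ^ (i + j) * (LINT z|lebesgue_on V. \<phi> z *\<^sub>R v z)" .
qed

lemma L1_loc_diff: "u \<in> L1_loc U \<Longrightarrow> v \<in> L1_loc U \<Longrightarrow> (\<lambda>z. u z - v z) \<in> L1_loc U"
 by (auto simp: L1_loc_def)

lemma weak_partial_diff:
 assumes U: "open U" and w: "has_weak_partial U i j u v" "has_weak_partial U i j u' v'"
 shows "has_weak_partial U i j (\<lambda>z. u z - u' z) (\<lambda>z. v z - v' z)"
 unfolding has_weak_partial_def
proof (intro conjI allI impI)
 have l: "u \<in> L1_loc U" "v \<in> L1_loc U" "u' \<in> L1_loc U" "v' \<in> L1_loc U" using w by (auto simp: has_weak_partial_def)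
 show "(\<lambda>z. u z - u' z) \<in> L1_loc U" "(\<lambda>z. v z - v' z) \<in> L1_loc U" by (intro L1_loc_diff l)+
 fix \<phi> assume t: "test_fun U \<phi>"
 note i = integrable_test_fun(2)[OF U test_fun_Dop[OF t]] integrable_test_fun(2)[OF U t]
 show "(LINT z|lebesgue_on U. Dop i j \<phi> z *\<^sub>R (u z - u' z)) = (- 1) ^ (i + j) * (LINT z|lebesgue_on U. \<phi> z *\<^sub>R (v z - v' z))"
  unfolding scaleR_diff_right
  by (subst Bochner_Integration.integral_diff[OF i(1)[OF l(1)] i(1)[OF l(3)]],
    subst Bochner_Integration.integral_diff[OF i(2)[OF l(2)] i(2)[OF l(4)]])
    (use w t in \<open>simp add: has_weak_partial_def right_diff_distrib\<close>)
qed

lemma weak_partial_cnj: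
 assumes w: "has_weak_partial U i j u v"
 shows "has_weak_partial U i j (\<lambda>z. cnj (u z)) (\<lambda>z. cnj (v z))"
 unfolding has_weak_partial_def
proof (intro conjI allI impI)
 show "(\<lambda>z. cnj (u z)) \<in> L1_loc U" "(\<lambda>z. cnj (v z)) \<in> L1_loc U"
  using w by (auto simp: has_weak_partial_def L1_loc_def)
 fix \<phi> assume t: "test_fun U \<phi>"
 have c: "(LINT z|lebesgue_on U. f z *\<^sub>R cnj (g z)) = cnj (LINT z|lebesgue_on U. f z *\<^sub>R g z)" for f g
  unfolding Bochner_Integration.integral_cnj[symmetric] by simp
 show "(LINT z|lebesgue_on U. Dop i j \<phi> z *\<^sub>R cnj (u z)) = (- 1) ^ (i + j) * (LINT z|lebesgue_on U. \<phi> z *\<^sub>R cnj (v z))"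
  unfolding c using w t by (simp add: has_weak_partial_def)
qed

section \<open>Lifts to the disc and derivatives on the octagon\<close>

lemma L2_iff: "u \<in> L2 S \<longleftrightarrow> sqi S u" by (simp add: L2_def sqi_def)

lemma L2norm_nrm: "L2norm S u = nrm S u" by (simp add: L2norm_def nrm_def)

lemma sqi_Re_Im:
 fixes u :: "complex \<Rightarrow> complex"
 assumes "sqi S u" shows "sqi S (\<lambda>z. Re (u z))" "sqi S (\<lambda>z. Im (u z))"
proof -
 have m: "(\<lambda>z. Re (u z)) \<in> borel_measurable (lebesgue_on S)" "(\<lambda>z. Im (u z)) \<in> borel_measurable (lebesgue_on S)"
  using sqiD(1)[OF assms] by (auto intro: borel_measurable_Re borel_measurable_Im measurable_compose)
 have n: "norm ((norm (Re w))^2) \<le> norm ((norm w)^2)" "norm ((norm (Im w))^2) \<le> norm ((norm w)^2)" for w :: complex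
  unfolding real_norm_def abs_power2 by (rule power_mono[OF abs_Re_le_cmod abs_ge_zero], rule power_mono[OF abs_Im_le_cmod abs_ge_zero])
 show "sqi S (\<lambda>z. Re (u z))" unfolding sqi_def
  by (intro conjI m(1) Bochner_Integration.integrable_bound[OF sqiD(2)[OF assms] borel_measurable_norm_sq[OF m(1)]] AE_I2 n(1))
 show "sqi S (\<lambda>z. Im (u z))" unfolding sqi_def
  by (intro conjI m(2) Bochner_Integration.integrable_bound[OF sqiD(2)[OF assms] borel_measurable_norm_sq[OF m(2)]] AE_I2 n(2))
qed

text \<open>Names the lift and its square integrable weak derivatives, which membership in
  \<open>W 1\<close> only asserts to exist.\<close>

definition W1_lift :: "(complex \<Rightarrow> complex) \<Rightarrow> (complex \<Rightarrow> complex) \<Rightarrow> (nat \<Rightarrow> nat \<Rightarrow> complex \<Rightarrow> complex) \<Rightarrow> bool" where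
 "W1_lift u v d \<longleftrightarrow> (\<forall>i j. i + j \<le> 1 \<longrightarrow> d i j \<in> L2_loc disc \<and> has_weak_partial disc i j v (d i j)) \<and>
   (\<forall>g\<in>DDGroup. AE z in lD. v (g z) = v z) \<and> (AE z in lF. u z = v z)"

lemma W1_liftD:
 assumes "W1_lift u v d"
 shows "i + j \<le> 1 \<Longrightarrow> has_weak_partial disc i j v (d i j)" "i + j \<le> 1 \<Longrightarrow> d i j \<in> L2_loc disc"
  "g \<in> DDGroup \<Longrightarrow> AE z in lD. v (g z) = v z" "AE z in lF. u z = v z"
 using assms by (auto simp: W1_lift_def)

lemma W1_iff_lift: "u \<in> W 1 \<longleftrightarrow> (\<exists>v d. W1_lift u v d)"
proof
 assume "u \<in> W 1"
 then obtain v where v: "v \<in> H_loc 1 disc" "\<forall>g\<in>DDGroup. AE z in lD. v (g z) = v z" "AE z in lF. u z = v z"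
  by (auto simp: W_def)
 have "\<forall>i j. \<exists>d. i + j \<le> 1 \<longrightarrow> d \<in> L2_loc disc \<and> has_weak_partial disc i j v d"
  using v(1) by (auto simp: H_loc_def Bex_def)
 then obtain d where "\<forall>i j. i + j \<le> 1 \<longrightarrow> d i j \<in> L2_loc disc \<and> has_weak_partial disc i j v (d i j)" by metis
 then show "\<exists>v d. W1_lift u v d" using v(2,3) unfolding W1_lift_def by blast
next
 assume "\<exists>v d. W1_lift u v d"
 then show "u \<in> W 1" unfolding W1_lift_def W_def H_loc_def by blast
qed

lemma AE_Fund_to_interior: "AE z in lF. P z \<Longrightarrow> AE z in lebesgue_on (interior Fund). P z"
 by (erule AE_lebesgue_on_subset[OF _ interior_subset]) auto

text \<open>\<open>dF\<close> is a choice. Restricting the weak derivative of a lift to the interior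
  of the octagon shows that there is something to choose, hence that the chosen function is a weak
  derivative.\<close>

lemma W1_weak_partial:
 assumes "u \<in> W 1" "i + j \<le> 1"
 shows "has_weak_partial (interior Fund) i j u (dF i j u)"
proof -
 obtain v d where "W1_lift u v d" using assms(1) W1_iff_lift by blast
 note vd = W1_liftD(1,4)[OF this]
 have "has_weak_partial (interior Fund) i j u (d i j)"
  by (rule weak_partial_restrict[OF open_disc open_interior _ vd(1)[OF assms(2)] AE_Fund_to_interior[OF vd(2)]])
    (use Fund_disc interior_subset in blast)
 then show ?thesis unfolding dF_def weak_partial_def by (rule someI[of "has_weak_partial (interior Fund) i j u"])
qed

lemma dF_eqI:
 assumes "u \<in> W 1" "i + j \<le> 1" "has_weak_partial (interior Fund) i j u w"
 shows "AE z in lF. dF i j u z = w z"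
 by (rule AE_Fund_interior[OF weak_partial_unique[OF open_interior W1_weak_partial[OF assms(1,2)] assms(3)]])

lemma dF_diff:
 assumes "u \<in> W 1" "u' \<in> W 1" "(\<lambda>z. u z - u' z) \<in> W 1" "i + j \<le> 1"
 shows "AE z in lF. dF i j (\<lambda>z. u z - u' z) z = dF i j u z - dF i j u' z"
 by (rule dF_eqI[OF assms(3,4) weak_partial_diff[OF open_interior W1_weak_partial[OF assms(1,4)] W1_weak_partial[OF assms(2,4)]]])

lemma dF_cnj:
 assumes "u \<in> W 1" "(\<lambda>z. cnj (u z)) \<in> W 1" "i + j \<le> 1"
 shows "AE z in lF. dF i j (\<lambda>z. cnj (u z)) z = cnj (dF i j u z)"
 by (rule dF_eqI[OF assms(2,3) weak_partial_cnj[OF W1_weak_partial[OF assms(1,3)]]])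

lemma weak_partial_0_self: assumes "u \<in> L1_loc U" shows "has_weak_partial U 0 0 u u"
 using assms by (simp add: has_weak_partial_def)

lemma L2_loc_diff: "u \<in> L2_loc U \<Longrightarrow> v \<in> L2_loc U \<Longrightarrow> (\<lambda>z. u z - v z) \<in> L2_loc U"
 unfolding L2_loc_def L2_iff by (blast intro: sqi_diff)

lemma L2_loc_cnj: "u \<in> L2_loc U \<Longrightarrow> (\<lambda>z. cnj (u z)) \<in> L2_loc U"
 unfolding L2_loc_def L2_def by (auto intro!: borel_measurable_continuous_on[of cnj] continuous_intros)

lemma W1_diff: assumes "u \<in> W 1" "u' \<in> W 1" shows "(\<lambda>z. u z - u' z) \<in> W 1"
proof -
 obtain v d where "W1_lift u v d" using assms(1) W1_iff_lift by blast
 note v = W1_liftD[OF this]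
 obtain v' d' where "W1_lift u' v' d'" using assms(2) W1_iff_lift by blast
 note v' = W1_liftD[OF this]
 have "W1_lift (\<lambda>z. u z - u' z) (\<lambda>z. v z - v' z) (\<lambda>i j z. d i j z - d' i j z)"
  unfolding W1_lift_def
 proof (intro conjI allI impI ballI)
  show "(\<lambda>z. d i j z - d' i j z) \<in> L2_loc disc" if "i + j \<le> 1" for i j by (rule L2_loc_diff[OF v(2)[OF that] v'(2)[OF that]])
  show "has_weak_partial disc i j (\<lambda>z. v z - v' z) (\<lambda>z. d i j z - d' i j z)" if "i + j \<le> 1" for i j
   by (rule weak_partial_diff[OF open_disc v(1)[OF that] v'(1)[OF that]])
  show "AE z in lD. v (g z) - v' (g z) = v z - v' z" if g: "g \<in> DDGroup" for g
   using v(3)[OF g] v'(3)[OF g] by eventually_elim simp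
  show "AE z in lF. u z - u' z = v z - v' z"
   using v(4) v'(4) by eventually_elim simp
 qed
 then show ?thesis using W1_iff_lift by blast
qed

lemma W1_cnj: assumes "u \<in> W 1" shows "(\<lambda>z. cnj (u z)) \<in> W 1"
proof -
 obtain v d where "W1_lift u v d" using assms W1_iff_lift by blast
 note v = W1_liftD[OF this]
 have "W1_lift (\<lambda>z. cnj (u z)) (\<lambda>z. cnj (v z)) (\<lambda>i j z. cnj (d i j z))"
  unfolding W1_lift_def
 proof (intro conjI allI impI ballI)
  show "(\<lambda>z. cnj (d i j z)) \<in> L2_loc disc" if "i + j \<le> 1" for i j by (rule L2_loc_cnj[OF v(2)[OF that]])
  show "has_weak_partial disc i j (\<lambda>z. cnj (v z)) (\<lambda>z. cnj (d i j z))" if "i + j \<le> 1" for i j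
   by (rule weak_partial_cnj[OF v(1)[OF that]])
  show "AE z in lD. cnj (v (g z)) = cnj (v z)" if g: "g \<in> DDGroup" for g
   using v(3)[OF g] by eventually_elim simp
  show "AE z in lF. cnj (u z) = cnj (v z)"
   using v(4) by eventually_elim simp
 qed
 then show ?thesis using W1_iff_lift by blast
qed

text \<open>A real component of an element of the energy space, with its weak gradient on the disc.\<close>

definition rep :: "(complex \<Rightarrow> real) \<Rightarrow> (complex \<Rightarrow> real) \<Rightarrow> (complex \<Rightarrow> real) \<Rightarrow> bool" where
 "rep f fx fy \<longleftrightarrow> wp f fx fy \<and> sqi CF f \<and> sqi CF fx \<and> sqi CF fy \<and>
   (\<forall>k<4. AE z in lD. f (gen k z) = f z)"

lemma W1_rep:
 assumes u: "u \<in> W 1"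
 obtains f fx fy g gx gy where "rep f fx fy" "rep g gx gy"
  "AE z in lF. u z = Complex (f z) (g z)"
  "AE z in lF. dF 1 0 u z = Complex (fx z) (gx z)"
  "AE z in lF. dF 0 1 u z = Complex (fy z) (gy z)"
proof -
 obtain v d where "W1_lift u v d" using u W1_iff_lift by blast
 note v = W1_liftD[OF this]
 have l: "v \<in> L1_loc disc" "d i j \<in> L1_loc disc" if "i + j \<le> 1" for i j
  using v(1)[OF that] by (auto simp: has_weak_partial_def)
 \<comment> \<open>A locally integrable function is its own weak derivative of order 0; by
   uniqueness the lift inherits the square integrability of \<open>d 0 0\<close>.\<close>
 have vd: "AE z in lD. v z = d 0 0 z"
  by (rule weak_partial_unique[OF open_disc weak_partial_0_self v(1)]) (use l[of 0 0] in auto)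
 have sd: "sqi CF (d i j)" if "i + j \<le> 1" for i j
  using v(2)[OF that] CF_compact CF_disc by (auto simp: L2_loc_def L2_iff)
 have vm: "v \<in> borel_measurable (lebesgue_on CF)"
  using l(1)[of 0 0] CF_compact CF_disc borel_measurable_integrable by (auto simp: L1_loc_def)
 have sv: "sqi CF v"
 proof (rule sqi_cong_AE[OF sd[of 0 0] _ vm])
  show "AE x in lebesgue_on CF. d 0 0 x = v x"
   using AE_lebesgue_on_subset[OF vd CF_disc CF_sets disc_lebesgue] by eventually_elim simp
 qed simp
 have inv: "AE z in lD. v (gen k z) = v z" if k: "k < 4" for k
 proof (rule lebesgue_on_mono[OF v(3)[OF gen_in_DDGroup[OF k]]])
  fix z assume "v (restrict (gen k) disc z) = v z" "z \<in> disc"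
  then show "v (gen k z) = v z" by simp
 qed
 have invr: "AE z in lD. Re (v (gen k z)) = Re (v z)" "AE z in lD. Im (v (gen k z)) = Im (v z)" if "k < 4" for k
  using inv[OF that] by (auto elim!: eventually_mono)
 have "rep (\<lambda>z. Re (v z)) (\<lambda>z. Re (d 1 0 z)) (\<lambda>z. Re (d 0 1 z))"
  unfolding rep_def wp_def
  using l[of 0 0] l[of 1 0] l[of 0 1] weak_partial_Re_Im(1)[OF open_disc v(1)[of 1 0]] weak_partial_Re_Im(1)[OF open_disc v(1)[of 0 1]]
   sqi_Re_Im(1)[OF sv] sqi_Re_Im(1)[OF sd[of 1 0]] sqi_Re_Im(1)[OF sd[of 0 1]] invr(1)
  by (auto simp: L1_loc_iff)
 moreover have "rep (\<lambda>z. Im (v z)) (\<lambda>z. Im (d 1 0 z)) (\<lambda>z. Im (d 0 1 z))"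
  unfolding rep_def wp_def
  using l[of 0 0] l[of 1 0] l[of 0 1] weak_partial_Re_Im(2)[OF open_disc v(1)[of 1 0]] weak_partial_Re_Im(2)[OF open_disc v(1)[of 0 1]]
   sqi_Re_Im(2)[OF sv] sqi_Re_Im(2)[OF sd[of 1 0]] sqi_Re_Im(2)[OF sd[of 0 1]] invr(2)
  by (auto simp: L1_loc_iff)
 moreover have "AE z in lF. dF i j u z = d i j z" if "i + j \<le> 1" for i j
  by (rule dF_eqI[OF u that weak_partial_restrict[OF open_disc open_interior _ v(1)[OF that] AE_Fund_to_interior[OF v(4)]]])
    (use Fund_disc interior_subset in blast)
 from this[of 1 0] this[of 0 1] have "AE z in lF. dF 1 0 u z = Complex (Re (d 1 0 z)) (Im (d 1 0 z))"
  "AE z in lF. dF 0 1 u z = Complex (Re (d 0 1 z)) (Im (d 0 1 z))" by simp_all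
 ultimately show ?thesis using that[of "\<lambda>z. Re (v z)" "\<lambda>z. Re (d 1 0 z)" "\<lambda>z. Re (d 0 1 z)" "\<lambda>z. Im (v z)" "\<lambda>z. Im (d 1 0 z)" "\<lambda>z. Im (d 0 1 z)"] v(4)
  by simp
qed

lemma sqi_Complex:
 assumes "sqi S f" "sqi S g" shows "sqi S (\<lambda>z::complex. Complex (f z) (g z))"
proof -
 have "sqi S (\<lambda>z. complex_of_real (h z))" if "sqi S h" for h :: "complex \<Rightarrow> real"
  using that by (auto simp: sqi_def intro: borel_measurable_of_real)
 from sqi_add[OF this[OF assms(1)] sqi_cmult[OF this[OF assms(2)], of \<i>]] show ?thesis by (simp add: Complex_eq)
qed

lemma sqi_AE:
 fixes f g :: "complex \<Rightarrow> complex"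
 assumes "sqi Fund f" "AE z in lF. g z = f z" shows "sqi Fund g"
 by (rule sqi_cong_AE[OF assms(1) _ borel_measurable_AE_on[OF Fund_lebesgue sqiD(1)[OF assms(1)] assms(2)]])
   (use assms(2) in \<open>auto elim!: eventually_mono\<close>)

lemma rep_Fund:
 assumes "rep f fx fy" shows "sqi Fund f" "sqi Fund fx" "sqi Fund fy"
 using assms sqi_subset(1)[OF _ rF(2) Fund_lebesgue CF_sets] by (auto simp: rep_def)

lemma W1_sqi:
 assumes u: "u \<in> W 1" shows "sqi Fund u" "sqi Fund (dF 1 0 u)" "sqi Fund (dF 0 1 u)"
proof -
 obtain f fx fy g gx gy where r: "rep f fx fy" "rep g gx gy"
  "AE z in lF. u z = Complex (f z) (g z)"
  "AE z in lF. dF 1 0 u z = Complex (fx z) (gx z)"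
  "AE z in lF. dF 0 1 u z = Complex (fy z) (gy z)"
  by (rule W1_rep[OF u])
 show "sqi Fund u" by (rule sqi_AE[OF sqi_Complex[OF rep_Fund(1)[OF r(1)] rep_Fund(1)[OF r(2)]] r(3)])
 show "sqi Fund (dF 1 0 u)" by (rule sqi_AE[OF sqi_Complex[OF rep_Fund(2)[OF r(1)] rep_Fund(2)[OF r(2)]] r(4)])
 show "sqi Fund (dF 0 1 u)" by (rule sqi_AE[OF sqi_Complex[OF rep_Fund(3)[OF r(1)] rep_Fund(3)[OF r(2)]] r(5)])
qed

lemma nrm_dF_le_Wnorm: "nrm Fund (dF 1 0 u) \<le> Wnorm 1 u" "nrm Fund (dF 0 1 u) \<le> Wnorm 1 u"
proof -
 have e: "Wnorm 1 u = sqrt ((nrm Fund (dF 0 0 u))^2 + (nrm Fund (dF 0 1 u))^2 + (nrm Fund (dF 1 0 u))^2)"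
  unfolding Wnorm_def L2norm_nrm by (simp add: atMost_Suc)
 show "nrm Fund (dF 1 0 u) \<le> Wnorm 1 u" "nrm Fund (dF 0 1 u) \<le> Wnorm 1 u"
  unfolding e by (rule real_le_rsqrt, simp)+
qed

lemma rep_approx:
 assumes "rep f fx fy"
 shows "smooth_on disc (Kn n f)" "k < 4 \<Longrightarrow> z \<in> disc \<Longrightarrow> Kn n f (gen k z) = Kn n f z"
  "(\<lambda>n. nrm Fund (\<lambda>z. Kn n f z - f z)) \<longlonglongrightarrow> 0"
  "(\<lambda>n. nrm Fund (\<lambda>z. partial 1 (Kn n f) z - fx z)) \<longlonglongrightarrow> 0"
  "(\<lambda>n. nrm Fund (\<lambda>z. partial \<i> (Kn n f) z - fy z)) \<longlonglongrightarrow> 0"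
proof -
 have a: "wp f fx fy" "sqi CF f" "sqi CF fx" "sqi CF fy" "l1loc disc f" and i: "\<And>k. k < 4 \<Longrightarrow> AE z in lD. f (gen k z) = f z"
  using assms by (auto simp: rep_def wp_def)
 show "smooth_on disc (Kn n f)" by (rule Kn_smooth[OF a(5)])
 show "k < 4 \<Longrightarrow> z \<in> disc \<Longrightarrow> Kn n f (gen k z) = Kn n f z" by (rule Kn_gen[OF a(5) i])
 show "(\<lambda>n. nrm Fund (\<lambda>z. Kn n f z - f z)) \<longlonglongrightarrow> 0" by (rule Kn_tendsto[OF a(2,5)])
 show "(\<lambda>n. nrm Fund (\<lambda>z. partial 1 (Kn n f) z - fx z)) \<longlonglongrightarrow> 0"
  "(\<lambda>n. nrm Fund (\<lambda>z. partial \<i> (Kn n f) z - fy z)) \<longlonglongrightarrow> 0"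
  by (rule Kn_gradient_tendsto[OF a(1,3,4)])+
qed

lemma integral_mult_tendsto:
 fixes h :: "nat \<Rightarrow> complex \<Rightarrow> 'b::{real_normed_field, banach, second_countable_topology}"
 assumes h: "\<And>n. sqi S (h n)" "sqi S f" and q: "sqi S q" and lim: "(\<lambda>n. nrm S (\<lambda>z. h n z - f z)) \<longlonglongrightarrow> 0"
 shows "(\<lambda>n. LINT z|lebesgue_on S. h n z * q z) \<longlonglongrightarrow> (LINT z|lebesgue_on S. f z * q z)"
proof (rule LIM_zero_cancel, rule tendsto_norm_zero_cancel, rule tendsto_sandwich[OF _ _ tendsto_const])
 show "(\<lambda>n. nrm S (\<lambda>z. h n z - f z) * nrm S q) \<longlonglongrightarrow> 0" using tendsto_mult_right[OF lim, of "nrm S q"] by simp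
 have "norm ((LINT z|lebesgue_on S. h n z * q z) - (LINT z|lebesgue_on S. f z * q z)) \<le> nrm S (\<lambda>z. h n z - f z) * nrm S q" for n
  using Cauchy_Schwarz_integral[OF sqi_diff[OF h(1)[of n] h(2)] q] sqi_mult_integrable(1)[OF h(1)[of n] q] sqi_mult_integrable(1)[OF h(2) q]
  by (simp add: left_diff_distrib)
 then show "\<forall>\<^sub>F n in sequentially. norm ((LINT z|lebesgue_on S. h n z * q z) - (LINT z|lebesgue_on S. f z * q z)) \<le> nrm S (\<lambda>z. h n z - f z) * nrm S q"
  by simp
qed auto

lemma continuous_disc_sqi: "continuous_on disc f \<Longrightarrow> sqi Fund f"
 for f :: "complex \<Rightarrow> 'b::{real_normed_field, banach, second_countable_topology}"
 by (rule continuous_sqi[OF compact_Fund continuous_on_subset[OF _ Fund_disc]])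

text \<open>\<open>Green\<close> for the averages of f, which are smooth and invariant at every
  point; both the averages and their gradients converge in L2 of the octagon.\<close>

lemma Green_rep:
 assumes r: "rep f fx fy" and p: "smooth_on disc \<phi>" "\<And>k z. k < 4 \<Longrightarrow> z \<in> disc \<Longrightarrow> \<phi> (gen k z) = \<phi> z"
 shows "(LINT z|lF. fx z * partial 1 \<phi> z) + (LINT z|lF. fy z * partial \<i> \<phi> z) + (LINT z|lF. f z * lap \<phi> z) = 0"
proof -
 note s = rep_approx(1)[OF r]
 note c = continuous_disc_sqi[OF smooth_continuous_partial[OF s Basis_c(1)]] continuous_disc_sqi[OF smooth_continuous_partial[OF s Basis_c(2)]] continuous_disc_sqi[OF smooth_on_continuous[OF s]]
 note d = continuous_disc_sqi[OF smooth_continuous_partial[OF p(1) Basis_c(1)]] continuous_disc_sqi[OF smooth_continuous_partial[OF p(1) Basis_c(2)]] continuous_disc_sqi[OF lap_continuous[OF p(1)]]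
 have "(\<lambda>n. (LINT z|lF. partial 1 (Kn n f) z * partial 1 \<phi> z) + (LINT z|lF. partial \<i> (Kn n f) z * partial \<i> \<phi> z) + (LINT z|lF. Kn n f z * lap \<phi> z))
   \<longlonglongrightarrow> (LINT z|lF. fx z * partial 1 \<phi> z) + (LINT z|lF. fy z * partial \<i> \<phi> z) + (LINT z|lF. f z * lap \<phi> z)"
  by (intro tendsto_add integral_mult_tendsto rep_approx(3-5)[OF r] rep_Fund[OF r] c d)
 moreover have "(LINT z|lF. partial 1 (Kn n f) z * partial 1 \<phi> z) + (LINT z|lF. partial \<i> (Kn n f) z * partial \<i> \<phi> z) + (LINT z|lF. Kn n f z * lap \<phi> z) = 0" for n
  using Green[OF s p(1) rep_approx(2)[OF r] p(2), of n] sqi_mult_integrable(1)[OF c(1)[of n] d(1)] sqi_mult_integrable(1)[OF c(2)[of n] d(2)] sqi_mult_integrable(1)[OF c(3)[of n] d(3)]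
  by (simp add: gdot_def)
 ultimately show ?thesis using LIMSEQ_unique[OF _ tendsto_const] by force
qed

section \<open>Pairings depending on time\<close>

definition cL2 :: "(real \<Rightarrow> complex \<Rightarrow> complex) \<Rightarrow> bool" where
 "cL2 X \<longleftrightarrow> (\<forall>t\<ge>0. sqi Fund (X t) \<and> ((\<lambda>s. nrm Fund (\<lambda>z. X s z - X t z)) \<longlongrightarrow> 0) (at t within {0..}))"

definition dL2 :: "(real \<Rightarrow> complex \<Rightarrow> complex) \<Rightarrow> (real \<Rightarrow> complex \<Rightarrow> complex) \<Rightarrow> bool" where
 "dL2 X X' \<longleftrightarrow> (\<forall>t\<ge>0. sqi Fund (X' t) \<and> ((\<lambda>s. nrm Fund (\<lambda>z. (X s z - X t z) /\<^sub>R (s - t) - X' t z)) \<longlongrightarrow> 0) (at t within {0..}))"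

text \<open>Bilinear, without conjugation, as in the variational problem; positivity arguments
  insert the conjugate explicitly.\<close>

definition pr :: "(complex \<Rightarrow> complex) \<Rightarrow> (complex \<Rightarrow> complex) \<Rightarrow> complex" where
 "pr f g = (LINT z|lF. f z * g z)"

lemma pr_bound: "sqi Fund f \<Longrightarrow> sqi Fund g \<Longrightarrow> cmod (pr f g) \<le> nrm Fund f * nrm Fund g"
 unfolding pr_def by (rule Cauchy_Schwarz_integral)

lemma pr_diff:
 assumes "sqi Fund f" "sqi Fund f'" "sqi Fund g"
 shows "pr (\<lambda>z. f z - f' z) g = pr f g - pr f' g" "pr g (\<lambda>z. f z - f' z) = pr g f - pr g f'"
 unfolding pr_def left_diff_distrib right_diff_distrib
 by (intro Bochner_Integration.integral_diff sqi_mult_integrable(1) assms)+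

lemma pr_add:
 assumes "sqi Fund f" "sqi Fund f'" "sqi Fund g"
 shows "pr (\<lambda>z. f z + f' z) g = pr f g + pr f' g" "pr g (\<lambda>z. f z + f' z) = pr g f + pr g f'"
 unfolding pr_def distrib_left distrib_right
 by (intro Bochner_Integration.integral_add sqi_mult_integrable(1) assms)+

lemma pr_cmult: "pr (\<lambda>z. c * f z) g = c * pr f g" "pr f (\<lambda>z. c * g z) = c * pr f g"
 unfolding pr_def mult.assoc mult.left_commute[of _ c] by (rule integral_mult_right_zero)+

lemma cL2_sqi: "cL2 X \<Longrightarrow> t \<ge> 0 \<Longrightarrow> sqi Fund (X t)" by (simp add: cL2_def)

lemma cL2_const: "sqi Fund h \<Longrightarrow> cL2 (\<lambda>t. h)" by (simp add: cL2_def nrm_def)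

lemma tendsto_0_le:
 fixes f g :: "real \<Rightarrow> real"
 assumes "(g \<longlongrightarrow> 0) (at t within {0..})" "\<And>s. s \<ge> 0 \<Longrightarrow> s \<noteq> t \<Longrightarrow> f s \<le> g s" "\<And>s. 0 \<le> f s"
 shows "(f \<longlongrightarrow> 0) (at t within {0..})"
 by (rule tendsto_sandwich[OF _ _ tendsto_const assms(1)]) (use assms(2,3) in \<open>auto simp: eventually_at_filter\<close>)

lemma cL2_nrm_tendsto:
 assumes X: "cL2 X" and t: "t \<ge> 0" shows "((\<lambda>s. nrm Fund (X s)) \<longlongrightarrow> nrm Fund (X t)) (at t within {0..})"
proof (rule LIM_zero_cancel, rule tendsto_rabs_zero_cancel, rule tendsto_0_le)
 show "((\<lambda>s. nrm Fund (\<lambda>z. X s z - X t z)) \<longlongrightarrow> 0) (at t within {0..})" using X t by (simp add: cL2_def)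
 fix s :: real assume s: "s \<ge> 0"
 note q = cL2_sqi[OF X s] cL2_sqi[OF X t]
 let ?A = "(\<lambda>z. X s z - X t z)"
 have "nrm Fund (X s) \<le> nrm Fund (X t) + nrm Fund ?A"
  using nrm_triangle[OF q(2) sqi_diff[OF q]] by simp
 moreover have "nrm Fund (X t) \<le> nrm Fund (X s) + nrm Fund ?A"
  using nrm_triangle[OF q(1) sqi_diff[OF q(2,1)]] nrm_minus_commute[of Fund "X t" "X s"] by simp
 ultimately show "\<bar>nrm Fund (X s) - nrm Fund (X t)\<bar> \<le> nrm Fund ?A" by linarith
qed auto

lemma cL2_nrm_continuous: "cL2 X \<Longrightarrow> continuous_on {0..} (\<lambda>t. nrm Fund (X t))"
 unfolding continuous_on_def using cL2_nrm_tendsto by auto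

lemma cL2_bound:
 assumes X: "cL2 X" obtains M where "M \<ge> 0" "\<And>t. 0 \<le> t \<Longrightarrow> t \<le> b \<Longrightarrow> nrm Fund (X t) \<le> M"
proof -
 have "bounded ((\<lambda>t. nrm Fund (X t)) ` {0..b})"
  by (intro compact_imp_bounded compact_continuous_image continuous_on_subset[OF cL2_nrm_continuous[OF X]]) auto
 then obtain M where M: "\<forall>t\<in>{0..b}. \<bar>nrm Fund (X t)\<bar> \<le> M" by (auto simp: bounded_iff)
 have "nrm Fund (X t) \<le> max M 0" if t: "0 \<le> t" "t \<le> b" for t
 proof -
  have "\<bar>nrm Fund (X t)\<bar> \<le> M" using M t by simp
  then show ?thesis by linarith
 qed
 then show ?thesis using that[of "max M 0"] by simp
qed

text \<open>Points near (t, r) may have first coordinate t itself, so the limit has to be the value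
  of f at t.\<close>

lemma tendsto_fst_within:
 fixes f :: "real \<Rightarrow> real" and t r :: real
 assumes "(f \<longlongrightarrow> f t) (at t within S)"
 shows "((\<lambda>q. f (fst q)) \<longlongrightarrow> f t) (at (t, r) within S \<times> T)"
proof (rule tendstoI)
 fix e :: real assume e: "e > 0"
 obtain d where d: "d > 0" "\<forall>x\<in>S. x \<noteq> t \<and> dist x t < d \<longrightarrow> dist (f x) (f t) < e"
  using tendstoD[OF assms e] unfolding eventually_at by blast
 have "dist (f (fst q)) (f t) < e" if "q \<in> S \<times> T" "dist q (t, r) < d" for q
  using d e that dist_fst_le[of q "(t, r)"] by (cases "fst q = t") auto
 then show "\<forall>\<^sub>F q in at (t, r) within S \<times> T. dist (f (fst q)) (f t) < e"
  unfolding eventually_at using d(1) by blast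
qed

lemma tendsto_snd_within:
 fixes f :: "real \<Rightarrow> real" and t r :: real
 assumes "(f \<longlongrightarrow> f r) (at r within T)"
 shows "((\<lambda>q. f (snd q)) \<longlongrightarrow> f r) (at (t, r) within S \<times> T)"
proof (rule tendstoI)
 fix e :: real assume e: "e > 0"
 obtain d where d: "d > 0" "\<forall>x\<in>T. x \<noteq> r \<and> dist x r < d \<longrightarrow> dist (f x) (f r) < e"
  using tendstoD[OF assms e] unfolding eventually_at by blast
 have "dist (f (snd q)) (f r) < e" if "q \<in> S \<times> T" "dist q (t, r) < d" for q
  using d e that dist_snd_le[of q "(t, r)"] by (cases "snd q = r") auto
 then show "\<forall>\<^sub>F q in at (t, r) within S \<times> T. dist (f (snd q)) (f r) < e"
  unfolding eventually_at using d(1) by blast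
qed

text \<open>The difference splits into a pairing of X s - X t with Y and one of X t with the
  increment of Y. Continuity in two independent times is what the positive kernel argument asks
  for.\<close>

lemma pr_joint_continuous:
 assumes X: "cL2 X" and Y: "cL2 Y"
 shows "continuous_on ({0..} \<times> {0..}) (\<lambda>p. pr (X (fst p)) (Y (snd p)))"
 unfolding continuous_on_def
proof
 fix p :: "real \<times> real" assume "p \<in> {0..} \<times> {0..}"
 then obtain t r where p: "p = (t, r)" "t \<ge> 0" "r \<ge> 0" by auto
 let ?F = "at p within {0..} \<times> {0..}"
 have ev: "\<forall>\<^sub>F q in ?F. q \<in> {0..} \<times> {0..}" by (auto simp: eventually_at_filter)
 have nX: "((\<lambda>s. nrm Fund (\<lambda>z. X s z - X t z)) \<longlongrightarrow> nrm Fund (\<lambda>z. X t z - X t z)) (at t within {0..})"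
  and nY: "((\<lambda>s. nrm Fund (\<lambda>z. Y s z - Y r z)) \<longlongrightarrow> nrm Fund (\<lambda>z. Y r z - Y r z)) (at r within {0..})"
  using X Y p by (auto simp: cL2_def nrm_def)
 have tX: "((\<lambda>q. nrm Fund (\<lambda>z. X (fst q) z - X t z)) \<longlongrightarrow> 0) ?F"
  using tendsto_fst_within[OF nX] by (simp add: nrm_def p(1))
 have tY: "((\<lambda>q. nrm Fund (\<lambda>z. Y (snd q) z - Y r z)) \<longlongrightarrow> 0) ?F"
  using tendsto_snd_within[OF nY] by (simp add: nrm_def p(1))
 have tN: "((\<lambda>q. nrm Fund (Y (snd q))) \<longlongrightarrow> nrm Fund (Y r)) ?F"
  using tendsto_snd_within[OF cL2_nrm_tendsto[OF Y p(3)]] by (simp add: p(1))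
 have "((\<lambda>q. pr (X (fst q)) (Y (snd q))) \<longlongrightarrow> pr (X t) (Y r)) ?F"
 proof (rule LIM_zero_cancel, rule tendsto_norm_zero_cancel, rule tendsto_sandwich[OF _ _ tendsto_const])
  show "((\<lambda>q. nrm Fund (\<lambda>z. X (fst q) z - X t z) * nrm Fund (Y (snd q)) + nrm Fund (X t) * nrm Fund (\<lambda>z. Y (snd q) z - Y r z)) \<longlongrightarrow> 0) ?F"
   using tendsto_add[OF tendsto_mult[OF tX tN] tendsto_mult[OF tendsto_const[of "nrm Fund (X t)"] tY]] by simp
  show "\<forall>\<^sub>F q in ?F. cmod (pr (X (fst q)) (Y (snd q)) - pr (X t) (Y r))
    \<le> nrm Fund (\<lambda>z. X (fst q) z - X t z) * nrm Fund (Y (snd q)) + nrm Fund (X t) * nrm Fund (\<lambda>z. Y (snd q) z - Y r z)"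
   using ev
  proof eventually_elim
   case (elim q)
   then have q: "fst q \<ge> 0" "snd q \<ge> 0" by auto
   note s = cL2_sqi[OF X q(1)] cL2_sqi[OF X p(2)] cL2_sqi[OF Y q(2)] cL2_sqi[OF Y p(3)]
   let ?A = "(\<lambda>z. X (fst q) z - X t z)"
   let ?B = "(\<lambda>z. Y (snd q) z - Y r z)"
   have "pr (X (fst q)) (Y (snd q)) - pr (X t) (Y r) = pr ?A (Y (snd q)) + pr (X t) ?B"
    using pr_diff(1)[OF s(1,2,3)] pr_diff(2)[OF s(3,4,2)] by simp
   then have "cmod (pr (X (fst q)) (Y (snd q)) - pr (X t) (Y r)) \<le> cmod (pr ?A (Y (snd q))) + cmod (pr (X t) ?B)"
    by (simp only: norm_triangle_ineq)
   also have "\<dots> \<le> nrm Fund ?A * nrm Fund (Y (snd q)) + nrm Fund (X t) * nrm Fund ?B"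
    by (rule add_mono[OF pr_bound[OF sqi_diff[OF s(1,2)] s(3)] pr_bound[OF s(2) sqi_diff[OF s(3,4)]]])
   finally show ?case .
  qed
 qed auto
 then show "((\<lambda>q. pr (X (fst q)) (Y (snd q))) \<longlongrightarrow> pr (X (fst p)) (Y (snd p))) ?F" using p(1) by simp
qed

lemma pr_continuous:
 assumes "cL2 X" "cL2 Y" shows "continuous_on {0..} (\<lambda>t. pr (X t) (Y t))"
proof -
 have "continuous_on {0::real..} (\<lambda>t. (t, t))" by (intro continuous_intros)
 then have "continuous_on {0..} (\<lambda>t. (\<lambda>p. pr (X (fst p)) (Y (snd p))) (t, t))"
  by (rule continuous_on_compose2[OF pr_joint_continuous[OF assms]]) auto
 then show ?thesis by simp
qed

lemma dL2_const: "dL2 (\<lambda>t. h) (\<lambda>t z. 0)"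
 by (simp add: dL2_def nrm_def sqi_def)

text \<open>Product rule for L2 difference quotients. The remainder is the sum of three pairings:
  the quotient error of X with Y s, X' with Y s - Y t, and X t with the quotient error of Y.
  Cauchy-Schwarz sends each to 0.\<close>

lemma pr_derivative:
 assumes X: "cL2 X" "dL2 X X'" and Y: "cL2 Y" "dL2 Y Y'" and t: "t \<ge> 0"
 shows "((\<lambda>s. pr (X s) (Y s)) has_vector_derivative (pr (X' t) (Y t) + pr (X t) (Y' t))) (at t within {0..})"
 unfolding has_vector_derivative_def has_derivative_within
proof (intro conjI)
 let ?F = "at t within {0..}"
 show "bounded_linear (\<lambda>x. x *\<^sub>R (pr (X' t) (Y t) + pr (X t) (Y' t)))" by (rule bounded_linear_scaleR_left)
 define dX where "dX = (\<lambda>s z. (X s z - X t z) /\<^sub>R (s - t) - X' t z)"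
 define dY where "dY = (\<lambda>s z. (Y s z - Y t z) /\<^sub>R (s - t) - Y' t z)"
 have lim: "((\<lambda>s. nrm Fund (dX s)) \<longlongrightarrow> 0) ?F" "((\<lambda>s. nrm Fund (dY s)) \<longlongrightarrow> 0) ?F"
  "((\<lambda>s. nrm Fund (\<lambda>z. Y s z - Y t z)) \<longlongrightarrow> 0) ?F"
  using X(2) Y t by (auto simp: dL2_def cL2_def dX_def dY_def)
 have X': "sqi Fund (X' t)" and Y': "sqi Fund (Y' t)" using X(2) Y(2) t by (auto simp: dL2_def)
 show "((\<lambda>s. (1 / norm (s - t)) *\<^sub>R (pr (X s) (Y s) - (pr (X t) (Y t) + (s - t) *\<^sub>R (pr (X' t) (Y t) + pr (X t) (Y' t))))) \<longlongrightarrow> 0) ?F"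
 proof (rule tendsto_norm_zero_cancel, rule tendsto_0_le)
  show "((\<lambda>s. nrm Fund (dX s) * nrm Fund (Y s) + nrm Fund (X' t) * nrm Fund (\<lambda>z. Y s z - Y t z) + nrm Fund (X t) * nrm Fund (dY s)) \<longlongrightarrow> 0) ?F"
   using tendsto_add[OF tendsto_add[OF tendsto_mult[OF lim(1) cL2_nrm_tendsto[OF Y(1) t]] tendsto_mult[OF tendsto_const[of "nrm Fund (X' t)"] lim(3)]]
    tendsto_mult[OF tendsto_const[of "nrm Fund (X t)"] lim(2)]] by simp
  fix s :: real assume s: "s \<ge> 0" and st: "s \<noteq> t"
  note q = cL2_sqi[OF X(1) s] cL2_sqi[OF X(1) t] cL2_sqi[OF Y(1) s] cL2_sqi[OF Y(1) t]
  define c where "c = complex_of_real (s - t)"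
  have c0: "c \<noteq> 0" using st by (simp add: c_def)
  have dXe: "dX s = (\<lambda>z. inverse c * (X s z - X t z) - X' t z)" and dYe: "dY s = (\<lambda>z. inverse c * (Y s z - Y t z) - Y' t z)"
   by (simp_all add: dX_def dY_def c_def scaleR_conv_of_real fun_eq_iff)
  have sX: "sqi Fund (dX s)" unfolding dXe by (rule sqi_diff[OF sqi_cmult[OF sqi_diff[OF q(1,2)]] X'])
  have sY: "sqi Fund (dY s)" unfolding dYe by (rule sqi_diff[OF sqi_cmult[OF sqi_diff[OF q(3,4)]] Y'])
  have 1: "pr (dX s) (Y s) = inverse c * (pr (X s) (Y s) - pr (X t) (Y s)) - pr (X' t) (Y s)"
   unfolding dXe pr_diff(1)[OF sqi_cmult[OF sqi_diff[OF q(1,2)]] X' q(3)] pr_cmult pr_diff(1)[OF q(1,2,3)] ..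
  have 2: "pr (X t) (dY s) = inverse c * (pr (X t) (Y s) - pr (X t) (Y t)) - pr (X t) (Y' t)"
   unfolding dYe pr_diff(2)[OF sqi_cmult[OF sqi_diff[OF q(3,4)]] Y' q(2)] pr_cmult pr_diff(2)[OF q(3,4,2)] ..
  let ?A = "(\<lambda>z. Y s z - Y t z)"
  have 3: "pr (X' t) ?A = pr (X' t) (Y s) - pr (X' t) (Y t)" by (rule pr_diff(2)[OF q(3,4) X'])
  have alg: "P - (Q + c * (A + B)) = c * ((inverse c * (P - R) - A') + (A' - A) + (inverse c * (R - Q) - B))" for P Q R A A' B
   using c0 by (simp add: field_simps)
  have e: "pr (X s) (Y s) - (pr (X t) (Y t) + (s - t) *\<^sub>R (pr (X' t) (Y t) + pr (X t) (Y' t)))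
    = c * (pr (dX s) (Y s) + pr (X' t) (\<lambda>z. Y s z - Y t z) + pr (X t) (dY s))"
   unfolding 1 2 3 scaleR_conv_of_real c_def[symmetric] by (rule alg)
  have nc: "norm c = norm (s - t)" by (simp add: c_def del: of_real_diff)
  have "norm ((1 / norm (s - t)) *\<^sub>R (pr (X s) (Y s) - (pr (X t) (Y t) + (s - t) *\<^sub>R (pr (X' t) (Y t) + pr (X t) (Y' t)))))
   = cmod (pr (dX s) (Y s) + pr (X' t) (\<lambda>z. Y s z - Y t z) + pr (X t) (dY s))"
   unfolding e norm_scaleR norm_mult nc using st by simp
  also have "\<dots> \<le> cmod (pr (dX s) (Y s)) + cmod (pr (X' t) ?A) + cmod (pr (X t) (dY s))"
   by (rule order_trans[OF norm_triangle_ineq add_right_mono[OF norm_triangle_ineq]])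
  also have "\<dots> \<le> nrm Fund (dX s) * nrm Fund (Y s) + nrm Fund (X' t) * nrm Fund ?A + nrm Fund (X t) * nrm Fund (dY s)"
   by (rule add_mono[OF add_mono[OF pr_bound[OF sX q(3)] pr_bound[OF X' sqi_diff[OF q(3,4)]]] pr_bound[OF q(2) sY]])
  finally show "norm ((1 / norm (s - t)) *\<^sub>R (pr (X s) (Y s) - (pr (X t) (Y t) + (s - t) *\<^sub>R (pr (X' t) (Y t) + pr (X t) (Y' t)))))
   \<le> nrm Fund (dX s) * nrm Fund (Y s) + nrm Fund (X' t) * nrm Fund (\<lambda>z. Y s z - Y t z) + nrm Fund (X t) * nrm Fund (dY s)" .
 qed auto
qed

section \<open>Test functions of time and the distributional equation\<close>

lemma test_time:
 assumes "test_fun {0<..} \<eta>"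
 obtains \<alpha> \<beta> :: real where "0 < \<alpha>" "\<alpha> < \<beta>" "\<And>t. t \<le> \<alpha> \<or> \<beta> \<le> t \<Longrightarrow> \<eta> t = 0"
proof -
 obtain C where C: "compact C" "C \<subseteq> {0<..}" "\<And>x. x \<notin> C \<Longrightarrow> \<eta> x = 0" using test_fun_support[OF assms] by blast
 show ?thesis
 proof (cases "C = {}")
  case True
  then show ?thesis using that[of 1 2] C(3) by simp
 next
  case False
  \<comment> \<open>The interval is taken a little larger than the support, so that the function
    vanishes at its end points and integration by parts leaves no boundary term.\<close>
  obtain l where l: "l \<in> C" "\<forall>t\<in>C. l \<le> t" using compact_attains_inf[OF C(1) False] by blast
  obtain u where u: "u \<in> C" "\<forall>t\<in>C. t \<le> u" using compact_attains_sup[OF C(1) False] by blast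
  have lp: "l > 0" using l(1) C(2) by auto
  have "t \<notin> C" if "t \<le> l / 2 \<or> u + 1 \<le> t" for t
  proof
   assume "t \<in> C"
   then have "l \<le> t" "t \<le> u" using l u by auto
   then show False using that lp by auto
  qed
  then show ?thesis using that[of "l / 2" "u + 1"] lp l u C(3) by fastforce
 qed
qed

lemma test_time_deriv:
 assumes "test_fun {0<..} (\<eta> :: real \<Rightarrow> real)"
 shows "(\<eta> has_real_derivative deriv \<eta> t) (at t)" "deriv \<eta> = partial 1 \<eta>" "test_fun {0<..} (deriv \<eta>)" "continuous_on S \<eta>"
proof -
 have s: "smooth_on UNIV \<eta>" using assms by (simp add: test_fun_def)
 show d: "(\<eta> has_real_derivative deriv \<eta> t) (at t)" for t
  using smooth_on_differentiable[OF s, of t] by (simp add: DERIV_deriv_iff_real_differentiable)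
 show e: "deriv \<eta> = partial 1 \<eta>" using partial_real_deriv[OF d] by auto
 show "test_fun {0<..} (deriv \<eta>)" unfolding e by (rule test_fun_partial[OF assms]) simp
 show "continuous_on S \<eta>" by (rule continuous_on_subset[OF smooth_on_continuous[OF s]]) simp
qed

lemma deriv_2: "(deriv ^^ 2) \<eta> = deriv (deriv \<eta>)" by (simp add: numeral_2_eq_2)

lemma time_integral:
 fixes f :: "real \<Rightarrow> 'b::{euclidean_space, real_normed_field}"
 assumes c: "continuous_on {\<alpha>..\<beta>} f" and "0 < \<alpha>" and z: "\<And>t. t > 0 \<Longrightarrow> t \<notin> {\<alpha>..\<beta>} \<Longrightarrow> f t = 0"
 shows "(LINT t|lT. f t) = integral {\<alpha>..\<beta>} f" "integrable lT f"
proof -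
 have i: "integrable (lebesgue_on {\<alpha>..\<beta>}) f"
  by (rule sqi_integrable[OF lmeasurable_compact[OF compact_Icc] continuous_sqi[OF compact_Icc c]])
 have r: "integrable lT f = integrable (lebesgue_on {\<alpha>..\<beta>}) f" "(LINT t|lT. f t) = (LINT t|lebesgue_on {\<alpha>..\<beta>}. f t)"
  by (rule restrict_zero_outside; use assms in auto)+
 show "(LINT t|lT. f t) = integral {\<alpha>..\<beta>} f"
  unfolding r(2) by (rule lebesgue_integral_eq_integral[OF i]) simp
 show "integrable lT f" using r(1) i by simp
qed

lemma time_parts:
 fixes A A' :: "real \<Rightarrow> complex"
 assumes e: "test_fun {0<..} \<eta>" and A: "\<And>t. t \<ge> 0 \<Longrightarrow> (A has_vector_derivative A' t) (at t within {0..})" and A': "continuous_on {0..} A'"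
 shows "(LINT t|lT. deriv \<eta> t *\<^sub>R A t) = - (LINT t|lT. \<eta> t *\<^sub>R A' t)"
proof -
 obtain \<alpha> \<beta> where ab: "0 < \<alpha>" "\<alpha> < \<beta>" "\<And>t. t \<le> \<alpha> \<or> \<beta> \<le> t \<Longrightarrow> \<eta> t = 0" using test_time[OF e] by blast
 note d = test_time_deriv[OF e]
 have sub: "{\<alpha>..\<beta>} \<subseteq> {0..}" using ab by auto
 have cA: "continuous_on {0..} A"
  using A has_vector_derivative_continuous unfolding continuous_on_eq_continuous_within by (metis atLeast_iff)
 have d0: "deriv \<eta> t = 0" if "t \<notin> {\<alpha>..\<beta>}" for t
  unfolding d(2) by (rule partial_zero_outside[of "{\<alpha>..\<beta>}"]) (use ab that in auto)
 have c1: "continuous_on {\<alpha>..\<beta>} (\<lambda>t. deriv \<eta> t *\<^sub>R A t)" and c2: "continuous_on {\<alpha>..\<beta>} (\<lambda>t. \<eta> t *\<^sub>R A' t)"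
  by (intro continuous_on_scaleR d(4) test_time_deriv(4)[OF d(3)] continuous_on_subset[OF cA sub] continuous_on_subset[OF A' sub])+
 have 1: "(LINT t|lT. deriv \<eta> t *\<^sub>R A t) = integral {\<alpha>..\<beta>} (\<lambda>t. deriv \<eta> t *\<^sub>R A t)"
  by (rule time_integral(1)[OF c1 ab(1)]) (use d0 in auto)
 have 2: "(LINT t|lT. \<eta> t *\<^sub>R A' t) = integral {\<alpha>..\<beta>} (\<lambda>t. \<eta> t *\<^sub>R A' t)"
  by (rule time_integral(1)[OF c2 ab(1)]) (use ab in auto)
 let ?A = "(\<lambda>t. \<eta> t *\<^sub>R A' t + deriv \<eta> t *\<^sub>R A t)"
 have "(?A has_integral (\<eta> \<beta> *\<^sub>R A \<beta> - \<eta> \<alpha> *\<^sub>R A \<alpha>)) {\<alpha>..\<beta>}"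
 proof (rule fundamental_theorem_of_calculus)
  fix t assume t: "t \<in> {\<alpha>..\<beta>}"
  show "((\<lambda>t. \<eta> t *\<^sub>R A t) has_vector_derivative (\<eta> t *\<^sub>R A' t + deriv \<eta> t *\<^sub>R A t)) (at t within {\<alpha>..\<beta>})"
   by (rule has_vector_derivative_scaleR[OF has_field_derivative_at_within[OF d(1)] has_vector_derivative_within_subset[OF A sub]])
     (use t ab in auto)
 qed (use ab in auto)
 then have "integral {\<alpha>..\<beta>} ?A = 0"
  using ab(3) by (simp add: integral_unique)
 then show ?thesis
  unfolding 1 2 using integral_add[OF integrable_continuous_interval[OF c2] integrable_continuous_interval[OF c1]]
  by (simp add: eq_neg_iff_add_eq_0 add.commute)
qed

text \<open>The kernels N dstep(N (t - s)) form an approximate identity: they live within 1/N of s,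
  their integral is the total rise 1 of \<open>sstep\<close>, and their L1 norm is at most 2 dB. The
  positivity of s keeps them in the open half-line for large n.\<close>

lemma mollify_time:
 fixes F :: "real \<Rightarrow> complex"
 assumes F: "continuous_on {0..} F" and s: "s > 0"
 shows "(\<lambda>n. LINT t|lT. (real (Suc n) * dstep (real (Suc n) * (t - s))) *\<^sub>R F t) \<longlonglongrightarrow> F s"
proof (rule LIMSEQ_I)
 fix e :: real assume e: "e > 0"
 define e' where "e' = e / (4 * (dB + 1))"
 have e': "e' > 0" using e dB(1) by (simp add: e'_def)
 have "continuous (at s within {0..}) F" using F s by (auto simp: continuous_on_eq_continuous_within)
 then obtain d where d: "d > 0" "\<forall>t\<in>{0..}. dist t s < d \<longrightarrow> dist (F t) (F s) < e'"
  unfolding continuous_within_eps_delta using e' by blast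
 obtain m :: nat where m: "1 / min d s < real m" using reals_Archimedean2 by blast
 show "\<exists>no. \<forall>n\<ge>no. norm ((LINT t|lT. (real (Suc n) * dstep (real (Suc n) * (t - s))) *\<^sub>R F t) - F s) < e"
 proof (intro exI allI impI)
  fix n assume n: "n \<ge> m"
  define N where "N = real (Suc n)"
  have N: "N > 0" by (simp add: N_def)
  define m0 where "m0 = min d s"
  have m0: "m0 > 0" using d(1) s by (simp add: m0_def)
  have mN: "1 / m0 < N" using m n by (simp add: N_def m0_def)
  then have "1 / N < m0" using N m0 by (simp add: field_simps)
  then have r: "1 / N < d" "1 / N < s" by (auto simp: m0_def)
  define a where "a = s - 1 / N" define b where "b = s + 1 / N"
  have ab: "0 < a" "a < b" using r N by (auto simp: a_def b_def)
  have sub: "{a..b} \<subseteq> {0..}" using ab by auto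
  let ?A = "(\<lambda>t. N * dstep (N * (t - s)))"
  have ds: "continuous_on S ?A" for S
   by (intro continuous_intros continuous_on_compose2[OF smooth_on_continuous[OF smooth_dstep]]) auto
  have z: "dstep (N * (t - s)) = 0" if "t \<notin> {a..b}" for t
  proof (rule dstep_eq_0)
   have "\<bar>t - s\<bar> > 1 / N" using that by (auto simp: a_def b_def)
   then show "1 < \<bar>N * (t - s)\<bar>" unfolding abs_mult using N by (simp add: divide_less_eq mult.commute)
  qed
  let ?B = "(\<lambda>t. (N * dstep (N * (t - s))) *\<^sub>R F t)"
  have c: "continuous_on {a..b} ?B"
   by (intro continuous_on_scaleR ds continuous_on_subset[OF F sub])
  let ?C = "(\<lambda>t. (N * dstep (N * (t - s))) *\<^sub>R F s)"
  have cs: "continuous_on {a..b} ?C"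
   by (intro continuous_on_scaleR ds continuous_on_const)
  have 1: "(LINT t|lT. (N * dstep (N * (t - s))) *\<^sub>R F t) = integral {a..b} ?B"
   by (rule time_integral(1)[OF c ab(1)]) (use z in auto)
  have "(?A has_integral (sstep (N * (b - s)) - sstep (N * (a - s)))) {a..b}"
  proof (rule fundamental_theorem_of_calculus)
   fix t
   have "((\<lambda>t. sstep (N * (t - s))) has_real_derivative dstep (N * (t - s)) * N) (at t)"
    by (rule DERIV_chain'[OF _ sstep_deriv]) (auto intro!: derivative_eq_intros)
   then show "((\<lambda>t. sstep (N * (t - s))) has_vector_derivative N * dstep (N * (t - s))) (at t within {a..b})"
    by (simp add: has_real_derivative_iff_has_vector_derivative mult.commute has_vector_derivative_at_within)
  qed (use ab in auto)
  moreover have "sstep (N * (b - s)) - sstep (N * (a - s)) = 1" using N by (simp add: a_def b_def sstep_0 sstep_1)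
  ultimately have "(?A has_integral 1) {a..b}" by simp
  from has_integral_scaleR_left[OF this, of "F s"] have 2: "integral {a..b} ?C = F s"
   by (simp add: integral_unique)
  have eq: "(LINT t|lT. (N * dstep (N * (t - s))) *\<^sub>R F t) - F s
    = integral {a..b} (\<lambda>t. (N * dstep (N * (t - s))) *\<^sub>R F t - (N * dstep (N * (t - s))) *\<^sub>R F s)"
   unfolding 1 using 2 integral_diff[OF integrable_continuous_interval[OF c] integrable_continuous_interval[OF cs]] by simp
  have "norm (integral {a..b} (\<lambda>t. (N * dstep (N * (t - s))) *\<^sub>R F t - (N * dstep (N * (t - s))) *\<^sub>R F s)) \<le> (N * dB * e') * (b - a)"
  proof (rule integral_bound)
   fix t assume t: "t \<in> {a..b}"
   have td: "dist t s < d" using t r by (auto simp: dist_real_def a_def b_def)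
   then have "norm (F t - F s) \<le> e'" using d(2) t sub by (auto simp: dist_norm less_imp_le)
   then have "\<bar>N * dstep (N * (t - s))\<bar> * norm (F t - F s) \<le> (N * dB) * e'"
    unfolding abs_mult using N e' dB by (intro mult_mono) auto
   then show "norm ((N * dstep (N * (t - s))) *\<^sub>R F t - (N * dstep (N * (t - s))) *\<^sub>R F s) \<le> N * dB * e'"
    unfolding scaleR_diff_right[symmetric] norm_scaleR .
  qed (use ab c cs in \<open>auto intro: continuous_on_diff\<close>)
  also have "\<dots> = 2 * dB * e'" using N by (simp add: a_def b_def)
  also have "\<dots> < e"
  proof -
   have "2 * dB * e' = (2 * dB / (4 * (dB + 1))) * e" by (simp add: e'_def)
   also have "\<dots> < 1 * e" using dB(1) e by (intro mult_strict_right_mono) (auto simp: divide_less_eq)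
   finally show ?thesis by simp
  qed
  finally show "norm ((LINT t|lT. (real (Suc n) * dstep (real (Suc n) * (t - s))) *\<^sub>R F t) - F s) < e"
   unfolding eq[unfolded N_def] unfolding N_def .
 qed
qed

text \<open>The test function is a difference of two steps, at s and at T. Its derivative is a
  difference of two approximate point masses, so F takes the same value at s and T; continuity
  reaches the time 0.\<close>

lemma du_Bois_Reymond:
 fixes F :: "real \<Rightarrow> complex"
 assumes F: "continuous_on {0..} F" and 0: "\<And>\<eta>. test_fun {0<..} \<eta> \<Longrightarrow> (LINT t|lT. deriv \<eta> t *\<^sub>R F t) = 0"
  and T: "T \<ge> 0"
 shows "F T = F 0"
proof -
 have eq: "F s = F T" if sT: "0 < s" "s < T" for s T
 proof -
  let ?K = "\<lambda>s n. LINT t|lT. (real (Suc n) * dstep (real (Suc n) * (t - s))) *\<^sub>R F t"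
  obtain m :: nat where m: "1 / s < real m" using reals_Archimedean2 by blast
  have e: "?K s n = ?K T n" if n: "n \<ge> m" for n
  proof -
   define N where "N = real (Suc n)"
   have N: "N > 0" by (simp add: N_def)
   have mN: "1 / s < N" using m n by (simp add: N_def)
   then have r: "1 / N < s" using N sT by (simp add: field_simps)
   define \<eta> where "\<eta> = (\<lambda>t. sstep (N * (t - s)) - sstep (N * (t - T)))"
   have sm: "smooth_on UNIV (\<lambda>t. sstep (N * (t - s)))" for s
    by (rule smooth_on_compose[OF smooth_on_sstep open_UNIV open_UNIV subset_UNIV])
      (intro smooth_on_cmult smooth_on_diff smooth_on_const open_UNIV smooth_on_linear bounded_linear_ident)
   have supp: "{t. \<eta> t \<noteq> 0} \<subseteq> {s - 1 / N..T + 1 / N}"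
   proof
    fix t assume t: "t \<in> {t. \<eta> t \<noteq> 0}"
    show "t \<in> {s - 1 / N..T + 1 / N}"
    proof (rule ccontr)
     assume "t \<notin> {s - 1 / N..T + 1 / N}"
     then consider "t < s - 1 / N" | "t > T + 1 / N" by fastforce
     then show False
     proof cases
      case 1
      then have "N * (t - s) \<le> -1" "N * (t - T) \<le> -1" using N sT by (simp_all add: field_simps) (smt (verit) mult_less_cancel_left_pos)
      then show False using t by (simp add: \<eta>_def sstep_0)
     next
      case 2
      then have "N * (t - s) \<ge> 1" "N * (t - T) \<ge> 1" using N sT by (simp_all add: field_simps) (smt (verit) mult_less_cancel_left_pos)
      then show False using t by (simp add: \<eta>_def sstep_1)
     qed
    qed
   qed
   have cl: "closure {t. \<eta> t \<noteq> 0} \<subseteq> {s - 1 / N..T + 1 / N}" by (rule closure_minimal[OF supp]) simp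
   have "test_fun {0<..} \<eta>"
    unfolding test_fun_def
   proof (intro conjI)
    show "smooth_on UNIV \<eta>" unfolding \<eta>_def by (intro smooth_on_diff sm open_UNIV)
    show "compact (closure {t. \<eta> t \<noteq> 0})" using bounded_subset[OF bounded_closed_interval supp] by (simp add: compact_closure)
    show "closure {t. \<eta> t \<noteq> 0} \<subseteq> {0<..}" using cl r by fastforce
   qed
   from 0[OF this] have z: "(LINT t|lT. deriv \<eta> t *\<^sub>R F t) = 0" .
   have dd: "((\<lambda>t. sstep (N * (t - s))) has_real_derivative N * dstep (N * (t - s))) (at t)" for s t
   proof -
    have "((\<lambda>t. sstep (N * (t - s))) has_real_derivative dstep (N * (t - s)) * N) (at t)"
     by (rule DERIV_chain'[OF _ sstep_deriv]) (auto intro!: derivative_eq_intros)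
    then show ?thesis by (simp add: mult.commute)
   qed
   have de: "deriv \<eta> t = N * dstep (N * (t - s)) - N * dstep (N * (t - T))" for t
    unfolding \<eta>_def by (rule DERIV_imp_deriv[OF DERIV_diff[OF dd dd]])
   have int: "integrable lT (\<lambda>t. (N * dstep (N * (t - s))) *\<^sub>R F t)" if s: "1 / N < s" for s
   proof (rule time_integral(2)[where \<alpha>="s - 1 / N" and \<beta>="s + 1 / N"])
    show "continuous_on {s - 1 / N..s + 1 / N} (\<lambda>t. (N * dstep (N * (t - s))) *\<^sub>R F t)"
     using s by (intro continuous_on_scaleR continuous_on_subset[OF F] continuous_intros continuous_on_compose2[OF smooth_on_continuous[OF smooth_dstep]]) auto
    show "(N * dstep (N * (t - s))) *\<^sub>R F t = 0" if "t \<notin> {s - 1 / N..s + 1 / N}" for t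
    proof -
     have "\<bar>t - s\<bar> > 1 / N" using that by auto
     then have "1 < \<bar>N * (t - s)\<bar>" unfolding abs_mult using N by (simp add: divide_less_eq mult.commute)
     then show ?thesis using dstep_eq_0 by simp
    qed
   qed (use s in auto)
   have "(LINT t|lT. (N * dstep (N * (t - s))) *\<^sub>R F t) - (LINT t|lT. (N * dstep (N * (t - T))) *\<^sub>R F t) = 0"
    using z unfolding de scaleR_diff_left using int[OF r] int[of T] r sT by (subst (asm) Bochner_Integration.integral_diff) auto
   then show ?thesis unfolding N_def by simp
  qed
  have T0: "T > 0" using sT by simp
  have "\<forall>\<^sub>F n in sequentially. ?K s n = ?K T n" by (rule eventually_sequentiallyI[OF e])
  then have "?K T \<longlonglongrightarrow> F s" by (rule Lim_transform_eventually[OF mollify_time[OF F sT(1)]])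
  then show ?thesis by (rule LIMSEQ_unique[OF _ mollify_time[OF F T0]])
 qed
 have c: "F t = F 1" if "t \<in> {0<..}" for t
 proof -
  consider "t < 1" | "t = 1" | "1 < t" by linarith
  then show ?thesis
  proof cases
   case 1 then show ?thesis using that by (intro eq) auto
  next
   case 2 then show ?thesis by simp
  next
   case 3 then show ?thesis by (intro eq[symmetric]) auto
  qed
 qed
 have cl: "F t = F 1" if "t \<in> closure {0<..}" for t
  by (rule continuous_constant_on_closure[OF _ c that]) (use F in simp_all)
 have "F T = F 1" "F 0 = F 1" by (rule cl; use T in simp)+
 then show ?thesis by (rule trans[OF _ sym])
qed

text \<open>With D a primitive of C, the equation says that A' + B + D has zero derivative as a
  distribution. This continuous function is then constant up to the time 0.\<close>

lemma distr_ode_integrated: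
 assumes A: "\<And>t. t \<ge> 0 \<Longrightarrow> (A has_vector_derivative A' t) (at t within {0..})" and A': "continuous_on {0..} A'"
  and B: "continuous_on {0..} B" and C: "continuous_on {0..} C" and ode: "distr_ode A B C" and T: "T \<ge> 0"
 shows "A' T + B T + integral {0..T} C = A' 0 + B 0"
proof -
 define D where "D = (\<lambda>t. integral {0..t} C)"
 have D: "(D has_vector_derivative C t) (at t within {0..})" if t: "t \<ge> 0" for t
 proof -
  have "(D has_vector_derivative C t) (at t within {0..t+1})"
   unfolding D_def by (rule integral_has_vector_derivative[OF continuous_on_subset[OF C]]) (use t in auto)
  moreover have "at t within {0..t+1} = at t within {0..}"
   by (rule at_within_nhd[of _ "{..<t+1}"]) auto
  ultimately show ?thesis by simp
 qed
 have cD: "continuous_on {0..} D"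
  using D has_vector_derivative_continuous unfolding continuous_on_eq_continuous_within by (metis atLeast_iff)
 define F where "F = (\<lambda>t. A' t + B t + D t)"
 have cF: "continuous_on {0..} F" unfolding F_def by (intro continuous_on_add A' B cD)
 have "F T = F 0"
 proof (rule du_Bois_Reymond[OF cF _ T])
  fix \<eta> :: "real \<Rightarrow> real" assume e: "test_fun {0<..} \<eta>"
  note d = test_time_deriv[OF e]
  obtain \<alpha> \<beta> where ab: "0 < \<alpha>" "\<alpha> < \<beta>" "\<And>t. t \<le> \<alpha> \<or> \<beta> \<le> t \<Longrightarrow> deriv \<eta> t = 0" using test_time[OF d(3)] by blast
  have int: "integrable lT (\<lambda>t. deriv \<eta> t *\<^sub>R f t)" if "continuous_on {0..} f" for f :: "real \<Rightarrow> complex"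
   by (rule time_integral(2)[OF _ ab(1), of \<beta>])
     (use ab in \<open>auto intro!: continuous_on_scaleR test_time_deriv(4)[OF d(3)] continuous_on_subset[OF that]\<close>)
  let ?A = "(LINT t|lT. deriv \<eta> t *\<^sub>R A' t)"
  let ?B = "(LINT t|lT. deriv \<eta> t *\<^sub>R F t)"
  let ?C = "(LINT t|lT. deriv \<eta> t *\<^sub>R D t)"
  have "?B = ?A + (LINT t|lT. deriv \<eta> t *\<^sub>R B t) + ?C"
   unfolding F_def scaleR_add_right using int[OF A'] int[OF B] int[OF cD] by simp
  also have "?A = - (LINT t|lT. (deriv ^^ 2) \<eta> t *\<^sub>R A t)"
   using time_parts[OF d(3) A A'] by (simp add: deriv_2)
  also have "?C = - (LINT t|lT. \<eta> t *\<^sub>R C t)"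
   by (rule time_parts[OF e D C])
  also have "- (LINT t|lT. (deriv ^^ 2) \<eta> t *\<^sub>R A t) + (LINT t|lT. deriv \<eta> t *\<^sub>R B t) + - (LINT t|lT. \<eta> t *\<^sub>R C t)
   = - ((LINT t|lT. (deriv ^^ 2) \<eta> t *\<^sub>R A t) - (LINT t|lT. deriv \<eta> t *\<^sub>R B t) + (LINT t|lT. \<eta> t *\<^sub>R C t))" by simp
  also have "\<dots> = 0" using ode e unfolding distr_ode_def by simp
  finally show "?B = 0" .
 qed
 then show ?thesis by (simp add: F_def D_def)
qed

section \<open>Integrals of positive kernels over a triangle\<close>

lemma integral_step_lower:
 fixes f :: "real \<Rightarrow> real"
 assumes f: "continuous_on {0..real k * h} f" and h: "h \<ge> 0"
  and lb: "\<And>j t. j < k \<Longrightarrow> real j * h \<le> t \<Longrightarrow> t \<le> real (Suc j) * h \<Longrightarrow> c j \<le> f t"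
 shows "(\<Sum>j<k. h * c j) \<le> integral {0..real k * h} f"
 using f lb
proof (induction k)
 case (Suc k)
 have le: "0 \<le> real k * h" "real k * h \<le> real (Suc k) * h" using h by (auto intro: mult_right_mono)
 have i: "f integrable_on {0..real (Suc k) * h}" by (rule integrable_continuous_interval[OF Suc.prems(1)])
 have "(\<Sum>j<k. h * c j) \<le> integral {0..real k * h} f"
  by (rule Suc.IH[OF continuous_on_subset[OF Suc.prems(1)]]) (use le Suc.prems(2) in auto)
 moreover have "h * c k \<le> integral {real k * h..real (Suc k) * h} f"
 proof -
  have "h * c k = integral {real k * h..real (Suc k) * h} (\<lambda>_. c k)" using h by (simp add: algebra_simps)
  also have "\<dots> \<le> integral {real k * h..real (Suc k) * h} f"
   by (rule integral_le[OF _ integrable_subinterval_real[OF i]]) (use le Suc.prems(2)[of k] in auto)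
  finally show ?thesis .
 qed
 moreover have "integral {0..real k * h} f + integral {real k * h..real (Suc k) * h} f = integral {0..real (Suc k) * h} f"
  by (rule Henstock_Kurzweil_Integration.integral_combine[OF le i])
 ultimately show ?case by simp
qed simp

lemma sum_symmetric_square:
 fixes G :: "nat \<Rightarrow> nat \<Rightarrow> real"
 assumes "\<And>i j. G i j = G j i"
 shows "(\<Sum>i<n. \<Sum>j<n. G i j) = 2 * (\<Sum>j<n. \<Sum>i<j. G i j) + (\<Sum>i<n. G i i)"
proof (induction n)
 case (Suc n)
 have "(\<Sum>i<n. G n i) = (\<Sum>i<n. G i n)" using assms by simp
 then show ?case using Suc by (simp add: sum.distrib)
qed simp

text \<open>Riemann sums reduce this to the positivity of the double sums; thus no integration theory for
 functions with values in L2 is needed.\<close>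

lemma positive_kernel_triangle:
 fixes G :: "real \<Rightarrow> real \<Rightarrow> real"
 assumes T: "T > 0" and c: "continuous_on ({0..T} \<times> {0..T}) (\<lambda>p. G (fst p) (snd p))"
  and sym: "\<And>s t. G s t = G t s"
  and pos: "\<And>n (x :: nat \<Rightarrow> real). (\<And>i. i < n \<Longrightarrow> x i \<in> {0..T}) \<Longrightarrow> 0 \<le> (\<Sum>i<n. \<Sum>j<n. G (x i) (x j))"
  and g: "continuous_on {0..T} (\<lambda>t. integral {0..t} (\<lambda>s. G s t))"
 shows "0 \<le> integral {0..T} (\<lambda>t. integral {0..t} (\<lambda>s. G s t))"
proof (rule field_le_epsilon)
 fix e :: real assume e: "e > 0"
 let ?Q = "{0..T} \<times> {0..T}"
 have cQ: "compact ?Q" by (intro compact_Times compact_Icc)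
 have "bounded ((\<lambda>p. G (fst p) (snd p)) ` ?Q)" by (rule compact_imp_bounded[OF compact_continuous_image[OF c cQ]])
 then obtain M0 where "\<forall>x\<in>(\<lambda>p. G (fst p) (snd p)) ` ?Q. norm x \<le> M0" unfolding bounded_iff by blast
 then have M0: "\<And>p. p \<in> ?Q \<Longrightarrow> \<bar>G (fst p) (snd p)\<bar> \<le> M0" by auto
 define M where "M = max M0 1"
 have M: "M > 0" "\<And>s t. s \<in> {0..T} \<Longrightarrow> t \<in> {0..T} \<Longrightarrow> \<bar>G s t\<bar> \<le> M"
  using M0[of "(s,t)" for s t] by (force simp: M_def)+
 define \<epsilon> where "\<epsilon> = e / (2 * T^2)"
 \<comment> \<open>The number \<epsilon> bounds the error of replacing G by its grid values; over
   the whole square this costs at most T^2 \<epsilon> = e/2.\<close>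
 have eps: "\<epsilon> > 0" using e T by (simp add: \<epsilon>_def)
 have "uniformly_continuous_on ?Q (\<lambda>p. G (fst p) (snd p))" by (rule compact_uniformly_continuous[OF c cQ])
 then obtain \<delta> where d: "\<delta> > 0" "\<And>p q. p \<in> ?Q \<Longrightarrow> q \<in> ?Q \<Longrightarrow> dist q p < \<delta> \<Longrightarrow> dist (G (fst q) (snd q)) (G (fst p) (snd p)) < \<epsilon>"
  unfolding uniformly_continuous_on_def using eps by metis
 \<comment> \<open>The first bound gives a mesh with 2 h < \<delta>. The second gives 4 T h M < e,
   which pays for the incomplete last cells of the inner integrals, T h M in all, and for the
   diagonal, another T h M / 2.\<close>
 obtain n0 :: nat where n0: "max (2 * T / \<delta>) (4 * T^2 * M / e) < real n0" using reals_Archimedean2 by blast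
 define n where "n = Suc n0"
 have n: "n > 0" "2 * T / \<delta> < real n" "4 * T^2 * M / e < real n" using n0 by (auto simp: n_def)
 define h where "h = T / real n"
 have h: "h > 0" "real n * h = T" "2 * h < \<delta>" "4 * T * h * M < e"
  using n T d(1) e by (auto simp: h_def field_simps power2_eq_square)
 have kn: "real k * h \<le> T" "real k * h \<ge> 0" if "k \<le> n" for k
  using that h mult_right_mono[of "real k" "real n" h] by auto
 define S where "S = (\<lambda>j. \<Sum>i<j. h * (G (real i * h) (real j * h) - \<epsilon>))"
 have cG: "continuous_on {a..b} (\<lambda>s. G s t)" if "0 \<le> a" "b \<le> T" "t \<in> {0..T}" for a b t
 proof -
  have "continuous_on {a..b} (\<lambda>s. (\<lambda>p. G (fst p) (snd p)) (s, t))"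
   by (rule continuous_on_compose2[OF c]) (use that in \<open>auto intro!: continuous_intros\<close>)
  then show ?thesis by simp
 qed
 \<comment> \<open>The inner integral up to the grid point j h is bounded below by its Riemann sum;
   the rest, up to t, has length at most h and loses at most h M.\<close>
 have low: "S j - h * M \<le> integral {0..t} (\<lambda>s. G s t)" if j: "j < n" and t: "real j * h \<le> t" "t \<le> real (Suc j) * h" for j t
 proof -
  have tT: "t \<le> T" "t \<ge> 0" using t kn[of j] kn[of "Suc j"] j by auto
  have "S j \<le> integral {0..real j * h} (\<lambda>s. G s t)"
   unfolding S_def
  proof (rule integral_step_lower[OF cG])
   fix i s assume i: "i < j" and s: "real i * h \<le> s" "s \<le> real (Suc i) * h"
   have s0: "s \<in> {0..T}" "real i * h \<in> {0..T}" "real j * h \<in> {0..T}"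
    using s kn[of i] kn[of "Suc i"] kn[of j] i j by auto
   have "dist (real i * h, real j * h) (s, t) \<le> \<bar>real i * h - s\<bar> + \<bar>real j * h - t\<bar>"
    by (simp add: dist_Pair_Pair dist_real_def sqrt_sum_squares_le_sum_abs)
   also have "\<dots> \<le> 2 * h" using s t by (simp add: algebra_simps)
   finally have "dist (real i * h, real j * h) (s, t) < \<delta>" using h(3) by linarith
   then have "dist (G (real i * h) (real j * h)) (G s t) < \<epsilon>"
    using d(2)[of "(s, t)" "(real i * h, real j * h)"] s0 tT by auto
   then show "G (real i * h) (real j * h) - \<epsilon> \<le> G s t" by (simp add: dist_real_def)
  qed (use h kn[of j] j tT in auto)
  moreover have "- (h * M) \<le> integral {real j * h..t} (\<lambda>s. G s t)"
  proof -
   have "norm (integral {real j * h..t} (\<lambda>s. G s t)) \<le> M * (t - real j * h)"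
    by (rule integral_bound[OF t(1) cG]) (use M(2) kn[of j] j tT in auto)
   also have "\<dots> \<le> M * h" using t M(1) by (intro mult_left_mono) (auto simp: algebra_simps)
   finally show ?thesis by (simp add: mult.commute)
  qed
  moreover have "integral {0..real j * h} (\<lambda>s. G s t) + integral {real j * h..t} (\<lambda>s. G s t) = integral {0..t} (\<lambda>s. G s t)"
   by (rule Henstock_Kurzweil_Integration.integral_combine[OF _ t(1) integrable_continuous_interval[OF cG]]) (use kn[of j] j tT in auto)
  ultimately show ?thesis by linarith
 qed
 have "(\<Sum>j<n. h * (S j - h * M)) \<le> integral {0..real n * h} (\<lambda>t. integral {0..t} (\<lambda>s. G s t))"
  by (rule integral_step_lower) (use g h low in auto)
 moreover have "(\<Sum>j<n. h * (S j - h * M)) \<ge> - e"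
 proof -
  have symG: "\<And>i j. G (real i * h) (real j * h) = G (real j * h) (real i * h)" by (rule sym)
  \<comment> \<open>By symmetry the full double sum is twice the sum over the strict triangle plus
    the diagonal. The full sum is nonnegative and the diagonal is at most n M, so the triangle is
    bounded below.\<close>
  define U where "U = (\<Sum>j<n. \<Sum>i<j. G (real i * h) (real j * h))"
  have "0 \<le> (\<Sum>i<n. \<Sum>j<n. G (real i * h) (real j * h))" by (rule pos) (use kn in auto)
  moreover have "(\<Sum>i<n. \<Sum>j<n. G (real i * h) (real j * h)) = 2 * U + (\<Sum>i<n. G (real i * h) (real i * h))"
   unfolding U_def by (rule sum_symmetric_square[of "\<lambda>i j. G (real i * h) (real j * h)" n, OF symG])
  moreover have "(\<Sum>i<n. G (real i * h) (real i * h)) \<le> (\<Sum>i<n. M)"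
  proof (rule sum_mono)
   fix i assume "i \<in> {..<n}"
   then have "\<bar>G (real i * h) (real i * h)\<bar> \<le> M" using kn[of i] by (intro M(2)) auto
   then show "G (real i * h) (real i * h) \<le> M" by linarith
  qed
  moreover have "(\<Sum>i<n. M) = real n * M" by simp
  ultimately have U: "- (real n * M) \<le> 2 * U" by linarith
  have Sj: "S j \<ge> h * (\<Sum>i<j. G (real i * h) (real j * h)) - T * \<epsilon>" if "j < n" for j
  proof -
   have "S j = h * (\<Sum>i<j. G (real i * h) (real j * h)) - (real j * h) * \<epsilon>"
    unfolding S_def by (simp add: right_diff_distrib sum_subtractf sum_distrib_left)
   moreover have "(real j * h) * \<epsilon> \<le> T * \<epsilon>" using kn[of j] that eps by (intro mult_right_mono) auto
   ultimately show ?thesis by linarith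
  qed
  have low2: "(\<Sum>j<n. h * (S j - h * M)) \<ge> (\<Sum>j<n. h * (h * (\<Sum>i<j. G (real i * h) (real j * h)) - T * \<epsilon> - h * M))"
   using Sj h(1) by (intro sum_mono mult_left_mono) auto
  have sp: "(\<Sum>j<n. h * (h * (\<Sum>i<j. G (real i * h) (real j * h)) - T * \<epsilon> - h * M)) = h^2 * U - (real n * h) * (T * \<epsilon> + h * M)"
   unfolding U_def by (simp add: algebra_simps sum_subtractf sum.distrib sum_distrib_left power2_eq_square)
  have 1: "h^2 * U - T * (T * \<epsilon> + h * M) \<le> (\<Sum>j<n. h * (S j - h * M))"
   using low2 unfolding sp unfolding h(2) .
  have "h^2 * (- (real n * M)) \<le> h^2 * (2 * U)" using U by (intro mult_left_mono) auto
  moreover have "h^2 * (- (real n * M)) = - (T * h * M)" unfolding h(2)[symmetric] by (simp add: power2_eq_square)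
  moreover have "h^2 * (2 * U) = 2 * (h^2 * U)" by (rule mult.left_commute)
  ultimately have 2: "- (T * h * M) \<le> 2 * (h^2 * U)" by (simp only:)
  have 3: "T * (T * \<epsilon>) = e / 2" using T by (simp add: \<epsilon>_def power2_eq_square)
  have "T * (T * \<epsilon> + h * M) = e / 2 + T * h * M" using 3 by (simp add: distrib_left)
  then show ?thesis using 1 2 h(4) e by linarith
 qed
 ultimately show "0 \<le> integral {0..T} (\<lambda>t. integral {0..t} (\<lambda>s. G s t)) + e" unfolding h(2) by linarith
qed

section \<open>Operations on curves in L2\<close>

lemma cL2_comparison:
 assumes X: "cL2 X" and s: "\<And>t. t \<ge> 0 \<Longrightarrow> sqi Fund (Y t)"
  and le: "\<And>s t. s \<ge> 0 \<Longrightarrow> t \<ge> 0 \<Longrightarrow> nrm Fund (\<lambda>z. Y s z - Y t z) \<le> B * nrm Fund (\<lambda>z. X s z - X t z)"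
 shows "cL2 Y"
 unfolding cL2_def
proof (intro allI impI conjI)
 fix t :: real assume t: "t \<ge> 0"
 show "sqi Fund (Y t)" by (rule s[OF t])
 let ?A = "(\<lambda>s. B * nrm Fund (\<lambda>z. X s z - X t z))"
 have "(?A \<longlongrightarrow> B * 0) (at t within {0..})"
  using X t by (intro tendsto_mult_left) (auto simp: cL2_def)
 then have lim: "(?A \<longlongrightarrow> 0) (at t within {0..})" by simp
 show "((\<lambda>s. nrm Fund (\<lambda>z. Y s z - Y t z)) \<longlongrightarrow> 0) (at t within {0..})"
  by (rule tendsto_0_le[OF lim]) (use le t in \<open>auto simp: nrm_nonneg\<close>)
qed

lemma dL2_comparison:
 assumes X: "dL2 X X'" and s: "\<And>t. t \<ge> 0 \<Longrightarrow> sqi Fund (Y' t)"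
  and le: "\<And>s t. s \<ge> 0 \<Longrightarrow> t \<ge> 0 \<Longrightarrow> nrm Fund (\<lambda>z. (Y s z - Y t z) /\<^sub>R (s - t) - Y' t z) \<le> B * nrm Fund (\<lambda>z. (X s z - X t z) /\<^sub>R (s - t) - X' t z)"
 shows "dL2 Y Y'"
 unfolding dL2_def
proof (intro allI impI conjI)
 fix t :: real assume t: "t \<ge> 0"
 show "sqi Fund (Y' t)" by (rule s[OF t])
 let ?A = "(\<lambda>s. B * nrm Fund (\<lambda>z. (X s z - X t z) /\<^sub>R (s - t) - X' t z))"
 have "(?A \<longlongrightarrow> B * 0) (at t within {0..})"
  using X t by (intro tendsto_mult_left) (auto simp: dL2_def)
 then have lim: "(?A \<longlongrightarrow> 0) (at t within {0..})" by simp
 show "((\<lambda>s. nrm Fund (\<lambda>z. (Y s z - Y t z) /\<^sub>R (s - t) - Y' t z)) \<longlongrightarrow> 0) (at t within {0..})"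
  by (rule tendsto_0_le[OF lim]) (use le t in \<open>auto simp: nrm_nonneg\<close>)
qed

definition wmul :: "(complex \<Rightarrow> real) \<Rightarrow> (complex \<Rightarrow> complex) \<Rightarrow> complex \<Rightarrow> complex" where
 "wmul c f z = complex_of_real (c z) * f z"

definition bdd :: "(complex \<Rightarrow> real) \<Rightarrow> bool" where
 "bdd c \<longleftrightarrow> c \<in> borel_measurable lF \<and> (\<exists>B. AE z in lF. \<bar>c z\<bar> \<le> B)"

lemma bddE:
 assumes "bdd c" obtains B where "B \<ge> 0" "AE z in lF. \<bar>c z\<bar> \<le> B" "c \<in> borel_measurable lF"
proof -
 obtain B where B: "AE z in lF. \<bar>c z\<bar> \<le> B" and m: "c \<in> borel_measurable lF" using assms by (auto simp: bdd_def)
 have "AE z in lF. \<bar>c z\<bar> \<le> max B 0" using B by eventually_elim simp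
 then show ?thesis using that[of "max B 0"] m by simp
qed

lemma bdd_mult: assumes "bdd c" "bdd d" shows "bdd (\<lambda>z. c z * d z)"
proof -
 obtain B where B: "B \<ge> 0" "AE z in lF. \<bar>c z\<bar> \<le> B" "c \<in> borel_measurable lF" by (rule bddE[OF assms(1)])
 obtain D where D: "D \<ge> 0" "AE z in lF. \<bar>d z\<bar> \<le> D" "d \<in> borel_measurable lF" by (rule bddE[OF assms(2)])
 have "AE z in lF. \<bar>c z * d z\<bar> \<le> B * D"
  using B(2) D(2) by eventually_elim (use B(1) in \<open>auto simp: abs_mult intro!: mult_mono\<close>)
 then show ?thesis using B(3) D(3) by (auto simp: bdd_def)
qed

lemma bdd_continuous: assumes "continuous_on disc c" shows "bdd c"
proof -
 obtain B where "\<And>z. z \<in> Fund \<Longrightarrow> \<bar>c z\<bar> \<le> B" using continuous_bounded_on[OF compact_Fund Fund_disc assms] by blast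
 then have "AE z in lF. \<bar>c z\<bar> \<le> B" by (intro AE_I2) simp
 then show ?thesis using continuous_measurable_on[OF assms Fund_disc Fund_lebesgue] by (auto simp: bdd_def)
qed

lemma wmul_L2:
 assumes "bdd c" obtains B where "B \<ge> 0" "\<And>f. sqi Fund f \<Longrightarrow> sqi Fund (wmul c f)" "\<And>f. sqi Fund f \<Longrightarrow> nrm Fund (wmul c f) \<le> B * nrm Fund f"
proof -
 obtain B where B: "B \<ge> 0" "AE z in lF. \<bar>c z\<bar> \<le> B" "c \<in> borel_measurable lF" by (rule bddE[OF assms])
 have m: "(\<lambda>z. complex_of_real (c z)) \<in> borel_measurable lF" using B(3) by (auto intro: borel_measurable_of_real)
 have n: "AE z in lF. norm (complex_of_real (c z)) \<le> B" using B(2) by simp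
 show ?thesis
  by (rule that[OF B(1)]; unfold wmul_def[abs_def]; rule sqi_bounded_mult[OF _ m n] nrm_bounded_mult[OF _ m n B(1)])
qed

lemma cL2_wmul:
 assumes "bdd c" "cL2 X" shows "cL2 (\<lambda>t. wmul c (X t))"
proof -
 obtain B where B: "B \<ge> 0" "\<And>f. sqi Fund f \<Longrightarrow> sqi Fund (wmul c f)" "\<And>f. sqi Fund f \<Longrightarrow> nrm Fund (wmul c f) \<le> B * nrm Fund f"
  using wmul_L2[OF assms(1)] by metis
 show ?thesis
 proof (rule cL2_comparison[OF assms(2)])
  show "sqi Fund (wmul c (X t))" if "t \<ge> 0" for t by (rule B(2)[OF cL2_sqi[OF assms(2) that]])
  fix s t :: real assume st: "s \<ge> 0" "t \<ge> 0"
  have "(\<lambda>z. wmul c (X s) z - wmul c (X t) z) = wmul c (\<lambda>z. X s z - X t z)" by (simp add: wmul_def fun_eq_iff right_diff_distrib)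
  then show "nrm Fund (\<lambda>z. wmul c (X s) z - wmul c (X t) z) \<le> B * nrm Fund (\<lambda>z. X s z - X t z)"
   using B(3)[OF sqi_diff[OF cL2_sqi[OF assms(2) st(1)] cL2_sqi[OF assms(2) st(2)]]] by simp
 qed
qed

lemma sqi_quotient:
 assumes "cL2 X" "dL2 X X'" "s \<ge> 0" "t \<ge> 0" shows "sqi Fund (\<lambda>z. (X s z - X t z) /\<^sub>R (s - t) - X' t z)"
proof -
 have X': "sqi Fund (X' t)" using assms by (auto simp: dL2_def)
 have "sqi Fund (\<lambda>z. complex_of_real (inverse (s - t)) * (X s z - X t z) - X' t z)"
  by (rule sqi_diff[OF sqi_cmult[OF sqi_diff[OF cL2_sqi[OF assms(1,3)] cL2_sqi[OF assms(1,4)]]] X'])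
 then show ?thesis by (simp add: scaleR_conv_of_real)
qed

lemma dL2_wmul:
 assumes "bdd c" "cL2 X" "dL2 X X'" shows "dL2 (\<lambda>t. wmul c (X t)) (\<lambda>t. wmul c (X' t))"
proof -
 obtain B where B: "B \<ge> 0" "\<And>f. sqi Fund f \<Longrightarrow> sqi Fund (wmul c f)" "\<And>f. sqi Fund f \<Longrightarrow> nrm Fund (wmul c f) \<le> B * nrm Fund f"
  using wmul_L2[OF assms(1)] by metis
 show ?thesis
 proof (rule dL2_comparison[OF assms(3)])
  show "sqi Fund (wmul c (X' t))" if "t \<ge> 0" for t using B(2) assms(3) that by (auto simp: dL2_def)
  fix s t :: real assume st: "s \<ge> 0" "t \<ge> 0"
  let ?A = "(\<lambda>z. (wmul c (X s) z - wmul c (X t) z) /\<^sub>R (s - t) - wmul c (X' t) z)"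
  let ?B = "(\<lambda>z. (X s z - X t z) /\<^sub>R (s - t) - X' t z)"
  have "?A = wmul c ?B"
   by (simp add: wmul_def fun_eq_iff right_diff_distrib scaleR_conv_of_real)
  then show "nrm Fund ?A \<le> B * nrm Fund ?B"
   using B(3)[OF sqi_quotient[OF assms(2,3) st]] by simp
 qed
qed

lemma sqi_cnj: "sqi S f \<Longrightarrow> sqi S (\<lambda>z. cnj (f z))"
 by (auto simp: sqi_def intro!: borel_measurable_continuous_on[of cnj] continuous_intros)

lemma nrm_cnj: "nrm S (\<lambda>z. cnj (f z)) = nrm S f" by (simp add: nrm_def)

lemma cL2_cnj: assumes "cL2 X" shows "cL2 (\<lambda>t z. cnj (X t z))"
proof (rule cL2_comparison[OF assms, where B=1])
 show "sqi Fund (\<lambda>z. cnj (X t z))" if "t \<ge> 0" for t by (rule sqi_cnj[OF cL2_sqi[OF assms that]])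
 show "nrm Fund (\<lambda>z. cnj (X s z) - cnj (X t z)) \<le> 1 * nrm Fund (\<lambda>z. X s z - X t z)" for s t
  using nrm_cnj[of Fund "\<lambda>z. X s z - X t z"] by simp
qed

lemma dL2_cnj: assumes "dL2 X X'" shows "dL2 (\<lambda>t z. cnj (X t z)) (\<lambda>t z. cnj (X' t z))"
proof (rule dL2_comparison[OF assms, where B=1])
 show "sqi Fund (\<lambda>z. cnj (X' t z))" if "t \<ge> 0" for t using assms that by (auto simp: dL2_def intro: sqi_cnj)
 show "nrm Fund (\<lambda>z. (cnj (X s z) - cnj (X t z)) /\<^sub>R (s - t) - cnj (X' t z)) \<le> 1 * nrm Fund (\<lambda>z. (X s z - X t z) /\<^sub>R (s - t) - X' t z)" for s t
  using nrm_cnj[of Fund "\<lambda>z. (X s z - X t z) /\<^sub>R (s - t) - X' t z"] by simp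
qed

lemma cL2_diff: assumes X: "cL2 X" and Y: "cL2 Y" shows "cL2 (\<lambda>t z. X t z - Y t z)"
 unfolding cL2_def
proof (intro allI impI conjI)
 fix t :: real assume t: "t \<ge> 0"
 show "sqi Fund (\<lambda>z. X t z - Y t z)" by (rule sqi_diff[OF cL2_sqi[OF X t] cL2_sqi[OF Y t]])
 have lim: "((\<lambda>s. nrm Fund (\<lambda>z. X s z - X t z) + nrm Fund (\<lambda>z. Y s z - Y t z)) \<longlongrightarrow> 0) (at t within {0..})"
  by (rule tendsto_eq_intros) (use X Y t in \<open>auto simp: cL2_def\<close>)
 show "((\<lambda>s. nrm Fund (\<lambda>z. (X s z - Y s z) - (X t z - Y t z))) \<longlongrightarrow> 0) (at t within {0..})"
 proof (rule tendsto_0_le[OF lim])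
  fix s :: real assume s: "s \<ge> 0"
  show "nrm Fund (\<lambda>z. (X s z - Y s z) - (X t z - Y t z)) \<le> nrm Fund (\<lambda>z. X s z - X t z) + nrm Fund (\<lambda>z. Y s z - Y t z)"
   using nrm_triangle[OF sqi_diff[OF cL2_sqi[OF X s] cL2_sqi[OF X t]] sqi_diff[OF cL2_sqi[OF Y t] cL2_sqi[OF Y s]]]
   unfolding nrm_minus_commute[of Fund "Y t" "Y s"] by (simp add: algebra_simps)
 qed (simp add: nrm_nonneg)
qed

lemma dL2_diff:
 assumes X: "cL2 X" "dL2 X X'" and Y: "cL2 Y" "dL2 Y Y'" shows "dL2 (\<lambda>t z. X t z - Y t z) (\<lambda>t z. X' t z - Y' t z)"
 unfolding dL2_def
proof (intro allI impI conjI)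
 fix t :: real assume t: "t \<ge> 0"
 have X': "sqi Fund (X' t)" and Y': "sqi Fund (Y' t)" using X(2) Y(2) t by (auto simp: dL2_def)
 show "sqi Fund (\<lambda>z. X' t z - Y' t z)" by (rule sqi_diff[OF X' Y'])
 let ?dX = "\<lambda>s z. (X s z - X t z) /\<^sub>R (s - t) - X' t z"
 let ?dY = "\<lambda>s z. (Y s z - Y t z) /\<^sub>R (s - t) - Y' t z"
 have lim: "((\<lambda>s. nrm Fund (?dX s) + nrm Fund (?dY s)) \<longlongrightarrow> 0) (at t within {0..})"
  by (rule tendsto_eq_intros) (use X Y t in \<open>auto simp: dL2_def\<close>)
 show "((\<lambda>s. nrm Fund (\<lambda>z. ((X s z - Y s z) - (X t z - Y t z)) /\<^sub>R (s - t) - (X' t z - Y' t z))) \<longlongrightarrow> 0) (at t within {0..})"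
 proof (rule tendsto_0_le[OF lim])
  fix s :: real assume s: "s \<ge> 0"
  let ?A = "(\<lambda>z. ((X s z - Y s z) - (X t z - Y t z)) /\<^sub>R (s - t) - (X' t z - Y' t z))"
  show "nrm Fund ?A \<le> nrm Fund (?dX s) + nrm Fund (?dY s)"
  proof -
   have "?A = (\<lambda>z. ?dX s z + (-1) * ?dY s z)"
    by (rule ext) (simp add: scaleR_diff_right)
   then show ?thesis using nrm_triangle[OF sqi_quotient[OF X s t] sqi_cmult[OF sqi_quotient[OF Y s t], of "-1"]]
    unfolding nrm_cmult by simp
  qed
 qed (simp add: nrm_nonneg)
qed

text \<open>The chosen derivative of a difference is the difference of the chosen derivatives only
  almost everywhere, but the norms agree, and \<open>Wnorm\<close> dominates them.\<close>

lemma cont_W1_cL2: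
 assumes c: "cont_W1 X" and ij: "(i, j) = (1, 0) \<or> (i, j) = (0, 1)" shows "cL2 (\<lambda>t. dF i j (X t))"
 unfolding cL2_def
proof (intro allI impI conjI)
 fix t :: real assume t: "t \<ge> 0"
 have W: "X s \<in> W 1" if "s \<ge> 0" for s using c that by (simp add: cont_W1_def)
 have sq: "sqi Fund (dF i j u)" if "u \<in> W 1" for u using W1_sqi(2,3)[OF that] ij by auto
 show "sqi Fund (dF i j (X t))" by (rule sq[OF W[OF t]])
 have lim: "((\<lambda>s. Wnorm 1 (\<lambda>z. X s z - X t z)) \<longlongrightarrow> 0) (at t within {0..})" using c t by (simp add: cont_W1_def)
 show "((\<lambda>s. nrm Fund (\<lambda>z. dF i j (X s) z - dF i j (X t) z)) \<longlongrightarrow> 0) (at t within {0..})"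
 proof (rule tendsto_0_le[OF lim])
  fix s :: real assume s: "s \<ge> 0"
  let ?A = "(\<lambda>z. X s z - X t z)"
  show "nrm Fund (\<lambda>z. dF i j (X s) z - dF i j (X t) z) \<le> Wnorm 1 ?A"
  proof -
   have Wd: "?A \<in> W 1" by (rule W1_diff[OF W[OF s] W[OF t]])
   have "AE z in lF. dF i j ?A z = dF i j (X s) z - dF i j (X t) z"
    by (rule dF_diff[OF W[OF s] W[OF t] Wd]) (use ij in auto)
   then have "AE z in lF. norm (dF i j (X s) z - dF i j (X t) z) = norm (dF i j ?A z)"
    by eventually_elim simp
   then have "nrm Fund (\<lambda>z. dF i j (X s) z - dF i j (X t) z) = nrm Fund (dF i j ?A)"
    by (rule nrm_cong_AE[OF _ sqiD(1)[OF sqi_diff[OF sq[OF W[OF s]] sq[OF W[OF t]]]] sqiD(1)[OF sq[OF Wd]]])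
   also have "\<dots> \<le> Wnorm 1 ?A" using nrm_dF_le_Wnorm ij by auto
   finally show ?thesis .
  qed
 qed (simp add: nrm_nonneg)
qed

lemma energy_classD:
 assumes "energy_class X X'"
 shows "t \<ge> 0 \<Longrightarrow> X t \<in> W 1" "cL2 X" "cL2 X'" "dL2 X X'" "cL2 (\<lambda>t. dF 1 0 (X t))" "cL2 (\<lambda>t. dF 0 1 (X t))"
 using assms cont_W1_cL2[of X 1 0] cont_W1_cL2[of X 0 1]
 by (auto simp: energy_class_def cont_W1_def cont_L2_def cL2_def dL2_def has_L2_time_derivative_def L2_iff L2norm_nrm)

abbreviation ch :: "(complex \<Rightarrow> real) \<Rightarrow> complex \<Rightarrow> complex" where
 "ch f \<equiv> \<lambda>z. complex_of_real (f z)"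

lemma sqi_ch: "sqi S f \<Longrightarrow> sqi S (ch f)"
 by (auto simp: sqi_def intro: borel_measurable_of_real)

lemma nrm_ch: "nrm S (ch f) = nrm S f" by (simp add: nrm_def)

lemma pr_cong_AE:
 assumes "sqi Fund f" "sqi Fund g" "AE z in lF. f z = f' z" "AE z in lF. g z = g' z"
 shows "pr f g = pr f' g'"
 unfolding pr_def
proof (rule integral_cong_AE)
 have f': "AE z in lF. f' z = f z" "AE z in lF. g' z = g z" using assms(3,4) by (auto elim: eventually_mono)
 show "(\<lambda>z. f z * g z) \<in> borel_measurable lF" "(\<lambda>z. f' z * g' z) \<in> borel_measurable lF"
  using sqiD(1)[OF assms(1)] sqiD(1)[OF assms(2)] sqiD(1)[OF sqi_AE[OF assms(1) f'(1)]] sqiD(1)[OF sqi_AE[OF assms(2) f'(2)]] by auto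
 show "AE z in lF. f z * g z = f' z * g' z" using assms(3,4) by eventually_elim simp
qed

lemma pr_Complex:
 assumes u: "AE z in lF. u z = Complex (f z) (g z)" and f: "sqi Fund f" and g: "sqi Fund g" and X: "sqi Fund X"
 shows "pr X u = pr X (ch f) + \<i> * pr X (ch g)"
proof -
 have u': "sqi Fund u" by (rule sqi_AE[OF sqi_Complex[OF f g] u])
 have "pr X u = pr X (\<lambda>z. ch f z + \<i> * ch g z)"
  by (rule pr_cong_AE[OF X u']) (use u in \<open>auto simp: Complex_eq\<close>)
 also have "\<dots> = pr X (ch f) + pr X (\<lambda>z. \<i> * ch g z)"
  by (rule pr_add(2)[OF sqi_ch[OF f] sqi_cmult[OF sqi_ch[OF g]] X])
 finally show ?thesis unfolding pr_cmult .
qed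

lemma pr_ch_ch: "pr (ch f) (ch g) = complex_of_real (LINT z|lF. f z * g z)"
 unfolding pr_def of_real_mult[symmetric] by (rule integral_complex_of_real)

lemma pr_commute: "pr f g = pr g f" by (simp add: pr_def mult.commute)

lemma Green_W1:
 assumes u: "u \<in> W 1" and p: "smooth_on disc \<phi>" "\<And>k z. k < 4 \<Longrightarrow> z \<in> disc \<Longrightarrow> \<phi> (gen k z) = \<phi> z"
 shows "pr (dF 1 0 u) (ch (partial 1 \<phi>)) + pr (dF 0 1 u) (ch (partial \<i> \<phi>)) + pr u (ch (lap \<phi>)) = 0"
proof -
 obtain f fx fy g gx gy where r: "rep f fx fy" "rep g gx gy"
  "AE z in lF. u z = Complex (f z) (g z)"
  "AE z in lF. dF 1 0 u z = Complex (fx z) (gx z)"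
  "AE z in lF. dF 0 1 u z = Complex (fy z) (gy z)"
  by (rule W1_rep[OF u])
 note d = sqi_ch[OF continuous_disc_sqi[OF smooth_continuous_partial[OF p(1) Basis_c(1)]]]
  sqi_ch[OF continuous_disc_sqi[OF smooth_continuous_partial[OF p(1) Basis_c(2)]]] sqi_ch[OF continuous_disc_sqi[OF lap_continuous[OF p(1)]]]
 have "pr (ch (partial 1 \<phi>)) (dF 1 0 u) + pr (ch (partial \<i> \<phi>)) (dF 0 1 u) + pr (ch (lap \<phi>)) u
  = complex_of_real ((LINT z|lF. fx z * partial 1 \<phi> z) + (LINT z|lF. fy z * partial \<i> \<phi> z) + (LINT z|lF. f z * lap \<phi> z))
   + \<i> * complex_of_real ((LINT z|lF. gx z * partial 1 \<phi> z) + (LINT z|lF. gy z * partial \<i> \<phi> z) + (LINT z|lF. g z * lap \<phi> z))"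
  unfolding pr_Complex[OF r(4) rep_Fund(2)[OF r(1)] rep_Fund(2)[OF r(2)] d(1)]
   pr_Complex[OF r(5) rep_Fund(3)[OF r(1)] rep_Fund(3)[OF r(2)] d(2)]
   pr_Complex[OF r(3) rep_Fund(1)[OF r(1)] rep_Fund(1)[OF r(2)] d(3)]
  unfolding pr_ch_ch by (simp add: mult.commute algebra_simps)
 also have "\<dots> = 0"
  using Green_rep[OF r(1) p] Green_rep[OF r(2) p] by (simp only: of_real_0 mult_zero_right add_0_right)
 finally show ?thesis unfolding pr_commute[of "ch (partial 1 \<phi>)"] pr_commute[of "ch (partial \<i> \<phi>)"] pr_commute[of "ch (lap \<phi>)"] .
qed

text \<open>The class of functions q(snd x) with q smooth is closed under derivatives in space
  directions, and contains 0, the derivative in the time direction.\<close>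

lemma smooth_on_snd:
 fixes p :: "complex \<Rightarrow> real" and S :: "real set"
 assumes S: "open S" and p: "smooth_on disc p" shows "smooth_on (S \<times> disc) (\<lambda>x. p (snd x))"
proof (rule smooth_on_coinduct[where P="\<lambda>f. \<exists>q. smooth_on disc q \<and> (\<forall>x\<in>S \<times> disc. f x = q (snd x))"])
 have o: "open (S \<times> disc)" by (rule open_Times[OF S open_disc])
 have D: "(f has_derivative (\<lambda>h. D (snd h))) (at x)"
  if "x \<in> S \<times> disc" "\<forall>x\<in>S \<times> disc. f x = q (snd x)" "(q has_derivative D) (at (snd x))" for f q D and x :: "real \<times> complex"
 proof -
  have "((\<lambda>x. q (snd x)) has_derivative (\<lambda>h. D (snd h))) (at x)"
   by (rule has_derivative_compose[OF has_derivative_snd[OF has_derivative_ident] that(3)])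
  then show ?thesis by (rule has_derivative_transform_within_open[OF _ o that(1)]) (use that(2) in auto)
 qed
 show "\<exists>q. smooth_on disc q \<and> (\<forall>x\<in>S \<times> disc. p (snd x) = q (snd x))" using p by auto
 fix f :: "real \<times> complex \<Rightarrow> real"
 assume "\<exists>q. smooth_on disc q \<and> (\<forall>x\<in>S \<times> disc. f x = q (snd x))"
 then obtain q where q: "smooth_on disc q" "\<forall>x\<in>S \<times> disc. f x = q (snd x)" by blast
 have qd: "\<exists>D. (q has_derivative D) (at (snd x))" if "x \<in> S \<times> disc" for x :: "real \<times> complex"
  using smooth_on_differentiable[OF q(1), of "snd x"] that unfolding differentiable_def by auto
 show "f differentiable (at x)" if "x \<in> S \<times> disc" for x
  using qd[OF that] D[OF that q(2)] unfolding differentiable_def by blast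
 fix b :: "real \<times> complex" assume b: "b \<in> Basis"
 have pb: "partial b f x = partial (snd b) q (snd x)" if x: "x \<in> S \<times> disc" for x
 proof -
  obtain E where E: "(q has_derivative E) (at (snd x))" using qd[OF x] by blast
  show ?thesis unfolding partial_eqI[OF D[OF x q(2) E]] partial_eqI[OF E] ..
 qed
 show "\<exists>g. (\<exists>q. smooth_on disc q \<and> (\<forall>x\<in>S \<times> disc. g x = q (snd x))) \<and> (\<forall>x\<in>S \<times> disc. partial b f x = g x)"
 proof (cases "snd b = 0")
  case True
  have "partial (snd b) q z = 0" if zd: "z \<in> disc" for z
  proof -
   obtain E where E: "(q has_derivative E) (at z)"
    using smooth_on_differentiable[OF q(1) zd] unfolding differentiable_def by auto
   show ?thesis unfolding partial_eqI[OF E] True using has_derivative_bounded_linear[OF E] by (simp add: linear_simps)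
  qed
  then have "\<forall>x\<in>S \<times> disc. partial b f x = (\<lambda>_. 0) x" using pb by auto
  then show ?thesis using smooth_on_const[of disc 0] by (intro exI[of _ "\<lambda>_. 0"]) auto
 next
  case False
  then have "snd b \<in> Basis" using b by (auto simp: Basis_prod_def)
  then show ?thesis using smooth_on_partial[OF q(1)] pb by blast
 qed
qed (rule open_Times[OF S open_disc])

text \<open>On the compact support of the time function the norms of X t are bounded, so convergence
  of the test functions in L2 gives uniform convergence of the pairings.\<close>

lemma pairing_limit:
 assumes z: "test_fun {0<..} \<zeta>" and X: "cL2 X" and q: "sqi Fund q" "\<And>n. sqi Fund (qn n)" and lim: "(\<lambda>n. nrm Fund (\<lambda>z. qn n z - q z)) \<longlonglongrightarrow> 0"
 shows "(\<lambda>n. LINT t|lT. \<zeta> t *\<^sub>R pr (X t) (qn n)) \<longlonglongrightarrow> (LINT t|lT. \<zeta> t *\<^sub>R pr (X t) q)"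
  and "integrable lT (\<lambda>t. \<zeta> t *\<^sub>R pr (X t) q)"
proof -
 obtain \<alpha> \<beta> where ab: "0 < \<alpha>" "\<alpha> < \<beta>" "\<And>t. t \<le> \<alpha> \<or> \<beta> \<le> t \<Longrightarrow> \<zeta> t = 0" using test_time[OF z] by blast
 have sub: "{\<alpha>..\<beta>} \<subseteq> {0..}" using ab by auto
 have zc: "continuous_on {\<alpha>..\<beta>} \<zeta>" by (rule test_time_deriv(4)[OF z])
 have c: "continuous_on {\<alpha>..\<beta>} (\<lambda>t. \<zeta> t *\<^sub>R pr (X t) h)" if "sqi Fund h" for h
  by (rule continuous_on_scaleR[OF zc continuous_on_subset[OF pr_continuous[OF X cL2_const[OF that]] sub]])
 have e: "(LINT t|lT. \<zeta> t *\<^sub>R pr (X t) h) = integral {\<alpha>..\<beta>} (\<lambda>t. \<zeta> t *\<^sub>R pr (X t) h)"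
  "integrable lT (\<lambda>t. \<zeta> t *\<^sub>R pr (X t) h)" if "sqi Fund h" for h
  by (rule time_integral[OF c[OF that] ab(1)]; use ab in auto)+
 show "integrable lT (\<lambda>t. \<zeta> t *\<^sub>R pr (X t) q)" by (rule e(2)[OF q(1)])
 obtain M where M: "M \<ge> 0" "\<And>t. 0 \<le> t \<Longrightarrow> t \<le> \<beta> \<Longrightarrow> nrm Fund (X t) \<le> M" using cL2_bound[OF X, of \<beta>] by metis
 have "bounded (\<zeta> ` {\<alpha>..\<beta>})" by (intro compact_imp_bounded compact_continuous_image zc) simp
 then obtain Z0 where Z0: "\<forall>x\<in>\<zeta> ` {\<alpha>..\<beta>}. norm x \<le> Z0" unfolding bounded_iff by blast
 define Z where "Z = max Z0 0"
 have Z: "Z \<ge> 0" "\<And>t. t \<in> {\<alpha>..\<beta>} \<Longrightarrow> \<bar>\<zeta> t\<bar> \<le> Z" using Z0 by (auto simp: Z_def le_max_iff_disj)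
 have lim': "(\<lambda>n. (Z * (M * nrm Fund (\<lambda>z. qn n z - q z))) * (\<beta> - \<alpha>)) \<longlonglongrightarrow> 0"
  using tendsto_mult[OF tendsto_mult[OF tendsto_const[of Z] tendsto_mult[OF tendsto_const[of M] lim]] tendsto_const[of "\<beta> - \<alpha>"]] by simp
 show "(\<lambda>n. LINT t|lT. \<zeta> t *\<^sub>R pr (X t) (qn n)) \<longlonglongrightarrow> (LINT t|lT. \<zeta> t *\<^sub>R pr (X t) q)"
 proof (rule LIM_zero_cancel, rule tendsto_norm_zero_cancel, rule tendsto_sandwich[OF _ _ tendsto_const lim'])
  have "norm ((LINT t|lT. \<zeta> t *\<^sub>R pr (X t) (qn n)) - (LINT t|lT. \<zeta> t *\<^sub>R pr (X t) q)) \<le> (Z * (M * nrm Fund (\<lambda>z. qn n z - q z))) * (\<beta> - \<alpha>)" for n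
  proof -
   have d: "(LINT t|lT. \<zeta> t *\<^sub>R pr (X t) (qn n)) - (LINT t|lT. \<zeta> t *\<^sub>R pr (X t) q)
    = integral {\<alpha>..\<beta>} (\<lambda>t. \<zeta> t *\<^sub>R pr (X t) (qn n) - \<zeta> t *\<^sub>R pr (X t) q)"
    unfolding e(1)[OF q(1)] e(1)[OF q(2)]
    by (rule Henstock_Kurzweil_Integration.integral_diff[symmetric, OF integrable_continuous_interval[OF c[OF q(2)]] integrable_continuous_interval[OF c[OF q(1)]]])
   show ?thesis unfolding d
   proof (rule integral_bound)
    show "\<alpha> \<le> \<beta>" using ab by simp
    show "continuous_on {\<alpha>..\<beta>} (\<lambda>t. \<zeta> t *\<^sub>R pr (X t) (qn n) - \<zeta> t *\<^sub>R pr (X t) q)"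
     by (rule continuous_on_diff[OF c[OF q(2)] c[OF q(1)]])
    fix t assume t: "t \<in> {\<alpha>..\<beta>}"
    then have t0: "t \<ge> 0" "t \<le> \<beta>" using ab by auto
    have "\<zeta> t *\<^sub>R pr (X t) (qn n) - \<zeta> t *\<^sub>R pr (X t) q = \<zeta> t *\<^sub>R pr (X t) (\<lambda>z. qn n z - q z)"
     unfolding pr_diff(2)[OF q(2) q(1) cL2_sqi[OF X t0(1)]] by (rule scaleR_diff_right[symmetric])
    then have "norm (\<zeta> t *\<^sub>R pr (X t) (qn n) - \<zeta> t *\<^sub>R pr (X t) q) = \<bar>\<zeta> t\<bar> * cmod (pr (X t) (\<lambda>z. qn n z - q z))" by simp
    moreover have "cmod (pr (X t) (\<lambda>z. qn n z - q z)) \<le> M * nrm Fund (\<lambda>z. qn n z - q z)"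
     by (rule order_trans[OF pr_bound[OF cL2_sqi[OF X t0(1)] sqi_diff[OF q(2) q(1)]] mult_right_mono[OF M(2)[OF t0] nrm_nonneg]])
    ultimately show "norm (\<zeta> t *\<^sub>R pr (X t) (qn n) - \<zeta> t *\<^sub>R pr (X t) q) \<le> Z * (M * nrm Fund (\<lambda>z. qn n z - q z))"
     using mult_mono[OF Z(2)[OF t] _ Z(1) norm_ge_zero] by simp
   qed
  qed
  then show "\<forall>\<^sub>F n in sequentially. norm ((LINT t|lT. \<zeta> t *\<^sub>R pr (X t) (qn n)) - (LINT t|lT. \<zeta> t *\<^sub>R pr (X t) q)) \<le> (Z * (M * nrm Fund (\<lambda>z. qn n z - q z))) * (\<beta> - \<alpha>)"
   by simp
 qed simp
qed

section \<open>The variational problem\<close>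

lemma partial_cmult_disc:
 assumes p: "smooth_on disc p" and z: "z \<in> disc" shows "partial b (\<lambda>w. c * p w) z = c * partial b p z"
 using partial_affine[OF smooth_on_differentiable[OF p z], of b c 0] by simp

lemma lap_cmult:
 assumes p: "smooth_on disc p" and z: "z \<in> disc" shows "lap (\<lambda>w. c * p w) z = c * lap p z"
proof -
 have "partial b (partial b (\<lambda>w. c * p w)) z = c * partial b (partial b p) z" if b: "b \<in> Basis" for b
 proof -
  have "partial b (partial b (\<lambda>w. c * p w)) z = partial b (\<lambda>w. c * partial b p w) z"
   by (rule partial_cong_open[OF open_disc z]) (rule partial_cmult_disc[OF p])
  then show ?thesis unfolding partial_cmult_disc[OF smooth_on_partial[OF p b] z] .
 qed
 then show ?thesis unfolding lap_def by (simp add: Basis_c distrib_left)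
qed

lemma Laplace_K_weight:
 assumes "z \<in> disc" shows "hyp_weight z * Laplace_K f z = lap f z"
 using disc_pos[OF assms] by (simp add: Laplace_K_def hyp_weight_def lap_def)

lemma deriv_2_cmult:
 assumes "test_fun {0<..} \<eta>" shows "(deriv ^^ 2) (\<lambda>s. \<eta> s * c) t = (deriv ^^ 2) \<eta> t * c"
proof -
 have 1: "deriv (\<lambda>s. f s * c) = (\<lambda>s. deriv f s * c)" if "test_fun {0<..} f" for f :: "real \<Rightarrow> real"
  by (rule ext) (rule DERIV_imp_deriv[OF DERIV_cmult_right[OF test_time_deriv(1)[OF that]]])
 show ?thesis unfolding deriv_2 1[OF assms] 1[OF test_time_deriv(3)[OF assms]] ..
qed

lemma test_fun_K_product:
 assumes e: "test_fun {0<..} \<eta>" and p: "smooth_on disc p" and inv: "\<And>k z. k < 4 \<Longrightarrow> z \<in> disc \<Longrightarrow> p (gen k z) = p z"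
 shows "test_fun_K (\<lambda>x. \<eta> (fst x) * p (snd x))"
 unfolding test_fun_K_def
proof (intro conjI)
 let ?A = "({0<..} \<times> disc :: (real \<times> complex) set)"
 have o: "open ?A" by (intro open_Times open_disc open_greaterThan)
 have "smooth_on ?A (\<lambda>x. \<eta> (fst x))"
  by (rule smooth_on_compose[OF _ o open_UNIV subset_UNIV smooth_on_linear[OF bounded_linear_fst]])
    (use e in \<open>simp add: test_fun_def\<close>)
 then show "smooth_on ?A (\<lambda>x. \<eta> (fst x) * p (snd x))"
  by (rule smooth_on_mult[OF o _ smooth_on_snd[OF open_greaterThan p]])
 show "\<forall>g\<in>DDGroup. \<forall>t>0. \<forall>z\<in>disc. \<eta> (fst (t, g z)) * p (snd (t, g z)) = \<eta> (fst (t, z)) * p (snd (t, z))"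
  using DDGroup_invariant[OF inv] by simp
 obtain \<alpha> \<beta> where ab: "0 < \<alpha>" "\<alpha> < \<beta>" "\<And>t. t \<le> \<alpha> \<or> \<beta> \<le> t \<Longrightarrow> \<eta> t = 0" using test_time[OF e] by blast
 have "\<forall>t>0. \<forall>z\<in>disc. t \<notin> {\<alpha>..\<beta>} \<longrightarrow> \<eta> (fst (t, z)) * p (snd (t, z)) = 0" using ab(3) by auto
 then show "\<exists>\<alpha>>0. \<exists>\<beta>. \<forall>t>0. \<forall>z\<in>disc. t \<notin> {\<alpha>..\<beta>} \<longrightarrow> \<eta> (fst (t, z)) * p (snd (t, z)) = 0" using ab(1) by blast
qed

lemma time_pairing_integrable:
 assumes "test_fun {0<..} \<zeta>" "cL2 X" "sqi Fund q" shows "integrable lT (\<lambda>t. \<zeta> t *\<^sub>R pr (X t) q)"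
 by (rule pairing_limit(2)[OF assms assms(3)]) (simp add: nrm_def)

lemma bdd_weight: "bdd hyp_weight" by (rule bdd_continuous[OF weight_continuous])

section \<open>From the wave equation to the variational equation\<close>

context
 fixes a :: "complex \<Rightarrow> real"
 assumes a: "bdd a"
begin

abbreviation "wa \<equiv> \<lambda>z. hyp_weight z * a z"

lemma bdd_wa: "bdd wa" by (rule bdd_mult[OF bdd_weight a])

text \<open>The equation tested with \<eta>(t) q(z), where (qx, qy) stands for the gradient of q.
  The three functions are separate arguments so that each converges on its own in the density
  argument. The damping term keeps \<psi>', as in the wave equation.\<close>

abbreviation "wform \<psi> \<psi>' \<eta> q qx qy \<equiv> (LINT t|lT. (deriv ^^ 2) \<eta> t *\<^sub>R pr (wmul hyp_weight (\<psi> t)) q)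
   + (LINT t|lT. \<eta> t *\<^sub>R pr (dF 1 0 (\<psi> t)) qx)
   + (LINT t|lT. \<eta> t *\<^sub>R pr (dF 0 1 (\<psi> t)) qy)
   + (LINT t|lT. \<eta> t *\<^sub>R pr (wmul wa (\<psi>' t)) q)"

lemma wave_smooth:
 assumes en: "energy_class \<psi> \<psi>'" and w: "wave_equation_K a \<psi> \<psi>'" and e: "test_fun {0<..} \<eta>"
  and p: "smooth_on disc p" "\<And>k z. k < 4 \<Longrightarrow> z \<in> disc \<Longrightarrow> p (gen k z) = p z"
 shows "wform \<psi> \<psi>' \<eta> (ch p) (ch (partial 1 p)) (ch (partial \<i> p)) = 0"
proof -
 note E = energy_classD[OF en]
 note d = sqi_ch[OF continuous_disc_sqi[OF smooth_on_continuous[OF p(1)]]] sqi_ch[OF continuous_disc_sqi[OF smooth_continuous_partial[OF p(1) Basis_c(1)]]]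
  sqi_ch[OF continuous_disc_sqi[OF smooth_continuous_partial[OF p(1) Basis_c(2)]]] sqi_ch[OF continuous_disc_sqi[OF lap_continuous[OF p(1)]]]
 note c = cL2_wmul[OF bdd_weight E(2)] cL2_wmul[OF bdd_wa E(3)]
 have e2: "test_fun {0<..} ((deriv ^^ 2) \<eta>)" unfolding deriv_2 by (intro test_time_deriv(3) e)
 define \<theta> where "\<theta> = (\<lambda>x::real \<times> complex. \<eta> (fst x) * p (snd x))"
 have inner: "(LINT z|lF. hyp_weight z *\<^sub>R
    (((deriv ^^ 2) (\<lambda>s. \<theta> (s, z)) t - Laplace_K (\<lambda>w. \<theta> (t, w)) z) *\<^sub>R \<psi> t z + (\<theta> (t, z) * a z) *\<^sub>R \<psi>' t z))
   = (deriv ^^ 2) \<eta> t *\<^sub>R pr (wmul hyp_weight (\<psi> t)) (ch p) + \<eta> t *\<^sub>R pr (dF 1 0 (\<psi> t)) (ch (partial 1 p))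
    + \<eta> t *\<^sub>R pr (dF 0 1 (\<psi> t)) (ch (partial \<i> p)) + \<eta> t *\<^sub>R pr (wmul wa (\<psi>' t)) (ch p)" (is "?L = ?R") if t: "t > 0" for t
 proof -
  have t0: "t \<ge> 0" using t by simp
  note s = cL2_sqi[OF c(1) t0] cL2_sqi[OF c(2) t0] cL2_sqi[OF E(2) t0]
  have "?L = (LINT z|lF. (complex_of_real ((deriv ^^ 2) \<eta> t) * (wmul hyp_weight (\<psi> t) z * ch p z)
    - complex_of_real (\<eta> t) * (\<psi> t z * ch (lap p) z)) + complex_of_real (\<eta> t) * (wmul wa (\<psi>' t) z * ch p z))"
  proof (rule lebesgue_on_cong_int)
   fix z assume "z \<in> Fund"
   then have zd: "z \<in> disc" using Fund_disc by auto
   have 1: "(deriv ^^ 2) (\<lambda>s. \<theta> (s, z)) t = (deriv ^^ 2) \<eta> t * p z" by (simp add: \<theta>_def deriv_2_cmult[OF e])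
   have "hyp_weight z * Laplace_K (\<lambda>w. \<theta> (t, w)) z = \<eta> t * lap p z"
    unfolding Laplace_K_weight[OF zd] by (simp add: \<theta>_def lap_cmult[OF p(1) zd])
   then have H: "hyp_weight z * ((deriv ^^ 2) (\<lambda>s. \<theta> (s, z)) t - Laplace_K (\<lambda>w. \<theta> (t, w)) z) = hyp_weight z * ((deriv ^^ 2) \<eta> t * p z) - \<eta> t * lap p z"
    unfolding 1 right_diff_distrib by simp
   show "hyp_weight z *\<^sub>R (((deriv ^^ 2) (\<lambda>s. \<theta> (s, z)) t - Laplace_K (\<lambda>w. \<theta> (t, w)) z) *\<^sub>R \<psi> t z + (\<theta> (t, z) * a z) *\<^sub>R \<psi>' t z)
    = (complex_of_real ((deriv ^^ 2) \<eta> t) * (wmul hyp_weight (\<psi> t) z * ch p z) - complex_of_real (\<eta> t) * (\<psi> t z * ch (lap p) z)) + complex_of_real (\<eta> t) * (wmul wa (\<psi>' t) z * ch p z)"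
    unfolding scaleR_add_right scaleR_scaleR H by (simp add: \<theta>_def wmul_def scaleR_conv_of_real algebra_simps)
  qed
  also have "\<dots> = (complex_of_real ((deriv ^^ 2) \<eta> t) * pr (wmul hyp_weight (\<psi> t)) (ch p) - complex_of_real (\<eta> t) * pr (\<psi> t) (ch (lap p))) + complex_of_real (\<eta> t) * pr (wmul wa (\<psi>' t)) (ch p)"
   using sqi_mult_integrable(1)[OF s(1) d(1)] sqi_mult_integrable(1)[OF s(3) d(4)] sqi_mult_integrable(1)[OF s(2) d(1)]
   unfolding pr_def by simp
  \<comment> \<open>Green's formula trades the Laplacian of p for gradients; the weight has already
    cancelled against the conformal factor of the Laplace-Beltrami operator.\<close>
  also have "pr (\<psi> t) (ch (lap p)) = - (pr (dF 1 0 (\<psi> t)) (ch (partial 1 p)) + pr (dF 0 1 (\<psi> t)) (ch (partial \<i> p)))"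
   using Green_W1[OF E(1)[OF t0] p] by (simp only: eq_neg_iff_add_eq_0 add.commute add.left_commute add.assoc)
  finally show ?thesis by (simp only: scaleR_conv_of_real mult_minus_right distrib_left diff_minus_eq_add minus_add_distrib) (simp add: algebra_simps)
 qed
 have "test_fun_K \<theta>" unfolding \<theta>_def by (rule test_fun_K_product[OF e p])
 then have "(LINT t|lT. LINT z|lF. hyp_weight z *\<^sub>R
    (((deriv ^^ 2) (\<lambda>s. \<theta> (s, z)) t - Laplace_K (\<lambda>w. \<theta> (t, w)) z) *\<^sub>R \<psi> t z + (\<theta> (t, z) * a z) *\<^sub>R \<psi>' t z)) = 0"
  using w unfolding wave_equation_K_def by blast
 moreover have "(LINT t|lT. LINT z|lF. hyp_weight z *\<^sub>R
    (((deriv ^^ 2) (\<lambda>s. \<theta> (s, z)) t - Laplace_K (\<lambda>w. \<theta> (t, w)) z) *\<^sub>R \<psi> t z + (\<theta> (t, z) * a z) *\<^sub>R \<psi>' t z))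
   = (LINT t|lT. (deriv ^^ 2) \<eta> t *\<^sub>R pr (wmul hyp_weight (\<psi> t)) (ch p) + \<eta> t *\<^sub>R pr (dF 1 0 (\<psi> t)) (ch (partial 1 p))
    + \<eta> t *\<^sub>R pr (dF 0 1 (\<psi> t)) (ch (partial \<i> p)) + \<eta> t *\<^sub>R pr (wmul wa (\<psi>' t)) (ch p))"
  by (rule lebesgue_on_cong_int) (rule inner, simp)
 moreover note i = time_pairing_integrable[OF e2 c(1) d(1)] time_pairing_integrable[OF e E(5) d(2)] time_pairing_integrable[OF e E(6) d(3)] time_pairing_integrable[OF e c(2) d(1)]
 have "(LINT t|lT. (deriv ^^ 2) \<eta> t *\<^sub>R pr (wmul hyp_weight (\<psi> t)) (ch p) + \<eta> t *\<^sub>R pr (dF 1 0 (\<psi> t)) (ch (partial 1 p))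
    + \<eta> t *\<^sub>R pr (dF 0 1 (\<psi> t)) (ch (partial \<i> p)) + \<eta> t *\<^sub>R pr (wmul wa (\<psi>' t)) (ch p))
   = wform \<psi> \<psi>' \<eta> (ch p) (ch (partial 1 p)) (ch (partial \<i> p))"
  by (simp only: Bochner_Integration.integral_add Bochner_Integration.integrable_add i)
 ultimately show ?thesis by (simp only:)
qed

text \<open>The averages of p are smooth and invariant, so they are covered by
  \<open>wave_smooth\<close>; each term of the form is continuous for the convergence of p and of
  its gradient in L2.\<close>

lemma wave_rep:
 assumes en: "energy_class \<psi> \<psi>'" and w: "wave_equation_K a \<psi> \<psi>'" and e: "test_fun {0<..} \<eta>" and r: "rep p px py"
 shows "wform \<psi> \<psi>' \<eta> (ch p) (ch px) (ch py) = 0" (is "?R = 0")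
proof -
 note E = energy_classD[OF en]
 note c = cL2_wmul[OF bdd_weight E(2)] cL2_wmul[OF bdd_wa E(3)]
 have e2: "test_fun {0<..} ((deriv ^^ 2) \<eta>)" unfolding deriv_2 by (intro test_time_deriv(3) e)
 note s = rep_approx(1)[OF r]
 have n: "nrm Fund (\<lambda>z. ch f z - ch g z) = nrm Fund (\<lambda>z. f z - g z)" for f g
  using nrm_ch[of Fund "\<lambda>z. f z - g z"] by simp
 have q: "sqi Fund (ch (Kn n p))" "sqi Fund (ch (partial 1 (Kn n p)))" "sqi Fund (ch (partial \<i> (Kn n p)))" for n
  by (rule sqi_ch[OF continuous_disc_sqi[OF smooth_on_continuous[OF s]]], rule sqi_ch[OF continuous_disc_sqi[OF smooth_continuous_partial[OF s Basis_c(1)]]],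
    rule sqi_ch[OF continuous_disc_sqi[OF smooth_continuous_partial[OF s Basis_c(2)]]])
 note l = rep_approx(3-5)[OF r, folded n]
 note f = sqi_ch[OF rep_Fund(1)[OF r]] sqi_ch[OF rep_Fund(2)[OF r]] sqi_ch[OF rep_Fund(3)[OF r]]
 let ?S = "\<lambda>n. wform \<psi> \<psi>' \<eta> (ch (Kn n p)) (ch (partial 1 (Kn n p))) (ch (partial \<i> (Kn n p)))"
 have lim: "?S \<longlonglongrightarrow> ?R"
  by (intro tendsto_add pairing_limit(1)[OF e2 c(1) f(1) q(1) l(1)] pairing_limit(1)[OF e E(5) f(2) q(2) l(2)]
    pairing_limit(1)[OF e E(6) f(3) q(3) l(3)] pairing_limit(1)[OF e c(2) f(1) q(1) l(1)])
 have "?S n = 0" for n by (rule wave_smooth[OF en w e s rep_approx(2)[OF r]])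
 then have "?S = (\<lambda>n. 0)" by (rule ext)
 from lim[unfolded this] show ?thesis by (rule LIMSEQ_unique[OF _ tendsto_const])
qed

lemma variational_pr:
 assumes en: "energy_class \<psi> \<psi>'" and p: "\<phi> \<in> W 1"
 shows "distr_ode (\<lambda>t. LINT z|lF. hyp_weight z *\<^sub>R (\<psi> t z * \<phi> z))
   (\<lambda>t. LINT z|lF. (hyp_weight z * a z) *\<^sub>R (\<psi> t z * \<phi> z))
   (\<lambda>t. LINT z|lF. dF 1 0 (\<psi> t) z * dF 1 0 \<phi> z + dF 0 1 (\<psi> t) z * dF 0 1 \<phi> z)
  \<longleftrightarrow> distr_ode (\<lambda>t. pr (wmul hyp_weight (\<psi> t)) \<phi>) (\<lambda>t. pr (wmul wa (\<psi> t)) \<phi>)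
   (\<lambda>t. pr (dF 1 0 (\<psi> t)) (dF 1 0 \<phi>) + pr (dF 0 1 (\<psi> t)) (dF 0 1 \<phi>))"
proof -
 note E = energy_classD[OF en]
 have m: "(LINT z|lF. c z *\<^sub>R (\<psi> t z * \<phi> z)) = pr (wmul c (\<psi> t)) \<phi>" for c t
  by (simp add: pr_def wmul_def scaleR_conv_of_real mult.assoc)
 have C: "(LINT t|lT. \<eta> t *\<^sub>R (LINT z|lF. dF 1 0 (\<psi> t) z * dF 1 0 \<phi> z + dF 0 1 (\<psi> t) z * dF 0 1 \<phi> z))
   = (LINT t|lT. \<eta> t *\<^sub>R (pr (dF 1 0 (\<psi> t)) (dF 1 0 \<phi>) + pr (dF 0 1 (\<psi> t)) (dF 0 1 \<phi>)))" for \<eta> :: "real \<Rightarrow> real"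
 proof (rule lebesgue_on_cong_int)
  fix t :: real assume "t \<in> {0<..}"
  then have W: "\<psi> t \<in> W 1" by (intro E(1)) simp
  show "\<eta> t *\<^sub>R (LINT z|lF. dF 1 0 (\<psi> t) z * dF 1 0 \<phi> z + dF 0 1 (\<psi> t) z * dF 0 1 \<phi> z) = \<eta> t *\<^sub>R (pr (dF 1 0 (\<psi> t)) (dF 1 0 \<phi>) + pr (dF 0 1 (\<psi> t)) (dF 0 1 \<phi>))"
   unfolding pr_def
   by (subst Bochner_Integration.integral_add[OF sqi_mult_integrable(1)[OF W1_sqi(2)[OF W] W1_sqi(2)[OF p]] sqi_mult_integrable(1)[OF W1_sqi(3)[OF W] W1_sqi(3)[OF p]]]) simp
 qed
 show ?thesis unfolding distr_ode_def m C ..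
qed

lemma pr_zero: "pr f (\<lambda>z. 0) = 0" by (simp add: pr_def)

lemma pr_wmul_derivative:
 assumes c: "bdd c" and X: "cL2 X" "dL2 X X'" and h: "sqi Fund h" and t: "t \<ge> 0"
 shows "((\<lambda>s. pr (wmul c (X s)) h) has_vector_derivative pr (wmul c (X' t)) h) (at t within {0..})"
 using pr_derivative[OF cL2_wmul[OF c X(1)] dL2_wmul[OF c X] cL2_const[OF h] dL2_const t] by (simp add: pr_zero)

text \<open>A complex test function is split into real components, for which \<open>wave_rep\<close>
  holds. An integration by parts in time turns the pairing of \<eta> with a \<psi>' into the
  distributional derivative of the damping term.\<close>

lemma wave_variational:
 assumes en: "energy_class \<psi> \<psi>'" and w: "wave_equation_K a \<psi> \<psi>'"
 shows "variational_equation a \<psi>"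
 unfolding variational_equation_def
proof
 fix \<phi> assume p: "\<phi> \<in> W 1"
 note E = energy_classD[OF en]
 note c = cL2_wmul[OF bdd_weight E(2)] cL2_wmul[OF bdd_wa E(3)] E(5,6)
 obtain f fx fy g gx gy where r: "rep f fx fy" "rep g gx gy"
  and f: "AE z in lF. \<phi> z = Complex (f z) (g z)"
  and fx: "AE z in lF. dF 1 0 \<phi> z = Complex (fx z) (gx z)"
  and fy: "AE z in lF. dF 0 1 \<phi> z = Complex (fy z) (gy z)"
  by (rule W1_rep[OF p])
 have split: "(LINT t|lT. \<zeta> t *\<^sub>R pr (X t) u) = (LINT t|lT. \<zeta> t *\<^sub>R pr (X t) (ch v)) + \<i> * (LINT t|lT. \<zeta> t *\<^sub>R pr (X t) (ch v'))"
  if z: "test_fun {0<..} \<zeta>" and X: "cL2 X" and u: "AE z in lF. u z = Complex (v z) (v' z)" and v: "sqi Fund v" and v': "sqi Fund v'" for \<zeta> X u v v'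
 proof -
  have "(LINT t|lT. \<zeta> t *\<^sub>R pr (X t) u) = (LINT t|lT. \<zeta> t *\<^sub>R pr (X t) (ch v) + \<i> * (\<zeta> t *\<^sub>R pr (X t) (ch v')))"
  proof (rule lebesgue_on_cong_int)
   fix t :: real assume "t \<in> {0<..}"
   then have "sqi Fund (X t)" by (intro cL2_sqi[OF X]) simp
   from pr_Complex[OF u v v' this] show "\<zeta> t *\<^sub>R pr (X t) u = \<zeta> t *\<^sub>R pr (X t) (ch v) + \<i> * (\<zeta> t *\<^sub>R pr (X t) (ch v'))"
    by (simp add: scaleR_add_right)
  qed
  also have "\<dots> = (LINT t|lT. \<zeta> t *\<^sub>R pr (X t) (ch v)) + (LINT t|lT. \<i> * (\<zeta> t *\<^sub>R pr (X t) (ch v')))"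
   by (rule Bochner_Integration.integral_add[OF time_pairing_integrable[OF z X sqi_ch[OF v]] integrable_mult_right[OF time_pairing_integrable[OF z X sqi_ch[OF v']]]])
  finally show ?thesis by (simp only: integral_mult_right_zero)
 qed
 show "distr_ode (\<lambda>t. LINT z|lF. hyp_weight z *\<^sub>R (\<psi> t z * \<phi> z))
   (\<lambda>t. LINT z|lF. (hyp_weight z * a z) *\<^sub>R (\<psi> t z * \<phi> z))
   (\<lambda>t. LINT z|lF. dF 1 0 (\<psi> t) z * dF 1 0 \<phi> z + dF 0 1 (\<psi> t) z * dF 0 1 \<phi> z)"
  unfolding variational_pr[OF en p] distr_ode_def
 proof (intro allI impI)
  fix \<eta> :: "real \<Rightarrow> real" assume e: "test_fun {0<..} \<eta>"
  have e2: "test_fun {0<..} ((deriv ^^ 2) \<eta>)" unfolding deriv_2 by (intro test_time_deriv(3) e)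
  have B: "(LINT t|lT. deriv \<eta> t *\<^sub>R pr (wmul wa (\<psi> t)) \<phi>) = - (LINT t|lT. \<eta> t *\<^sub>R pr (wmul wa (\<psi>' t)) \<phi>)"
   by (rule time_parts[OF e pr_wmul_derivative[OF bdd_wa E(2,4) W1_sqi(1)[OF p]] pr_continuous[OF c(2) cL2_const[OF W1_sqi(1)[OF p]]]])
  have C: "(LINT t|lT. \<eta> t *\<^sub>R (pr (dF 1 0 (\<psi> t)) (dF 1 0 \<phi>) + pr (dF 0 1 (\<psi> t)) (dF 0 1 \<phi>)))
   = (LINT t|lT. \<eta> t *\<^sub>R pr (dF 1 0 (\<psi> t)) (dF 1 0 \<phi>)) + (LINT t|lT. \<eta> t *\<^sub>R pr (dF 0 1 (\<psi> t)) (dF 0 1 \<phi>))"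
   unfolding scaleR_add_right
   by (rule Bochner_Integration.integral_add[OF time_pairing_integrable[OF e c(3) W1_sqi(2)[OF p]] time_pairing_integrable[OF e c(4) W1_sqi(3)[OF p]]])
  have "(LINT t|lT. (deriv ^^ 2) \<eta> t *\<^sub>R pr (wmul hyp_weight (\<psi> t)) \<phi>)
   - (LINT t|lT. deriv \<eta> t *\<^sub>R pr (wmul wa (\<psi> t)) \<phi>)
   + (LINT t|lT. \<eta> t *\<^sub>R (pr (dF 1 0 (\<psi> t)) (dF 1 0 \<phi>) + pr (dF 0 1 (\<psi> t)) (dF 0 1 \<phi>)))
   = (wform \<psi> \<psi>' \<eta> (ch f) (ch fx) (ch fy))
   + \<i> * (wform \<psi> \<psi>' \<eta> (ch g) (ch gx) (ch gy))"
   unfolding B C split[OF e2 c(1) f rep_Fund(1)[OF r(1)] rep_Fund(1)[OF r(2)]] split[OF e c(2) f rep_Fund(1)[OF r(1)] rep_Fund(1)[OF r(2)]]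
    split[OF e c(3) fx rep_Fund(2)[OF r(1)] rep_Fund(2)[OF r(2)]] split[OF e c(4) fy rep_Fund(3)[OF r(1)] rep_Fund(3)[OF r(2)]]
   by (simp only: distrib_left diff_minus_eq_add ac_simps)
  also have "\<dots> = 0" unfolding wave_rep[OF en w e r(1)] wave_rep[OF en w e r(2)] by simp
  finally show "(LINT t|lT. (deriv ^^ 2) \<eta> t *\<^sub>R pr (wmul hyp_weight (\<psi> t)) \<phi>)
   - (LINT t|lT. deriv \<eta> t *\<^sub>R pr (wmul wa (\<psi> t)) \<phi>)
   + (LINT t|lT. \<eta> t *\<^sub>R (pr (dF 1 0 (\<psi> t)) (dF 1 0 \<phi>) + pr (dF 0 1 (\<psi> t)) (dF 0 1 \<phi>))) = 0" .
 qed
qed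

text \<open>An identity at each time T, for each fixed \<phi>: hence \<phi> may afterwards be chosen
  depending on T.\<close>

lemma variational_integrated:
 assumes en: "energy_class \<psi> \<psi>'" and v: "variational_equation a \<psi>" and p: "\<phi> \<in> W 1" and T: "T \<ge> 0"
 shows "pr (wmul hyp_weight (\<psi>' T)) \<phi> + pr (wmul wa (\<psi> T)) \<phi> + integral {0..T} (\<lambda>s. pr (dF 1 0 (\<psi> s)) (dF 1 0 \<phi>) + pr (dF 0 1 (\<psi> s)) (dF 0 1 \<phi>))
  = pr (wmul hyp_weight (\<psi>' 0)) \<phi> + pr (wmul wa (\<psi> 0)) \<phi>"
proof -
 note E = energy_classD[OF en]
 note s = cL2_const[OF W1_sqi(1)[OF p]] cL2_const[OF W1_sqi(2)[OF p]] cL2_const[OF W1_sqi(3)[OF p]]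
 show ?thesis
 proof (rule distr_ode_integrated[OF _ _ _ _ _ T])
  let ?B = "(\<lambda>t. pr (wmul hyp_weight (\<psi> t)) \<phi>)"
  show "(?B has_vector_derivative pr (wmul hyp_weight (\<psi>' t)) \<phi>) (at t within {0..})" if "t \<ge> 0" for t
   by (rule pr_wmul_derivative[OF bdd_weight E(2,4) W1_sqi(1)[OF p] that])
  show "continuous_on {0..} (\<lambda>t. pr (wmul hyp_weight (\<psi>' t)) \<phi>)" by (rule pr_continuous[OF cL2_wmul[OF bdd_weight E(3)] s(1)])
  show "continuous_on {0..} (\<lambda>t. pr (wmul wa (\<psi> t)) \<phi>)" by (rule pr_continuous[OF cL2_wmul[OF bdd_wa E(2)] s(1)])
  let ?A = "(\<lambda>t. pr (dF 1 0 (\<psi> t)) (dF 1 0 \<phi>) + pr (dF 0 1 (\<psi> t)) (dF 0 1 \<phi>))"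
  show "continuous_on {0..} ?A"
   by (rule continuous_on_add[OF pr_continuous[OF E(5) s(2)] pr_continuous[OF E(6) s(3)]])
  show "distr_ode ?B (\<lambda>t. pr (wmul wa (\<psi> t)) \<phi>) ?A"
   using v p variational_pr[OF en p] unfolding variational_equation_def by blast
 qed
qed

section \<open>Uniqueness by positivity\<close>

lemma pr_gram_nonneg:
 assumes "\<And>i. i < n \<Longrightarrow> sqi Fund (f i)"
 shows "0 \<le> (\<Sum>i<n. \<Sum>j<n. Re (pr (f i) (\<lambda>z. cnj (f j z))))"
proof -
 have i: "integrable lF (\<lambda>z. f i z * cnj (f j z))" if "i < n" "j < n" for i j
  by (rule sqi_mult_integrable(1)[OF assms[OF that(1)] sqi_cnj[OF assms[OF that(2)]]])
 let ?A = "(LINT z|lF. (cmod (\<Sum>i<n. f i z))^2)"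
 let ?B = "(\<Sum>i<n. \<Sum>j<n. pr (f i) (\<lambda>z. cnj (f j z)))"
 have "?B = (LINT z|lF. (\<Sum>i<n. \<Sum>j<n. f i z * cnj (f j z)))"
  unfolding pr_def using i by (subst Bochner_Integration.integral_sum) (auto intro!: sum.cong Bochner_Integration.integral_sum[symmetric])
 also have "\<dots> = (LINT z|lF. complex_of_real ((cmod (\<Sum>i<n. f i z))^2))"
 proof (rule lebesgue_on_cong_int)
  fix z
  have "(\<Sum>i<n. \<Sum>j<n. f i z * cnj (f j z)) = (\<Sum>i<n. f i z) * cnj (\<Sum>i<n. f i z)" by (simp add: sum_product)
  then show "(\<Sum>i<n. \<Sum>j<n. f i z * cnj (f j z)) = complex_of_real ((cmod (\<Sum>i<n. f i z))^2)" by (simp only: complex_norm_square)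
 qed
 also have "\<dots> = complex_of_real ?A" by (rule integral_complex_of_real)
 finally have "Re ?B = ?A" by simp
 moreover have "0 \<le> ?A" by (rule Bochner_Integration.integral_nonneg) simp
 ultimately show ?thesis by (simp only: Re_sum)
qed

lemma pr_cnj_swap: "pr (wmul c f) (\<lambda>z. cnj (g z)) = cnj (pr (wmul c g) (\<lambda>z. cnj (f z)))"
 unfolding pr_def wmul_def Bochner_Integration.integral_cnj[symmetric] by (simp add: mult_ac)

lemma Re_pr_wmul_self:
 assumes c: "bdd c" and f: "sqi Fund f"
 shows "Re (pr (wmul c f) (\<lambda>z. cnj (f z))) = (LINT z|lF. c z * (cmod (f z))^2)"
proof -
 have "pr (wmul c f) (\<lambda>z. cnj (f z)) = (LINT z|lF. complex_of_real (c z * (cmod (f z))^2))"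
  unfolding pr_def wmul_def of_real_mult complex_norm_square by (simp only: mult.assoc)
 then show ?thesis by (simp only: integral_complex_of_real Re_complex_of_real)
qed

lemma wmul_diff: "wmul c (\<lambda>z. f z - g z) = (\<lambda>z. wmul c f z - wmul c g z)"
 by (simp add: wmul_def fun_eq_iff right_diff_distrib)

lemma variational_unique:
 assumes a0: "AE z in lF. a z \<ge> 0"
  and u: "energy_class u u'" "variational_equation a u" and v: "energy_class v v'" "variational_equation a v"
  and i: "AE z in lF. u 0 z = v 0 z" "AE z in lF. u' 0 z = v' 0 z"
  and T: "T \<ge> 0"
 shows "AE z in lF. u T z = v T z"
proof -
 note Eu = energy_classD[OF u(1)] and Ev = energy_classD[OF v(1)]
 define w where "w = (\<lambda>t z. u t z - v t z)"
 define w' where "w' = (\<lambda>t z. u' t z - v' t z)"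
 define X where "X = (\<lambda>t z. dF 1 0 (u t) z - dF 1 0 (v t) z)"
 define Y where "Y = (\<lambda>t z. dF 0 1 (u t) z - dF 0 1 (v t) z)"
 define cW where "cW = (\<lambda>t z. cnj (w t z))"
 have W: "cL2 w" "dL2 w w'" "cL2 w'" unfolding w_def w'_def
  by (rule cL2_diff[OF Eu(2) Ev(2)], rule dL2_diff[OF Eu(2,4) Ev(2,4)], rule cL2_diff[OF Eu(3) Ev(3)])
 have X: "cL2 X" and Y: "cL2 Y" unfolding X_def Y_def by (rule cL2_diff[OF Eu(5) Ev(5)], rule cL2_diff[OF Eu(6) Ev(6)])
 have cW: "cL2 cW" "dL2 cW (\<lambda>t z. cnj (w' t z))" unfolding cW_def by (rule cL2_cnj[OF W(1)], rule dL2_cnj[OF W(2)])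
 define K where "K = (\<lambda>s t. pr (X s) (\<lambda>z. cnj (X t z)) + pr (Y s) (\<lambda>z. cnj (Y t z)))"
 have Kj: "continuous_on ({0..} \<times> {0..}) (\<lambda>q. K (fst q) (snd q))"
  unfolding K_def by (rule continuous_on_add[OF pr_joint_continuous[OF X cL2_cnj[OF X]] pr_joint_continuous[OF Y cL2_cnj[OF Y]]])
 have Kc: "continuous_on {0..t} (\<lambda>s. K s t)" if "t \<ge> 0" for t
 proof -
  have "continuous_on {0..t} (\<lambda>s. (\<lambda>q. K (fst q) (snd q)) (s, t))"
   by (rule continuous_on_compose2[OF Kj]) (use that in \<open>auto intro!: continuous_intros\<close>)
  then show ?thesis by simp
 qed
 \<comment> \<open>The integrated equation up to the time t, tested with the conjugate of w t. The
   second argument of K stays at t while the first runs over [0, t].\<close>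
 have key: "pr (wmul hyp_weight (w' t)) (cW t) + pr (wmul wa (w t)) (cW t) + integral {0..t} (\<lambda>s. K s t) = 0" if t: "t \<ge> 0" for t
 proof -
  have Wd: "w t \<in> W 1" unfolding w_def by (rule W1_diff[OF Eu(1)[OF t] Ev(1)[OF t]])
  define \<phi> where "\<phi> = cW t"
  have p: "\<phi> \<in> W 1" unfolding \<phi>_def cW_def by (rule W1_cnj[OF Wd])
  note sp = W1_sqi[OF p]
  have dphi: "AE z in lF. dF i j \<phi> z = cnj (dF i j (u t) z - dF i j (v t) z)" if "i + j \<le> 1" for i j
   using dF_cnj[OF Wd p[unfolded \<phi>_def cW_def] that] dF_diff[OF Eu(1)[OF t] Ev(1)[OF t] Wd[unfolded w_def] that]
   unfolding \<phi>_def cW_def w_def by eventually_elim simp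
  have VI: "pr (wmul hyp_weight (u' t)) \<phi> + pr (wmul wa (u t)) \<phi> + integral {0..t} (\<lambda>s. pr (dF 1 0 (u s)) (dF 1 0 \<phi>) + pr (dF 0 1 (u s)) (dF 0 1 \<phi>))
    = pr (wmul hyp_weight (v' t)) \<phi> + pr (wmul wa (v t)) \<phi> + integral {0..t} (\<lambda>s. pr (dF 1 0 (v s)) (dF 1 0 \<phi>) + pr (dF 0 1 (v s)) (dF 0 1 \<phi>))"
  proof -
   have "pr (wmul hyp_weight (u' 0)) \<phi> = pr (wmul hyp_weight (v' 0)) \<phi>"
    by (rule pr_cong_AE[OF cL2_sqi[OF cL2_wmul[OF bdd_weight Eu(3)]] sp(1)]) (use i(2) in \<open>auto simp: wmul_def elim!: eventually_mono\<close>)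
   moreover have "pr (wmul wa (u 0)) \<phi> = pr (wmul wa (v 0)) \<phi>"
    by (rule pr_cong_AE[OF cL2_sqi[OF cL2_wmul[OF bdd_wa Eu(2)]] sp(1)]) (use i(1) in \<open>auto simp: wmul_def elim!: eventually_mono\<close>)
   ultimately show ?thesis unfolding variational_integrated[OF u p t] variational_integrated[OF v p t] by simp
  qed
  have 1: "pr (wmul hyp_weight (w' t)) \<phi> = pr (wmul hyp_weight (u' t)) \<phi> - pr (wmul hyp_weight (v' t)) \<phi>"
   unfolding w'_def wmul_diff
   by (rule pr_diff(1)[OF cL2_sqi[OF cL2_wmul[OF bdd_weight Eu(3)] t] cL2_sqi[OF cL2_wmul[OF bdd_weight Ev(3)] t] sp(1)])
  have 2: "pr (wmul wa (w t)) \<phi> = pr (wmul wa (u t)) \<phi> - pr (wmul wa (v t)) \<phi>"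
   unfolding w_def wmul_diff
   by (rule pr_diff(1)[OF cL2_sqi[OF cL2_wmul[OF bdd_wa Eu(2)] t] cL2_sqi[OF cL2_wmul[OF bdd_wa Ev(2)] t] sp(1)])
  let ?A = "(dF 1 0 \<phi>)"
  let ?B = "(dF 0 1 \<phi>)"
  have 3: "K s t = (pr (dF 1 0 (u s)) ?A + pr (dF 0 1 (u s)) ?B) - (pr (dF 1 0 (v s)) ?A + pr (dF 0 1 (v s)) ?B)" if s: "s \<in> {0..t}" for s
  proof -
   have s0: "s \<ge> 0" using s by simp
   have "pr (X s) (\<lambda>z. cnj (X t z)) = pr (X s) ?A"
    by (rule pr_cong_AE[OF cL2_sqi[OF X s0] sqi_cnj[OF cL2_sqi[OF X t]]]) (use dphi[of 1 0] in \<open>auto simp: X_def elim!: eventually_mono\<close>)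
   moreover have "pr (Y s) (\<lambda>z. cnj (Y t z)) = pr (Y s) ?B"
    by (rule pr_cong_AE[OF cL2_sqi[OF Y s0] sqi_cnj[OF cL2_sqi[OF Y t]]]) (use dphi[of 0 1] in \<open>auto simp: Y_def elim!: eventually_mono\<close>)
   moreover have "pr (X s) ?A = pr (dF 1 0 (u s)) ?A - pr (dF 1 0 (v s)) ?A"
    unfolding X_def by (rule pr_diff(1)[OF cL2_sqi[OF Eu(5) s0] cL2_sqi[OF Ev(5) s0] sp(2)])
   moreover have "pr (Y s) ?B = pr (dF 0 1 (u s)) ?B - pr (dF 0 1 (v s)) ?B"
    unfolding Y_def by (rule pr_diff(1)[OF cL2_sqi[OF Eu(6) s0] cL2_sqi[OF Ev(6) s0] sp(3)])
   ultimately show ?thesis unfolding K_def by simp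
  qed
  have ci: "(\<lambda>s. pr (dF 1 0 (r s)) ?A + pr (dF 0 1 (r s)) ?B) integrable_on {0..t}"
   if "cL2 (\<lambda>t. dF 1 0 (r t))" "cL2 (\<lambda>t. dF 0 1 (r t))" for r
   by (rule integrable_continuous_interval[OF continuous_on_subset[OF continuous_on_add[OF pr_continuous[OF that(1) cL2_const[OF sp(2)]] pr_continuous[OF that(2) cL2_const[OF sp(3)]]]]]) auto
  let ?G = "(\<lambda>s. pr (dF 1 0 (u s)) ?A + pr (dF 0 1 (u s)) ?B)"
  let ?H = "(\<lambda>s. pr (dF 1 0 (v s)) ?A + pr (dF 0 1 (v s)) ?B)"
  have "integral {0..t} (\<lambda>s. K s t) = integral {0..t} (\<lambda>s. (pr (dF 1 0 (u s)) ?A + pr (dF 0 1 (u s)) ?B) - (pr (dF 1 0 (v s)) ?A + pr (dF 0 1 (v s)) ?B))"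
   by (rule Henstock_Kurzweil_Integration.integral_cong) (rule 3)
  also have "\<dots> = integral {0..t} ?G - integral {0..t} ?H"
   by (rule Henstock_Kurzweil_Integration.integral_diff[OF ci[OF Eu(5,6)] ci[OF Ev(5,6)]])
  finally have 4: "integral {0..t} (\<lambda>s. K s t) = integral {0..t} ?G - integral {0..t} ?H" .
  have alg: "A + B + C = A' + B' + C' \<Longrightarrow> (A - A') + (B - B') + (C - C') = 0" for A B C A' B' C' :: complex by (simp add: algebra_simps)
  show ?thesis unfolding \<phi>_def[symmetric] 1 2 4 by (rule alg[OF VI])
 qed
 define E where "E = (\<lambda>t. Re (pr (wmul hyp_weight (w t)) (cW t)))"
 define ED where "ED = (\<lambda>t. 2 * Re (pr (wmul hyp_weight (w' t)) (cW t)))"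
 define P where "P = (\<lambda>t. Re (pr (wmul wa (w t)) (cW t)))"
 define G where "G = (\<lambda>s t. Re (K s t))"
 have Ed: "(E has_vector_derivative ED t) (at t within {0..})" if t: "t \<ge> 0" for t
 \<comment> \<open>The product rule gives a term and its complex conjugate, so the derivative is
   twice one real part.\<close>
 proof -
  let ?D = "(pr (wmul hyp_weight (w' t)) (cW t) + pr (wmul hyp_weight (w t)) (\<lambda>z. cnj (w' t z)))"
  have "(E has_vector_derivative Re ?D) (at t within {0..})"
   unfolding E_def
   by (rule bounded_linear.has_vector_derivative[OF bounded_linear_Re pr_derivative[OF cL2_wmul[OF bdd_weight W(1)] dL2_wmul[OF bdd_weight W(1,2)] cW t]])
  moreover have "Re ?D = ED t"
   unfolding pr_cnj_swap[of hyp_weight "w t" "w' t"] ED_def cW_def by simp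
  ultimately show ?thesis by simp
 qed
 have EDc: "continuous_on {0..} ED" unfolding ED_def
  by (intro continuous_on_mult continuous_on_const continuous_on_Re pr_continuous[OF cL2_wmul[OF bdd_weight W(3)] cW(1)])
 have Pc: "continuous_on {0..} P" unfolding P_def
  by (intro continuous_on_Re pr_continuous[OF cL2_wmul[OF bdd_wa W(1)] cW(1)])
 have Re_int: "Re (integral {0..t} (\<lambda>s. K s t)) = integral {0..t} (\<lambda>s. G s t)" if "t \<ge> 0" for t
  unfolding G_def using integral_linear[OF integrable_continuous_interval[OF Kc[OF that]] bounded_linear_Re] by (simp add: o_def)
 have EDe: "ED t = - 2 * (P t + integral {0..t} (\<lambda>s. G s t))" if t: "t \<ge> 0" for t
  using arg_cong[OF key[OF t], of Re] Re_int[OF t] unfolding ED_def P_def by simp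
 have P0: "P t \<ge> 0" if t: "t \<ge> 0" for t
 proof -
  have "0 \<le> (LINT z|lF. (hyp_weight z * a z) * (cmod (w t z))^2)"
  proof (rule integral_nonneg_AE)
   have "AE z in lF. z \<in> Fund" by (rule AE_I2) simp
   then show "AE z in lF. 0 \<le> (hyp_weight z * a z) * (cmod (w t z))^2"
    using a0
   proof eventually_elim
    case (elim z)
    then have "hyp_weight z > 0" using hyp_weight_pos Fund_disc by auto
    then show ?case using elim by simp
   qed
  qed
  then show ?thesis unfolding P_def cW_def Re_pr_wmul_self[OF bdd_wa cL2_sqi[OF W(1) t]] .
 qed
 have E0: "E 0 = 0"
 proof -
  have "pr (wmul hyp_weight (w 0)) (cW 0) = 0"
   unfolding pr_def by (rule integral_eq_zero_AE) (use i(1) in \<open>auto simp: wmul_def w_def elim!: eventually_mono\<close>)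
  then show ?thesis by (simp add: E_def)
 qed
 have ET: "E T \<le> 0"
 proof (cases "T = 0")
  case False
  then have T0: "T > 0" using T by simp
  have sub: "{0..T} \<subseteq> {0..}" by auto
  let ?C = "(\<lambda>t. integral {0..t} (\<lambda>s. G s t))"
  \<comment> \<open>The identity \<open>EDe\<close> expresses the inner integral through two
    continuous functions, so its continuity in t is read off from there.\<close>
  have gc: "continuous_on {0..T} ?C"
  proof (rule continuous_on_eq)
   show "continuous_on {0..T} (\<lambda>t. - (1 / 2) * ED t - P t)"
    by (intro continuous_on_diff continuous_on_mult continuous_on_const continuous_on_subset[OF EDc sub] continuous_on_subset[OF Pc sub])
   show "- (1 / 2) * ED t - P t = integral {0..t} (\<lambda>s. G s t)" if "t \<in> {0..T}" for t proof -
    have "ED t = - 2 * (P t + integral {0..t} (\<lambda>s. G s t))" by (rule EDe) (use that in simp)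
    moreover have "- (1 / 2) * (- 2 * (A + B)) - A = B" for A B :: real by (simp add: algebra_simps)
    ultimately show ?thesis by (simp only:)
   qed
  qed
  have "0 \<le> integral {0..T} ?C"
  proof (rule positive_kernel_triangle[OF T0 _ _ _ gc])
   show "continuous_on ({0..T} \<times> {0..T}) (\<lambda>q. G (fst q) (snd q))"
    unfolding G_def by (intro continuous_on_Re continuous_on_subset[OF Kj]) auto
   have sw: "pr f (\<lambda>z. cnj (g z)) = cnj (pr g (\<lambda>z. cnj (f z)))" for f g
    unfolding pr_def Bochner_Integration.integral_cnj[symmetric] by (simp add: mult.commute)
   show "G s t = G t s" for s t
    unfolding G_def K_def sw[of "X s" "X t"] sw[of "Y s" "Y t"] by simp
   fix n and x :: "nat \<Rightarrow> real" assume x: "\<And>i. i < n \<Longrightarrow> x i \<in> {0..T}"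
   have "0 \<le> (\<Sum>i<n. \<Sum>j<n. Re (pr (X (x i)) (\<lambda>z. cnj (X (x j) z))))"
    by (rule pr_gram_nonneg, rule cL2_sqi[OF X]) (use x in auto)
   moreover have "0 \<le> (\<Sum>i<n. \<Sum>j<n. Re (pr (Y (x i)) (\<lambda>z. cnj (Y (x j) z))))"
    by (rule pr_gram_nonneg, rule cL2_sqi[OF Y]) (use x in auto)
   ultimately show "0 \<le> (\<Sum>i<n. \<Sum>j<n. G (x i) (x j))"
    unfolding G_def K_def by (simp add: sum.distrib)
  qed
  moreover have "0 \<le> integral {0..T} P"
   by (rule Henstock_Kurzweil_Integration.integral_nonneg[OF integrable_continuous_interval[OF continuous_on_subset[OF Pc sub]]]) (use P0 in auto)
  moreover have "(ED has_integral (E T - E 0)) {0..T}"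
   by (rule fundamental_theorem_of_calculus[OF T]) (rule has_vector_derivative_within_subset[OF Ed sub], simp)
  then have "E T - E 0 = integral {0..T} ED" by (simp add: integral_unique)
  moreover have "integral {0..T} ED = - 2 * (integral {0..T} P + integral {0..T} ?C)"
  proof -
   let ?J = "(\<lambda>t. P t + integral {0..t} (\<lambda>s. G s t))"
   have "integral {0..T} ED = integral {0..T} (\<lambda>t. - 2 * (P t + integral {0..t} (\<lambda>s. G s t)))"
    by (rule Henstock_Kurzweil_Integration.integral_cong) (simp add: EDe)
   also have "\<dots> = - 2 * integral {0..T} ?J" by (rule integral_mult_right)
   also have "integral {0..T} ?J = integral {0..T} P + integral {0..T} ?C"
    by (rule Henstock_Kurzweil_Integration.integral_add[OF integrable_continuous_interval[OF continuous_on_subset[OF Pc sub]] integrable_continuous_interval[OF gc]])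
   finally show ?thesis .
  qed
  moreover have "e \<le> 0" if "0 \<le> g" "0 \<le> q" "e - e0 = d" "d = - 2 * (q + g)" "e0 = 0" for e e0 d q g :: real
   using that by simp
  ultimately show ?thesis using E0 by blast
 qed (use E0 in simp)
 have sW: "sqi Fund (w T)" by (rule cL2_sqi[OF W(1) T])
 \<comment> \<open>The weight is at least 4 on the disc, so E T <= 0 forces the L2 norm of the
   difference to vanish.\<close>
 have "4 * (nrm Fund (w T))^2 \<le> E T"
 proof -
  let ?E = "(LINT z|lF. hyp_weight z * (cmod (w T z))^2)"
  have eT: "E T = ?E"
   unfolding E_def cW_def by (rule Re_pr_wmul_self[OF bdd_weight sW])
  have "integrable lF (\<lambda>z. wmul hyp_weight (w T) z * cnj (w T z))"
   by (rule sqi_mult_integrable(1)[OF cL2_sqi[OF cL2_wmul[OF bdd_weight W(1)] T] sqi_cnj[OF sW]])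
  moreover have "wmul hyp_weight (w T) z * cnj (w T z) = complex_of_real (hyp_weight z * (cmod (w T z))^2)" for z
   unfolding wmul_def of_real_mult complex_norm_square by (simp only: mult.assoc)
  ultimately have i: "integrable lF (\<lambda>z. hyp_weight z * (cmod (w T z))^2)"
   by (simp only: complex_of_real_integrable_eq)
  have "4 * (nrm Fund (w T))^2 = (LINT z|lF. 4 * (cmod (w T z))^2)" unfolding nrm_sq by simp
  also have "\<dots> \<le> ?E"
   by (rule integral_mono[OF integrable_mult_right[OF sqiD(2)[OF sW]] i])
     (use weight_ge_4 Fund_disc in \<open>auto intro!: mult_right_mono\<close>)
  finally show ?thesis unfolding eT .
 qed
 then have "(nrm Fund (w T))^2 \<le> 0" using ET by linarith
 then have "nrm Fund (w T) = 0" by simp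
 from nrm_eq_0_AE[OF sW this] show ?thesis by eventually_elim (simp add: w_def)
qed

end

text \<open>Elements of the energy class are representatives, free on null sets and at negative
  times; uniqueness accordingly means equality almost everywhere at each t >= 0.\<close>

theorem theorem3p1:
 fixes a :: "complex \<Rightarrow> real"
  and \<psi>0 \<psi>1 :: "complex \<Rightarrow> complex"
  and \<psi> :: "real \<Rightarrow> complex \<Rightarrow> complex"
 assumes "a \<in> Linf" and "AE z in lebesgue_on Fund. a z \<ge> 0"
  and "\<psi>0 \<in> W 2" and "\<psi>1 \<in> W 1"
  and "finite_energy_solution a \<psi>0 \<psi>1 \<psi>"
 shows "variational_solution a \<psi>0 \<psi>1 \<psi> \<and>
  (\<forall>u. variational_solution a \<psi>0 \<psi>1 u \<longrightarrow>
    (\<forall>t\<ge>0. AE z in lebesgue_on Fund. u t z = \<psi> t z))"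
proof -
 have a: "bdd a" using assms(1) by (auto simp: Linf_def bdd_def)
 obtain \<psi>' where p: "energy_class \<psi> \<psi>'" "initial_data \<psi>0 \<psi>1 \<psi> \<psi>'" "wave_equation_K a \<psi> \<psi>'"
  using assms(5) by (auto simp: finite_energy_solution_def)
 have v: "variational_equation a \<psi>" by (rule wave_variational[OF a p(1,3)])
 have "AE z in lF. u t z = \<psi> t z" if u: "variational_solution a \<psi>0 \<psi>1 u" and t: "t \<ge> 0" for u t
 proof -
  obtain u' where u': "energy_class u u'" "initial_data \<psi>0 \<psi>1 u u'" "variational_equation a u"
   using u by (auto simp: variational_solution_def)
  \<comment> \<open>Each solution brings its own time derivative; at time 0 both derivatives agree
    with \<psi>1 almost everywhere, hence with each other.\<close>
  have "AE z in lF. u 0 z = \<psi> 0 z" "AE z in lF. u' 0 z = \<psi>' 0 z"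
   using u'(2) p(2) unfolding initial_data_def by (auto elim!: eventually_elim2)
  then show ?thesis by (rule variational_unique[OF a assms(2) u'(1,3) p(1) v _ _ t])
 qed
 then show ?thesis using p v by (auto simp: variational_solution_def)
qed

end
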